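(* Let $\mathscr A$ be the category of finite length modules over a finite hereditary ring, assume that $\mathscr A$ is connected (not a direct sum of two nonzero abelian subcategories) and of infinite type (i.e. it has infinitely many isomorphism classes of indecomposable objects). Let $\mathscr A_-$ (respectively $\mathscr A_+$) be the full subcategory of preprojective (respectively preinjective) objects and let $\mathscr A_0$ be the full subcategory of objects $C$ such that $\mathrm{Ext}^1_{\mathscr A}(P,C)=0$ for all objects $P$ of $\mathscr A_-$ and $\mathrm{Ext}^1_{\mathscr A}(C,I)=0$ for all objects $I$ of $\mathscr A_+$. Then: (a) The Hall algebra admits a triangular decomposition $H_{\mathscr A}\cong H_{\mathscr A_-}\otimes H_{\mathscr A_0}\otimes H_{\mathscr A_+}$, i.e. the multiplication map $H_{\mathscr A_-}\otimes H_{\mathscr A_0}\otimes H_{\mathscr A_+}\to H_{\mathscr A}$ is an isomorphism of vector spaces. (b) $\mathrm{Exp}_{\mathscr A}=\mathrm{Exp}_{\mathscr A_-}\,\mathrm{Exp}_{\mathscr A_0}\,\mathrm{Exp}_{\mathscr A_+}$ in $\widehat H_{\mathscr A}$.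
   Context: Let $\tau^+$ be the Auslander--Reiten translation on $\mathscr A$ and $\tau^-$ its left adjoint (inverse translation). An indecomposable $M$ is preprojective (respectively preinjective) if $(\tau^+)^nM$ is a nonzero projective (respectively $(\tau^-)^nM$ is a nonzero injective) for some $n\ge0$; an arbitrary object is preprojective (respectively preinjective) if all its indecomposable summands are. The categories $\mathscr A_\pm,\mathscr A_0$ are closed under extensions. The Hall algebra $H_{\mathscr A}$ is the $\mathbb Q$-vector space with basis the isomorphism classes $[M]$ and multiplication $[M][N]=\sum_{[K]}F_{MN}^K[K]$, where $F_{MN}^K$ is the number of subobjects $U\subset K$ with $U\cong N$, $K/U\cong M$. For a full subcategory $\mathscr B$ closed under extensions, $H_{\mathscr B}\subset H_{\mathscr A}$ is the subalgebra spanned by classes of objects of $\mathscr B$, and $\mathrm{Exp}_{\mathscr B}=\sum_{[B]\in\mathrm{Iso}\,\mathscr B}[B]$ in the completion $\widehat H_{\mathscr A}=\prod_{\gamma\in K_0(\mathscr A)}H_{\mathscr A,\gamma}$. *)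

theory Defs
  imports Complex_Main "HOL-Algebra.Module" "HOL-Algebra.AbelCoset" "HOL-Algebra.Free_Abelian_Groups" "HOL-Library.Function_Algebras"
begin

section \<open>Left modules over a ring\<close>

text \<open>
  The library locale \<open>module\<close> requires a commutative ring of scalars, so left modules over an
  arbitrary ring are introduced here, on the same record type.  The ring fields
  \<open>mult\<close> and \<open>one\<close> of that record play no role.
\<close>

locale left_module = R?: ring R + M?: abelian_group M
  for R :: "('r, 's) ring_scheme" (structure) and M :: "('r, 'a, 'm) module_scheme" (structure) +
  assumes smult_closed: "\<lbrakk>a \<in> carrier R; x \<in> carrier M\<rbrakk> \<Longrightarrow> a \<odot>\<^bsub>M\<^esub> x \<in> carrier M"
    and smult_l_distr: "\<lbrakk>a \<in> carrier R; b \<in> carrier R; x \<in> carrier M\<rbrakk> \<Longrightarrow>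
      (a \<oplus>\<^bsub>R\<^esub> b) \<odot>\<^bsub>M\<^esub> x = a \<odot>\<^bsub>M\<^esub> x \<oplus>\<^bsub>M\<^esub> b \<odot>\<^bsub>M\<^esub> x"
    and smult_r_distr: "\<lbrakk>a \<in> carrier R; x \<in> carrier M; y \<in> carrier M\<rbrakk> \<Longrightarrow>
      a \<odot>\<^bsub>M\<^esub> (x \<oplus>\<^bsub>M\<^esub> y) = a \<odot>\<^bsub>M\<^esub> x \<oplus>\<^bsub>M\<^esub> a \<odot>\<^bsub>M\<^esub> y"
    and smult_assoc: "\<lbrakk>a \<in> carrier R; b \<in> carrier R; x \<in> carrier M\<rbrakk> \<Longrightarrow>
      (a \<otimes>\<^bsub>R\<^esub> b) \<odot>\<^bsub>M\<^esub> x = a \<odot>\<^bsub>M\<^esub> (b \<odot>\<^bsub>M\<^esub> x)"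
    and smult_one: "x \<in> carrier M \<Longrightarrow> \<one>\<^bsub>R\<^esub> \<odot>\<^bsub>M\<^esub> x = x"

definition reg_mod :: "('r, 's) ring_scheme \<Rightarrow> ('r, 'r) module" where
  "reg_mod R = \<lparr>carrier = carrier R, mult = (\<otimes>\<^bsub>R\<^esub>), one = \<one>\<^bsub>R\<^esub>, ring.zero = \<zero>\<^bsub>R\<^esub>,
                ring.add = (\<oplus>\<^bsub>R\<^esub>), smult = (\<otimes>\<^bsub>R\<^esub>)\<rparr>"

text \<open>Homomorphisms are extensional, so that equality of morphisms is equality of functions.\<close>

definition mod_hom :: "('r, 's) ring_scheme \<Rightarrow> ('r, 'a) module \<Rightarrow> ('r, 'b) module \<Rightarrow> ('a \<Rightarrow> 'b) set"
  where "mod_hom R M N = {f \<in> carrier M \<rightarrow>\<^sub>E carrier N.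
      (\<forall>x\<in>carrier M. \<forall>y\<in>carrier M. f (x \<oplus>\<^bsub>M\<^esub> y) = f x \<oplus>\<^bsub>N\<^esub> f y) \<and>
      (\<forall>r\<in>carrier R. \<forall>x\<in>carrier M. f (r \<odot>\<^bsub>M\<^esub> x) = r \<odot>\<^bsub>N\<^esub> f x)}"

definition mod_iso :: "('r, 's) ring_scheme \<Rightarrow> ('r, 'a) module \<Rightarrow> ('r, 'b) module \<Rightarrow> bool" where
  "mod_iso R M N \<longleftrightarrow> (\<exists>f\<in>mod_hom R M N. bij_betw f (carrier M) (carrier N))"

definition sub_mod :: "('r, 'a) module \<Rightarrow> 'a set \<Rightarrow> ('r, 'a) module" where
  "sub_mod M U = M\<lparr>carrier := U\<rparr>"

definition quot_mod :: "('r, 'a) module \<Rightarrow> 'a set \<Rightarrow> ('r, 'a set) module" where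
  "quot_mod M U = \<lparr>carrier = a_rcosets\<^bsub>M\<^esub> U, mult = undefined, one = undefined,
     ring.zero = U, ring.add = set_add M, smult = (\<lambda>r X. \<Union>x\<in>X. U +>\<^bsub>M\<^esub> (r \<odot>\<^bsub>M\<^esub> x))\<rparr>"

definition is_zero :: "('r, 'a) module \<Rightarrow> bool" where
  "is_zero M \<longleftrightarrow> carrier M = {\<zero>\<^bsub>M\<^esub>}"

definition int_direct_sum :: "('r, 's) ring_scheme \<Rightarrow> ('r, 'a) module \<Rightarrow> 'a set \<Rightarrow> 'a set \<Rightarrow> bool"
  where "int_direct_sum R M U V \<longleftrightarrow> submodule U R M \<and> submodule V R M \<and>
      U \<inter> V = {\<zero>\<^bsub>M\<^esub>} \<and> U <+>\<^bsub>M\<^esub> V = carrier M"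

definition indecomposable :: "('r, 's) ring_scheme \<Rightarrow> ('r, 'a) module \<Rightarrow> bool" where
  "indecomposable R M \<longleftrightarrow> \<not> is_zero M \<and>
     (\<forall>U V. int_direct_sum R M U V \<longrightarrow> U = {\<zero>\<^bsub>M\<^esub>} \<or> V = {\<zero>\<^bsub>M\<^esub>})"

definition composition_series ::
  "('r, 's) ring_scheme \<Rightarrow> ('r, 'a) module \<Rightarrow> 'a set list \<Rightarrow> bool" where
  "composition_series R M Us \<longleftrightarrow>
     Us \<noteq> [] \<and> hd Us = {\<zero>\<^bsub>M\<^esub>} \<and> last Us = carrier M \<and> (\<forall>U\<in>set Us. submodule U R M) \<and>
     (\<forall>i. Suc i < length Us \<longrightarrow> Us ! i \<subset> Us ! Suc i \<and>
        \<not> (\<exists>W. submodule W R M \<and> Us ! i \<subset> W \<and> W \<subset> Us ! Suc i))"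

definition finite_length :: "('r, 's) ring_scheme \<Rightarrow> ('r, 'a) module \<Rightarrow> bool" where
  "finite_length R M \<longleftrightarrow> left_module R M \<and> (\<exists>Us. composition_series R M Us)"


section \<open>The category of finite length modules\<close>

text \<open>
  Over a finite ring a module of finite length is finite, hence isomorphic to one whose carrier is
  a set of natural numbers.  The modules of finite length with carrier in \<open>nat\<close> therefore form a
  small category equivalent to the category of all modules of finite length.
\<close>

definition fl_mods :: "('r, 's) ring_scheme \<Rightarrow> ('r, nat) module set" where
  "fl_mods R = {M. finite_length R M}"

definition iso_class :: "('r, 's) ring_scheme \<Rightarrow> ('r, 'a) module \<Rightarrow> ('r, nat) module set" where
  "iso_class R M = {N \<in> fl_mods R. mod_iso R M N}"

definition iso_classes ::
  "('r, 's) ring_scheme \<Rightarrow> ('r, nat) module set \<Rightarrow> ('r, nat) module set set" where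
  "iso_classes R \<B> = iso_class R ` \<B>"

definition projective :: "('r, 's) ring_scheme \<Rightarrow> ('r, 'a) module \<Rightarrow> bool" where
  \<comment> \<open>The test epimorphisms are those of \<open>fl_mods R\<close>.  For \<open>R\<close> finite and \<open>P\<close> finitely generated
      this already gives the lifting property against epimorphisms of arbitrary modules.\<close>
  "projective R P \<longleftrightarrow> left_module R P \<and>
     (\<forall>M\<in>fl_mods R. \<forall>N\<in>fl_mods R. \<forall>g\<in>mod_hom R M N. \<forall>f\<in>mod_hom R P N.
        g ` carrier M = carrier N \<longrightarrow> (\<exists>h\<in>mod_hom R P M. compose (carrier P) g h = f))"

definition injective :: "('r, 's) ring_scheme \<Rightarrow> ('r, 'a) module \<Rightarrow> bool" where
  "injective R I \<longleftrightarrow> left_module R I \<and>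
     (\<forall>M\<in>fl_mods R. \<forall>N\<in>fl_mods R. \<forall>g\<in>mod_hom R M N. \<forall>f\<in>mod_hom R M I.
        inj_on g (carrier M) \<longrightarrow> (\<exists>h\<in>mod_hom R N I. compose (carrier M) h g = f))"

text \<open>For finite rings, as for all two-sided Noetherian rings, left and right hereditary coincide.\<close>

definition hereditary :: "('r, 's) ring_scheme \<Rightarrow> bool" where
  "hereditary R \<longleftrightarrow>
     (\<forall>J. submodule J R (reg_mod R) \<longrightarrow> projective R (sub_mod (reg_mod R) J))"

definition abelian_subcat :: "('r, 's) ring_scheme \<Rightarrow> ('r, nat) module set \<Rightarrow> bool" where
  \<comment> \<open>full subcategories closed under isomorphisms, finite direct sums, kernels and cokernels\<close>
  "abelian_subcat R \<B> \<longleftrightarrow> \<B> \<subseteq> fl_mods R \<and>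
     (\<forall>M\<in>\<B>. iso_class R M \<subseteq> \<B>) \<and>
     (\<exists>Z\<in>\<B>. is_zero Z) \<and>
     (\<forall>M\<in>fl_mods R. \<forall>U V. int_direct_sum R M U V \<and> sub_mod M U \<in> \<B> \<and> sub_mod M V \<in> \<B> \<longrightarrow> M \<in> \<B>) \<and>
     (\<forall>M\<in>\<B>. \<forall>N\<in>\<B>. \<forall>f\<in>mod_hom R M N.
        sub_mod M {x \<in> carrier M. f x = \<zero>\<^bsub>N\<^esub>} \<in> \<B> \<and>
        iso_class R (quot_mod N (f ` carrier M)) \<subseteq> \<B>)"

definition cat_direct_sum ::
  "('r, 's) ring_scheme \<Rightarrow> ('r, nat) module set \<Rightarrow> ('r, nat) module set \<Rightarrow> bool" where
  \<comment> \<open>the category of finite length modules is the direct sum of its full subcategories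
      \<open>\<B>\<close> and \<open>\<C>\<close>\<close>
  "cat_direct_sum R \<B> \<C> \<longleftrightarrow>
     (\<forall>M\<in>\<B>. \<forall>N\<in>\<C>. (\<forall>f\<in>mod_hom R M N. \<forall>x\<in>carrier M. f x = \<zero>\<^bsub>N\<^esub>) \<and>
                    (\<forall>f\<in>mod_hom R N M. \<forall>x\<in>carrier N. f x = \<zero>\<^bsub>M\<^esub>)) \<and>
     (\<forall>M\<in>fl_mods R. \<exists>U V. int_direct_sum R M U V \<and> sub_mod M U \<in> \<B> \<and> sub_mod M V \<in> \<C>)"

definition connected_cat :: "('r, 's) ring_scheme \<Rightarrow> bool" where
  "connected_cat R \<longleftrightarrow> \<not> (\<exists>\<B> \<C>. abelian_subcat R \<B> \<and> abelian_subcat R \<C> \<and>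
      (\<exists>M\<in>\<B>. \<not> is_zero M) \<and> (\<exists>M\<in>\<C>. \<not> is_zero M) \<and> cat_direct_sum R \<B> \<C>)"

definition infinite_type :: "('r, 's) ring_scheme \<Rightarrow> bool" where
  "infinite_type R \<longleftrightarrow> infinite (iso_classes R {M \<in> fl_mods R. indecomposable R M})"


section \<open>The functor Ext\<close>

text \<open>
  For a finite module \<open>M\<close> the free module on the set \<open>carrier M\<close> maps onto \<open>M\<close>; let
  \<open>syz_mod R M\<close> be the kernel.  As the middle term is projective,
  Ext\<open>\<^sup>1(M,N)\<close> is the cokernel of the restriction map
  Hom\<open>(free_mod R M, N) \<rightarrow>\<close> Hom\<open>(syz_mod R M, N)\<close>.  This presentation of \<open>M\<close> is functorial.
\<close>

definition free_mod :: "('r, 's) ring_scheme \<Rightarrow> ('r, 'a) module \<Rightarrow> ('r, 'a \<Rightarrow> 'r) module" where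
  "free_mod R M = \<lparr>carrier = carrier M \<rightarrow>\<^sub>E carrier R, mult = undefined, one = undefined,
     ring.zero = (\<lambda>m\<in>carrier M. \<zero>\<^bsub>R\<^esub>),
     ring.add = (\<lambda>c d. \<lambda>m\<in>carrier M. c m \<oplus>\<^bsub>R\<^esub> d m),
     smult = (\<lambda>r c. \<lambda>m\<in>carrier M. r \<otimes>\<^bsub>R\<^esub> c m)\<rparr>"

definition syz_mod :: "('r, 's) ring_scheme \<Rightarrow> ('r, 'a) module \<Rightarrow> ('r, 'a \<Rightarrow> 'r) module" where
  "syz_mod R M = sub_mod (free_mod R M)
     {c \<in> carrier (free_mod R M). (\<Oplus>\<^bsub>M\<^esub>m\<in>carrier M. c m \<odot>\<^bsub>M\<^esub> m) = \<zero>\<^bsub>M\<^esub>}"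

definition hom_group ::
  "('r, 's) ring_scheme \<Rightarrow> ('r, 'a) module \<Rightarrow> ('r, 'b) module \<Rightarrow> ('a \<Rightarrow> 'b) monoid" where
  "hom_group R M N = \<lparr>carrier = mod_hom R M N,
     mult = (\<lambda>f g. \<lambda>x\<in>carrier M. f x \<oplus>\<^bsub>N\<^esub> g x),
     one = (\<lambda>x\<in>carrier M. \<zero>\<^bsub>N\<^esub>)\<rparr>"

definition ext1_bd ::
  "('r, 's) ring_scheme \<Rightarrow> ('r, 'a) module \<Rightarrow> ('r, 'b) module \<Rightarrow> (('a \<Rightarrow> 'r) \<Rightarrow> 'b) set" where
  "ext1_bd R M N = (\<lambda>f. restrict f (carrier (syz_mod R M))) ` mod_hom R (free_mod R M) N"

definition ext1 ::
  "('r, 's) ring_scheme \<Rightarrow> ('r, 'a) module \<Rightarrow> ('r, 'b) module \<Rightarrow> (('a \<Rightarrow> 'r) \<Rightarrow> 'b) set monoid" where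
  "ext1 R M N = hom_group R (syz_mod R M) N Mod ext1_bd R M N"

definition ext1_vanishes ::
  "('r, 's) ring_scheme \<Rightarrow> ('r, 'a) module \<Rightarrow> ('r, 'b) module \<Rightarrow> bool" where
  "ext1_vanishes R M N \<longleftrightarrow> carrier (ext1 R M N) = {\<one>\<^bsub>ext1 R M N\<^esub>}"

text \<open>
  Functoriality: \<open>ext1_post\<close> is the map Ext\<open>\<^sup>1(M,N) \<rightarrow>\<close> Ext\<open>\<^sup>1(M,N')\<close> induced by
  \<open>g : N \<rightarrow> N'\<close>, and \<open>ext1_pre\<close> the map Ext\<open>\<^sup>1(M',N) \<rightarrow>\<close> Ext\<open>\<^sup>1(M,N)\<close> induced by \<open>g : M \<rightarrow> M'\<close>.
  The unions range over the representatives of a class, all of which yield the same coset.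
\<close>

definition ext1_post :: "('r, 's) ring_scheme \<Rightarrow> ('r, 'a) module \<Rightarrow> ('r, 'c) module \<Rightarrow>
    ('b \<Rightarrow> 'c) \<Rightarrow> (('a \<Rightarrow> 'r) \<Rightarrow> 'b) set \<Rightarrow> (('a \<Rightarrow> 'r) \<Rightarrow> 'c) set" where
  "ext1_post R M N' g X = (\<Union>\<phi>\<in>X. ext1_bd R M N' #>\<^bsub>hom_group R (syz_mod R M) N'\<^esub>
      compose (carrier (syz_mod R M)) g \<phi>)"

definition free_map :: "('r, 's) ring_scheme \<Rightarrow> ('r, 'a) module \<Rightarrow> ('r, 'b) module \<Rightarrow>
    ('a \<Rightarrow> 'b) \<Rightarrow> ('a \<Rightarrow> 'r) \<Rightarrow> 'b \<Rightarrow> 'r" where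
  "free_map R M M' g c = (\<lambda>m\<in>carrier M'. \<Oplus>\<^bsub>R\<^esub>x\<in>{x \<in> carrier M. g x = m}. c x)"

definition ext1_pre :: "('r, 's) ring_scheme \<Rightarrow> ('r, 'a) module \<Rightarrow> ('r, 'c) module \<Rightarrow>
    ('r, 'b) module \<Rightarrow> ('a \<Rightarrow> 'c) \<Rightarrow> (('c \<Rightarrow> 'r) \<Rightarrow> 'b) set \<Rightarrow> (('a \<Rightarrow> 'r) \<Rightarrow> 'b) set" where
  "ext1_pre R M M' N g X = (\<Union>\<phi>\<in>X. ext1_bd R M N #>\<^bsub>hom_group R (syz_mod R M) N\<^esub>
      compose (carrier (syz_mod R M)) \<phi> (free_map R M M' g))"


section \<open>The Auslander--Reiten translations\<close>

text \<open>
  Over a hereditary Artin algebra \<open>R\<close> the Auslander--Reiten translation \<open>D Tr\<close> is the functor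
  \<open>D\<close> Ext\<open>\<^sup>1(-,R)\<close>: here Ext\<open>\<^sup>1(M,R)\<close> is a right module through the right
  multiplications of \<open>R\<close>, and \<open>D\<close> is the duality between finite right and left modules.
  On finite abelian groups \<open>D\<close> is Hom into \<open>\<rat>/\<int>\<close>, or equivalently into the unit circle.
\<close>

definition circle_group :: "complex monoid" where
  "circle_group = \<lparr>carrier = {z. cmod z = 1}, mult = (*), one = 1\<rparr>"

definition characters :: "'a monoid \<Rightarrow> ('a \<Rightarrow> complex) set" where
  "characters G = hom G circle_group \<inter> extensional (carrier G)"

type_synonym ('r, 'a) tau_elem = "(('a \<Rightarrow> 'r) \<Rightarrow> 'r) set \<Rightarrow> complex"

definition tau_mod ::
  "('r, 's) ring_scheme \<Rightarrow> ('r, 'a) module \<Rightarrow> ('r, ('r, 'a) tau_elem) module" where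
  "tau_mod R M = (let E = ext1 R M (reg_mod R) in
     \<lparr>carrier = characters E, mult = undefined, one = undefined,
      ring.zero = (\<lambda>X\<in>carrier E. 1),
      ring.add = (\<lambda>\<chi> \<psi>. \<lambda>X\<in>carrier E. \<chi> X * \<psi> X),
      smult = (\<lambda>r \<chi>. \<lambda>X\<in>carrier E. \<chi> (ext1_post R M (reg_mod R) (\<lambda>s\<in>carrier R. s \<otimes>\<^bsub>R\<^esub> r) X))\<rparr>)"

definition tau_map :: "('r, 's) ring_scheme \<Rightarrow> ('r, 'a) module \<Rightarrow> ('r, 'b) module \<Rightarrow>
    ('a \<Rightarrow> 'b) \<Rightarrow> ('r, 'a) tau_elem \<Rightarrow> ('r, 'b) tau_elem" where
  "tau_map R M M' g = (\<lambda>\<chi>\<in>carrier (tau_mod R M).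
     \<lambda>Y\<in>carrier (ext1 R M' (reg_mod R)). \<chi> (ext1_pre R M M' (reg_mod R) g Y))"

definition tau_plus ::
  "('r, 's) ring_scheme \<Rightarrow> ('r, nat) module \<Rightarrow> ('r, nat) module \<Rightarrow> bool" where
  \<comment> \<open>\<open>N\<close> is a copy of \<open>\<tau>\<^sup>+M\<close>\<close>
  "tau_plus R M N \<longleftrightarrow> N \<in> fl_mods R \<and> mod_iso R (tau_mod R M) N"

definition tau_minus ::
  "('r, 's) ring_scheme \<Rightarrow> ('r, nat) module \<Rightarrow> ('r, nat) module \<Rightarrow> bool" where
  \<comment> \<open>\<open>X\<close> is a copy of \<open>\<tau>\<^sup>-N\<close>, the value at \<open>N\<close> of the left adjoint of the functor
      \<open>\<tau>\<^sup>+ = (tau_mod, tau_map)\<close>: there is a universal morphism \<open>\<eta> : N \<rightarrow> \<tau>\<^sup>+X\<close>\<close>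
  "tau_minus R N X \<longleftrightarrow> X \<in> fl_mods R \<and>
     (\<exists>\<eta>\<in>mod_hom R N (tau_mod R X). \<forall>M\<in>fl_mods R. \<forall>f\<in>mod_hom R N (tau_mod R M).
        \<exists>!g. g \<in> mod_hom R X M \<and> compose (carrier N) (tau_map R X M g) \<eta> = f)"

definition preprojective :: "('r, 's) ring_scheme \<Rightarrow> ('r, nat) module set" where
  "preprojective R = {M \<in> fl_mods R. \<forall>U V. int_direct_sum R M U V \<and> indecomposable R (sub_mod M U) \<longrightarrow>
     (\<exists>n P. (tau_plus R ^^ n) (sub_mod M U) P \<and> projective R P \<and> \<not> is_zero P)}"

definition preinjective :: "('r, 's) ring_scheme \<Rightarrow> ('r, nat) module set" where
  "preinjective R = {M \<in> fl_mods R. \<forall>U V. int_direct_sum R M U V \<and> indecomposable R (sub_mod M U) \<longrightarrow>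
     (\<exists>n I. (tau_minus R ^^ n) (sub_mod M U) I \<and> injective R I \<and> \<not> is_zero I)}"

definition regular :: "('r, 's) ring_scheme \<Rightarrow> ('r, nat) module set" where
  "regular R = {C \<in> fl_mods R. (\<forall>P\<in>preprojective R. ext1_vanishes R P C) \<and>
                              (\<forall>I\<in>preinjective R. ext1_vanishes R C I)}"


section \<open>The Hall algebra and its completion\<close>

text \<open>
  Elements of the Hall algebra and of its completion are functions from isomorphism classes to
  the rationals, \<open>f\<close> standing for the formal sum of all \<open>f X \<cdot> X\<close>.
\<close>

type_synonym 'r hall = "('r, nat) module set \<Rightarrow> rat"

definition fscale :: "rat \<Rightarrow> ('x \<Rightarrow> rat) \<Rightarrow> 'x \<Rightarrow> rat" where
  "fscale c f = (\<lambda>x. c * f x)"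

definition basis_vec :: "'x \<Rightarrow> 'x \<Rightarrow> rat" where
  "basis_vec x = (\<lambda>y. if y = x then 1 else 0)"

definition hall_space :: "('r, 's) ring_scheme \<Rightarrow> ('r, nat) module set \<Rightarrow> 'r hall set" where
  "hall_space R \<B> = module.span fscale (basis_vec ` iso_classes R \<B>)"

definition hall_number :: "('r, 's) ring_scheme \<Rightarrow> ('r, nat) module set \<Rightarrow>
    ('r, nat) module set \<Rightarrow> ('r, nat) module \<Rightarrow> nat" where
  "hall_number R X Y K = card {U. submodule U R K \<and>
     iso_class R (sub_mod K U) = Y \<and> iso_class R (quot_mod K U) = X}"

definition hall_mult :: "('r, 's) ring_scheme \<Rightarrow> 'r hall \<Rightarrow> 'r hall \<Rightarrow> 'r hall" where
  \<comment> \<open>A module of finite length over a finite ring has only finitely many submodules, so the sum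
      is finite.\<close>
  "hall_mult R f g = (\<lambda>Z. if Z \<in> iso_classes R (fl_mods R) then
       (let K = (SOME K. K \<in> Z);
            S = {(X, Y). X \<in> iso_classes R (fl_mods R) \<and> Y \<in> iso_classes R (fl_mods R) \<and>
                         hall_number R X Y K \<noteq> 0}
        in \<Sum>(X, Y)\<in>S. of_nat (hall_number R X Y K) * f X * g Y)
     else 0)"

definition K0_rels :: "('r, 's) ring_scheme \<Rightarrow> (('r, nat) module set \<Rightarrow>\<^sub>0 int) set" where
  "K0_rels R = generate (free_Abelian_group (iso_classes R (fl_mods R)))
     {frag_of (iso_class R K) - frag_of (iso_class R (sub_mod K U)) - frag_of (iso_class R (quot_mod K U))
      | K U. K \<in> fl_mods R \<and> submodule U R K}"

definition K0 :: "('r, 's) ring_scheme \<Rightarrow> (('r, nat) module set \<Rightarrow>\<^sub>0 int) set monoid" where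
  "K0 R = free_Abelian_group (iso_classes R (fl_mods R)) Mod K0_rels R"

definition K0_class ::
  "('r, 's) ring_scheme \<Rightarrow> ('r, nat) module set \<Rightarrow> (('r, nat) module set \<Rightarrow>\<^sub>0 int) set" where
  "K0_class R X = K0_rels R #>\<^bsub>free_Abelian_group (iso_classes R (fl_mods R))\<^esub> frag_of X"

definition hall_completion :: "('r, 's) ring_scheme \<Rightarrow> 'r hall set" where
  \<comment> \<open>the product over \<open>\<gamma> \<in> K\<^sub>0\<close> of the homogeneous components of degree \<open>\<gamma>\<close>\<close>
  "hall_completion R = {f. (\<forall>X. f X \<noteq> 0 \<longrightarrow> X \<in> iso_classes R (fl_mods R)) \<and>
     (\<forall>\<gamma>\<in>carrier (K0 R). finite {X. f X \<noteq> 0 \<and> K0_class R X = \<gamma>})}"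

definition Exp_hall :: "('r, 's) ring_scheme \<Rightarrow> ('r, nat) module set \<Rightarrow> 'r hall" where
  "Exp_hall R \<B> = (\<lambda>X. if X \<in> iso_classes R \<B> then 1 else 0)"

text \<open>
  The tensor product of three spaces of functions, realised inside the functions of three
  variables, where the canonical map from the abstract tensor product is injective.
\<close>

definition pure_tensor :: "('x \<Rightarrow> rat) \<Rightarrow> ('y \<Rightarrow> rat) \<Rightarrow> ('z \<Rightarrow> rat) \<Rightarrow> 'x \<times> 'y \<times> 'z \<Rightarrow> rat" where
  "pure_tensor u v w = (\<lambda>(x, y, z). u x * v y * w z)"

definition tensor3 :: "('x \<Rightarrow> rat) set \<Rightarrow> ('y \<Rightarrow> rat) set \<Rightarrow> ('z \<Rightarrow> rat) set \<Rightarrow>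
    ('x \<times> 'y \<times> 'z \<Rightarrow> rat) set" where
  "tensor3 U V W = module.span fscale {pure_tensor u v w | u v w. u \<in> U \<and> v \<in> V \<and> w \<in> W}"

end

theory Submission
  imports Defs "HOL-Algebra.Multiplicative_Group"
begin

text \<open>
  Over a finite hereditary ring, Ext\<open>\<^sup>1(M, N)\<close> is dual to Hom\<open>(N, \<tau>M)\<close>, and \<open>\<tau>\<close> is fully faithful on modules
  without projective summands.  Moving along translation orbits one sees that there are no nonzero
  maps from preinjective modules to indecomposable modules that are not preinjective, nor from
  indecomposable modules that are not preprojective to preprojective ones.  Connectedness and infinite
  type enter only through the fact that no indecomposable module is both preprojective and
  preinjective.  Hence every module \<open>K\<close> has a unique filtration \<open>U \<subseteq> V \<subseteq> K\<close> with \<open>U\<close> preinjective, \<open>V/U\<close>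
  regular and \<open>K/V\<close> preprojective, and it splits because the relevant groups Ext\<open>\<^sup>1\<close> vanish.  In a
  product of elements of the three subalgebras the coefficient of \<open>K\<close> is therefore a single term, that
  of the filtration, and \<open>K\<close> is determined by its three subquotients, which can be arbitrary.
\<close>

text \<open>All modules in play are finite, and the homological statements are proved by counting:
  exact sequences become equations between products of sizes of Hom and Ext, and an injection
  between finite sets of equal size is onto. This gives full faithfulness of \<tau> without an
  explicit inverse. Heredity acts mostly through one fact: a finite module whose elements are
  separated by its maps to \<open>R\<close> is projective. It makes syzygies projective and so
  provides the dual bases behind the duality of Ext and Hom. The inverse translate is specified only
  by a universal property. Before orbits can be followed in its direction an object with that
  property has to be constructed, as in the adjoint functor theorem, with finiteness supplying the
  bound. That no indecomposable is both preprojective and preinjective is decided on indecomposable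
  projectives. If some of them lie in orbits of injectives and others do not, the two kinds have no
  nonzero maps between them and the category splits; if all do, orbits have bounded length and the
  type is finite.\<close>

abbreviation (input) zero_at ("\<zero>\<^sub>_" [1000] 1000) where "zero_at M \<equiv> ring.zero M"
abbreviation (input) add_at ("_ \<oplus>\<^sub>_ _" [65, 1000, 66] 65) where "add_at x M y \<equiv> ring.add M x y"
abbreviation (input) minus_at ("_ \<ominus>\<^sub>_ _" [65, 1000, 66] 65) where "minus_at x M y \<equiv> a_minus M x y"
abbreviation (input) smult_at ("_ \<odot>\<^sub>_ _" [70, 1000, 71] 70) where "smult_at r M x \<equiv> smult M r x"

type_synonym 'r nmod = "('r, nat) module"
abbreviation (input) car where "car \<equiv> carrier"

section \<open>Finite modules over a finite ring\<close>

locale finite_ring = ring R for R :: "('r, 's) ring_scheme" (structure) +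
  assumes finite_R: "finite (car R)"
begin

abbreviation indec where "indec \<equiv> indecomposable R"
abbreviation Hom where "Hom \<equiv> mod_hom R"
abbreviation tmap where "tmap \<equiv> tau_map R"
abbreviation fmap where "fmap \<equiv> free_map R"

text \<open>\<open>finite_length_iff\<close> shows this to be finite length over the finite ring.
  The carrier type stays free, since free modules, cosets and character groups do not live on
  \<open>nat\<close>.\<close>

definition fm :: "('r, 'a) module => bool" where
  "fm M \<longleftrightarrow> left_module R M \<and> finite (car M)"

text \<open>Unlike \<open>mod_hom\<close> this does not ask for extensionality, so composites and
  differences of maps can be written as plain lambda terms; \<open>restrict_mod_hom\<close> returns
  to \<open>mod_hom\<close> when homomorphisms are counted or compared.\<close>

definition lin :: "('r, 'a) module => ('r, 'b) module => ('a => 'b) => bool" where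
  "lin M N f \<longleftrightarrow> f \<in> car M \<rightarrow> car N \<and>
     (\<forall>x\<in>car M. \<forall>y\<in>car M. f (x \<oplus>\<^sub>M y) = f x \<oplus>\<^sub>N f y) \<and>
     (\<forall>r\<in>car R. \<forall>x\<in>car M. f (r \<odot>\<^sub>M x) = r \<odot>\<^sub>N f x)"

definition ker :: "('r, 'a) module => ('r, 'b) module => ('a => 'b) => 'a set" where
  "ker M N f = {x \<in> car M. f x = \<zero>\<^sub>N}"

lemma fm_mod: "fm M ==> left_module R M" and fm_finite [simp]: "fm M ==> finite (car M)" by (auto simp: fm_def)

lemma fm_ag: "fm M ==> abelian_group M" using left_module.axioms(2) fm_mod by blast

lemma fm_zero [simp]: "fm M ==> \<zero>\<^sub>M \<in> car M" by (simp add: fm_ag abelian_groupE(2))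

lemma fm_add [simp]: "[|fm M; x \<in> car M; y \<in> car M|] ==> x \<oplus>\<^sub>M y \<in> car M" by (simp add: fm_ag abelian_groupE(1))

lemma fm_inv [simp]: "[|fm M; x \<in> car M|] ==> \<ominus>\<^bsub>M\<^esub> x \<in> car M" by (simp add: fm_ag abelian_group.a_inv_closed)

lemma fm_minus [simp]: "[|fm M; x \<in> car M; y \<in> car M|] ==> x \<ominus>\<^sub>M y \<in> car M" by (simp add: a_minus_def)

lemma fm_smult [simp]: "[|fm M; r \<in> car R; x \<in> car M|] ==> r \<odot>\<^sub>M x \<in> car M" by (meson fm_mod left_module.smult_closed)

lemma fm_zeros [simp]:
  assumes "fm M" "x \<in> car M"
  shows "\<zero>\<^sub>M \<oplus>\<^sub>M x = x" "x \<oplus>\<^sub>M \<zero>\<^sub>M = x" "x \<ominus>\<^sub>M x = \<zero>\<^sub>M" "x \<ominus>\<^sub>M \<zero>\<^sub>M = x"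
    "x \<oplus>\<^sub>M (\<ominus>\<^bsub>M\<^esub> x) = \<zero>\<^sub>M" "(\<ominus>\<^bsub>M\<^esub> x) \<oplus>\<^sub>M x = \<zero>\<^sub>M" "\<ominus>\<^bsub>M\<^esub> (\<ominus>\<^bsub>M\<^esub> x) = x"
    "\<ominus>\<^bsub>M\<^esub> \<zero>\<^sub>M = \<zero>\<^sub>M"
proof -
  interpret M: abelian_group M using assms fm_ag by auto
  show "\<zero>\<^sub>M \<oplus>\<^sub>M x = x" "x \<oplus>\<^sub>M \<zero>\<^sub>M = x" "x \<ominus>\<^sub>M x = \<zero>\<^sub>M" "x \<ominus>\<^sub>M \<zero>\<^sub>M = x"
    "x \<oplus>\<^sub>M (\<ominus>\<^bsub>M\<^esub> x) = \<zero>\<^sub>M" "(\<ominus>\<^bsub>M\<^esub> x) \<oplus>\<^sub>M x = \<zero>\<^sub>M" "\<ominus>\<^bsub>M\<^esub> (\<ominus>\<^bsub>M\<^esub> x) = x" "\<ominus>\<^bsub>M\<^esub> \<zero>\<^sub>M = \<zero>\<^sub>M"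
    using assms by (auto simp: a_minus_def M.r_neg M.l_neg M.add.inv_one[folded a_inv_def, simplified])
qed

lemma fm_smult_simps:
  assumes "fm M"
  shows "[|a \<in> car R; b \<in> car R; x \<in> car M|] ==> (a \<oplus> b) \<odot>\<^sub>M x = a \<odot>\<^sub>M x \<oplus>\<^sub>M b \<odot>\<^sub>M x"
    "[|a \<in> car R; x \<in> car M; y \<in> car M|] ==> a \<odot>\<^sub>M (x \<oplus>\<^sub>M y) = a \<odot>\<^sub>M x \<oplus>\<^sub>M a \<odot>\<^sub>M y"
    "[|a \<in> car R; b \<in> car R; x \<in> car M|] ==> (a \<otimes> b) \<odot>\<^sub>M x = a \<odot>\<^sub>M (b \<odot>\<^sub>M x)"
    "x \<in> car M ==> \<one> \<odot>\<^sub>M x = x"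
  using fm_mod[OF assms] left_module.smult_l_distr left_module.smult_r_distr left_module.smult_assoc
    left_module.smult_one by fast+

lemma lin_closed: "[|lin M N f; x \<in> car M|] ==> f x \<in> car N" by (auto simp: lin_def)

lemma lin_add: "[|lin M N f; x \<in> car M; y \<in> car M|] ==> f (x \<oplus>\<^sub>M y) = f x \<oplus>\<^sub>N f y" by (auto simp: lin_def)

lemma lin_smult: "[|lin M N f; r \<in> car R; x \<in> car M|] ==> f (r \<odot>\<^sub>M x) = r \<odot>\<^sub>N f x" by (auto simp: lin_def)

lemma lin_zero:
  assumes "fm M" "fm N" "lin M N f" shows "f \<zero>\<^sub>M = \<zero>\<^sub>N"
proof -
  interpret N: abelian_group N using assms fm_ag by auto
  have "f \<zero>\<^sub>M \<oplus>\<^sub>N f \<zero>\<^sub>M = f \<zero>\<^sub>M"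
    using lin_add[OF assms(3), of "\<zero>\<^sub>M" "\<zero>\<^sub>M"] assms(1) by simp
  thus ?thesis using lin_closed[OF assms(3)] assms(1) by (metis N.add.r_cancel_one' fm_zero)
qed

lemma fm_smult_zero [simp]:
  assumes "fm M"
  shows "x \<in> car M ==> \<zero> \<odot>\<^sub>M x = \<zero>\<^sub>M" "r \<in> car R ==> r \<odot>\<^sub>M \<zero>\<^sub>M = \<zero>\<^sub>M"
proof -
  interpret M: abelian_group M using assms fm_ag by auto
  show "\<zero> \<odot>\<^sub>M x = \<zero>\<^sub>M" if "x \<in> car M"
    using that assms by (metis M.add.r_cancel_one' l_zero zero_closed fm_smult fm_smult_simps(1))
  show "r \<odot>\<^sub>M \<zero>\<^sub>M = \<zero>\<^sub>M" if "r \<in> car R"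
    using that assms by (metis M.add.r_cancel_one' M.l_zero M.zero_closed fm_smult fm_smult_simps(2))
qed

lemma lin_inv:
  assumes "fm M" "fm N" "lin M N f" "x \<in> car M" shows "f (\<ominus>\<^bsub>M\<^esub> x) = \<ominus>\<^bsub>N\<^esub> f x"
proof -
  interpret N: abelian_group N using assms fm_ag by auto
  have "f (\<ominus>\<^bsub>M\<^esub> x) \<oplus>\<^sub>N f x = \<zero>\<^sub>N"
    using lin_add[OF assms(3), of "\<ominus>\<^bsub>M\<^esub> x" x] lin_zero[OF assms(1-3)] assms by simp
  thus ?thesis using assms by (metis N.minus_equality fm_inv lin_closed)
qed

lemma lin_minus:
  "[|fm M; fm N; lin M N f; x \<in> car M; y \<in> car M|] ==> f (x \<ominus>\<^sub>M y) = f x \<ominus>\<^sub>N f y"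
  by (simp add: a_minus_def lin_add lin_inv)

lemma fm_smult_inv:
  assumes "fm M" "x \<in> car M" shows "(\<ominus> \<one>) \<odot>\<^sub>M x = \<ominus>\<^bsub>M\<^esub> x"
proof -
  interpret M: abelian_group M using assms fm_ag by auto
  have "(\<ominus> \<one>) \<odot>\<^sub>M x \<oplus>\<^sub>M x = \<zero>\<^sub>M"
    using assms by (metis l_neg add.inv_closed one_closed fm_smult_simps(1,4) fm_smult_zero(1))
  thus ?thesis using assms by (metis M.minus_equality add.inv_closed one_closed fm_smult)
qed

lemma fm_smult_minus:
  assumes "fm M" "r \<in> car R" "x \<in> car M" "y \<in> car M"
  shows "r \<odot>\<^sub>M (x \<ominus>\<^sub>M y) = r \<odot>\<^sub>M x \<ominus>\<^sub>M r \<odot>\<^sub>M y"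
proof -
  interpret M: abelian_group M using assms fm_ag by auto
  have "r \<odot>\<^sub>M (\<ominus>\<^bsub>M\<^esub> y) \<oplus>\<^sub>M r \<odot>\<^sub>M y = \<zero>\<^sub>M"
    using assms fm_smult_simps(2)[of M r "\<ominus>\<^bsub>M\<^esub> y" y] by simp
  hence "r \<odot>\<^sub>M (\<ominus>\<^bsub>M\<^esub> y) = \<ominus>\<^bsub>M\<^esub> (r \<odot>\<^sub>M y)"
    using assms by (metis M.minus_equality fm_inv fm_smult)
  thus ?thesis using assms by (simp add: a_minus_def fm_smult_simps)
qed

lemma fm_minus_add:
  assumes "fm M" "x \<in> car M" "y \<in> car M"
  shows "(x \<ominus>\<^sub>M y) \<oplus>\<^sub>M y = x" "y \<oplus>\<^sub>M (x \<ominus>\<^sub>M y) = x" "(x \<oplus>\<^sub>M y) \<ominus>\<^sub>M y = x"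
    "(x \<oplus>\<^sub>M y) \<ominus>\<^sub>M x = y"
proof -
  interpret M: abelian_group M using assms fm_ag by auto
  show "(x \<ominus>\<^sub>M y) \<oplus>\<^sub>M y = x" "y \<oplus>\<^sub>M (x \<ominus>\<^sub>M y) = x" "(x \<oplus>\<^sub>M y) \<ominus>\<^sub>M y = x"
    "(x \<oplus>\<^sub>M y) \<ominus>\<^sub>M x = y"
    using assms M.a_lcomm[of x y "\<ominus>\<^bsub>M\<^esub> x"] M.a_lcomm[of y x "\<ominus>\<^bsub>M\<^esub> y"] by (auto simp: a_minus_def M.a_assoc M.r_neg M.l_neg)
qed

lemma fm_minus_eq_zero:
  assumes "fm M" "x \<in> car M" "y \<in> car M"
  shows "x \<ominus>\<^sub>M y = \<zero>\<^sub>M \<longleftrightarrow> x = y" using fm_minus_add(1)[OF assms] assms by auto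

lemma fm_add4:
  assumes "fm M" "a \<in> car M" "b \<in> car M" "c \<in> car M" "d \<in> car M"
  shows "(a \<oplus>\<^sub>M b) \<oplus>\<^sub>M (c \<oplus>\<^sub>M d) = (a \<oplus>\<^sub>M c) \<oplus>\<^sub>M (b \<oplus>\<^sub>M d)"
    "(a \<oplus>\<^sub>M b) \<ominus>\<^sub>M (c \<oplus>\<^sub>M d) = (a \<ominus>\<^sub>M c) \<oplus>\<^sub>M (b \<ominus>\<^sub>M d)"
proof -
  interpret M: abelian_group M using assms fm_ag by auto
  show "(a \<oplus>\<^sub>M b) \<oplus>\<^sub>M (c \<oplus>\<^sub>M d) = (a \<oplus>\<^sub>M c) \<oplus>\<^sub>M (b \<oplus>\<^sub>M d)"
    "(a \<oplus>\<^sub>M b) \<ominus>\<^sub>M (c \<oplus>\<^sub>M d) = (a \<ominus>\<^sub>M c) \<oplus>\<^sub>M (b \<ominus>\<^sub>M d)"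
    using assms by (auto simp: a_minus_def M.a_ac M.minus_add)
qed

lemma fm_comm: "[|fm M; x \<in> car M; y \<in> car M|] ==> x \<oplus>\<^sub>M y = y \<oplus>\<^sub>M x" by (simp add: fm_ag abelian_groupE(4))

lemma lin_comp: "[|lin M N f; lin N L g|] ==> lin M L (\<lambda>x. g (f x))" by (auto simp: lin_def Pi_def)

lemma lin_id: "lin M M (\<lambda>x. x)" by (auto simp: lin_def)

lemma lin_zero_map: "fm N ==> lin M N (\<lambda>x. \<zero>\<^sub>N)" by (auto simp: lin_def)

lemma lin_plus: "[|fm N; lin M N f; lin M N g|] ==> lin M N (\<lambda>x. f x \<oplus>\<^sub>N g x)"
  unfolding lin_def by (auto simp: fm_add4(1) fm_smult_simps Pi_def)

lemma lin_diff: "[|fm N; lin M N f; lin M N g|] ==> lin M N (\<lambda>x. f x \<ominus>\<^sub>N g x)"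
  unfolding lin_def by (auto simp: fm_add4(2) fm_smult_minus Pi_def)

lemma lin_cong: "[|lin M N f; !!x. x \<in> car M ==> f x = g x; fm M|] ==> lin M N g" unfolding lin_def by (auto simp: Pi_iff)

lemma mod_hom_iff: "f \<in> Hom M N \<longleftrightarrow> lin M N f \<and> f \<in> extensional (car M)" by (auto simp: mod_hom_def lin_def PiE_def)

lemma restrict_mod_hom: "[|lin M N f; fm M|] ==> restrict f (car M) \<in> Hom M N" by (simp add: mod_hom_iff lin_cong[of M N f])

lemma mod_hom_eqI:
  "[|f \<in> Hom M N; g \<in> Hom M N; !!x. x \<in> car M ==> f x = g x|] ==> f = g" by (auto simp: mod_hom_iff intro: extensionalityI)

lemma finite_mod_hom [simp]: "[|fm M; fm N|] ==> finite (Hom M N)"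
  by (rule finite_subset[of _ "car M \<rightarrow>\<^sub>E car N"]) (auto simp: mod_hom_def intro: finite_PiE)

text \<open>Module axioms pass along a surjection compatible with the operations. Quotients, copies
  on natural numbers and tables of operations are all certified in this way.\<close>

lemma fm_surj:
  assumes M: "fm M" and img: "q ` car M = car N"
    and add: "!!x y. [|x \<in> car M; y \<in> car M|] ==> q x \<oplus>\<^sub>N q y = q (x \<oplus>\<^sub>M y)"
    and zero: "\<zero>\<^sub>N = q \<zero>\<^sub>M"
    and smult: "!!r x. [|r \<in> car R; x \<in> car M|] ==> r \<odot>\<^sub>N q x = q (r \<odot>\<^sub>M x)"
  shows "fm N" "lin M N q"
proof -
  interpret M: abelian_group M using M fm_ag by auto
  have *: "!!y. y \<in> car N ==> \<exists>x\<in>car M. y = q x" using img by auto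
  have [simp]: "!!x. x \<in> car M ==> q x \<in> car N" using img by auto
  have "abelian_group N"
  proof (rule abelian_groupI)
    show "\<exists>y\<in>car N. y \<oplus>\<^sub>N x = \<zero>\<^sub>N" if x: "x \<in> car N" for x
    proof -
      obtain x' where "x' \<in> car M" "x = q x'" using * x by blast
      thus ?thesis using M by (intro bexI[of _ "q (\<ominus>\<^bsub>M\<^esub> x')"]) (auto simp: zero add M.l_neg)
    qed
  qed (auto dest!: * simp: add zero M M.a_ac)
  hence "left_module R N" using ring_axioms by (intro left_module.intro left_module_axioms.intro)
      (auto dest!: * simp: add smult M fm_smult_simps)
  thus "fm N" using M img fm_def by (metis finite_imageI)
  show "lin M N q" using add smult by (auto simp: lin_def)
qed

section \<open>Submodules, kernels, images and sums\<close>

lemma fm_sub: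
  assumes "fm M" "submodule U R M" shows "fm (sub_mod M U)"
proof -
  interpret M: abelian_group M using assms fm_ag by auto
  interpret U: submodule U R M by fact
  have U: "U \<subseteq> car M" "\<zero>\<^sub>M \<in> U" "!!x y. [|x \<in> U; y \<in> U|] ==> x \<oplus>\<^sub>M y \<in> U"
    "!!x. x \<in> U ==> \<ominus>\<^bsub>M\<^esub> x \<in> U" using U.subset U.one_closed U.m_closed U.m_inv_closed by (auto simp: a_inv_def)
  have "abelian_group (sub_mod M U)"
  proof (rule abelian_groupI)
    show "\<exists>y\<in>car (sub_mod M U). y \<oplus>\<^sub>(sub_mod M U) x = \<zero>\<^sub>(sub_mod M U)" if "x \<in> car (sub_mod M U)" for x
      by (rule bexI[of _ "\<ominus>\<^bsub>M\<^esub> x"]) (use that U(1,4) M.l_neg[of x] in \<open>auto simp: sub_mod_def\<close>)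
  qed (use U in \<open>auto simp: sub_mod_def subset_iff M.a_ac\<close>)
  hence "left_module R (sub_mod M U)" using ring_axioms U by (intro left_module.intro left_module_axioms.intro)
      (auto simp: sub_mod_def subset_iff assms fm_smult_simps)
  thus ?thesis using U assms by (auto simp: fm_def sub_mod_def intro: finite_subset)
qed

lemma sub_mod_simps [simp]:
  "car (sub_mod M U) = U" "\<zero>\<^sub>(sub_mod M U) = \<zero>\<^sub>M" "x \<oplus>\<^sub>(sub_mod M U) y = x \<oplus>\<^sub>M y"
  "r \<odot>\<^sub>(sub_mod M U) x = r \<odot>\<^sub>M x" by (auto simp: sub_mod_def)

text \<open>Negatives come for free as multiples by \<open>\<ominus> \<one>\<close>, so closure
  under addition and scalars suffices.\<close>

lemma sub_iff:
  assumes M: "fm M"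
  shows "submodule U R M \<longleftrightarrow> U \<subseteq> car M \<and> \<zero>\<^sub>M \<in> U \<and> (\<forall>x\<in>U. \<forall>y\<in>U. x \<oplus>\<^sub>M y \<in> U) \<and>
    (\<forall>r\<in>car R. \<forall>x\<in>U. r \<odot>\<^sub>M x \<in> U)"
proof
  assume "submodule U R M"
  then interpret U: submodule U R M .
  show "U \<subseteq> car M \<and> \<zero>\<^sub>M \<in> U \<and> (\<forall>x\<in>U. \<forall>y\<in>U. x \<oplus>\<^sub>M y \<in> U) \<and>
    (\<forall>r\<in>car R. \<forall>x\<in>U. r \<odot>\<^sub>M x \<in> U)" using U.subset U.one_closed U.m_closed by auto
next
  interpret M: abelian_group M using assms fm_ag by auto
  assume U: "U \<subseteq> car M \<and> \<zero>\<^sub>M \<in> U \<and> (\<forall>x\<in>U. \<forall>y\<in>U. x \<oplus>\<^sub>M y \<in> U) \<and>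
    (\<forall>r\<in>car R. \<forall>x\<in>U. r \<odot>\<^sub>M x \<in> U)"
  hence "\<ominus>\<^bsub>M\<^esub> x \<in> U" if "x \<in> U" for x using that fm_smult_inv[OF M, of x] a_inv_closed[OF one_closed] by (metis subsetD)
  thus "submodule U R M" using U by (intro submodule.intro subgroup.intro submodule_axioms.intro) (auto simp: a_inv_def)
qed

lemma subD:
  assumes "submodule U R M" "fm M"
  shows "U \<subseteq> car M" "\<zero>\<^sub>M \<in> U" "!!x. x \<in> U ==> x \<in> car M"
    "!!x y. [|x \<in> U; y \<in> U|] ==> x \<oplus>\<^sub>M y \<in> U" "!!r x. [|r \<in> car R; x \<in> U|] ==> r \<odot>\<^sub>M x \<in> U"
  using assms(1) unfolding sub_iff[OF assms(2)] by auto

lemma sub_minus: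
  assumes "submodule U R M" "fm M" "x \<in> U" "y \<in> U" shows "x \<ominus>\<^sub>M y \<in> U"
proof -
  have "\<ominus>\<^bsub>M\<^esub> y = (\<ominus> \<one>) \<odot>\<^sub>M y" using assms by (simp add: fm_smult_inv subD(3))
  hence "\<ominus>\<^bsub>M\<^esub> y \<in> U" using assms subD(5)[OF assms(1,2)] by simp
  thus ?thesis using assms by (simp add: a_minus_def subD(4))
qed

lemma sub_mod_minus:
  assumes "submodule U R M" "fm M" "x \<in> U" "y \<in> U" shows "x \<ominus>\<^sub>(sub_mod M U) y = x \<ominus>\<^sub>M y"
proof -
  note S = fm_sub[OF assms(2,1)]
  have "lin (sub_mod M U) M (\<lambda>x. x)" using assms by (auto simp: lin_def subD(3))
  thus ?thesis using lin_minus[OF S assms(2)] assms by simp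
qed

lemma sub_mod_self: "sub_mod M (car M) = M" by (simp add: sub_mod_def)

lemma lin_incl: "[|fm M; submodule U R M|] ==> lin (sub_mod M U) M (\<lambda>x. x)" by (auto simp: lin_def subD(3))

lemma lin_sub_dom: "[|lin M N f; submodule U R M; fm M|] ==> lin (sub_mod M U) N f" by (auto simp: lin_def subD(3))

lemma lin_sub_cod: "[|lin M N f; !!x. x \<in> car M ==> f x \<in> U|] ==> lin M (sub_mod N U) f" by (auto simp: lin_def)

lemma sub_sub:
  assumes "fm M" "submodule U R M"
  shows "submodule V R (sub_mod M U) \<longleftrightarrow> submodule V R M \<and> V \<subseteq> U" using assms by (auto simp: sub_iff fm_sub)

lemma sub_mod_sub_mod: "sub_mod (sub_mod M U) V = sub_mod M V" by (simp add: sub_mod_def)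

lemma sub_all: "fm M ==> submodule (car M) R M" by (simp add: sub_iff)

lemma sub_zero: "fm M ==> submodule {\<zero>\<^sub>M} R M" by (simp add: sub_iff)

lemma sub_Int: "[|fm M; submodule U R M; submodule V R M|] ==> submodule (U \<inter> V) R M" by (auto simp: sub_iff)

lemma sub_ker: "[|fm M; fm N; lin M N f|] ==> submodule (ker M N f) R M" by (auto simp: sub_iff ker_def lin_add lin_smult lin_zero)

lemma sub_vimage:
  "[|fm M; fm N; lin M N f; submodule V R N|] ==> submodule {x \<in> car M. f x \<in> V} R M" by (auto simp: sub_iff lin_add lin_smult lin_zero)

lemma sub_image:
  assumes "fm M" "fm N" "lin M N f" "submodule U R M" shows "submodule (f ` U) R N"
proof -
  have U: "!!x. x \<in> U ==> x \<in> car M" using assms subD by blast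
  show ?thesis unfolding sub_iff[OF assms(2)]
  proof (intro conjI ballI)
    show "f ` U \<subseteq> car N" using U lin_closed[OF assms(3)] by auto
    show "\<zero>\<^sub>N \<in> f ` U" using lin_zero[OF assms(1-3)] subD(2)[OF assms(4,1)] by (metis imageI)
    show "a \<oplus>\<^sub>N b \<in> f ` U" if ab: "a \<in> f ` U" "b \<in> f ` U" for a b
    proof -
      obtain u v where "a = f u" "b = f v" "u \<in> U" "v \<in> U" using ab by blast
      thus ?thesis using lin_add[OF assms(3), of u v] U subD(4)[OF assms(4,1), of u v] by force
    qed
    show "r \<odot>\<^sub>N b \<in> f ` U" if ab: "r \<in> car R" "b \<in> f ` U" for r b
    proof -
      obtain v where "b = f v" "v \<in> U" using ab by blast
      thus ?thesis using ab lin_smult[OF assms(3), of r v] U subD(5)[OF assms(4,1), of r v] by force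
    qed
  qed
qed

definition plus_set :: "('r, 'a) module => 'a set => 'a set => 'a set" where
  "plus_set M U V = {u \<oplus>\<^sub>M v | u v. u \<in> U \<and> v \<in> V}"

lemma set_add_plus_set: "U <+>\<^bsub>M\<^esub> V = plus_set M U V" by (auto simp: plus_set_def set_add_def set_mult_def)

lemma sub_plus:
  assumes "fm M" "submodule U R M" "submodule V R M" shows "submodule (plus_set M U V) R M" unfolding sub_iff[OF assms(1)]
proof (intro conjI ballI)
  have UV: "!!x. x \<in> U ==> x \<in> car M" "!!x. x \<in> V ==> x \<in> car M" using assms subD by blast+
  show "plus_set M U V \<subseteq> car M" using UV assms by (auto simp: plus_set_def)
  show "\<zero>\<^sub>M \<in> plus_set M U V" using assms subD(2) fm_zeros(1)[OF assms(1) fm_zero[OF assms(1)]] unfolding plus_set_def by force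
  show "a \<oplus>\<^sub>M b \<in> plus_set M U V" if ab: "a \<in> plus_set M U V" "b \<in> plus_set M U V" for a b
  proof -
    obtain u v u' v' where *: "a = u \<oplus>\<^sub>M v" "b = u' \<oplus>\<^sub>M v'" "u \<in> U" "u' \<in> U" "v \<in> V" "v' \<in> V"
      using ab unfolding plus_set_def by blast
    hence "a \<oplus>\<^sub>M b = (u \<oplus>\<^sub>M u') \<oplus>\<^sub>M (v \<oplus>\<^sub>M v')" using UV assms fm_add4 by metis
    moreover have "u \<oplus>\<^sub>M u' \<in> U" "v \<oplus>\<^sub>M v' \<in> V" using * subD(4)[OF assms(2,1)] subD(4)[OF assms(3,1)] by auto
    ultimately show ?thesis unfolding plus_set_def by blast
  qed
  show "r \<odot>\<^sub>M a \<in> plus_set M U V" if ab: "r \<in> car R" "a \<in> plus_set M U V" for r a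
  proof -
    obtain u v where *: "a = u \<oplus>\<^sub>M v" "u \<in> U" "v \<in> V" using ab unfolding plus_set_def by blast
    hence "r \<odot>\<^sub>M a = r \<odot>\<^sub>M u \<oplus>\<^sub>M r \<odot>\<^sub>M v" using UV assms fm_smult_simps ab by metis
    moreover have "r \<odot>\<^sub>M u \<in> U" "r \<odot>\<^sub>M v \<in> V" using * ab subD(5)[OF assms(2,1)] subD(5)[OF assms(3,1)] by auto
    ultimately show ?thesis unfolding plus_set_def by blast
  qed
qed

lemma plus_set_upper:
  assumes "fm M" "submodule U R M" "submodule V R M"
  shows "U \<subseteq> plus_set M U V" "V \<subseteq> plus_set M U V"
proof -
  have "u = u \<oplus>\<^sub>M \<zero>\<^sub>M" if "u \<in> U" for u using assms that subD(3) by force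
  thus "U \<subseteq> plus_set M U V" using subD(2)[OF assms(3,1)] by (auto simp: plus_set_def)
  have "u = \<zero>\<^sub>M \<oplus>\<^sub>M u" if "u \<in> V" for u using assms that subD(3) by force
  thus "V \<subseteq> plus_set M U V" using subD(2)[OF assms(2,1)] by (auto simp: plus_set_def)
qed

lemma inj_on_iff_ker:
  assumes "fm M" "fm N" "lin M N f"
  shows "inj_on f (car M) \<longleftrightarrow> (\<forall>x\<in>car M. f x = \<zero>\<^sub>N --> x = \<zero>\<^sub>M)"
proof
  assume "inj_on f (car M)"
  thus "\<forall>x\<in>car M. f x = \<zero>\<^sub>N --> x = \<zero>\<^sub>M" using lin_zero[OF assms] assms by (metis fm_zero inj_onD)
next
  assume *: "\<forall>x\<in>car M. f x = \<zero>\<^sub>N --> x = \<zero>\<^sub>M"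
  show "inj_on f (car M)"
  proof (rule inj_onI)
    fix x y assume xy: "x \<in> car M" "y \<in> car M" "f x = f y"
    have "f y \<in> car N" using xy lin_closed[OF assms(3)] by blast
    hence "f (x \<ominus>\<^sub>M y) = \<zero>\<^sub>N" using xy lin_minus[OF assms xy(1,2)] assms by simp
    thus "x = y" using * xy assms fm_minus_eq_zero by (metis fm_minus)
  qed
qed

text \<open>A map killing the kernel of an epimorphism descends. Its value is taken at an arbitrary
  preimage; \<open>fq\<close> makes the choice immaterial, and linearity is then checked on
  preimages.\<close>

lemma factor:
  assumes "fm M" "fm Q" "fm N" and q: "lin M Q q" and onto: "q ` car M = car Q" and f: "lin M N f"
    and k: "!!x. [|x \<in> car M; q x = \<zero>\<^sub>Q|] ==> f x = \<zero>\<^sub>N"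
  obtains g where "lin Q N g" "!!x. x \<in> car M ==> g (q x) = f x"
proof -
  have fq: "f x = f y" if "x \<in> car M" "y \<in> car M" "q x = q y" for x y
  proof -
    have "q y \<in> car Q" "f x \<in> car N" "f y \<in> car N" using that lin_closed[OF q] lin_closed[OF f] by blast+
    moreover have "q (x \<ominus>\<^sub>M y) = \<zero>\<^sub>Q" using that lin_minus[OF assms(1,2) q] assms(2) \<open>q y \<in> car Q\<close> by simp
    hence "f (x \<ominus>\<^sub>M y) = \<zero>\<^sub>N" using k[of "x \<ominus>\<^sub>M y"] that assms(1) by simp
    ultimately show ?thesis using that lin_minus[OF assms(1,3) f] assms fm_minus_eq_zero by metis
  qed
  define g where "g = (\<lambda>y. f (SOME x. x \<in> car M \<and> q x = y))"
  have g: "g (q x) = f x" if "x \<in> car M" for x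
    unfolding g_def by (rule fq) (use that someI_ex[of "\<lambda>z. z \<in> car M \<and> q z = q x"] in auto)
  have "lin Q N g" unfolding lin_def
  proof (intro conjI ballI funcsetI)
    have ex: "\<exists>x'\<in>car M. y = q x'" if "y \<in> car Q" for y using onto that by auto
    show "g y \<in> car N" if "y \<in> car Q" for y using ex[OF that] g lin_closed[OF f] by auto
    show "g (y \<oplus>\<^sub>Q z) = g y \<oplus>\<^sub>N g z" if yz: "y \<in> car Q" "z \<in> car Q" for y z
    proof -
      obtain y' z' where "y' \<in> car M" "z' \<in> car M" "y = q y'" "z = q z'" using ex yz by blast
      thus ?thesis using g lin_add[OF q] lin_add[OF f] assms(1) by (metis fm_add)
    qed
    show "g (r \<odot>\<^sub>Q y) = r \<odot>\<^sub>N g y" if yz: "r \<in> car R" "y \<in> car Q" for r y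
    proof -
      obtain y' where "y' \<in> car M" "y = q y'" using ex yz by blast
      thus ?thesis using g lin_smult[OF q] lin_smult[OF f] assms(1) yz by (metis fm_smult)
    qed
  qed
  thus thesis using g that by blast
qed

lemma factor':
  assumes "fm M" "fm Q" "fm N" "lin M Q q" "q ` car M = car Q" "lin M N f"
    and "!!x. [|x \<in> car M; q x = \<zero>\<^sub>Q|] ==> f x = \<zero>\<^sub>N"
  shows "\<exists>g. lin Q N g \<and> (\<forall>x\<in>car M. g (q x) = f x)" using factor[OF assms(1-6)] assms(7) by metis

lemma lin_bij_inv:
  assumes "fm M" "lin M N f" "bij_betw f (car M) (car N)"
  shows "lin N M (inv_into (car M) f)" "bij_betw (inv_into (car M) f) (car N) (car M)"
proof -
  let ?g = "inv_into (car M) f"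
  have img: "f ` car M = car N" and inj: "inj_on f (car M)" using assms(3) by (auto simp: bij_betw_def)
  have g: "?g y \<in> car M" "f (?g y) = y" if "y \<in> car N" for y using that img by (auto intro: inv_into_into f_inv_into_f)
  have g': "?g (f x) = x" if "x \<in> car M" for x using that inj by simp
  show "lin N M ?g" unfolding lin_def
  proof (intro conjI ballI funcsetI)
    show "?g x \<in> car M" if "x \<in> car N" for x using g that by blast
    show "?g (x \<oplus>\<^sub>N y) = ?g x \<oplus>\<^sub>M ?g y" if "x \<in> car N" "y \<in> car N" for x y
      using g'[of "?g x \<oplus>\<^sub>M ?g y"] g that lin_add[OF assms(2), of "?g x" "?g y"] assms(1) by simp
    show "?g (r \<odot>\<^sub>N x) = r \<odot>\<^sub>M ?g x" if "r \<in> car R" "x \<in> car N" for x r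
      using g'[of "r \<odot>\<^sub>M ?g x"] g that lin_smult[OF assms(2), of r "?g x"] assms(1) by simp
  qed
  show "bij_betw ?g (car N) (car M)" using assms(3) bij_betw_inv_into by blast
qed

section \<open>Isomorphisms and copies of modules\<close>

lemma mod_isoI: "[|fm M; lin M N f; bij_betw f (car M) (car N)|] ==> mod_iso R M N"
  unfolding mod_iso_def by (rule bexI[of _ "restrict f (car M)"]) (auto simp: bij_betw_restrict_eq restrict_mod_hom)

lemma mod_isoI':
  "[|fm M; fm N; lin M N f; f ` car M = car N;
    !!x. [|x \<in> car M; f x = \<zero>\<^sub>N|] ==> x = \<zero>\<^sub>M|] ==> mod_iso R M N"
  by (rule mod_isoI) (auto simp: bij_betw_def inj_on_iff_ker)

lemma mod_isoE:
  assumes "mod_iso R M N" obtains f where "lin M N f" "bij_betw f (car M) (car N)" using assms mod_iso_def mod_hom_iff by metis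

lemma iso_refl: "fm M ==> mod_iso R M M" by (rule mod_isoI[of _ _ "\<lambda>x. x"]) (auto simp: lin_id bij_betw_def)

lemma iso_sym: "[|mod_iso R M N; fm M; fm N|] ==> mod_iso R N M" by (metis lin_bij_inv mod_isoE mod_isoI)

lemma iso_trans: "[|mod_iso R M N; mod_iso R N L; fm M|] ==> mod_iso R M L"
proof (elim mod_isoE)
  fix f g assume "fm M" "lin M N f" "bij_betw f (car M) (car N)"
    "lin N L g" "bij_betw g (car N) (car L)"
  thus "mod_iso R M L" using mod_isoI[of M L "\<lambda>x. g (f x)"] lin_comp[of M N f L g] bij_betw_trans[of f _ _ g] by (simp add: comp_def)
qed

lemma iso_card: "mod_iso R M N ==> card (car M) = card (car N)" by (metis bij_betw_same_card mod_isoE)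

lemma surj_iso:
  assumes "fm M" "fm Q" "fm N" "lin M Q q" "q ` car M = car Q" "lin M N f" "f ` car M = car N"
    and k: "!!x. x \<in> car M ==> q x = \<zero>\<^sub>Q \<longleftrightarrow> f x = \<zero>\<^sub>N"
  shows "mod_iso R Q N"
proof -
  obtain g where g: "lin Q N g" "!!x. x \<in> car M ==> g (q x) = f x" using factor[OF assms(1-6)] k by metis
  show ?thesis
  proof (rule mod_isoI'[OF assms(2,3) g(1)])
    show "g ` car Q = car N" using g(2) assms(5,7) by (metis (no_types, lifting) image_cong image_image)
    show "x = \<zero>\<^sub>Q" if "x \<in> car Q" "g x = \<zero>\<^sub>N" for x using that g(2) assms(5) k by (metis imageE)
  qed
qed

lemma is_zero_iff_card:
  assumes "fm M" shows "is_zero M \<longleftrightarrow> card (car M) = 1"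
proof
  assume "card (car M) = 1"
  then obtain x where x: "car M = {x}" by (rule card_1_singletonE)
  hence "x = \<zero>\<^sub>M" using fm_zero[OF assms] by simp
  thus "is_zero M" using x unfolding is_zero_def by simp
qed (simp add: is_zero_def)

text \<open>The definitions of projectivity, injectivity, the translates and isomorphism classes
  quantify over modules with carrier in \<open>nat\<close>. Copies carry their conclusions to
  carriers of other types.\<close>

lemma exists_nat_copy:
  fixes M :: "('r, 'a) module"
  assumes M: "fm M" obtains N :: "'r nmod" where "fm N" "mod_iso R M N"
proof -
  have "\<exists>h :: 'a => nat. inj_on h (car M)" using finite_imp_inj_to_nat_seg[of "car M"] M by auto
  then obtain h :: "'a => nat" where h: "inj_on h (car M)" ..
  let ?i = "inv_into (car M) h"
  define N :: "'r nmod" where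
    "N = \<lparr>carrier = h ` car M, mult = undefined, one = undefined, ring.zero = h \<zero>\<^sub>M,
      ring.add = (\<lambda>x y. h (?i x \<oplus>\<^sub>M ?i y)), smult = (\<lambda>r x. h (r \<odot>\<^sub>M ?i x))\<rparr>"
  have "fm N" "lin M N h" by (rule fm_surj[OF M, of h]; use h M in \<open>simp add: N_def\<close>)+
  moreover have "bij_betw h (car M) (car N)" using h by (auto simp: bij_betw_def N_def)
  ultimately show thesis using M mod_isoI that by blast
qed

lemma quot_mod:
  assumes M: "fm M" and U: "submodule U R M"
  shows "fm (quot_mod M U)" (is ?A) "lin M (quot_mod M U) (a_r_coset M U)" (is ?B)
    "a_r_coset M U ` car M = car (quot_mod M U)" (is ?C)
    "!!x. x \<in> car M ==> a_r_coset M U x = \<zero>\<^sub>(quot_mod M U) \<longleftrightarrow> x \<in> U"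
proof -
  interpret M: abelian_group M using M fm_ag by auto
  interpret U: submodule U R M by fact
  interpret US: abelian_subgroup U M by (rule abelian_subgroupI3)
      (use U.subgroup_axioms M.abelian_group_axioms in \<open>auto simp: additive_subgroup_def\<close>)
  have eq: "U +>\<^bsub>M\<^esub> x = U +>\<^bsub>M\<^esub> y \<longleftrightarrow> x \<ominus>\<^sub>M y \<in> U" if "x \<in> car M" "y \<in> car M" for x y
    using that by (metis US.a_rcos_module US.a_rcos_self US.a_repr_independence' US.a_repr_independenceD a_minus_def)
  \<comment> \<open>The scalar action on cosets is defined as a union over representatives; all of
    them contribute the same coset.\<close>
  have sm: "(\<Union>y\<in>U +>\<^bsub>M\<^esub> x. U +>\<^bsub>M\<^esub> (r \<odot>\<^sub>M y)) = U +>\<^bsub>M\<^esub> (r \<odot>\<^sub>M x)" if "r \<in> car R" "x \<in> car M" for r x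
  proof -
    have "U +>\<^bsub>M\<^esub> (r \<odot>\<^sub>M y) = U +>\<^bsub>M\<^esub> (r \<odot>\<^sub>M x)" if y: "y \<in> U +>\<^bsub>M\<^esub> x" for y
    proof -
      have yM: "y \<in> car M" using y US.a_elemrcos_carrier \<open>x \<in> car M\<close> by blast
      hence "y \<ominus>\<^sub>M x \<in> U" using US.a_rcos_module y \<open>x \<in> car M\<close> by (simp add: a_minus_def)
      hence "r \<odot>\<^sub>M (y \<ominus>\<^sub>M x) \<in> U" using \<open>r \<in> car R\<close> by simp
      thus ?thesis using eq yM M that \<open>r \<in> car R\<close> \<open>x \<in> car M\<close> by (simp add: fm_smult_minus)
    qed
    moreover have "x \<in> U +>\<^bsub>M\<^esub> x" using US.a_rcos_self that by blast
    ultimately show ?thesis by blast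
  qed
  show C: ?C by (auto simp: quot_mod_def A_RCOSETS_def')
  have U0: "U +>\<^bsub>M\<^esub> \<zero>\<^sub>M = U" using U.subset by simp
  have ops: "(U +>\<^bsub>M\<^esub> x) \<oplus>\<^sub>(quot_mod M U) (U +>\<^bsub>M\<^esub> y) = U +>\<^bsub>M\<^esub> (x \<oplus>\<^sub>M y)"
    "\<zero>\<^sub>(quot_mod M U) = U +>\<^bsub>M\<^esub> \<zero>\<^sub>M"
    "r \<in> car R ==> r \<odot>\<^sub>(quot_mod M U) (U +>\<^bsub>M\<^esub> x) = U +>\<^bsub>M\<^esub> (r \<odot>\<^sub>M x)"
    if "x \<in> car M" "y \<in> car M" for x y r using that U0 by (simp_all add: quot_mod_def US.a_rcos_sum sm)
  show ?A by (rule fm_surj(1)[OF M C]) (simp_all add: ops ops(2)[of "\<zero>\<^sub>M" "\<zero>\<^sub>M"] M)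
  show ?B by (rule fm_surj(2)[OF M C]) (simp_all add: ops ops(2)[of "\<zero>\<^sub>M" "\<zero>\<^sub>M"] M)
  show "a_r_coset M U x = \<zero>\<^sub>(quot_mod M U) \<longleftrightarrow> x \<in> U" if "x \<in> car M" for x
    using that eq[of x "\<zero>\<^sub>M"] M ops(2)[OF that that] by simp
qed

text \<open>A step from \<open>U\<close> to \<open>V\<close> of the series has no submodule strictly
  between, so any \<open>x \<in> V - U\<close> gives \<open>V = R x + U\<close>. Hence each step
  multiplies the size by at most that of \<open>R\<close>.\<close>

lemma finite_length_imp_finite:
  assumes M: "left_module R M" and Us: "composition_series R M Us"
  shows "finite (car M)"
proof -
  interpret M: left_module R M by fact
  \<comment> \<open>These two rules are rederived because finiteness, and with it \<open>fm\<close>,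
    is what is being proved.\<close>
  have zs: "\<zero> \<odot>\<^sub>M x = \<zero>\<^sub>M" if "x \<in> car M" for x
    using that M.smult_l_distr[of \<zero> \<zero> x] M.smult_closed[of \<zero> x] by (metis M.add.r_cancel_one' l_zero zero_closed)
  have ms: "(\<ominus> r) \<odot>\<^sub>M x = \<ominus>\<^bsub>M\<^esub> (r \<odot>\<^sub>M x)" if "x \<in> car M" "r \<in> car R" for x r
    using that M.smult_l_distr[of "\<ominus> r" r x] zs[of x] M.smult_closed by (metis M.M.minus_equality a_inv_closed l_neg)
  have "finite (Us ! i)" if "i < length Us" for i using that
  proof (induction i)
    case 0
    thus ?case using Us by (metis composition_series_def finite.emptyI finite.insertI hd_conv_nth)
  next
    case (Suc i)
    let ?U = "Us ! i" and ?V = "Us ! Suc i"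
    have fin: "finite ?U" using Suc by simp
    have U: "submodule ?U R M" and V: "submodule ?V R M" and UV: "?U \<subset> ?V"
      and max: "!!W. submodule W R M ==> \<not> (?U \<subset> W \<and> W \<subset> ?V)" using Us Suc.prems unfolding composition_series_def by auto
    interpret U: submodule ?U R M by fact
    interpret V: submodule ?V R M by fact
    obtain x where x: "x \<in> ?V" "x \<notin> ?U" using UV by blast
    hence xM [simp]: "x \<in> car M" using V.subset by auto
    have UM [simp]: "!!u. u \<in> ?U ==> u \<in> car M" using U.subset by auto
    define W where "W = (\<lambda>(r, u). r \<odot>\<^sub>M x \<oplus>\<^sub>M u) ` (car R \<times> ?U)"
    have WI: "r \<odot>\<^sub>M x \<oplus>\<^sub>M u \<in> W" if "r \<in> car R" "u \<in> ?U" for r u using that by (auto simp: W_def)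
    have WE: "\<exists>r u. r \<in> car R \<and> u \<in> ?U \<and> w = r \<odot>\<^sub>M x \<oplus>\<^sub>M u" if "w \<in> W" for w
      using that by (auto simp: W_def)
    have "submodule W R M"
    proof (intro submodule.intro subgroup.intro submodule_axioms.intro)
      show "W \<subseteq> car (add_monoid M)" by (auto simp: W_def M.smult_closed)
      show "\<one>\<^bsub>add_monoid M\<^esub> \<in> W" using WI[of \<zero> "\<zero>\<^sub>M"] U.one_closed zs[of x] by simp
      show "a \<otimes>\<^bsub>add_monoid M\<^esub> b \<in> W" if "a \<in> W" "b \<in> W" for a b
      proof -
        obtain r u s v where *: "r \<in> car R" "s \<in> car R" "u \<in> ?U" "v \<in> ?U"
          "a = r \<odot>\<^sub>M x \<oplus>\<^sub>M u" "b = s \<odot>\<^sub>M x \<oplus>\<^sub>M v"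
          using WE[OF \<open>a \<in> W\<close>] WE[OF \<open>b \<in> W\<close>] by blast
        have "a \<oplus>\<^sub>M b = (r \<oplus> s) \<odot>\<^sub>M x \<oplus>\<^sub>M (u \<oplus>\<^sub>M v)"
          using * by (simp add: M.smult_l_distr M.smult_closed M.M.a_ac)
        thus ?thesis using WI[of "r \<oplus> s" "u \<oplus>\<^sub>M v"] * U.m_closed[of u v] by simp
      qed
      show "inv\<^bsub>add_monoid M\<^esub> a \<in> W" if "a \<in> W" for a
      proof -
        obtain r u where *: "r \<in> car R" "u \<in> ?U" "a = r \<odot>\<^sub>M x \<oplus>\<^sub>M u" using WE[OF \<open>a \<in> W\<close>] by blast
        have "\<ominus>\<^bsub>M\<^esub> a = (\<ominus> r) \<odot>\<^sub>M x \<oplus>\<^sub>M (\<ominus>\<^bsub>M\<^esub> u)"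
          using * by (simp add: ms M.smult_closed M.M.minus_add)
        thus ?thesis using WI[of "\<ominus> r" "\<ominus>\<^bsub>M\<^esub> u"] * U.m_inv_closed[of u] by (simp add: a_inv_def)
      qed
      show "r \<odot>\<^sub>M a \<in> W" if "r \<in> car R" "a \<in> W" for r a
      proof -
        obtain s u where *: "s \<in> car R" "u \<in> ?U" "a = s \<odot>\<^sub>M x \<oplus>\<^sub>M u" using WE[OF \<open>a \<in> W\<close>] by blast
        have "r \<odot>\<^sub>M a = (r \<otimes> s) \<odot>\<^sub>M x \<oplus>\<^sub>M r \<odot>\<^sub>M u"
          using * that by (simp add: M.smult_r_distr M.smult_assoc M.smult_closed)
        thus ?thesis using WI[of "r \<otimes> s" "r \<odot>\<^sub>M u"] * that by simp
      qed
    qed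
    moreover have "?U \<subset> W"
    proof -
      have "u \<in> W" if "u \<in> ?U" for u using WI[OF zero_closed that] that by (simp add: zs)
      moreover have "x \<in> W" using WI[OF one_closed U.one_closed] by (simp add: M.smult_one)
      ultimately show ?thesis using x by blast
    qed
    moreover have "W \<subseteq> ?V" using x UV V.m_closed by (auto simp: W_def)
    ultimately have "W = ?V" using max by blast
    moreover have "finite W" using fin finite_R by (simp add: W_def)
    ultimately show ?case by simp
  qed
  thus ?thesis using Us unfolding composition_series_def by (metis diff_less last_conv_nth length_greater_0_conv zero_less_one)
qed

text \<open>Induction on the size of \<open>V\<close>: a maximal proper submodule \<open>W\<close>
  of \<open>V\<close> leaves nothing between, and its own series is prolonged by
  \<open>V\<close>.\<close>

lemma exists_composition_series:
  assumes M: "fm M" and "submodule V R M"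
  shows "\<exists>Us. Us \<noteq> [] \<and> hd Us = {\<zero>\<^sub>M} \<and> last Us = V \<and> (\<forall>U\<in>set Us. submodule U R M) \<and>
     (\<forall>i. Suc i < length Us --> Us ! i \<subset> Us ! Suc i \<and>
        \<not> (\<exists>W. submodule W R M \<and> Us ! i \<subset> W \<and> W \<subset> Us ! Suc i))" using assms(2)
proof (induction "card V" arbitrary: V rule: less_induct)
  case less
  note V = subD[OF less.prems M]
  have fV: "finite V" using V(1) M finite_subset fm_finite by blast
  show ?case
  proof (cases "V = {\<zero>\<^sub>M}")
    case True
    thus ?thesis using M sub_zero by (intro exI[of _ "[{\<zero>\<^sub>M}]"]) auto
  next
    case False
    let ?S = "{W. submodule W R M \<and> W \<subset> V}"
    have "finite ?S" by (rule finite_subset[of _ "Pow V"]) (use fV in auto)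
    moreover have "{\<zero>\<^sub>M} \<in> ?S" using False V sub_zero[OF M] by auto
    ultimately obtain W where W: "W \<in> ?S" and max: "!!W'. W' \<in> ?S ==> W \<subseteq> W' ==> W = W'"
      using finite_has_maximal[of ?S] by (metis (no_types, lifting) empty_iff)
    have "card W < card V" using W fV by (auto intro: psubset_card_mono)
    then obtain Us where Us: "Us \<noteq> []" "hd Us = {\<zero>\<^sub>M}" "last Us = W" "\<forall>U\<in>set Us. submodule U R M"
       "\<forall>i. Suc i < length Us --> Us ! i \<subset> Us ! Suc i \<and>
        \<not> (\<exists>W. submodule W R M \<and> Us ! i \<subset> W \<and> W \<subset> Us ! Suc i)" using less.hyps[of W] W by blast
    show ?thesis
    proof (intro exI[of _ "Us @ [V]"] conjI allI impI)
      fix i assume i: "Suc i < length (Us @ [V])"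
      show "(Us @ [V]) ! i \<subset> (Us @ [V]) ! Suc i"
        "\<not> (\<exists>W. submodule W R M \<and> (Us @ [V]) ! i \<subset> W \<and> W \<subset> (Us @ [V]) ! Suc i)"
      proof -
        have "(Us @ [V]) ! i \<subset> (Us @ [V]) ! Suc i \<and>
          \<not> (\<exists>W. submodule W R M \<and> (Us @ [V]) ! i \<subset> W \<and> W \<subset> (Us @ [V]) ! Suc i)"
        proof (cases "Suc i < length Us")
          case True
          thus ?thesis using Us(5) by (simp add: nth_append)
        next
          case False
          hence "(Us @ [V]) ! Suc i = V" "(Us @ [V]) ! i = W"
          proof -
            have "Suc i = length Us" using i False by simp
            thus "(Us @ [V]) ! Suc i = V" "(Us @ [V]) ! i = W" using Us(1,3) by (auto simp: nth_append last_conv_nth dest: sym)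
          qed
          thus ?thesis using W max by auto
        qed
        thus "(Us @ [V]) ! i \<subset> (Us @ [V]) ! Suc i"
        "\<not> (\<exists>W. submodule W R M \<and> (Us @ [V]) ! i \<subset> W \<and> W \<subset> (Us @ [V]) ! Suc i)" by blast+
      qed
    qed (use Us less.prems in auto)
  qed
qed

lemma finite_length_iff: "finite_length R M \<longleftrightarrow> fm M"
proof
  assume "finite_length R M"
  thus "fm M" using finite_length_imp_finite unfolding finite_length_def fm_def by auto
next
  assume "fm M"
  thus "finite_length R M" using exists_composition_series[OF \<open>fm M\<close> sub_all[OF \<open>fm M\<close>]] fm_mod[OF \<open>fm M\<close>]
    unfolding finite_length_def composition_series_def by simp
qed

lemma fl_mods_iff [simp]: "M \<in> fl_mods R \<longleftrightarrow> fm M" by (simp add: fl_mods_def finite_length_iff)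

subsection \<open>Direct sums and idempotents\<close>

lemma int_direct_sum_iff:
  "int_direct_sum R M U V \<longleftrightarrow> submodule U R M \<and> submodule V R M \<and> U \<inter> V = {\<zero>\<^sub>M} \<and>
    plus_set M U V = car M" by (simp add: int_direct_sum_def set_add_plus_set)

lemma int_direct_sum_sym:
  assumes "fm M" "int_direct_sum R M U V" shows "int_direct_sum R M V U"
proof -
  have "plus_set M U V = plus_set M V U" using assms unfolding plus_set_def int_direct_sum_iff
    by (metis (no_types, opaque_lifting) fm_comm[OF assms(1)] subD(3)[OF _ assms(1)])
  thus ?thesis using assms by (auto simp: int_direct_sum_iff)
qed

text \<open>\<open>p x\<close> is the only element of \<open>U\<close> that differs from
  \<open>x\<close> by an element of \<open>V\<close>. Linearity follows by checking this condition
  on the candidate values.\<close>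

lemma projection:
  assumes M: "fm M" and S: "int_direct_sum R M U V"
  obtains p where "lin M (sub_mod M U) p" "!!u. u \<in> U ==> p u = u"
    "!!v. v \<in> V ==> p v = \<zero>\<^sub>M" "!!x. x \<in> car M ==> x \<ominus>\<^sub>M p x \<in> V"
proof -
  have U: "submodule U R M" and V: "submodule V R M" and UV: "U \<inter> V = {\<zero>\<^sub>M}" "plus_set M U V = car M"
    using S unfolding int_direct_sum_iff by auto
  note U' = subD[OF U M] and V' = subD[OF V M]
  have uniq: "u = u'" if "u \<in> U" "u' \<in> U" "x \<in> car M" "x \<ominus>\<^sub>M u \<in> V" "x \<ominus>\<^sub>M u' \<in> V" for x u u'
  proof -
    interpret M: abelian_group M using M fm_ag by auto
    have "(x \<ominus>\<^sub>M u) \<ominus>\<^sub>M (x \<ominus>\<^sub>M u') \<in> V" using sub_minus[OF V M that(4,5)] .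
    moreover have "(x \<ominus>\<^sub>M u) \<ominus>\<^sub>M (x \<ominus>\<^sub>M u') = u' \<ominus>\<^sub>M u"
      using that U' fm_add4(2)[OF M that(3) fm_inv[OF M U'(3)[OF that(1)]] that(3) fm_inv[OF M U'(3)[OF that(2)]]] M
      by (simp add: a_minus_def M.a_comm)
    ultimately have "u' \<ominus>\<^sub>M u \<in> U \<inter> V" using sub_minus[OF U M that(2,1)] by simp
    thus ?thesis using UV that U' M fm_minus_eq_zero by (metis singletonD)
  qed
  define p where "p = (\<lambda>x. SOME u. u \<in> U \<and> x \<ominus>\<^sub>M u \<in> V)"
  have p: "p x \<in> U \<and> x \<ominus>\<^sub>M p x \<in> V" if "x \<in> car M" for x
  proof -
    obtain u v where "x = u \<oplus>\<^sub>M v" "u \<in> U" "v \<in> V" using \<open>x \<in> car M\<close> UV(2)[symmetric] unfolding plus_set_def by auto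
    hence "u \<in> U \<and> x \<ominus>\<^sub>M u \<in> V" using fm_minus_add(4)[OF M] U' V' by simp
    thus ?thesis unfolding p_def by (rule someI)
  qed
  have pI: "p x = u" if "x \<in> car M" "u \<in> U" "x \<ominus>\<^sub>M u \<in> V" for x u using uniq p that by blast
  have "lin M (sub_mod M U) p" unfolding lin_def
  proof (intro conjI ballI funcsetI)
    show "p x \<in> car (sub_mod M U)" if "x \<in> car M" for x using p that by simp
    show "p (x \<oplus>\<^sub>M y) = p x \<oplus>\<^sub>(sub_mod M U) p y" if "x \<in> car M" "y \<in> car M" for x y unfolding sub_mod_simps
      by (rule pI) (use that p M U' V'(4) fm_add4(2)[OF M, of x y "p x" "p y"] in auto)
    show "p (r \<odot>\<^sub>M x) = r \<odot>\<^sub>(sub_mod M U) p x" if "r \<in> car R" "x \<in> car M" for r x unfolding sub_mod_simps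
      by (rule pI) (use that p[of x] M U' V'(5)[of r "x \<ominus>\<^sub>M p x"] fm_smult_minus[OF M, of r x "p x"] in auto)
  qed
  moreover have "p u = u" if "u \<in> U" for u using that U' V' M by (intro pI) auto
  moreover have "p v = \<zero>\<^sub>M" if "v \<in> V" for v using that U' V' M by (intro pI) auto
  ultimately show thesis using p that by blast
qed

text \<open>Each \<open>x\<close> is the sum of \<open>x - s (f x)\<close>, which lies in the
  kernel, and \<open>s (f x)\<close>.\<close>

lemma retract_direct_sum:
  assumes M: "fm M" and N: "fm N" and f: "lin M N f" and s: "lin N M s"
    and fs: "!!y. y \<in> car N ==> f (s y) = y"
  shows "int_direct_sum R M (ker M N f) (s ` car N)" unfolding int_direct_sum_iff
proof (intro conjI)
  show K: "submodule (ker M N f) R M" using M N f sub_ker by blast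
  show S: "submodule (s ` car N) R M" using sub_image[OF N M s sub_all[OF N]] .
  show "ker M N f \<inter> s ` car N = {\<zero>\<^sub>M}" using subD(2)[OF K M] subD(2)[OF S M] fs lin_zero[OF N M s] by (auto simp: ker_def)
  show "plus_set M (ker M N f) (s ` car N) = car M"
  proof
    show "plus_set M (ker M N f) (s ` car N) \<subseteq> car M" using subD(1)[OF sub_plus[OF M K S] M] .
    show "car M \<subseteq> plus_set M (ker M N f) (s ` car N)"
    proof
      fix x assume x: "x \<in> car M"
      have fx: "f x \<in> car N" "s (f x) \<in> car M" using lin_closed[OF f x] lin_closed[OF s] by blast+
      have "x \<ominus>\<^sub>M s (f x) \<in> ker M N f" using x fx M N fs lin_minus[OF M N f x fx(2)] by (simp add: ker_def)
      moreover have "x = (x \<ominus>\<^sub>M s (f x)) \<oplus>\<^sub>M s (f x)" using fm_minus_add(1)[OF M x fx(2)] by simp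
      ultimately show "x \<in> plus_set M (ker M N f) (s ` car N)" using fx unfolding plus_set_def by blast
    qed
  qed
qed

text \<open>Decompositions correspond to idempotent endomorphisms. In this form indecomposability
  can be carried along an isomorphism or through a fully faithful functor.\<close>

lemma indecomposable_iff:
  assumes M: "fm M"
  shows "indec M \<longleftrightarrow> \<not> is_zero M \<and> (\<forall>e. lin M M e --> (\<forall>x\<in>car M. e (e x) = e x) -->
     (\<forall>x\<in>car M. e x = \<zero>\<^sub>M) \<or> (\<forall>x\<in>car M. e x = x))"
proof (intro iffI conjI allI impI)
  assume I: "indec M"
  thus "\<not> is_zero M" by (simp add: indecomposable_def)
  fix e assume e: "lin M M e" "\<forall>x\<in>car M. e (e x) = e x"
  have E: "submodule (e ` car M) R M" using sub_image[OF M M e(1) sub_all[OF M]] .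
  let ?N = "sub_mod M (e ` car M)"
  have "lin M ?N e" using e(1) by (rule lin_sub_cod) auto
  moreover have "lin ?N M (\<lambda>x. x)" using lin_incl[OF M E] .
  ultimately have "int_direct_sum R M (ker M ?N e) (e ` car M)" using retract_direct_sum[OF M fm_sub[OF M E], of e "\<lambda>x. x"] e by fastforce
  then consider "ker M ?N e = {\<zero>\<^sub>M}" | "e ` car M = {\<zero>\<^sub>M}" using I unfolding indecomposable_def by blast
  thus "(\<forall>x\<in>car M. e x = \<zero>\<^sub>M) \<or> (\<forall>x\<in>car M. e x = x)"
  proof cases
    case 1
    have "e x = x" if x: "x \<in> car M" for x
    proof -
      have ex: "e x \<in> car M" using lin_closed[OF e(1) x] .
      have "e (x \<ominus>\<^sub>M e x) = \<zero>\<^sub>M" using lin_minus[OF M M e(1) x ex] e(2) x ex M by simp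
      hence "x \<ominus>\<^sub>M e x \<in> ker M ?N e" using x ex M by (simp add: ker_def)
      thus ?thesis using 1 fm_minus_eq_zero[OF M x ex] by simp
    qed
    thus ?thesis by blast
  qed blast
next
  assume *: "\<not> is_zero M \<and> (\<forall>e. lin M M e --> (\<forall>x\<in>car M. e (e x) = e x) -->
     (\<forall>x\<in>car M. e x = \<zero>\<^sub>M) \<or> (\<forall>x\<in>car M. e x = x))"
  have "U = {\<zero>\<^sub>M} \<or> V = {\<zero>\<^sub>M}" if UV: "int_direct_sum R M U V" for U V
  proof -
    have U: "submodule U R M" and V: "submodule V R M" using UV unfolding int_direct_sum_iff by auto
    obtain p where p: "lin M (sub_mod M U) p" "!!u. u \<in> U ==> p u = u"
      "!!v. v \<in> V ==> p v = \<zero>\<^sub>M" by (rule projection[OF M UV]) (erule that; assumption)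
    have "lin M M p" using lin_comp[OF p(1) lin_incl[OF M U]] .
    moreover have "\<forall>x\<in>car M. p (p x) = p x" using p(2) lin_closed[OF p(1)] by auto
    ultimately have "(\<forall>x\<in>car M. p x = \<zero>\<^sub>M) \<or> (\<forall>x\<in>car M. p x = x)" using * by blast
    thus ?thesis
    proof
      assume "\<forall>x\<in>car M. p x = \<zero>\<^sub>M"
      hence "U \<subseteq> {\<zero>\<^sub>M}" using p(2) subD(3)[OF U M] by fastforce
      thus ?thesis using subD(2)[OF U M] by blast
    next
      assume "\<forall>x\<in>car M. p x = x"
      hence "V \<subseteq> {\<zero>\<^sub>M}" using p(3) subD(3)[OF V M] by fastforce
      thus ?thesis using subD(2)[OF V M] by blast
    qed
  qed
  thus "indec M" using * by (auto simp: indecomposable_def)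
qed

lemma iso_is_zero: "[|mod_iso R M N; fm M; fm N|] ==> is_zero M \<longleftrightarrow> is_zero N" using iso_card is_zero_iff_card by metis

lemma indecomposable_iso:
  assumes MN: "mod_iso R M N" and M: "fm M" and N: "fm N" and I: "indec M"
  shows "indec N"
proof -
  obtain f where f: "lin M N f" "bij_betw f (car M) (car N)" using MN mod_isoE by blast
  let ?g = "inv_into (car M) f"
  note g = lin_bij_inv[OF M f]
  have fg: "f (?g y) = y" "?g y \<in> car M" if "y \<in> car N" for y using that f(2) bij_betw_inv_into_right lin_closed[OF g(1)] by metis+
  have gf: "?g (f x) = x" "f x \<in> car N" if "x \<in> car M" for x using that f(2) bij_betw_inv_into_left lin_closed[OF f(1)] by metis+
  show ?thesis unfolding indecomposable_iff[OF N]
  proof (intro conjI allI impI)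
    show "\<not> is_zero N" using iso_is_zero[OF MN M N] I by (simp add: indecomposable_def)
    fix e assume e: "lin N N e" "\<forall>x\<in>car N. e (e x) = e x"
    have "lin M M (\<lambda>x. ?g (e (f x)))" by (intro lin_comp[OF lin_comp[OF f(1) e(1)] g(1)])
    moreover have "\<forall>x\<in>car M. ?g (e (f (?g (e (f x))))) = ?g (e (f x))" using e(2) fg gf lin_closed[OF e(1)] by simp
    ultimately have "(\<forall>x\<in>car M. ?g (e (f x)) = \<zero>\<^sub>M) \<or> (\<forall>x\<in>car M. ?g (e (f x)) = x)"
      using I unfolding indecomposable_iff[OF M] by blast
    thus "(\<forall>x\<in>car N. e x = \<zero>\<^sub>N) \<or> (\<forall>x\<in>car N. e x = x)"
    proof
      assume *: "\<forall>x\<in>car M. ?g (e (f x)) = \<zero>\<^sub>M"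
      have "e y = \<zero>\<^sub>N" if "y \<in> car N" for y
        using *[rule_format, of "?g y"] fg that fg[of "e y"] lin_closed[OF e(1) that] lin_zero[OF M N f(1)] by simp
      thus ?thesis by blast
    next
      assume *: "\<forall>x\<in>car M. ?g (e (f x)) = x"
      have "e y = y" if "y \<in> car N" for y using *[rule_format, of "?g y"] fg[OF that] fg[of "e y"] lin_closed[OF e(1) that] by metis
      thus ?thesis by blast
    qed
  qed
qed

section \<open>External direct sums\<close>

definition dsum :: "('r, 'a) module => ('r, 'b) module => ('r, 'a \<times> 'b) module" where
  "dsum M N = \<lparr>carrier = car M \<times> car N, mult = undefined, one = undefined,
     ring.zero = (\<zero>\<^sub>M, \<zero>\<^sub>N), ring.add = (\<lambda>x y. (fst x \<oplus>\<^sub>M fst y, snd x \<oplus>\<^sub>N snd y)),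
     smult = (\<lambda>r x. (r \<odot>\<^sub>M fst x, r \<odot>\<^sub>N snd x))\<rparr>"

lemma dsum_simps [simp]:
  "car (dsum M N) = car M \<times> car N" "\<zero>\<^sub>(dsum M N) = (\<zero>\<^sub>M, \<zero>\<^sub>N)"
  "x \<oplus>\<^sub>(dsum M N) y = (fst x \<oplus>\<^sub>M fst y, snd x \<oplus>\<^sub>N snd y)"
  "r \<odot>\<^sub>(dsum M N) x = (r \<odot>\<^sub>M fst x, r \<odot>\<^sub>N snd x)" by (auto simp: dsum_def)

lemma fm_dsum:
  assumes M: "fm M" and N: "fm N" shows "fm (dsum M N)"
proof -
  interpret M: abelian_group M using M fm_ag by auto
  interpret N: abelian_group N using N fm_ag by auto
  have "abelian_group (dsum M N)"
  proof (rule abelian_groupI)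
    show "\<exists>y\<in>car (dsum M N). y \<oplus>\<^sub>(dsum M N) x = \<zero>\<^sub>(dsum M N)" if "x \<in> car (dsum M N)" for x
      by (rule bexI[of _ "(\<ominus>\<^bsub>M\<^esub> fst x, \<ominus>\<^bsub>N\<^esub> snd x)"]) (use that M N in auto)
  qed (auto simp: M.a_ac N.a_ac)
  hence "left_module R (dsum M N)" using ring_axioms M N by (intro left_module.intro left_module_axioms.intro) (auto simp: fm_smult_simps)
  thus ?thesis using M N by (auto simp: fm_def)
qed

lemma dsum_lin:
  assumes "fm M" "fm N"
  shows "lin M (dsum M N) (\<lambda>x. (x, \<zero>\<^sub>N))" "lin N (dsum M N) (\<lambda>y. (\<zero>\<^sub>M, y))"
    "lin (dsum M N) M fst" "lin (dsum M N) N snd" using assms by (auto simp: lin_def)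

lemma lin_pair: "[|lin L M f; lin L N g|] ==> lin L (dsum M N) (\<lambda>x. (f x, g x))" by (auto simp: lin_def)

lemma lin_copair:
  assumes "fm M" "fm N" "fm L" "lin M L f" "lin N L g"
  shows "lin (dsum M N) L (\<lambda>x. f (fst x) \<oplus>\<^sub>L g (snd x))"
  by (rule lin_plus[OF assms(3) lin_comp[OF dsum_lin(3)[OF assms(1,2)] assms(4)]
      lin_comp[OF dsum_lin(4)[OF assms(1,2)] assms(5)]])

subsection \<open>Counting homomorphisms\<close>

text \<open>The zero map is always counted, so \<open>h M N = 1\<close> is the way to say that there
  is no nonzero homomorphism.\<close>

abbreviation h :: "('r, 'a) module => ('r, 'b) module => nat" where
  "h M N \<equiv> card (Hom M N)"

lemma h_pos: "[|fm M; fm N|] ==> h M N > 0" using restrict_mod_hom[OF lin_zero_map, of N M] by (auto simp: card_gt_0_iff)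

lemma h_eq_1:
  assumes "fm M" "fm N"
  shows "h M N = 1 \<longleftrightarrow> (\<forall>f. lin M N f --> (\<forall>x\<in>car M. f x = \<zero>\<^sub>N))"
proof
  let ?z = "\<lambda>x\<in>car M. \<zero>\<^sub>N"
  have z: "?z \<in> Hom M N" using restrict_mod_hom[OF lin_zero_map, of N M] assms by simp
  assume "h M N = 1"
  hence *: "Hom M N = {?z}" using z by (metis card_1_singletonE singletonD)
  have "f x = \<zero>\<^sub>N" if "lin M N f" "x \<in> car M" for f x
  proof -
    have "restrict f (car M) = ?z" using restrict_mod_hom[OF that(1) assms(1)] * by simp
    thus ?thesis using that(2) by (metis restrict_apply')
  qed
  thus "\<forall>f. lin M N f --> (\<forall>x\<in>car M. f x = \<zero>\<^sub>N)" by blast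
next
  let ?z = "\<lambda>x\<in>car M. \<zero>\<^sub>N"
  assume *: "\<forall>f. lin M N f --> (\<forall>x\<in>car M. f x = \<zero>\<^sub>N)"
  have z: "?z \<in> Hom M N" using restrict_mod_hom[OF lin_zero_map, of N M] assms by simp
  have "f = ?z" if "f \<in> Hom M N" for f by (rule mod_hom_eqI[OF that z]) (use that * mod_hom_iff in auto)
  hence "Hom M N = {?z}" using z by blast
  thus "h M N = 1" by simp
qed

lemma h_iso:
  assumes "mod_iso R M M'" "mod_iso R N N'" "fm M" "fm M'" "fm N" "fm N'"
  shows "h M N = h M' N'"
proof -
  have le: "h A B \<le> h A' B'" if AB: "mod_iso R A A'" "mod_iso R B B'" "fm A" "fm A'" "fm B" "fm B'"
    for A :: "('r, 'x) module" and A' :: "('r, 'y) module" and B :: "('r, 'z) module" and B' :: "('r, 'w) module"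
  proof -
    obtain a where a: "lin A' A a" "bij_betw a (car A') (car A)" by (rule mod_isoE[OF iso_sym[OF AB(1,3,4)]])
    obtain b where b: "lin B B' b" "bij_betw b (car B) (car B')" by (rule mod_isoE[OF AB(2)])
    show ?thesis
    proof (rule card_inj_on_le)
      let ?t = "\<lambda>f. \<lambda>x\<in>car A'. b (f (a x))"
      show "?t ` Hom A B \<subseteq> Hom A' B'" using that restrict_mod_hom[OF lin_comp[OF lin_comp[OF a(1)] b(1)]] by (auto simp: mod_hom_iff)
      show "inj_on ?t (Hom A B)"
      proof (rule inj_onI)
        fix f g assume fg: "f \<in> Hom A B" "g \<in> Hom A B" "?t f = ?t g"
        show "f = g"
        proof (rule mod_hom_eqI[OF fg(1,2)])
          fix x assume "x \<in> car A"
          then obtain y where y: "y \<in> car A'" "x = a y" using a(2) by (auto simp: bij_betw_def)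
          hence "b (f x) = b (g x)" using fun_cong[OF fg(3), of y] by simp
          thus "f x = g x" using b(2) fg(1,2) \<open>x \<in> car A\<close> lin_closed unfolding mod_hom_iff bij_betw_def by (metis inj_onD)
        qed
      qed
    qed (use that in simp)
  qed
  show ?thesis using le[OF assms] le[OF iso_sym[OF assms(1,3,4)] iso_sym[OF assms(2,5,6)] assms(4,3,6,5)] by simp
qed

text \<open>The homomorphism theorem in counted form. \<open>T\<close> may be any function whose
  fibres are the cosets of \<open>K\<close>; translating by one member \<open>g\<close> of a fibre
  identifies the fibre with \<open>K\<close>.\<close>

lemma card_hom_fibres:
  assumes A: "fm A" and B: "fm B" and K: "K \<subseteq> Hom A B"
    and T: "!!f g. [|f \<in> Hom A B; g \<in> Hom A B|] ==>
      T f = T g \<longleftrightarrow> (\<lambda>x\<in>car A. f x \<ominus>\<^sub>B g x) \<in> K"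
  shows "h A B = card K * card (T ` Hom A B)"
proof -
  let ?H = "Hom A B"
  have fib: "card {f \<in> ?H. T f = y} = card K" if y: "y \<in> T ` ?H" for y
  proof -
    obtain g where g: "g \<in> ?H" "y = T g" using y by blast
    have gB: "g x \<in> car B" if "x \<in> car A" for x using g that lin_closed[of A B g] by (simp add: mod_hom_iff)
    let ?p = "\<lambda>k. \<lambda>x\<in>car A. k x \<oplus>\<^sub>B g x"
    have kB: "k x \<in> car B" if "x \<in> car A" "k \<in> ?H" for x k using that lin_closed[of A B k] by (simp add: mod_hom_iff)
    have pm: "(\<lambda>x\<in>car A. ?p k x \<ominus>\<^sub>B g x) = k" if "k \<in> ?H" for k
    proof -
      have "(\<lambda>x\<in>car A. ?p k x \<ominus>\<^sub>B g x) x = k x" for x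
        using that kB gB fm_minus_add(3)[OF B] by (auto simp: mod_hom_iff extensional_def)
      thus ?thesis by blast
    qed
    have mp: "?p (\<lambda>x\<in>car A. f x \<ominus>\<^sub>B g x) = f" if "f \<in> ?H" for f
    proof -
      have "?p (\<lambda>x\<in>car A. f x \<ominus>\<^sub>B g x) x = f x" for x
        using that kB gB fm_minus_add(1)[OF B] by (auto simp: mod_hom_iff extensional_def)
      thus ?thesis by blast
    qed
    have pH: "?p k \<in> ?H" if "k \<in> ?H" for k using that g restrict_mod_hom[OF lin_plus[OF B, of A k g] A] by (auto simp: mod_hom_iff)
    have "bij_betw ?p K {f \<in> ?H. T f = y}"
    proof (rule bij_betwI')
      show "?p k = ?p k' \<longleftrightarrow> k = k'" if "k \<in> K" "k' \<in> K" for k k' using pm that K by (metis subsetD)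
      show "?p k \<in> {f \<in> ?H. T f = y}" if "k \<in> K" for k
        using pm[of k] pH[of k] that K T[OF pH[of k] g(1)] g(2) by (auto simp del: restrict_apply)
      show "\<exists>k\<in>K. f = ?p k" if "f \<in> {f \<in> ?H. T f = y}" for f
        using T[of f g] g mp[of f, symmetric] that by (intro bexI[of _ "\<lambda>x\<in>car A. f x \<ominus>\<^sub>B g x"]) simp_all
    qed
    thus ?thesis by (simp add: bij_betw_same_card)
  qed
  have "h A B = (\<Sum>y\<in>T ` ?H. card {f \<in> ?H. T f = y})" using sum_fun_comp[of ?H "T ` ?H" T "\<lambda>_. 1 :: nat"] A B by simp
  thus ?thesis using fib by simp
qed

lemma fm_reg: "fm (reg_mod R)"
proof -
  have "abelian_group (reg_mod R)" by (rule abelian_groupI) (auto simp: reg_mod_def a_ac intro!: bexI[of _ "\<ominus> _"] l_neg)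
  hence "left_module R (reg_mod R)" using ring_axioms
    by (intro left_module.intro left_module_axioms.intro) (auto simp: reg_mod_def l_distr r_distr m_assoc)
  thus ?thesis using finite_R by (auto simp: fm_def reg_mod_def)
qed

lemma reg_simps [simp]: "car (reg_mod R) = car R" "\<zero>\<^sub>(reg_mod R) = \<zero>"
  "x \<oplus>\<^sub>(reg_mod R) y = x \<oplus> y" "x \<odot>\<^sub>(reg_mod R) y = x \<otimes> y" by (auto simp: reg_mod_def)

lemma lin_from_reg: "[|fm M; m \<in> car M|] ==> lin (reg_mod R) M (\<lambda>r. r \<odot>\<^sub>M m)" by (auto simp: lin_def fm_smult_simps)

lemma lin_reg_eq: "[|lin (reg_mod R) M f; r \<in> car R|] ==> f r = r \<odot>\<^sub>M f \<one>" using lin_smult[of "reg_mod R" M f r \<one>] by simp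

text \<open>Evaluation at \<open>\<one>\<close>. It turns sizes of modules into numbers of
  homomorphisms, so that the Hom counts also yield cardinalities.\<close>

lemma h_reg:
  assumes M: "fm M" shows "h (reg_mod R) M = card (car M)"
proof -
  have "bij_betw (\<lambda>f. f \<one>) (Hom (reg_mod R) M) (car M)"
  proof (rule bij_betwI')
    show "f \<one> = g \<one> \<longleftrightarrow> f = g" if "f \<in> Hom (reg_mod R) M" "g \<in> Hom (reg_mod R) M" for f g
      using mod_hom_eqI[OF that] that lin_reg_eq by (metis mod_hom_iff reg_simps(1))
    show "f \<one> \<in> car M" if "f \<in> Hom (reg_mod R) M" for f using that lin_closed[of "reg_mod R" M f \<one>] by (simp add: mod_hom_iff)
    show "\<exists>f\<in>Hom (reg_mod R) M. m = f \<one>" if "m \<in> car M" for m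
      using restrict_mod_hom[OF lin_from_reg[OF M that] fm_reg] that fm_smult_simps(4)[OF M that]
      by (intro bexI[of _ "restrict (\<lambda>r. r \<odot>\<^sub>M m) (car R)"]) auto
  qed
  thus ?thesis by (rule bij_betw_same_card)
qed

subsection \<open>Projective modules\<close>

text \<open>\<open>projective\<close> only tests modules on \<open>nat\<close>; passing to copies of
  \<open>M\<close> and \<open>N\<close> gives lifting against finite modules of any carrier
  type.\<close>

lemma proj_lift:
  fixes M :: "('r, 'a) module" and N :: "('r, 'b) module" and P :: "('r, 'p) module"
  assumes P: "projective R P" "fm P" and M: "fm M" and N: "fm N" and g: "lin M N g" "g ` car M = car N"
    and f: "lin P N f"
  obtains k where "lin P M k" "!!x. x \<in> car P ==> g (k x) = f x"
proof -
  obtain M' :: "'r nmod" where M': "fm M'" "mod_iso R M M'" using exists_nat_copy[OF M] .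
  obtain N' :: "'r nmod" where N': "fm N'" "mod_iso R N N'" using exists_nat_copy[OF N] .
  obtain a where a: "lin M' M a" "bij_betw a (car M') (car M)" by (rule mod_isoE[OF iso_sym[OF M'(2) M M'(1)]])
  obtain b where b: "lin N N' b" "bij_betw b (car N) (car N')" by (rule mod_isoE[OF N'(2)])
  let ?g = "\<lambda>x\<in>car M'. b (g (a x))" and ?f = "\<lambda>x\<in>car P. b (f x)"
  have "?g \<in> Hom M' N'" using restrict_mod_hom[OF lin_comp[OF lin_comp[OF a(1) g(1)] b(1)] M'(1)] .
  moreover have "?f \<in> Hom P N'" using restrict_mod_hom[OF lin_comp[OF f b(1)] P(2)] .
  moreover have "?g ` car M' = car N'"
  proof -
    have "?g ` car M' = b ` (g ` (a ` car M'))" by (simp add: image_image)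
    thus ?thesis using a(2) g(2) b(2) by (simp add: bij_betw_def)
  qed
  ultimately obtain k where k: "k \<in> Hom P M'" "compose (car P) ?g k = ?f"
    using P(1) M'(1) N'(1) unfolding projective_def fl_mods_iff[symmetric] by blast
  have kl: "lin P M' k" using k(1) by (simp add: mod_hom_iff)
  have "g (a (k x)) = f x" if x: "x \<in> car P" for x
  proof -
    have "b (g (a (k x))) = b (f x)" using fun_cong[OF k(2), of x] x lin_closed[OF kl x] by (simp add: compose_def)
    thus ?thesis using b(2) lin_closed[OF f x] lin_closed[OF lin_comp[OF lin_comp[OF kl a(1)] g(1)] x] by (simp add: bij_betw_def inj_on_def)
  qed
  thus thesis using that[OF lin_comp[OF kl a(1)]] by simp
qed

lemma projectiveI:
  fixes P :: "('r, 'p) module"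
  assumes P: "fm P"
    and lift: "!!(M :: 'r nmod) (N :: 'r nmod) g f. [|fm M; fm N; lin M N g; g ` car M = car N; lin P N f|] ==>
      \<exists>k. lin P M k \<and> (\<forall>x\<in>car P. g (k x) = f x)"
  shows "projective R P" unfolding projective_def
proof (intro conjI ballI impI)
  show "left_module R P" using P fm_mod by auto
  fix M :: "'r nmod" and N :: "'r nmod" and g f
  assume *: "M \<in> fl_mods R" "N \<in> fl_mods R" "g \<in> Hom M N" "f \<in> Hom P N"
    "g ` car M = car N"
  then obtain k where k: "lin P M k" "\<forall>x\<in>car P. g (k x) = f x" using lift[of M N g f] by (auto simp: mod_hom_iff)
  have "compose (car P) g (restrict k (car P)) = f"
  proof
    show "compose (car P) g (restrict k (car P)) x = f x" for x using k * by (auto simp: compose_def mod_hom_iff extensional_def)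
  qed
  thus "\<exists>h\<in>Hom P M. compose (car P) g h = f" using restrict_mod_hom[OF k(1) P] by blast
qed

lemma projective_iso:
  assumes "mod_iso R P Q" "fm P" "fm Q" "projective R P" shows "projective R Q"
proof (rule projectiveI[OF assms(3)])
  fix M :: "'r nmod" and N :: "'r nmod" and g f
  assume *: "fm M" "fm N" "lin M N g" "g ` car M = car N" "lin Q N f"
  obtain a where a: "lin P Q a" "bij_betw a (car P) (car Q)" by (rule mod_isoE[OF assms(1)])
  note b = lin_bij_inv[OF assms(2) a]
  obtain k where k: "lin P M k" "!!x. x \<in> car P ==> g (k x) = f (a x)" using proj_lift[OF assms(4,2) *(1-4) lin_comp[OF a(1) *(5)]] by metis
  have "g (k (inv_into (car P) a x)) = f x" if "x \<in> car Q" for x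
    using k(2)[of "inv_into (car P) a x"] that lin_closed[OF b(1)] bij_betw_inv_into_right[OF a(2)] by simp
  thus "\<exists>k. lin Q M k \<and> (\<forall>x\<in>car Q. g (k x) = f x)" using lin_comp[OF b(1) k(1)] by blast
qed

text \<open>Since \<open>J\<close> is projective, \<open>c\<close> has a section \<open>s\<close>. A
  map on \<open>P\<close> is lifted separately on the kernel of \<open>c\<close> and on the image of
  \<open>s\<close>.\<close>

lemma projective_extension:
  assumes P: "fm P" and J: "fm J" "projective R J" and c: "lin P J c" "c ` car P = car J"
    and K: "projective R (sub_mod P (ker P J c))"
  shows "projective R P"
proof (rule projectiveI[OF P])
  fix M :: "'r nmod" and N :: "'r nmod" and g f
  assume *: "fm M" "fm N" "lin M N g" "g ` car M = car N" "lin P N f"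
  let ?K = "ker P J c"
  have KP: "submodule ?K R P" using sub_ker[OF P J(1) c(1)] .
  obtain s where s: "lin J P s" "!!y. y \<in> car J ==> c (s y) = y" using proj_lift[OF J(2,1) P J(1) c lin_id] by metis
  obtain a where a: "lin (sub_mod P ?K) M a" "!!x. x \<in> ?K ==> g (a x) = f x"
    using proj_lift[OF K fm_sub[OF P KP] *(1-4) lin_sub_dom[OF *(5) KP P]] by auto
  obtain b where b: "lin J M b" "!!y. y \<in> car J ==> g (b y) = f (s y)" using proj_lift[OF J(2,1) *(1-4) lin_comp[OF s(1) *(5)]] by metis
  have d: "lin P P (\<lambda>x. x \<ominus>\<^sub>P s (c x))" using lin_diff[OF P lin_id lin_comp[OF c(1) s(1)]] .
  have dK: "x \<ominus>\<^sub>P s (c x) \<in> ?K" if x: "x \<in> car P" for x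
    using x lin_closed[OF c(1) x] lin_closed[OF s(1) lin_closed[OF c(1) x]] s(2) lin_minus[OF P J(1) c(1), of x "s (c x)"] P J by (simp add: ker_def)
  let ?k = "\<lambda>x. a (x \<ominus>\<^sub>P s (c x)) \<oplus>\<^sub>M b (c x)"
  have "lin P (sub_mod P ?K) (\<lambda>x. x \<ominus>\<^sub>P s (c x))" using lin_sub_cod[OF d dK] .
  from lin_plus[OF *(1) lin_comp[OF this a(1)] lin_comp[OF c(1) b(1)]]
  have "lin P M ?k" .
  moreover have "g (?k x) = f x" if x: "x \<in> car P" for x
  proof -
    have cx: "c x \<in> car J" "s (c x) \<in> car P" using x lin_closed[OF c(1)] lin_closed[OF s(1)] by auto
    have "g (?k x) = f (x \<ominus>\<^sub>P s (c x)) \<oplus>\<^sub>N f (s (c x))"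
      using a(2)[OF dK[OF x]] b(2)[OF cx(1)] lin_add[OF *(3)] lin_closed[OF a(1)] dK[OF x] lin_closed[OF b(1) cx(1)] by simp
    also have "\<dots> = f x" using lin_add[OF *(5), of "x \<ominus>\<^sub>P s (c x)" "s (c x)"] fm_minus_add(1)[OF P x cx(2)] x cx P by simp
    finally show ?thesis .
  qed
  ultimately show "\<exists>k. lin P M k \<and> (\<forall>x\<in>car P. g (k x) = f x)" by blast
qed

lemma projective_zero:
  assumes "fm P" "is_zero P" shows "projective R P"
proof (rule projectiveI[OF assms(1)])
  fix M :: "'r nmod" and N :: "'r nmod" and g f
  assume *: "fm M" "fm N" "lin M N g" "g ` car M = car N" "lin P N f"
  hence "\<forall>x\<in>car P. g \<zero>\<^sub>M = f x" using assms lin_zero[OF assms(1) *(2,5)] lin_zero[OF *(1-3)] by (simp add: is_zero_def)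
  thus "\<exists>k. lin P M k \<and> (\<forall>x\<in>car P. g (k x) = f x)" using lin_zero_map[OF *(1)] by blast
qed

text \<open>For a finite module this means embedding in a finite power of \<open>R\<close>. Over a
  hereditary ring it amounts to projectivity, but in a form that is visibly inherited by
  submodules.\<close>

definition torsionless :: "('r, 'a) module => bool" where
  "torsionless M \<longleftrightarrow> (\<forall>x\<in>car M. x \<noteq> \<zero>\<^sub>M --> (\<exists>\<phi>. lin M (reg_mod R) \<phi> \<and> \<phi> x \<noteq> \<zero>))"

lemma torsionless_embed:
  assumes M: "fm M" and N: "fm N" and f: "lin M N f" and k: "!!x. [|x \<in> car M; f x = \<zero>\<^sub>N|] ==> x = \<zero>\<^sub>M"
    and T: "torsionless N"
  shows "torsionless M" unfolding torsionless_def
proof (intro ballI impI)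
  fix x assume x: "x \<in> car M" "x \<noteq> \<zero>\<^sub>M"
  hence "f x \<in> car N" "f x \<noteq> \<zero>\<^sub>N" using k lin_closed[OF f] by auto
  then obtain \<phi> where "lin N (reg_mod R) \<phi>" "\<phi> (f x) \<noteq> \<zero>" using T unfolding torsionless_def by blast
  thus "\<exists>\<phi>. lin M (reg_mod R) \<phi> \<and> \<phi> x \<noteq> \<zero>" using lin_comp[OF f] by blast
qed

end

locale hereditary_ring = finite_ring R for R :: "('r, 's) ring_scheme" (structure) +
  assumes hereditary: "hereditary R"
begin

lemma projective_left_ideal: "submodule J R (reg_mod R) ==> projective R (sub_mod (reg_mod R) J)" using hereditary by (auto simp: hereditary_def)

text \<open>Finitely many functionals whose only common zero is 0 embed \<open>P\<close> in a power
  of \<open>R\<close>. The image of one of them is a left ideal, projective by heredity, and splits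
  off; the remaining ones still separate its kernel.\<close>

lemma projective_functionals:
  fixes P :: "('r, 'a) module"
  assumes "finite I" "fm P" "!!i. i \<in> I ==> lin P (reg_mod R) (c i)"
    and "!!x. [|x \<in> car P; \<forall>i\<in>I. c i x = \<zero>|] ==> x = \<zero>\<^sub>P"
  shows "projective R P" using assms
proof (induction I arbitrary: P rule: finite_induct)
  case empty
  hence "is_zero P" using fm_zero[OF empty(1)] by (auto simp: is_zero_def)
  thus ?case using projective_zero empty by blast
next
  case (insert i I)
  note P = insert.prems(1)
  have ci: "lin P (reg_mod R) (c i)" using insert.prems(2) by blast
  let ?J = "c i ` car P" and ?K = "ker P (reg_mod R) (c i)"
  have J: "submodule ?J R (reg_mod R)" using sub_image[OF P fm_reg ci sub_all[OF P]] .
  have K: "submodule ?K R P" using sub_ker[OF P fm_reg ci] .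
  have KJ: "?K = ker P (sub_mod (reg_mod R) ?J) (c i)" by (simp add: ker_def)
  have "projective R (sub_mod P ?K)"
  proof (rule insert.IH)
    show "fm (sub_mod P ?K)" using fm_sub[OF P K] .
    show "lin (sub_mod P ?K) (reg_mod R) (c j)" if "j \<in> I" for j using lin_sub_dom[OF insert.prems(2) K P] that by blast
    show "x = \<zero>\<^sub>(sub_mod P ?K)" if "x \<in> car (sub_mod P ?K)" "\<forall>j\<in>I. c j x = \<zero>" for x
      using that insert.prems(3)[of x] by (auto simp: ker_def)
  qed
  thus ?case using projective_extension[OF P fm_sub[OF fm_reg J] projective_left_ideal[OF J], of "c i"]
      lin_sub_cod[OF ci, of ?J] KJ by auto
qed

lemma projective_torsionless:
  assumes P: "fm P" and T: "torsionless P" shows "projective R P"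
proof (rule projective_functionals[where I="Hom P (reg_mod R)" and c="\<lambda>f. f"])
  show "finite (Hom P (reg_mod R))" using P fm_reg by simp
  fix x assume x: "x \<in> car P" "\<forall>i\<in>Hom P (reg_mod R). i x = \<zero>"
  show "x = \<zero>\<^sub>P"
  proof (rule ccontr)
    assume "x \<noteq> \<zero>\<^sub>P"
    then obtain \<phi> where "lin P (reg_mod R) \<phi>" "\<phi> x \<noteq> \<zero>" using T x unfolding torsionless_def by blast
    thus False using x restrict_mod_hom[of P "reg_mod R" \<phi>] P by (metis restrict_apply')
  qed
qed (use P in \<open>auto simp: mod_hom_iff\<close>)

end

context finite_ring begin

subsection \<open>Free modules and syzygies\<close>

abbreviation F :: "('r, 'a) module => ('r, 'a => 'r) module" where "F M \<equiv> free_mod R M"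
abbreviation Om :: "('r, 'a) module => ('r, 'a => 'r) module" where "Om M \<equiv> syz_mod R M"

text \<open>The linear map from the free module that sends the basis vector at \<open>m\<close> to
  \<open>v m\<close>; \<open>pi\<close> is the free presentation of \<open>M\<close>.\<close>

definition aug :: "('r, 'a) module => ('r, 'b) module => ('a => 'b) => ('a => 'r) => 'b" where
  "aug M N v c = (\<Oplus>\<^bsub>N\<^esub>m\<in>car M. c m \<odot>\<^sub>N v m)"

definition unit_vec :: "('r, 'a) module => 'a => 'a => 'r" where
  "unit_vec M x = (\<lambda>m\<in>car M. if m = x then \<one> else \<zero>)"

abbreviation pi :: "('r, 'a) module => ('a => 'r) => 'a" where "pi M \<equiv> aug M M (\<lambda>x. x)"

lemma F_simps [simp]: "car (F M) = car M \<rightarrow>\<^sub>E car R" "\<zero>\<^sub>(F M) = (\<lambda>m\<in>car M. \<zero>)"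
  "x \<oplus>\<^sub>(F M) y = (\<lambda>m\<in>car M. x m \<oplus> y m)" "r \<odot>\<^sub>(F M) x = (\<lambda>m\<in>car M. r \<otimes> x m)"
  by (auto simp: free_mod_def)

lemma fm_F:
  fixes M :: "('r, 'a) module"
  assumes M: "fm M" shows "fm (F M)"
proof -
  have "abelian_group (F M)"
  proof (rule abelian_groupI)
    show "\<exists>y\<in>car (F M). y \<oplus>\<^sub>(F M) x = \<zero>\<^sub>(F M)" if "x \<in> car (F M)" for x
      by (rule bexI[of _ "\<lambda>m\<in>car M. \<ominus> x m"]) (use that in \<open>auto simp: l_neg PiE_def Pi_def\<close>)
    show "\<zero>\<^sub>(F M) \<oplus>\<^sub>(F M) x = x" if "x \<in> car (F M)" for x
      using that by (auto simp: PiE_def Pi_def extensional_def fun_eq_iff)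
  qed (auto simp: a_ac PiE_def Pi_def fun_eq_iff)
  hence "left_module R (F M)" using ring_axioms M by (intro left_module.intro left_module_axioms.intro)
      (auto simp: l_distr r_distr m_assoc PiE_def Pi_def fun_eq_iff extensional_def)
  thus ?thesis using M finite_R by (auto simp: fm_def intro: finite_PiE)
qed

lemma lin_aug:
  assumes M: "fm M" and N: "fm N" and v: "!!m. m \<in> car M ==> v m \<in> car N"
  shows "lin (F M) N (aug M N v)"
proof -
  interpret N: abelian_group N using N fm_ag by auto
  have smult: "(\<Oplus>\<^bsub>N\<^esub>m\<in>A. r \<odot>\<^sub>N (c m \<odot>\<^sub>N v m)) = r \<odot>\<^sub>N (\<Oplus>\<^bsub>N\<^esub>m\<in>A. c m \<odot>\<^sub>N v m)"
    if "finite A" "A \<subseteq> car M" "r \<in> car R" "c \<in> car M \<rightarrow> car R" for A r c using that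
  proof (induction A rule: finite_induct)
    case empty thus ?case using N by simp
  next
    case (insert x A)
    hence "(\<lambda>m. c m \<odot>\<^sub>N v m) \<in> A \<rightarrow> car N" "c x \<in> car R" "v x \<in> car N"
      using v N by (auto simp: Pi_def subset_iff)
    thus ?case using insert N by (simp add: Pi_def fm_smult_simps(2)[OF N])
  qed
  show ?thesis unfolding lin_def
  proof (intro conjI ballI funcsetI)
    show "aug M N v c \<in> car N" if "c \<in> car (F M)" for c
      unfolding aug_def by (rule N.finsum_closed) (use that v N in \<open>auto simp: PiE_iff\<close>)
    show "aug M N v (c \<oplus>\<^sub>(F M) d) = aug M N v c \<oplus>\<^sub>N aug M N v d" if "c \<in> car (F M)" "d \<in> car (F M)" for c d
    proof -
      have "aug M N v (c \<oplus>\<^sub>(F M) d) = (\<Oplus>\<^bsub>N\<^esub>m\<in>car M. c m \<odot>\<^sub>N v m \<oplus>\<^sub>N d m \<odot>\<^sub>N v m)"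
        unfolding aug_def by (rule N.finsum_cong') (use that v N in \<open>auto simp: fm_smult_simps PiE_def Pi_def\<close>)
      also have "\<dots> = aug M N v c \<oplus>\<^sub>N aug M N v d"
        unfolding aug_def by (rule N.finsum_addf) (use that v N in \<open>auto simp: PiE_iff\<close>)
      finally show ?thesis .
    qed
    show "aug M N v (r \<odot>\<^sub>(F M) c) = r \<odot>\<^sub>N aug M N v c" if "r \<in> car R" "c \<in> car (F M)" for r c
    proof -
      have "aug M N v (r \<odot>\<^sub>(F M) c) = (\<Oplus>\<^bsub>N\<^esub>m\<in>car M. r \<odot>\<^sub>N (c m \<odot>\<^sub>N v m))"
        unfolding aug_def by (rule N.finsum_cong') (use that v N in \<open>auto simp: fm_smult_simps PiE_def Pi_def\<close>)
      also have "\<dots> = r \<odot>\<^sub>N aug M N v c" unfolding aug_def by (rule smult) (use that M in auto)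
      finally show ?thesis .
    qed
  qed
qed

lemma unit_vec_closed [simp]: "unit_vec M x \<in> car (F M)" by (auto simp: unit_vec_def)

lemma unit_vec_closed' [simp]: "unit_vec M x \<in> car M \<rightarrow>\<^sub>E car R" by (auto simp: unit_vec_def)

lemma aug_unit:
  assumes M: "fm M" and N: "fm N" and v: "!!m. m \<in> car M ==> v m \<in> car N" and x: "x \<in> car M"
  shows "aug M N v (unit_vec M x) = v x"
proof -
  interpret N: abelian_group N using N fm_ag by auto
  have "aug M N v (unit_vec M x) = (\<Oplus>\<^bsub>N\<^esub>m\<in>car M. if m = x then v m else \<zero>\<^sub>N)"
    unfolding aug_def by (rule N.finsum_cong') (use v N x in \<open>auto simp: unit_vec_def fm_smult_simps\<close>)
  also have "\<dots> = v x" using N.finsum_singleton[of x "car M" v] M v x by (simp add: Pi_def eq_commute)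
  finally show ?thesis .
qed

lemma lin_F_eq:
  assumes M: "fm M" and N: "fm N" and f: "lin (F M) N f" and c: "c \<in> car (F M)"
  shows "f c = aug M N (\<lambda>m. f (unit_vec M m)) c"
proof -
  interpret N: abelian_group N using N fm_ag by auto
  have fu: "f (unit_vec M m) \<in> car N" for m using lin_closed[OF f] by simp
  \<comment> \<open>Truncating \<open>c\<close> to a finite set \<open>A\<close> of coordinates
    allows induction on \<open>A\<close>; the claim is the case of the whole carrier.\<close>
  have *: "f (\<lambda>m\<in>car M. if m \<in> A then c m else \<zero>) = (\<Oplus>\<^bsub>N\<^esub>m\<in>A. c m \<odot>\<^sub>N f (unit_vec M m))"
    if "finite A" "A \<subseteq> car M" for A using that
  proof (induction A rule: finite_induct)
    case empty
    have "(\<lambda>m\<in>car M. if m \<in> {} then c m else \<zero>) = \<zero>\<^sub>(F M)" by auto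
    thus ?case using lin_zero[OF fm_F[OF M] N f] by (simp only: N.finsum_empty)
  next
    case (insert x A)
    let ?a = "\<lambda>m\<in>car M. if m \<in> A then c m else \<zero>"
    have cx: "c x \<in> car R" and aF: "?a \<in> car (F M)" using insert.prems c by auto
    have "(\<lambda>m\<in>car M. if m \<in> insert x A then c m else \<zero>) = ?a \<oplus>\<^sub>(F M) c x \<odot>\<^sub>(F M) unit_vec M x"
      using c insert.hyps(2) insert.prems cx by (auto simp: unit_vec_def fun_eq_iff PiE_iff)
    hence "f (\<lambda>m\<in>car M. if m \<in> insert x A then c m else \<zero>) = f ?a \<oplus>\<^sub>N c x \<odot>\<^sub>N f (unit_vec M x)"
      using lin_add[OF f aF fm_smult[OF fm_F[OF M] cx unit_vec_closed]] lin_smult[OF f cx unit_vec_closed] by simp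
    also have "\<dots> = (\<Oplus>\<^bsub>N\<^esub>m\<in>insert x A. c m \<odot>\<^sub>N f (unit_vec M m))"
    proof -
      have "(\<lambda>m. c m \<odot>\<^sub>N f (unit_vec M m)) \<in> A \<rightarrow> car N" using insert.prems c fu N by (auto simp: PiE_iff subset_iff)
      moreover have "c x \<odot>\<^sub>N f (unit_vec M x) \<in> car N" using cx fu N by simp
      ultimately show ?thesis using insert.hyps insert.IH insert.prems by (simp only: N.finsum_insert insert_subset) (simp add: N.a_comm)
    qed
    finally show ?case .
  qed
  have "(\<lambda>m\<in>car M. if m \<in> car M then c m else \<zero>) = c" using c by (auto simp: fun_eq_iff PiE_def extensional_def)
  thus ?thesis using *[of "car M"] M by (simp add: aug_def)
qed

lemma lin_F_ext:
  assumes "fm M" "fm N" "lin (F M) N f" "lin (F M) N g"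
    and "!!m. m \<in> car M ==> f (unit_vec M m) = g (unit_vec M m)" and c: "c \<in> car (F M)"
  shows "f c = g c"
proof -
  interpret N: abelian_group N using assms(2) fm_ag by auto
  have "aug M N (\<lambda>m. f (unit_vec M m)) c = aug M N (\<lambda>m. g (unit_vec M m)) c" unfolding aug_def
    by (rule N.finsum_cong') (use assms(2,5) c lin_closed[OF assms(4) unit_vec_closed] in \<open>auto simp: PiE_iff\<close>)
  thus ?thesis using lin_F_eq[OF assms(1,2,3) c] lin_F_eq[OF assms(1,2,4) c] by simp
qed

lemma lin_pi: "fm M ==> lin (F M) M (pi M)" by (rule lin_aug) auto

lemma pi_unit: "[|fm M; x \<in> car M|] ==> pi M (unit_vec M x) = x" by (rule aug_unit) auto

lemma pi_onto: "fm M ==> pi M ` car (F M) = car M"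
proof (intro equalityI subsetI)
  fix x assume M: "fm M" and "x \<in> car M"
  thus "x \<in> pi M ` car (F M)" using pi_unit[of M x] unit_vec_closed[of M x] by (metis imageI)
qed (use lin_closed[OF lin_pi] in blast)

lemma Om_eq: "Om M = sub_mod (F M) (ker (F M) M (pi M))" unfolding syz_mod_def ker_def aug_def by simp

lemma sub_Om: "fm M ==> submodule (ker (F M) M (pi M)) R (F M)" using sub_ker[OF fm_F _ lin_pi] by blast

lemma fm_Om: "fm M ==> fm (Om M)" unfolding Om_eq by (rule fm_sub[OF fm_F sub_Om])

lemma Om_simps [simp]: "car (Om M) = ker (F M) M (pi M)" "\<zero>\<^sub>(Om M) = \<zero>\<^sub>(F M)" "x \<oplus>\<^sub>(Om M) y = x \<oplus>\<^sub>(F M) y"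
  "r \<odot>\<^sub>(Om M) x = r \<odot>\<^sub>(F M) x" unfolding Om_eq by auto

lemma Om_in_F: "x \<in> car (Om M) ==> x \<in> car (F M)" by (simp add: ker_def)

lemma lin_Om_F: "fm M ==> lin (Om M) (F M) (\<lambda>x. x)" unfolding Om_eq by (rule lin_incl[OF fm_F sub_Om])

lemma torsionless_F: "fm M ==> torsionless (F M)" unfolding torsionless_def
proof (intro ballI impI)
  fix x assume M: "fm M" and x: "x \<in> car (F M)" "x \<noteq> \<zero>\<^sub>(F M)"
  then obtain m where m: "m \<in> car M" "x m \<noteq> \<zero>" by (auto simp: PiE_def extensional_def fun_eq_iff split: if_splits)
  moreover have "lin (F M) (reg_mod R) (\<lambda>c. c m)" using m by (auto simp: lin_def)
  ultimately show "\<exists>\<phi>. lin (F M) (reg_mod R) \<phi> \<and> \<phi> x \<noteq> \<zero>" by blast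
qed

lemma torsionless_projective:
  assumes P: "fm P" "projective R P" shows "torsionless P"
proof -
  obtain s where s: "lin P (F P) s" "!!x. x \<in> car P ==> pi P (s x) = x"
    using proj_lift[OF P(2,1) fm_F[OF P(1)] P(1) lin_pi[OF P(1)] pi_onto[OF P(1)] lin_id] by metis
  show ?thesis
  proof (rule torsionless_embed[OF P(1) fm_F[OF P(1)] s(1) _ torsionless_F[OF P(1)]])
    show "x = \<zero>\<^sub>P" if "x \<in> car P" "s x = \<zero>\<^sub>(F P)" for x
      using s(2)[OF that(1)] that(2) lin_zero[OF fm_F[OF P(1)] P(1) lin_pi[OF P(1)]] by metis
  qed
qed

lemma torsionless_sub:
  assumes "fm M" "submodule U R M" "torsionless M" shows "torsionless (sub_mod M U)"
  by (rule torsionless_embed[OF fm_sub[OF assms(1,2)] assms(1) lin_incl[OF assms(1,2)] _ assms(3)]) auto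

end

context hereditary_ring begin

text \<open>Submodules of torsionless modules are torsionless, which settles submodules of
  projectives at once.\<close>

lemma projective_sub: "[|fm P; projective R P; submodule U R P|] ==> projective R (sub_mod P U)"
  by (meson fm_sub projective_torsionless torsionless_projective torsionless_sub)

lemma projective_F: "fm M ==> projective R (F M)" using projective_torsionless fm_F torsionless_F by blast

lemma projective_Om: "fm M ==> projective R (Om M)" unfolding Om_eq using projective_sub[OF fm_F projective_F sub_Om] by blast

lemma projective_reg: "projective R (reg_mod R)" using projective_left_ideal[of "car R"] sub_all[OF fm_reg] sub_mod_self[of "reg_mod R"] by simp

end

section \<open>Characters of finite abelian groups\<close>

lemma characters_iff:
  "\<chi> \<in> characters G \<longleftrightarrow> \<chi> \<in> extensional (car G) \<and> (\<forall>x\<in>car G. cmod (\<chi> x) = 1) \<and>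
    (\<forall>x\<in>car G. \<forall>y\<in>car G. \<chi> (x \<otimes>\<^bsub>G\<^esub> y) = \<chi> x * \<chi> y)"
  by (auto simp: characters_def hom_def circle_group_def)

lemma characters_one:
  assumes "group G" "\<chi> \<in> characters G" shows "\<chi> \<one>\<^bsub>G\<^esub> = 1"
proof -
  interpret group G by fact
  have "\<chi> \<one>\<^bsub>G\<^esub> * \<chi> \<one>\<^bsub>G\<^esub> = \<chi> \<one>\<^bsub>G\<^esub>" "\<chi> \<one>\<^bsub>G\<^esub> \<noteq> 0"
    using assms(2) by (force simp: characters_iff)+
  thus ?thesis by simp
qed

lemma characters_pow:
  assumes "group G" "\<chi> \<in> characters G" "x \<in> car G" shows "\<chi> (x [^]\<^bsub>G\<^esub> (n::nat)) = \<chi> x ^ n"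
proof -
  interpret group G by fact
  show ?thesis by (induction n) (use assms characters_one[OF assms(1,2)] in \<open>auto simp: characters_iff\<close>)
qed

locale finite_comm_group = comm_group G for G :: "'a monoid" (structure) +
  assumes fin: "finite (car G)"
begin

abbreviation Ch where "Ch H \<equiv> characters (G\<lparr>carrier := H\<rparr>)"

lemma Ch_iff: "\<chi> \<in> Ch H \<longleftrightarrow> \<chi> \<in> extensional H \<and> (\<forall>x\<in>H. cmod (\<chi> x) = 1) \<and> (\<forall>x\<in>H. \<forall>y\<in>H. \<chi> (x \<otimes> y) = \<chi> x * \<chi> y)"
  by (simp add: characters_iff)

lemma Ch_one: "[|subgroup H G; \<chi> \<in> Ch H|] ==> \<chi> \<one> = 1"
  using characters_one[of "G\<lparr>carrier := H\<rparr>" \<chi>] subgroup_imp_group by auto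

lemma Ch_pow: "[|subgroup H G; \<chi> \<in> Ch H; x \<in> H|] ==> \<chi> (x [^] (n::nat)) = \<chi> x ^ n"
  using characters_pow[of "G\<lparr>carrier := H\<rparr>" \<chi> x n] subgroup_imp_group by (simp add: nat_pow_consistent[symmetric])

text \<open>Let \<open>k\<close> be the order of \<open>a\<close> modulo \<open>H\<close>. A
  character of \<open>H\<close> extends to the subgroup generated by \<open>H\<close> and
  \<open>a\<close>, and its value at \<open>a\<close> may be any \<open>k\<close>-th root of its
  value at \<open>a [^] k\<close>. This freedom is what later separates elements.\<close>

lemma adjoin:
  assumes H: "subgroup H G" and a: "a \<in> car G"
  obtains k :: nat and H' where "k > 0" "a [^] k \<in> H" "k = 1 \<longleftrightarrow> a \<in> H" "subgroup H' G" "H \<subseteq> H'" "a \<in> H'"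
    "\<forall>\<chi>\<in>Ch H. \<forall>z. z ^ k = \<chi> (a [^] k) --> (\<exists>\<chi>'\<in>Ch H'. (\<forall>x\<in>H. \<chi>' x = \<chi> x) \<and> \<chi>' a = z)"
proof -
  interpret H: subgroup H G by fact
  have Hc [simp]: "x \<in> car G" if "x \<in> H" for x using that H.subset by auto
  define k where "k = (LEAST k::nat. k > 0 \<and> a [^] k \<in> H)"
  have "a [^] order G \<in> H" using pow_order_eq_1[OF a] H.one_closed by simp
  moreover have "order G > 0" using fin order_gt_0_iff_finite by blast
  ultimately have k: "k > 0 \<and> a [^] k \<in> H" unfolding k_def using LeastI[of "\<lambda>k. k > 0 \<and> a [^] k \<in> H"] by blast
  have kmin: "j = 0" if "a [^] j \<in> H" "j < k" for j
    using not_less_Least[of j "\<lambda>k. k > 0 \<and> a [^] k \<in> H"] that by (auto simp: k_def)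
  have powH: "x [^] m \<in> H" if "x \<in> H" for x and m :: nat by (induction m) (use that in auto)
  have kdvd: "k dvd j" if "a [^] j \<in> H" for j :: nat
  proof -
    have "a [^] j = (a [^] k) [^] (j div k) \<otimes> a [^] (j mod k)" using a by (simp add: nat_pow_pow nat_pow_mult)
    hence "a [^] (j mod k) = inv ((a [^] k) [^] (j div k)) \<otimes> a [^] j" using a by (simp add: inv_solve_left)
    moreover have "(a [^] k) [^] (j div k) \<in> H" using powH k by blast
    ultimately have "a [^] (j mod k) \<in> H" using that by simp
    thus ?thesis using kmin[of "j mod k"] k by auto
  qed
  define H' where "H' = {x \<otimes> a [^] (i::nat) | x i. x \<in> H}"
  have H'I: "x \<otimes> a [^] (i::nat) \<in> H'" if "x \<in> H" for x i using that by (auto simp: H'_def)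
  have mult: "(x \<otimes> a [^] i) \<otimes> (y \<otimes> a [^] j) = (x \<otimes> y) \<otimes> a [^] (i + j)" if "x \<in> H" "y \<in> H" for x y and i j :: nat
    using that a by (simp add: m_ac nat_pow_mult[symmetric])
  have H'c: "H' \<subseteq> car G" using a by (auto simp: H'_def)
  have HH': "H \<subseteq> H'" using H'I[of _ 0] by fastforce
  have aH': "a \<in> H'" using H'I[of \<one> 1] a by simp
  have closed: "x \<otimes> y \<in> H'" if "x \<in> H'" "y \<in> H'" for x y
    using that mult H'I unfolding H'_def by (smt (verit) H.m_closed mem_Collect_eq)
  have sH': "subgroup H' G"
  proof (rule subgroupI)
    show "inv x \<in> H'" if "x \<in> H'" for x
    proof -
      have xG: "x \<in> car G" using that H'c by blast
      have "x [^] n \<in> H'" for n :: nat by (induction n) (use that closed HH' H.one_closed in auto)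
      \<comment> \<open>In a finite group inverses are powers, so \<open>H'\<close> can be described
        by nonnegative exponents alone.\<close>
      moreover have "inv x = x [^] (order G - 1)"
      proof (rule inv_equality)
        have "x [^] (order G - 1) \<otimes> x = x [^] (Suc (order G - 1))" by simp
        also have "\<dots> = \<one>" using pow_order_eq_1[OF xG] \<open>order G > 0\<close> by (metis Suc_pred')
        finally show "x [^] (order G - 1) \<otimes> x = \<one>" .
      qed (use xG in auto)
      ultimately show ?thesis by simp
    qed
  qed (use H'c closed aH' in auto)
  \<comment> \<open>Two expressions for one element differ by a power of \<open>a [^] k\<close>,
    because \<open>k\<close> divides every exponent that brings \<open>a\<close> into
    \<open>H\<close>.\<close>
  have norm: "\<exists>m. j = i + k * m \<and> x = y \<otimes> (a [^] k) [^] m"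
    if "x \<in> H" "y \<in> H" "x \<otimes> a [^] i = y \<otimes> a [^] j" "i \<le> j" for x y and i j :: nat
  proof -
    have "x \<otimes> a [^] i = (y \<otimes> a [^] (j - i)) \<otimes> a [^] i" using that a by (simp add: m_assoc nat_pow_mult)
    hence x: "x = y \<otimes> a [^] (j - i)" using that a by simp
    hence "a [^] (j - i) = inv y \<otimes> x" using that a by (simp add: inv_solve_left)
    hence "a [^] (j - i) \<in> H" using that by simp
    then obtain m where "j - i = k * m" using kdvd by blast
    thus ?thesis using x a that by (intro exI[of _ m]) (auto simp: nat_pow_pow)
  qed
  have ext: "\<exists>\<chi>'\<in>Ch H'. (\<forall>x\<in>H. \<chi>' x = \<chi> x) \<and> \<chi>' a = z" if \<chi>: "\<chi> \<in> Ch H" and z: "z ^ k = \<chi> (a [^] k)" for \<chi> z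
  proof -
    have wd': "\<chi> x * z ^ i = \<chi> y * z ^ j"
      if xy: "x \<in> H" "y \<in> H" "x \<otimes> a [^] i = y \<otimes> a [^] j" "i \<le> j" for x y and i j :: nat
    proof -
      obtain m where m: "j = i + k * m" "x = y \<otimes> (a [^] k) [^] m" using norm xy by blast
      have kH: "(a [^] k) [^] m \<in> H" using powH k by blast
      have "\<chi> x = \<chi> y * \<chi> ((a [^] k) [^] m)" using \<chi> kH xy m(2) by (simp add: Ch_iff)
      also have "\<dots> = \<chi> y * (z ^ k) ^ m" using Ch_pow[OF H \<chi>, of "a [^] k" m] k z by simp
      finally show ?thesis using m(1) by (simp add: power_add power_mult mult.commute)
    qed
    have wd: "\<chi> x * z ^ i = \<chi> y * z ^ j"
      if "x \<in> H" "y \<in> H" "x \<otimes> a [^] i = y \<otimes> a [^] j" for x y and i j :: nat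
      using wd'[OF that] wd'[OF that(2,1) that(3)[symmetric]] by (metis nat_le_linear)
    define \<chi>' where "\<chi>' = (\<lambda>w\<in>H'. THE c. \<exists>x\<in>H. \<exists>i. w = x \<otimes> a [^] (i::nat) \<and> c = \<chi> x * z ^ i)"
    have \<chi>': "\<chi>' (x \<otimes> a [^] i) = \<chi> x * z ^ i" if "x \<in> H" for x and i :: nat
    proof -
      have "(THE c. \<exists>y\<in>H. \<exists>j. x \<otimes> a [^] i = y \<otimes> a [^] (j::nat) \<and> c = \<chi> y * z ^ j) = \<chi> x * z ^ i"
      proof (rule the_equality)
        show "\<exists>y\<in>H. \<exists>j. x \<otimes> a [^] i = y \<otimes> a [^] j \<and> \<chi> x * z ^ i = \<chi> y * z ^ j" using that by blast
        show "c = \<chi> x * z ^ i" if "\<exists>y\<in>H. \<exists>j. x \<otimes> a [^] i = y \<otimes> a [^] j \<and> c = \<chi> y * z ^ j" for c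
          using that wd[OF \<open>x \<in> H\<close>] by metis
      qed
      thus ?thesis unfolding \<chi>'_def using H'I[OF that, of i] by simp
    qed
    have "cmod (z ^ k) = 1" using \<chi> z k by (simp add: Ch_iff)
    hence cz: "cmod z = 1" using k power_eq_imp_eq_base[of "cmod z" k 1] by (simp add: norm_power)
    have "\<chi>' \<in> Ch H'" unfolding Ch_iff
    proof (intro conjI ballI)
      show "\<chi>' \<in> extensional H'" by (simp add: \<chi>'_def)
      show "cmod (\<chi>' w) = 1" if "w \<in> H'" for w using that \<chi>' \<chi> cz by (auto simp: H'_def Ch_iff norm_mult norm_power)
      show "\<chi>' (v \<otimes> w) = \<chi>' v * \<chi>' w" if vw: "v \<in> H'" "w \<in> H'" for v w
      proof -
        obtain x y and i j :: nat where "x \<in> H" "y \<in> H" "v = x \<otimes> a [^] i" "w = y \<otimes> a [^] j" using vw by (auto simp: H'_def)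
        thus ?thesis using \<chi>' mult[of x y i j] \<chi> by (simp add: Ch_iff power_add)
      qed
    qed
    moreover have "\<chi>' x = \<chi> x" if "x \<in> H" for x using \<chi>'[OF that, of 0] that by simp
    moreover have "\<chi>' a = z" using \<chi>'[of \<one> 1] a Ch_one[OF H \<chi>] by simp
    ultimately show ?thesis by blast
  qed
  have "k = 1 \<longleftrightarrow> a \<in> H"
  proof
    assume "a \<in> H"
    hence "k dvd 1" using kdvd[of 1] a by simp
    thus "k = 1" by simp
  qed (use k a in auto)
  thus thesis using that[of k H'] k sH' HH' aH' ext by simp
qed

text \<open>Complex numbers have all roots, so \<open>adjoin\<close> can be repeated until the whole
  group is reached.\<close>

lemma Ch_extend:
  assumes "subgroup H G" "\<chi> \<in> Ch H"
  shows "\<exists>\<chi>'\<in>characters G. \<forall>x\<in>H. \<chi>' x = \<chi> x" using assms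
proof (induction "card (car G) - card H" arbitrary: H \<chi> rule: less_induct)
  case less
  show ?case
  proof (cases "H = car G")
    case True
    thus ?thesis using less.prems by (intro bexI[of _ \<chi>]) auto
  next
    case False
    then obtain a where a: "a \<in> car G" "a \<notin> H" using subgroup.subset[OF less.prems(1)] by blast
    obtain k :: nat and H' where k: "k > 0" "a [^] k \<in> H" "k = 1 \<longleftrightarrow> a \<in> H" "subgroup H' G" "H \<subseteq> H'" "a \<in> H'"
      and ext: "\<forall>\<chi>\<in>Ch H. \<forall>z. z ^ k = \<chi> (a [^] k) --> (\<exists>\<chi>'\<in>Ch H'. (\<forall>x\<in>H. \<chi>' x = \<chi> x) \<and> \<chi>' a = z)"
      by (rule adjoin[OF less.prems(1) a(1)]) (rule that; assumption)
    have "\<chi> (a [^] k) \<noteq> 0" using less.prems(2) k(2) by (force simp: Ch_iff)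
    hence "card {z. z ^ k = \<chi> (a [^] k)} = k" using card_nth_roots k(1) by blast
    then obtain z where z: "z ^ k = \<chi> (a [^] k)" using k(1) by (metis (mono_tags) card.empty empty_Collect_eq less_irrefl)
    obtain \<chi>' where \<chi>': "\<chi>' \<in> Ch H'" "\<forall>x\<in>H. \<chi>' x = \<chi> x" using ext less.prems(2) z by blast
    have "H \<subset> H'" "H' \<subseteq> car G" using k a subgroup.subset by blast+
    hence "card H < card H'" "card H' \<le> card (car G)" using fin by (auto intro: psubset_card_mono card_mono finite_subset)
    hence "card (car G) - card H' < card (car G) - card H" by simp
    from less.hyps[OF this k(4) \<chi>'(1)] show ?thesis using \<chi>'(2) k(5) by (metis subsetD)
  qed
qed

text \<open>Start from the trivial subgroup: for \<open>x \<noteq> \<one>\<close> the order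
  \<open>k\<close> of \<open>x\<close> is at least 2, so some \<open>k\<close>-th root of unity
  other than 1 can be taken as the value at \<open>x\<close>.\<close>

lemma characters_separate:
  assumes x: "x \<in> car G" "x \<noteq> \<one>"
  obtains \<chi> where "\<chi> \<in> characters G" "\<chi> x \<noteq> 1"
proof -
  obtain k :: nat and H' where k: "k > 0" "x [^] k \<in> {\<one>}" "k = 1 \<longleftrightarrow> x \<in> {\<one>}" "subgroup H' G" "{\<one>} \<subseteq> H'" "x \<in> H'"
      and ext: "\<forall>\<chi>\<in>Ch {\<one>}. \<forall>z. z ^ k = \<chi> (x [^] k) --> (\<exists>\<chi>'\<in>Ch H'. (\<forall>x\<in>{\<one>}. \<chi>' x = \<chi> x) \<and> \<chi>' x = z)"
      by (rule adjoin[OF triv_subgroup x(1)]) (rule that; assumption)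
  have "k \<ge> 2" using k x by (cases "k = 1") auto
  hence "card {z::complex. z ^ k = 1} = k" using card_roots_unity_eq k(1) by blast
  hence "\<not> {z::complex. z ^ k = 1} \<subseteq> {1}" using \<open>k \<ge> 2\<close> card_mono[of "{1}" "{z::complex. z ^ k = 1}"] by auto
  then obtain z :: complex where z: "z ^ k = 1" "z \<noteq> 1" by blast
  have "(\<lambda>y\<in>{\<one>}. 1) \<in> Ch {\<one>}" by (auto simp: Ch_iff)
  from ext[rule_format, OF this, of z] obtain \<chi> where \<chi>: "\<chi> \<in> Ch H'" "\<chi> x = z" using z k(2) by auto
  obtain \<chi>' where "\<chi>' \<in> characters G" "\<forall>y\<in>H'. \<chi>' y = \<chi> y" using Ch_extend[OF k(4) \<chi>(1)] by blast
  thus thesis using that[of \<chi>'] \<chi>(2) z(2) k(6) by auto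
qed

lemma finite_characters: "finite (characters G)"
proof (rule finite_subset)
  have og: "order G > 0" using fin order_gt_0_iff_finite by blast
  show "characters G \<subseteq> car G \<rightarrow>\<^sub>E {z. z ^ order G = 1}"
  proof
    fix \<chi> assume \<chi>: "\<chi> \<in> characters G"
    have "\<chi> x ^ order G = 1" if "x \<in> car G" for x
      using characters_pow[OF is_group \<chi> that, of "order G"] pow_order_eq_1[OF that] characters_one[OF is_group \<chi>] by simp
    thus "\<chi> \<in> car G \<rightarrow>\<^sub>E {z. z ^ order G = 1}" using \<chi> unfolding characters_iff by (intro PiE_I) (auto simp: extensional_def)
  qed
  show "finite (car G \<rightarrow>\<^sub>E {z::complex. z ^ order G = 1})" using fin og finite_roots_unity by (intro finite_PiE) auto
qed

lemma sum_characters: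
  assumes "x \<in> car G" shows "(\<Sum>\<chi>\<in>characters G. \<chi> x) = (if x = \<one> then of_nat (card (characters G)) else 0)"
proof (cases "x = \<one>")
  case False
  obtain \<psi> where \<psi>: "\<psi> \<in> characters G" "\<psi> x \<noteq> 1" using characters_separate[OF assms False] .
  \<comment> \<open>Multiplication by \<open>\<psi>\<close> permutes the characters, so the sum is
    unchanged when it is multiplied by \<open>\<psi> x\<close>, which is not 1.\<close>
  let ?T = "\<lambda>\<chi>. \<lambda>y\<in>car G. \<chi> y * \<psi> y"
  have "\<psi> y \<noteq> 0" if "y \<in> car G" for y using \<psi>(1) that by (force simp: characters_iff)
  hence inj: "inj_on ?T (characters G)"
    by (intro inj_onI extensionalityI[of _ "car G"]) (auto simp: characters_iff fun_eq_iff restrict_def split: if_splits)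
  have "?T ` characters G \<subseteq> characters G" using \<psi>(1) by (auto simp: characters_iff norm_mult)
  hence "?T ` characters G = characters G" using endo_inj_surj[OF finite_characters _ inj] by blast
  hence "(\<Sum>\<chi>\<in>characters G. \<chi> x) = (\<Sum>\<chi>\<in>?T ` characters G. \<chi> x)" by simp
  also have "\<dots> = (\<Sum>\<chi>\<in>characters G. \<chi> x) * \<psi> x" using assms by (simp add: sum.reindex[OF inj] sum_distrib_right)
  finally show ?thesis using \<psi>(2) False by simp
next
  case True
  hence "(\<Sum>\<chi>\<in>characters G. \<chi> x) = (\<Sum>\<chi>\<in>characters G. 1)" using characters_one[OF is_group] by (intro sum.cong) auto
  thus ?thesis using True by simp
qed

lemma sum_character:
  assumes \<chi>: "\<chi> \<in> characters G"
  shows "(\<Sum>x\<in>car G. \<chi> x) = (if \<chi> = (\<lambda>x\<in>car G. 1) then of_nat (card (car G)) else 0)"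
proof (cases "\<chi> = (\<lambda>x\<in>car G. 1)")
  case False
  have "\<exists>a\<in>car G. \<chi> a \<noteq> 1"
  proof (rule ccontr)
    assume "\<not> ?thesis"
    hence "\<chi> = (\<lambda>x\<in>car G. 1)" by (intro extensionalityI[of \<chi> "car G"]) (use \<chi> in \<open>auto simp: characters_iff\<close>)
    thus False using False by blast
  qed
  then obtain a where a: "a \<in> car G" "\<chi> a \<noteq> 1" by blast
  have "(\<Sum>x\<in>car G. \<chi> x) = (\<Sum>x\<in>(\<lambda>x. a \<otimes> x) ` car G. \<chi> x)" using surj_const_mult[OF a(1)] by simp
  also have "\<dots> = \<chi> a * (\<Sum>x\<in>car G. \<chi> x)" using \<chi> a(1)
    by (simp add: sum.reindex[OF inj_on_cmult[OF a(1)]] sum_distrib_left characters_iff)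
  finally show ?thesis using a(2) False by simp
qed simp

text \<open>Sum \<open>\<chi> x\<close> over all pairs in both orders: by the two orthogonality
  relations one order gives the number of characters and the other the order of the group.\<close>

lemma card_characters: "card (characters G) = card (car G)"
proof -
  have one: "(\<lambda>x\<in>car G. 1) \<in> characters G" by (simp add: characters_iff)
  have "of_nat (card (characters G)) = (\<Sum>x\<in>car G. \<Sum>\<chi>\<in>characters G. \<chi> x)" using fin by (simp add: sum_characters)
  also have "\<dots> = (\<Sum>\<chi>\<in>characters G. \<Sum>x\<in>car G. \<chi> x)" by (rule sum.swap)
  also have "\<dots> = of_nat (card (car G))" using one finite_characters by (simp add: sum_character)
  finally show ?thesis using of_nat_eq_iff by blast
qed

end

section \<open>Extensions and the Auslander--Reiten translation\<close>

context finite_ring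
begin

section \<open>Cocycles, classes and characters of Ext\<close>

lemma comm_group_hom_group:
  assumes A: "fm A" and B: "fm B" shows "comm_group (hom_group R A B)"
proof (rule comm_groupI)
  interpret B: abelian_group B using B fm_ag by auto
  have cl: "!!f x. [|f \<in> Hom A B; x \<in> car A|] ==> f x \<in> car B" by (auto simp: mod_hom_def)
  show "f \<otimes>\<^bsub>hom_group R A B\<^esub> g \<in> car (hom_group R A B)"
    if "f \<in> car (hom_group R A B)" "g \<in> car (hom_group R A B)" for f g
    using that restrict_mod_hom[OF lin_plus[OF B] A, of f g] by (simp add: hom_group_def mod_hom_iff)
  show "\<one>\<^bsub>hom_group R A B\<^esub> \<in> car (hom_group R A B)"
    using restrict_mod_hom[OF lin_zero_map[OF B] A] by (simp add: hom_group_def)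
  show "f \<otimes>\<^bsub>hom_group R A B\<^esub> g \<otimes>\<^bsub>hom_group R A B\<^esub> k = f \<otimes>\<^bsub>hom_group R A B\<^esub> (g \<otimes>\<^bsub>hom_group R A B\<^esub> k)"
    if "f \<in> car (hom_group R A B)" "g \<in> car (hom_group R A B)" "k \<in> car (hom_group R A B)" for f g k
    using that cl by (auto simp: hom_group_def B.a_assoc intro!: restrict_ext)
  show "f \<otimes>\<^bsub>hom_group R A B\<^esub> g = g \<otimes>\<^bsub>hom_group R A B\<^esub> f"
    if "f \<in> car (hom_group R A B)" "g \<in> car (hom_group R A B)" for f g
    using that cl by (auto simp: hom_group_def B.a_comm intro!: restrict_ext)
  show "\<one>\<^bsub>hom_group R A B\<^esub> \<otimes>\<^bsub>hom_group R A B\<^esub> f = f" if "f \<in> car (hom_group R A B)" for f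
  proof (rule extensionalityI[of _ "car A"])
    show "f \<in> extensional (car A)" using that by (simp add: hom_group_def mod_hom_iff)
  qed (use that cl B in \<open>auto simp: hom_group_def\<close>)
  show "\<exists>g\<in>car (hom_group R A B). g \<otimes>\<^bsub>hom_group R A B\<^esub> f = \<one>\<^bsub>hom_group R A B\<^esub>"
    if "f \<in> car (hom_group R A B)" for f
  proof (rule bexI)
    let ?g = "\<lambda>x\<in>car A. \<zero>\<^sub>B \<ominus>\<^sub>B f x"
    show "?g \<in> car (hom_group R A B)"
      using that restrict_mod_hom[OF lin_diff[OF B lin_zero_map[OF B]] A, of f] by (simp add: hom_group_def mod_hom_iff)
    show "?g \<otimes>\<^bsub>hom_group R A B\<^esub> f = \<one>\<^bsub>hom_group R A B\<^esub>"
      using that cl B by (auto simp: hom_group_def fm_minus_add intro!: restrict_ext)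
  qed
qed

text \<open>A homomorphism on the syzygy represents zero in Ext exactly when it extends to the free
  module; see \<open>cls_extendable\<close>.\<close>

definition extendable :: "('r, 'a) module => ('r, 'b) module => (('a => 'r) => 'b) => bool" where
  "extendable M N \<psi> \<longleftrightarrow> (\<exists>\<Psi>. lin (F M) N \<Psi> \<and> (\<forall>x\<in>car (Om M). \<Psi> x = \<psi> x))"

text \<open>Restricting first lets a cocycle be any function that is linear on the syzygy, without
  extensionality.\<close>

definition cls :: "('r, 'a) module => ('r, 'b) module => (('a => 'r) => 'b) => (('a => 'r) => 'b) set" where
  "cls M N \<psi> = ext1_bd R M N #>\<^bsub>hom_group R (Om M) N\<^esub> restrict \<psi> (car (Om M))"

abbreviation e :: "('r, 'a) module => ('r, 'b) module => nat" where
  "e M N \<equiv> card (car (ext1 R M N))"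

lemma extendable_cong: "[|extendable M N \<psi>; !!x. x \<in> car (Om M) ==> \<psi> x = \<psi>' x|] ==> extendable M N \<psi>'"
  unfolding extendable_def by metis

lemma extendable_plus:
  "[|fm N; extendable M N \<phi>; extendable M N \<psi>|] ==> extendable M N (\<lambda>x. \<phi> x \<oplus>\<^sub>N \<psi> x)"
  unfolding extendable_def using lin_plus by (metis (no_types, lifting))

lemma extendable_diff:
  "[|fm N; extendable M N \<phi>; extendable M N \<psi>|] ==> extendable M N (\<lambda>x. \<phi> x \<ominus>\<^sub>N \<psi> x)"
  unfolding extendable_def using lin_diff by (metis (no_types, lifting))

lemma extendable_zero: "fm N ==> extendable M N (\<lambda>x. \<zero>\<^sub>N)" unfolding extendable_def using lin_zero_map by blast

lemma extendable_comp: "[|extendable M N \<psi>; lin N L g|] ==> extendable M L (\<lambda>x. g (\<psi> x))"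
  unfolding extendable_def using lin_comp by (metis (no_types, lifting))

lemma bd_iff:
  assumes "fm M" shows "\<psi> \<in> ext1_bd R M N \<longleftrightarrow> \<psi> \<in> Hom (Om M) N \<and> extendable M N \<psi>"
proof
  assume "\<psi> \<in> ext1_bd R M N"
  then obtain \<Psi> where \<Psi>: "\<Psi> \<in> Hom (F M) N" "\<psi> = restrict \<Psi> (car (Om M))" by (auto simp: ext1_bd_def)
  hence "lin (F M) N \<Psi>" by (simp add: mod_hom_iff)
  thus "\<psi> \<in> Hom (Om M) N \<and> extendable M N \<psi>"
    using restrict_mod_hom[OF lin_comp[OF lin_Om_F[OF assms]] fm_Om[OF assms], of N \<Psi>] \<Psi>(2) unfolding extendable_def by auto
next
  assume *: "\<psi> \<in> Hom (Om M) N \<and> extendable M N \<psi>"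
  then obtain \<Psi> where \<Psi>: "lin (F M) N \<Psi>" "\<forall>x\<in>car (Om M). \<Psi> x = \<psi> x" unfolding extendable_def by blast
  have "\<psi> = restrict (restrict \<Psi> (car (F M))) (car (Om M))" by (rule extensionalityI[of _ "car (Om M)"])
      (use * \<Psi> Om_in_F[of _ M] in \<open>auto simp: mod_hom_iff simp del: Om_simps F_simps\<close>)
  thus "\<psi> \<in> ext1_bd R M N" unfolding ext1_bd_def using restrict_mod_hom[OF \<Psi>(1) fm_F[OF assms]] by blast
qed

context
  fixes M :: "('r, 'a) module" and N :: "('r, 'b) module"
  assumes M: "fm M" and N: "fm N"
begin

abbreviation (input) HG where "HG \<equiv> hom_group R (Om M) N"

lemma HG_simps: "car HG = Hom (Om M) N" "f \<otimes>\<^bsub>HG\<^esub> g = (\<lambda>x\<in>car (Om M). f x \<oplus>\<^sub>N g x)"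
  "\<one>\<^bsub>HG\<^esub> = (\<lambda>x\<in>car (Om M). \<zero>\<^sub>N)" by (auto simp: hom_group_def)

lemma HG_comm: "comm_group HG" using comm_group_hom_group[OF fm_Om[OF M] N] .

lemma HG_inv:
  assumes "f \<in> Hom (Om M) N" shows "inv\<^bsub>HG\<^esub> f = (\<lambda>x\<in>car (Om M). \<ominus>\<^bsub>N\<^esub> f x)"
proof -
  interpret comm_group HG by (rule HG_comm)
  have fc: "f x \<in> car N" if "x \<in> car (Om M)" for x using assms that by (auto simp: mod_hom_def)
  have "(\<lambda>x\<in>car (Om M). \<zero>\<^sub>N \<ominus>\<^sub>N f x) \<in> Hom (Om M) N"
    using restrict_mod_hom[OF lin_diff[OF N lin_zero_map[OF N]] fm_Om[OF M], of f] assms by (simp add: mod_hom_iff)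
  moreover have "(\<lambda>x\<in>car (Om M). \<zero>\<^sub>N \<ominus>\<^sub>N f x) = (\<lambda>x\<in>car (Om M). \<ominus>\<^bsub>N\<^esub> f x)"
    by (rule restrict_ext) (use fc N in \<open>simp add: a_minus_def\<close>)
  ultimately have mem: "(\<lambda>x\<in>car (Om M). \<ominus>\<^bsub>N\<^esub> f x) \<in> car HG" by (simp add: HG_simps)
  have "(\<lambda>x\<in>car (Om M). \<ominus>\<^bsub>N\<^esub> f x) \<otimes>\<^bsub>HG\<^esub> f = \<one>\<^bsub>HG\<^esub>"
    unfolding HG_simps by (rule restrict_ext) (use fc N in simp)
  thus ?thesis using inv_equality[OF _ _ mem] assms by (simp add: HG_simps)
qed

lemma lin_restrict_Om: "lin (Om M) N \<psi> ==> restrict \<psi> (car (Om M)) \<in> Hom (Om M) N" using restrict_mod_hom fm_Om[OF M] by blast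

lemma bd_normal: "ext1_bd R M N \<lhd> HG"
proof -
  interpret comm_group HG by (rule HG_comm)
  have "subgroup (ext1_bd R M N) HG"
  proof (rule subgroupI)
    show "ext1_bd R M N \<subseteq> car HG" using bd_iff[OF M] by (auto simp: HG_simps)
    have "(\<lambda>x\<in>car (Om M). \<zero>\<^sub>N) \<in> ext1_bd R M N" unfolding bd_iff[OF M] using lin_restrict_Om[OF lin_zero_map[OF N]]
        extendable_cong[OF extendable_zero[OF N]] by (metis restrict_apply')
    thus "ext1_bd R M N \<noteq> {}" by blast
    show "inv\<^bsub>HG\<^esub> f \<in> ext1_bd R M N" if "f \<in> ext1_bd R M N" for f
    proof -
      have f: "f \<in> Hom (Om M) N" "extendable M N f" using that bd_iff[OF M] by auto
      have fc: "f x \<in> car N" if "x \<in> car (Om M)" for x using f(1) that by (auto simp: mod_hom_def)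
      have "inv\<^bsub>HG\<^esub> f \<in> Hom (Om M) N" using inv_closed[of f] f(1) by (simp add: HG_simps)
      moreover have "extendable M N (inv\<^bsub>HG\<^esub> f)" by (rule extendable_cong[OF extendable_diff[OF N extendable_zero[OF N] f(2)]])
          (use HG_inv[OF f(1)] N fc in \<open>simp add: a_minus_def del: Om_simps\<close>)
      ultimately show ?thesis using bd_iff[OF M] by blast
    qed
    show "f \<otimes>\<^bsub>HG\<^esub> g \<in> ext1_bd R M N" if "f \<in> ext1_bd R M N" "g \<in> ext1_bd R M N" for f g
    proof -
      have f: "f \<in> Hom (Om M) N" "extendable M N f" "g \<in> Hom (Om M) N" "extendable M N g" using that bd_iff[OF M] by auto
      have "f \<otimes>\<^bsub>HG\<^esub> g \<in> Hom (Om M) N" using m_closed[of f g] f by (simp add: HG_simps)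
      moreover have "extendable M N (f \<otimes>\<^bsub>HG\<^esub> g)"
        by (rule extendable_cong[OF extendable_plus[OF N f(2,4)]]) (simp add: HG_simps del: Om_simps)
      ultimately show ?thesis using bd_iff[OF M] by blast
    qed
  qed
  thus ?thesis by (rule subgroup_imp_normal)
qed

lemma cls_eq:
  assumes "lin (Om M) N \<phi>" "lin (Om M) N \<psi>"
  shows "cls M N \<phi> = cls M N \<psi> \<longleftrightarrow> extendable M N (\<lambda>x. \<phi> x \<ominus>\<^sub>N \<psi> x)"
proof -
  interpret comm_group HG by (rule HG_comm)
  interpret B: normal "ext1_bd R M N" HG by (rule bd_normal)
  let ?f = "restrict \<phi> (car (Om M))" and ?g = "restrict \<psi> (car (Om M))"
  have mem: "?f \<in> car HG" "?g \<in> car HG" using lin_restrict_Om assms by (auto simp: HG_simps)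
  have "cls M N \<phi> = cls M N \<psi> \<longleftrightarrow> ?f \<otimes>\<^bsub>HG\<^esub> inv\<^bsub>HG\<^esub> ?g \<in> ext1_bd R M N"
  proof
    assume "cls M N \<phi> = cls M N \<psi>"
    hence "?f \<in> ext1_bd R M N #>\<^bsub>HG\<^esub> ?g" unfolding cls_def using rcos_self[OF mem(1) B.subgroup_axioms] by simp
    thus "?f \<otimes>\<^bsub>HG\<^esub> inv\<^bsub>HG\<^esub> ?g \<in> ext1_bd R M N" using B.rcos_module[OF is_group mem(2,1)] by blast
  next
    assume "?f \<otimes>\<^bsub>HG\<^esub> inv\<^bsub>HG\<^esub> ?g \<in> ext1_bd R M N"
    hence "?f \<in> ext1_bd R M N #>\<^bsub>HG\<^esub> ?g" using B.rcos_module[OF is_group mem(2,1)] by blast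
    thus "cls M N \<phi> = cls M N \<psi>" unfolding cls_def using repr_independence[OF _ mem(2) B.subgroup_axioms] by metis
  qed
  also have "?f \<otimes>\<^bsub>HG\<^esub> inv\<^bsub>HG\<^esub> ?g = (\<lambda>x\<in>car (Om M). \<phi> x \<ominus>\<^sub>N \<psi> x)"
    using HG_inv[of ?g] mem by (auto simp: HG_simps a_minus_def simp del: Om_simps intro!: restrict_ext)
  also have "\<dots> \<in> ext1_bd R M N \<longleftrightarrow> extendable M N (\<lambda>x. \<phi> x \<ominus>\<^sub>N \<psi> x)"
    unfolding bd_iff[OF M] using lin_restrict_Om[OF lin_diff[OF N assms]] by (auto simp del: Om_simps elim: extendable_cong)
  finally show ?thesis .
qed

lemma ext1_comm_group: "finite_comm_group (ext1 R M N)"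
proof -
  interpret comm_group HG by (rule HG_comm)
  interpret B: normal "ext1_bd R M N" HG by (rule bd_normal)
  have "comm_group (ext1 R M N)" unfolding ext1_def using abelian_FactGroup[OF B.subgroup_axioms] .
  moreover have "finite (car HG)" using fm_Om[OF M] N by (simp add: HG_simps)
  hence "finite (car (ext1 R M N))" by (simp add: ext1_def FactGroup_def RCOSETS_def)
  ultimately show ?thesis by (simp add: finite_comm_group_def finite_comm_group_axioms_def)
qed

lemma cls_in: "lin (Om M) N \<psi> ==> cls M N \<psi> \<in> car (ext1 R M N)"
  using lin_restrict_Om by (auto simp: ext1_def FactGroup_def RCOSETS_def cls_def HG_simps)

lemma cls_ex:
  assumes "X \<in> car (ext1 R M N)" obtains \<psi> where "lin (Om M) N \<psi>" "X = cls M N \<psi>"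
proof -
  obtain f where f: "f \<in> Hom (Om M) N" "X = ext1_bd R M N #>\<^bsub>HG\<^esub> f"
    using assms by (auto simp: ext1_def FactGroup_def RCOSETS_def HG_simps)
  hence "lin (Om M) N f" "restrict f (car (Om M)) = f" by (auto simp: mod_hom_iff extensional_restrict simp del: Om_simps)
  thus thesis using that[of f] f by (simp add: cls_def)
qed

lemma cls_mult:
  assumes "lin (Om M) N \<phi>" "lin (Om M) N \<psi>"
  shows "cls M N \<phi> \<otimes>\<^bsub>ext1 R M N\<^esub> cls M N \<psi> = cls M N (\<lambda>x. \<phi> x \<oplus>\<^sub>N \<psi> x)"
proof -
  interpret B: normal "ext1_bd R M N" HG by (rule bd_normal)
  let ?f = "restrict \<phi> (car (Om M))" and ?g = "restrict \<psi> (car (Om M))"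
  have mem: "?f \<in> car HG" "?g \<in> car HG" using lin_restrict_Om assms by (auto simp: HG_simps)
  have "?f \<otimes>\<^bsub>HG\<^esub> ?g = (\<lambda>x\<in>car (Om M). \<phi> x \<oplus>\<^sub>N \<psi> x)"
    unfolding HG_simps by (auto intro!: restrict_ext)
  thus ?thesis using B.rcos_sum[OF mem] by (simp add: ext1_def FactGroup_def cls_def)
qed

lemma cls_one: "\<one>\<^bsub>ext1 R M N\<^esub> = cls M N (\<lambda>x. \<zero>\<^sub>N)"
proof -
  interpret comm_group HG by (rule HG_comm)
  interpret B: normal "ext1_bd R M N" HG by (rule bd_normal)
  have "cls M N (\<lambda>x. \<zero>\<^sub>N) = ext1_bd R M N #>\<^bsub>HG\<^esub> \<one>\<^bsub>HG\<^esub>" by (simp add: cls_def HG_simps)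
  also have "\<dots> = ext1_bd R M N" using coset_mult_one[OF B.subset] .
  finally show ?thesis by (simp add: ext1_def FactGroup_def)
qed

lemma cls_extendable:
  assumes "lin (Om M) N \<psi>" shows "cls M N \<psi> = \<one>\<^bsub>ext1 R M N\<^esub> \<longleftrightarrow> extendable M N \<psi>"
proof -
  have "!!x. x \<in> car (Om M) ==> \<psi> x \<in> car N" using lin_closed[OF assms] .
  hence "extendable M N (\<lambda>x. \<psi> x \<ominus>\<^sub>N \<zero>\<^sub>N) \<longleftrightarrow> extendable M N \<psi>"
    using N by (auto elim!: extendable_cong simp del: Om_simps)
  thus ?thesis unfolding cls_one using cls_eq[OF assms lin_zero_map[OF N]] by simp
qed

lemma ext1_vanishes_iff: "ext1_vanishes R M N \<longleftrightarrow> (\<forall>\<psi>. lin (Om M) N \<psi> --> extendable M N \<psi>)"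
proof
  assume "ext1_vanishes R M N"
  thus "\<forall>\<psi>. lin (Om M) N \<psi> --> extendable M N \<psi>" using cls_in cls_extendable unfolding ext1_vanishes_def by (metis singletonD)
next
  assume "\<forall>\<psi>. lin (Om M) N \<psi> --> extendable M N \<psi>"
  hence "X = \<one>\<^bsub>ext1 R M N\<^esub>" if "X \<in> car (ext1 R M N)" for X using cls_ex[OF that] cls_extendable by metis
  moreover have "\<one>\<^bsub>ext1 R M N\<^esub> \<in> car (ext1 R M N)" unfolding cls_one using cls_in[OF lin_zero_map[OF N]] .
  ultimately show "ext1_vanishes R M N" unfolding ext1_vanishes_def by blast
qed

lemma ext1_vanishes_card: "ext1_vanishes R M N \<longleftrightarrow> e M N = 1"
proof -
  have "\<one>\<^bsub>ext1 R M N\<^esub> \<in> car (ext1 R M N)" unfolding cls_one using cls_in[OF lin_zero_map[OF N]] .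
  thus ?thesis unfolding ext1_vanishes_def by (auto simp: card_1_singleton_iff)
qed

lemma cls_closed_iff: "[|lin (Om M) N \<phi>; !!x. x \<in> car (Om M) ==> \<phi> x = \<psi> x|] ==> cls M N \<phi> = cls M N \<psi>"
  unfolding cls_def by (metis restrict_ext)

text \<open>Counts the exact sequence from Hom(M, N) through Hom(F M, N) and Hom(Om M, N) to Ext(M,
  N): the kernel of the last map is \<open>ext1_bd\<close>, which is also the image of the map
  before it.\<close>

lemma e_formula: "e M N * h (F M) N = h (Om M) N * h M N"
proof -
  note O = fm_Om[OF M] and FM = fm_F[OF M]
  have img: "cls M N ` Hom (Om M) N = car (ext1 R M N)"
  proof (intro equalityI subsetI)
    fix X assume "X \<in> car (ext1 R M N)"
    then obtain \<psi> where \<psi>: "lin (Om M) N \<psi>" "X = cls M N \<psi>" by (rule cls_ex)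
    hence "X = cls M N (restrict \<psi> (car (Om M)))" using cls_closed_iff[OF \<psi>(1)] by (metis restrict_apply')
    thus "X \<in> cls M N ` Hom (Om M) N" using lin_restrict_Om[OF \<psi>(1)] by blast
  qed (auto simp: mod_hom_iff cls_in)
  have bd: "ext1_bd R M N \<subseteq> Hom (Om M) N" using bd_iff[OF M] by blast
  have "h (Om M) N = card (ext1_bd R M N) * card (cls M N ` Hom (Om M) N)"
  proof (rule card_hom_fibres[OF O N bd])
    fix f g assume "f \<in> Hom (Om M) N" "g \<in> Hom (Om M) N"
    hence fg: "lin (Om M) N f" "lin (Om M) N g" by (auto simp: mod_hom_iff)
    show "cls M N f = cls M N g \<longleftrightarrow> (\<lambda>x\<in>car (Om M). f x \<ominus>\<^sub>N g x) \<in> ext1_bd R M N"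
      unfolding cls_eq[OF fg] bd_iff[OF M] using lin_restrict_Om[OF lin_diff[OF N fg]] by (auto simp del: Om_simps elim: extendable_cong)
  qed
  moreover have "h (F M) N = h M N * card (ext1_bd R M N)"
  proof -
    \<comment> \<open>Maps on \<open>F M\<close> that vanish on the syzygy are those factoring
      through \<open>pi M\<close>, so there are as many of them as maps on \<open>M\<close>.\<close>
    let ?K = "(\<lambda>f. \<lambda>c\<in>car (F M). f (pi M c)) ` Hom M N"
    have KI: "k \<in> ?K \<longleftrightarrow> k \<in> Hom (F M) N \<and> (\<forall>x\<in>car (Om M). k x = \<zero>\<^sub>N)" for k
    proof
      assume "k \<in> ?K"
      then obtain f where f: "f \<in> Hom M N" "k = (\<lambda>c\<in>car (F M). f (pi M c))" by blast
      hence "lin M N f" by (simp add: mod_hom_iff)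
      thus "k \<in> Hom (F M) N \<and> (\<forall>x\<in>car (Om M). k x = \<zero>\<^sub>N)"
        using restrict_mod_hom[OF lin_comp[OF lin_pi[OF M]] FM, of N f] f(2) lin_zero[OF M N] by (auto simp: ker_def)
    next
      assume k: "k \<in> Hom (F M) N \<and> (\<forall>x\<in>car (Om M). k x = \<zero>\<^sub>N)"
      hence kl: "lin (F M) N k" by (simp add: mod_hom_iff)
      obtain f where f: "lin M N f" "!!x. x \<in> car (F M) ==> f (pi M x) = k x"
        using factor[OF FM M N lin_pi[OF M] pi_onto[OF M] kl] k by (auto simp: ker_def)
      have "(\<lambda>c\<in>car (F M). restrict f (car M) (pi M c)) = k" by (rule extensionalityI[of _ "car (F M)"])
          (use k f(2) lin_closed[OF lin_pi[OF M]] in \<open>auto simp: mod_hom_iff simp del: F_simps\<close>)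
      thus "k \<in> ?K" using restrict_mod_hom[OF f(1) M] by (rule image_eqI[OF sym])
    qed
    have "inj_on (\<lambda>f. \<lambda>c\<in>car (F M). f (pi M c)) (Hom M N)"
    proof (rule inj_onI)
      fix f g assume fg: "f \<in> Hom M N" "g \<in> Hom M N"
        "(\<lambda>c\<in>car (F M). f (pi M c)) = (\<lambda>c\<in>car (F M). g (pi M c))"
      show "f = g"
      proof (rule mod_hom_eqI[OF fg(1,2)])
        fix x assume "x \<in> car M"
        thus "f x = g x" using fun_cong[OF fg(3), of "unit_vec M x"] pi_unit[OF M] by simp
      qed
    qed
    hence "card ?K = h M N" by (rule card_image)
    moreover have "h (F M) N = card ?K * card ((\<lambda>f. restrict f (car (Om M))) ` Hom (F M) N)"
    proof (rule card_hom_fibres[OF FM N])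
      show "?K \<subseteq> Hom (F M) N" using KI by blast
      fix f g assume fg: "f \<in> Hom (F M) N" "g \<in> Hom (F M) N"
      hence l: "lin (F M) N f" "lin (F M) N g" by (auto simp: mod_hom_iff)
      have "restrict f (car (Om M)) = restrict g (car (Om M)) \<longleftrightarrow> (\<forall>x\<in>car (Om M). f x = g x)"
        unfolding restrict_def fun_eq_iff by auto
      also have "\<dots> \<longleftrightarrow> (\<forall>x\<in>car (Om M). f x \<ominus>\<^sub>N g x = \<zero>\<^sub>N)"
        using fm_minus_eq_zero[OF N lin_closed[OF l(1)] lin_closed[OF l(2)]] Om_in_F by blast
      also have "\<dots> \<longleftrightarrow> (\<lambda>x\<in>car (F M). f x \<ominus>\<^sub>N g x) \<in> ?K"
        unfolding KI using restrict_mod_hom[OF lin_diff[OF N l] FM] Om_in_F[of _ M] by (auto simp del: F_simps Om_simps)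
      finally show "restrict f (car (Om M)) = restrict g (car (Om M)) \<longleftrightarrow>
          (\<lambda>x\<in>car (F M). f x \<ominus>\<^sub>N g x) \<in> ?K" .
    qed
    ultimately show ?thesis by (simp add: ext1_bd_def)
  qed
  ultimately show ?thesis using img by simp
qed

text \<open>Characters of Ext are handled through their values on classes of cocycles.\<close>

lemma char_mult:
  "[|\<chi> \<in> characters (ext1 R M N); lin (Om M) N \<phi>; lin (Om M) N \<psi>|] ==>
    \<chi> (cls M N (\<lambda>x. \<phi> x \<oplus>\<^sub>N \<psi> x)) = \<chi> (cls M N \<phi>) * \<chi> (cls M N \<psi>)"
  using cls_mult[of \<phi> \<psi>, symmetric] cls_in[of \<phi>] cls_in[of \<psi>] by (simp add: characters_iff)

lemma char_norm: "[|\<chi> \<in> characters (ext1 R M N); lin (Om M) N \<phi>|] ==> cmod (\<chi> (cls M N \<phi>)) = 1"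
  using cls_in[of \<phi>] by (simp add: characters_iff)

lemma char_extendable:
  assumes "\<chi> \<in> characters (ext1 R M N)" "lin (Om M) N \<phi>" "extendable M N \<phi>" shows "\<chi> (cls M N \<phi>) = 1"
proof -
  interpret E: finite_comm_group "ext1 R M N" by (rule ext1_comm_group)
  show ?thesis using cls_extendable[OF assms(2)] assms characters_one[OF E.is_group] by metis
qed

lemma char_eqI:
  assumes "\<chi> \<in> characters (ext1 R M N)" "\<chi>' \<in> characters (ext1 R M N)"
    "!!\<phi>. lin (Om M) N \<phi> ==> \<chi> (cls M N \<phi>) = \<chi>' (cls M N \<phi>)"
  shows "\<chi> = \<chi>'"
proof (rule extensionalityI)
  show "\<chi> \<in> extensional (car (ext1 R M N))" "\<chi>' \<in> extensional (car (ext1 R M N))"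
    using assms(1,2) unfolding characters_iff by blast+
  fix X assume "X \<in> car (ext1 R M N)"
  then obtain \<psi> where "lin (Om M) N \<psi>" "X = cls M N \<psi>" by (rule cls_ex)
  thus "\<chi> X = \<chi>' X" using assms(3) by simp
qed

text \<open>A function on cocycles defines a character once it is multiplicative and equal to 1 on
  extendable cocycles, for then cohomologous cocycles receive the same value.\<close>

lemma char_exists:
  assumes norm: "!!\<phi>. lin (Om M) N \<phi> ==> cmod (c \<phi>) = 1"
    and cong: "!!\<phi> \<psi>. [|lin (Om M) N \<phi>; lin (Om M) N \<psi>; !!x. x \<in> car (Om M) ==> \<phi> x = \<psi> x|] ==> c \<phi> = c \<psi>"
    and mult: "!!\<phi> \<psi>. [|lin (Om M) N \<phi>; lin (Om M) N \<psi>|] ==> c (\<lambda>x. \<phi> x \<oplus>\<^sub>N \<psi> x) = c \<phi> * c \<psi>"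
    and ext: "!!\<phi>. [|lin (Om M) N \<phi>; extendable M N \<phi>|] ==> c \<phi> = 1"
  obtains \<chi> where "\<chi> \<in> characters (ext1 R M N)" "!!\<phi>. lin (Om M) N \<phi> ==> \<chi> (cls M N \<phi>) = c \<phi>"
proof -
  have wd: "c \<phi> = c \<psi>" if l: "lin (Om M) N \<phi>" "lin (Om M) N \<psi>" and eq: "cls M N \<phi> = cls M N \<psi>" for \<phi> \<psi>
  proof -
    have d: "lin (Om M) N (\<lambda>x. \<phi> x \<ominus>\<^sub>N \<psi> x)" using lin_diff[OF N l] .
    have "c \<phi> = c (\<lambda>x. (\<phi> x \<ominus>\<^sub>N \<psi> x) \<oplus>\<^sub>N \<psi> x)" by (rule cong[OF l(1) lin_plus[OF N d l(2)]])
        (use fm_minus_add(1)[OF N lin_closed[OF l(1)] lin_closed[OF l(2)]] in metis)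
    also have "\<dots> = c \<psi>" using mult[OF d l(2)] ext[OF d] eq cls_eq[OF l] by simp
    finally show ?thesis .
  qed
  define \<chi> where "\<chi> = (\<lambda>X\<in>car (ext1 R M N). c (SOME \<phi>. lin (Om M) N \<phi> \<and> cls M N \<phi> = X))"
  have \<chi>: "\<chi> (cls M N \<phi>) = c \<phi>" if "lin (Om M) N \<phi>" for \<phi>
  proof -
    have "lin (Om M) N (SOME \<psi>. lin (Om M) N \<psi> \<and> cls M N \<psi> = cls M N \<phi>) \<and>
      cls M N (SOME \<psi>. lin (Om M) N \<psi> \<and> cls M N \<psi> = cls M N \<phi>) = cls M N \<phi>"
      using someI[of "\<lambda>\<psi>. lin (Om M) N \<psi> \<and> cls M N \<psi> = cls M N \<phi>" \<phi>] that by simp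
    thus ?thesis unfolding \<chi>_def using wd[OF _ that] cls_in[OF that] by simp
  qed
  have "\<chi> \<in> characters (ext1 R M N)" unfolding characters_iff
  proof (intro conjI ballI)
    show "\<chi> \<in> extensional (car (ext1 R M N))" by (simp add: \<chi>_def)
    fix X assume X: "X \<in> car (ext1 R M N)"
    then obtain \<phi> where \<phi>: "lin (Om M) N \<phi>" "X = cls M N \<phi>" by (rule cls_ex)
    thus "cmod (\<chi> X) = 1" using \<chi> norm by simp
    fix Y assume Y: "Y \<in> car (ext1 R M N)"
    then obtain \<psi> where \<psi>: "lin (Om M) N \<psi>" "Y = cls M N \<psi>" by (rule cls_ex)
    show "\<chi> (X \<otimes>\<^bsub>ext1 R M N\<^esub> Y) = \<chi> X * \<chi> Y"
      using \<phi> \<psi> cls_mult \<chi> mult lin_plus[OF N \<phi>(1) \<psi>(1)] by simp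
  qed
  thus thesis using \<chi> that by blast
qed

text \<open>Characters separate the elements of a finite abelian group, so triviality of a class can
  be tested through them.\<close>

lemma char_separate:
  assumes "lin (Om M) N \<phi>" "!!\<chi>. \<chi> \<in> characters (ext1 R M N) ==> \<chi> (cls M N \<phi>) = 1"
  shows "extendable M N \<phi>"
proof -
  interpret E: finite_comm_group "ext1 R M N" by (rule ext1_comm_group)
  show ?thesis using E.characters_separate[OF cls_in[OF assms(1)]] assms(2) cls_extendable[OF assms(1)] by metis
qed

lemma char_sum:
  assumes \<chi>: "\<chi> \<in> characters (ext1 R M N)" and A: "finite A" and f: "!!a. a \<in> A ==> lin (Om M) N (f a)"
  shows "\<chi> (cls M N (\<lambda>x. \<Oplus>\<^bsub>N\<^esub>a\<in>A. f a x)) = (\<Prod>a\<in>A. \<chi> (cls M N (f a)))"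
    "lin (Om M) N (\<lambda>x. \<Oplus>\<^bsub>N\<^esub>a\<in>A. f a x)"
proof -
  interpret N: abelian_group N using N fm_ag by auto
  have "\<chi> (cls M N (\<lambda>x. \<Oplus>\<^bsub>N\<^esub>a\<in>A. f a x)) = (\<Prod>a\<in>A. \<chi> (cls M N (f a))) \<and> lin (Om M) N (\<lambda>x. \<Oplus>\<^bsub>N\<^esub>a\<in>A. f a x)"
    using A f
  proof (induction A rule: finite_induct)
    case empty
    thus ?case using lin_zero_map[OF N, of "Om M"] char_extendable[OF \<chi> lin_zero_map[OF N] extendable_zero[OF N]] by simp
  next
    case (insert b A)
    have l: "lin (Om M) N (f b)" "lin (Om M) N (\<lambda>x. \<Oplus>\<^bsub>N\<^esub>a\<in>A. f a x)" using insert by auto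
    have eq: "f b x \<oplus>\<^sub>N (\<Oplus>\<^bsub>N\<^esub>a\<in>A. f a x) = (\<Oplus>\<^bsub>N\<^esub>a\<in>insert b A. f a x)" if x: "x \<in> car (Om M)" for x
      by (rule N.finsum_insert[symmetric]) (use insert.hyps lin_closed[OF insert.prems x] in auto)
    have l': "lin (Om M) N (\<lambda>x. \<Oplus>\<^bsub>N\<^esub>a\<in>insert b A. f a x)" by (rule lin_cong[OF lin_plus[OF N l] eq fm_Om[OF M]])
    have "cls M N (\<lambda>x. f b x \<oplus>\<^sub>N (\<Oplus>\<^bsub>N\<^esub>a\<in>A. f a x)) = cls M N (\<lambda>x. \<Oplus>\<^bsub>N\<^esub>a\<in>insert b A. f a x)"
      by (rule cls_closed_iff[OF lin_plus[OF N l] eq])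
    thus ?case using char_mult[OF \<chi> l] insert l' by simp
  qed
  thus "\<chi> (cls M N (\<lambda>x. \<Oplus>\<^bsub>N\<^esub>a\<in>A. f a x)) = (\<Prod>a\<in>A. \<chi> (cls M N (f a)))"
    "lin (Om M) N (\<lambda>x. \<Oplus>\<^bsub>N\<^esub>a\<in>A. f a x)" by blast+
qed

end

section \<open>Functoriality of the free presentation\<close>

lemma finsum_reg: "finsum R f A = finsum (reg_mod R) f A" by (simp add: finsum_def reg_mod_def finprod_def)

lemma lin_coord:
  assumes M: "fm M" and m: "m \<in> car M" shows "lin (F M) (reg_mod R) (\<lambda>c. c m)" using m by (auto simp: lin_def)

text \<open>Each coordinate of the image is the linear extension of an indicator function, so
  linearity of \<open>free_map\<close> is inherited from \<open>lin_aug\<close>.\<close>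

lemma free_map_coord:
  assumes M: "fm M" and c: "c \<in> car (F M)" and m: "m \<in> car M'"
  shows "fmap M M' g c m = aug M (reg_mod R) (\<lambda>x. if g x = m then \<one> else \<zero>) c"
proof -
  interpret N: abelian_group "reg_mod R" using fm_reg fm_ag by auto
  have "(\<Oplus>\<^bsub>reg_mod R\<^esub>x\<in>car M. c x \<otimes> (if g x = m then \<one> else \<zero>)) = (\<Oplus>\<^bsub>reg_mod R\<^esub>x\<in>{x \<in> car M. g x = m}. c x)"
    by (rule N.add.finprod_mono_neutral_cong_right) (use M c in \<open>auto simp: PiE_iff\<close>)
  thus ?thesis using m by (simp add: free_map_def finsum_reg aug_def)
qed

lemma lin_free_map:
  assumes M: "fm M" and M': "fm M'"
  shows "lin (F M) (F M') (fmap M M' g)"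
proof -
  have A: "lin (F M) (reg_mod R) (aug M (reg_mod R) (\<lambda>x. if g x = m then \<one> else \<zero>))" for m by (rule lin_aug[OF M fm_reg]) auto
  note fmF = fm_F[OF M]
  have ext: "fmap M M' g c \<in> extensional (car M')" for c by (simp add: free_map_def)
  have cl: "fmap M M' g c m \<in> car R" if "c \<in> car (F M)" "m \<in> car M'" for c m
    using lin_closed[OF A that(1)] free_map_coord[OF M that] by simp
  show ?thesis unfolding lin_def
  proof (intro conjI ballI funcsetI)
    show "fmap M M' g c \<in> car (F M')" if "c \<in> car (F M)" for c using cl[OF that] ext[of c] by (auto simp: PiE_iff)
    show "fmap M M' g (c \<oplus>\<^sub>(F M) d) = fmap M M' g c \<oplus>\<^sub>(F M') fmap M M' g d"
      if cd: "c \<in> car (F M)" "d \<in> car (F M)" for c d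
    proof (rule extensionalityI[of _ "car M'"])
      fix m assume m: "m \<in> car M'"
      show "fmap M M' g (c \<oplus>\<^sub>(F M) d) m = (fmap M M' g c \<oplus>\<^sub>(F M') fmap M M' g d) m"
        using lin_add[OF A cd, of m] free_map_coord[OF M fm_add[OF fmF cd] m] free_map_coord[OF M cd(1) m] free_map_coord[OF M cd(2) m] m by (simp del: F_simps(3)) simp
    qed (auto simp: free_map_def)
    show "fmap M M' g (r \<odot>\<^sub>(F M) c) = r \<odot>\<^sub>(F M') fmap M M' g c"
      if cd: "r \<in> car R" "c \<in> car (F M)" for c r
    proof (rule extensionalityI[of _ "car M'"])
      fix m assume m: "m \<in> car M'"
      show "fmap M M' g (r \<odot>\<^sub>(F M) c) m = (r \<odot>\<^sub>(F M') fmap M M' g c) m"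
        using lin_smult[OF A cd, of m] free_map_coord[OF M fm_smult[OF fmF cd] m] free_map_coord[OF M cd(2) m] m by (simp del: F_simps(4)) simp
    qed (auto simp: free_map_def)
  qed
qed

lemma free_map_unit:
  assumes M: "fm M" and M': "fm M'" and x: "x \<in> car M"
  shows "fmap M M' g (unit_vec M x) = unit_vec M' (g x)"
proof (rule extensionalityI[of _ "car M'"])
  fix m assume m: "m \<in> car M'"
  show "fmap M M' g (unit_vec M x) m = unit_vec M' (g x) m"
    using free_map_coord[OF M unit_vec_closed m, of g] aug_unit[OF M fm_reg, of "\<lambda>x. if g x = m then \<one> else \<zero>", OF _ x] m
    by (simp add: unit_vec_def[of M'])
qed (auto simp: free_map_def unit_vec_def)

lemma pi_free_map:
  assumes M: "fm M" and M': "fm M'" and g: "lin M M' g" and c: "c \<in> car (F M)"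
  shows "pi M' (fmap M M' g c) = g (pi M c)"
proof (rule lin_F_ext[OF M M' lin_comp[OF lin_free_map[OF M M'] lin_pi[OF M']] lin_comp[OF lin_pi[OF M] g] _ c])
  show "pi M' (fmap M M' g (unit_vec M m)) = g (pi M (unit_vec M m))" if "m \<in> car M" for m
    using that free_map_unit[OF M M' that] pi_unit[OF M that] pi_unit[OF M' lin_closed[OF g that]] by simp
qed

lemma lin_free_map_Om:
  assumes M: "fm M" and M': "fm M'" and g: "lin M M' g"
  shows "lin (Om M) (Om M') (fmap M M' g)"
proof -
  have "lin (Om M) (F M') (fmap M M' g)" using lin_comp[OF lin_Om_F[OF M] lin_free_map[OF M M']] .
  moreover have "fmap M M' g x \<in> ker (F M') M' (pi M')" if "x \<in> car (Om M)" for x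
    using that pi_free_map[OF M M' g Om_in_F[OF that]] lin_closed[OF lin_free_map[OF M M'] Om_in_F[OF that]]
      lin_zero[OF M M' g] by (simp add: ker_def)
  ultimately show ?thesis unfolding Om_eq[of M'] by (rule lin_sub_cod)
qed

lemma free_map_comp:
  assumes M: "fm M" and M': "fm M'" and M'': "fm M''" and f: "!!x. x \<in> car M ==> f x \<in> car M'" and c: "c \<in> car (F M)"
  shows "fmap M' M'' g (fmap M M' f c) = fmap M M'' (\<lambda>x. g (f x)) c"
  by (rule lin_F_ext[OF M fm_F[OF M''] lin_comp[OF lin_free_map[OF M M'] lin_free_map[OF M' M'']] lin_free_map[OF M M''] _ c])
    (simp add: free_map_unit M M' M'' f)

lemma free_map_cong:
  assumes M: "fm M" and M': "fm M'" and "!!x. x \<in> car M ==> f x = g x" and c: "c \<in> car (F M)"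
  shows "fmap M M' f c = fmap M M' g c" by (rule lin_F_ext[OF M fm_F[OF M'] lin_free_map[OF M M'] lin_free_map[OF M M'] _ c])
    (simp add: free_map_unit M M' assms(3))

lemma free_map_id:
  assumes M: "fm M" and c: "c \<in> car (F M)"
  shows "fmap M M (\<lambda>x. x) c = c" by (rule lin_F_ext[OF M fm_F[OF M] lin_free_map[OF M M] lin_id _ c])
    (simp add: free_map_unit M)

lemma extendable_pre:
  assumes M: "fm M" and M': "fm M'" and g: "lin M M' g" and "extendable M' N \<psi>"
  shows "extendable M N (\<lambda>x. \<psi> (fmap M M' g x))"
proof -
  obtain \<Psi> where \<Psi>: "lin (F M') N \<Psi>" "\<forall>x\<in>car (Om M'). \<Psi> x = \<psi> x" using assms(4) unfolding extendable_def by blast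
  show ?thesis unfolding extendable_def
    using lin_comp[OF lin_free_map[OF M M', of g] \<Psi>(1)] \<Psi>(2) lin_closed[OF lin_free_map_Om[OF M M' g]] by blast
qed

lemma in_clsE:
  assumes M: "fm M" and N: "fm N" and \<psi>: "lin (Om M) N \<psi>" and \<phi>: "\<phi> \<in> cls M N \<psi>"
  shows "lin (Om M) N \<phi> \<and> cls M N \<phi> = cls M N \<psi> \<and> extendable M N (\<lambda>x. \<phi> x \<ominus>\<^sub>N \<psi> x)"
proof -
  obtain b where b: "b \<in> ext1_bd R M N" "\<phi> = b \<otimes>\<^bsub>hom_group R (Om M) N\<^esub> restrict \<psi> (car (Om M))"
    using \<phi> unfolding cls_def r_coset_def by blast
  have b': "b \<in> Hom (Om M) N" "extendable M N b" "lin (Om M) N b" using b(1) unfolding bd_iff[OF M] by (auto simp: mod_hom_iff)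
  have \<phi>x: "\<phi> x = b x \<oplus>\<^sub>N \<psi> x" if "x \<in> car (Om M)" for x using that b(2) by (simp add: hom_group_def del: Om_simps)
  have l: "lin (Om M) N \<phi>" using lin_cong[OF lin_plus[OF N b'(3) \<psi>] _ fm_Om[OF M], of \<phi>] \<phi>x by simp
  have "extendable M N (\<lambda>x. \<phi> x \<ominus>\<^sub>N \<psi> x)" by (rule extendable_cong[OF b'(2)])
      (use \<phi>x fm_minus_add(3)[OF N lin_closed[OF b'(3)] lin_closed[OF \<psi>]] in \<open>simp del: Om_simps\<close>)
  thus ?thesis using cls_eq[OF M N l \<psi>] l by blast
qed

lemma cls_self:
  assumes M: "fm M" and N: "fm N" and \<psi>: "lin (Om M) N \<psi>" shows "restrict \<psi> (car (Om M)) \<in> cls M N \<psi>"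
proof -
  interpret comm_group "hom_group R (Om M) N" by (rule HG_comm[OF M N])
  interpret B: normal "ext1_bd R M N" "hom_group R (Om M) N" by (rule bd_normal[OF M N])
  show ?thesis unfolding cls_def
    by (rule rcos_self[OF _ B.subgroup_axioms]) (use lin_restrict_Om[OF M N \<psi>] in \<open>simp add: hom_group_def\<close>)
qed

lemma ext1_post_cls:
  assumes M: "fm M" and N: "fm N" and N': "fm N'" and g: "lin N N' g" and \<psi>: "lin (Om M) N \<psi>"
  shows "ext1_post R M N' g (cls M N \<psi>) = cls M N' (\<lambda>x. g (\<psi> x))"
proof -
  have *: "ext1_bd R M N' #>\<^bsub>hom_group R (Om M) N'\<^esub> compose (car (Om M)) g \<phi> = cls M N' (\<lambda>x. g (\<psi> x))"
    if "\<phi> \<in> cls M N \<psi>" for \<phi>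
  proof -
    have \<phi>: "lin (Om M) N \<phi>" "extendable M N (\<lambda>x. \<phi> x \<ominus>\<^sub>N \<psi> x)" using in_clsE[OF M N \<psi> that] by auto
    have "cls M N' (\<lambda>x. g (\<phi> x)) = cls M N' (\<lambda>x. g (\<psi> x))"
      unfolding cls_eq[OF M N' lin_comp[OF \<phi>(1) g] lin_comp[OF \<psi> g]] by (rule extendable_cong[OF extendable_comp[OF \<phi>(2) g]])
        (rule lin_minus[OF N N' g lin_closed[OF \<phi>(1)] lin_closed[OF \<psi>]])
    thus ?thesis by (simp add: cls_def compose_def)
  qed
  show ?thesis unfolding ext1_post_def using * cls_self[OF M N \<psi>] by blast
qed

lemma ext1_pre_cls:
  assumes M: "fm M" and M': "fm M'" and N: "fm N" and g: "lin M M' g" and \<psi>: "lin (Om M') N \<psi>"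
  shows "ext1_pre R M M' N g (cls M' N \<psi>) = cls M N (\<lambda>x. \<psi> (fmap M M' g x))"
proof -
  note gO = lin_free_map_Om[OF M M' g]
  have *: "ext1_bd R M N #>\<^bsub>hom_group R (Om M) N\<^esub> compose (car (Om M)) \<phi> (fmap M M' g) = cls M N (\<lambda>x. \<psi> (fmap M M' g x))"
    if "\<phi> \<in> cls M' N \<psi>" for \<phi>
  proof -
    have \<phi>: "lin (Om M') N \<phi>" "extendable M' N (\<lambda>x. \<phi> x \<ominus>\<^sub>N \<psi> x)" using in_clsE[OF M' N \<psi> that] by auto
    have "cls M N (\<lambda>x. \<phi> (fmap M M' g x)) = cls M N (\<lambda>x. \<psi> (fmap M M' g x))"
      unfolding cls_eq[OF M N lin_comp[OF gO \<phi>(1)] lin_comp[OF gO \<psi>]] using extendable_pre[OF M M' g \<phi>(2)] .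
    thus ?thesis by (simp add: cls_def compose_def)
  qed
  show ?thesis unfolding ext1_pre_def using * cls_self[OF M' N \<psi>] by blast
qed

subsection \<open>The translate as a finite module\<close>

abbreviation tau :: "('r, 'a) module => ('r, ('r, 'a) tau_elem) module" where "tau M \<equiv> tau_mod R M"
abbreviation Rm :: "('r, 'r) module" where "Rm \<equiv> reg_mod R"

lemma lin_rmult: "r \<in> car R ==> lin Rm Rm (\<lambda>s. s \<otimes> r)" by (auto simp: lin_def l_distr m_assoc)

lemma lin_rmult_comp: "[|r \<in> car R; lin M Rm \<phi>|] ==> lin M Rm (\<lambda>x. \<phi> x \<otimes> r)" using lin_comp[OF _ lin_rmult] by blast

lemma tau_carrier [simp]: "car (tau M) = characters (ext1 R M Rm)" by (simp add: tau_mod_def Let_def)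

context
  fixes M :: "('r, 'a) module"
  assumes M: "fm M"
begin

lemma tau_add: "lin (Om M) Rm \<phi> ==> (\<chi> \<oplus>\<^sub>(tau M) \<psi>) (cls M Rm \<phi>) = \<chi> (cls M Rm \<phi>) * \<psi> (cls M Rm \<phi>)"
  using cls_in[OF M fm_reg] by (simp add: tau_mod_def Let_def)

lemma tau_zero: "lin (Om M) Rm \<phi> ==> \<zero>\<^sub>(tau M) (cls M Rm \<phi>) = 1" using cls_in[OF M fm_reg] by (simp add: tau_mod_def Let_def)

lemma tau_smult:
  assumes r: "r \<in> car R" and \<phi>: "lin (Om M) Rm \<phi>"
  shows "(r \<odot>\<^sub>(tau M) \<chi>) (cls M Rm \<phi>) = \<chi> (cls M Rm (\<lambda>x. \<phi> x \<otimes> r))"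
proof -
  have l: "lin Rm Rm (\<lambda>s\<in>car R. s \<otimes> r)" using lin_cong[OF lin_rmult[OF r] _ fm_reg] by simp
  have "cls M Rm (\<lambda>x. (\<lambda>s\<in>car R. s \<otimes> r) (\<phi> x)) = cls M Rm (\<lambda>x. \<phi> x \<otimes> r)"
    by (rule cls_closed_iff[OF M fm_reg lin_comp[OF \<phi> l]]) (use lin_closed[OF \<phi>] in simp)
  thus ?thesis using cls_in[OF M fm_reg \<phi>] ext1_post_cls[OF M fm_reg fm_reg l \<phi>] by (simp add: tau_mod_def Let_def)
qed

lemma tau_ops_closed:
  assumes \<chi>: "\<chi> \<in> car (tau M)"
  shows "\<psi> \<in> car (tau M) ==> \<chi> \<oplus>\<^sub>(tau M) \<psi> \<in> car (tau M)" "\<zero>\<^sub>(tau M) \<in> car (tau M)"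
    "r \<in> car R ==> r \<odot>\<^sub>(tau M) \<chi> \<in> car (tau M)"
proof -
  interpret E: finite_comm_group "ext1 R M Rm" by (rule ext1_comm_group[OF M fm_reg])
  show "\<chi> \<oplus>\<^sub>(tau M) \<psi> \<in> car (tau M)" if "\<psi> \<in> car (tau M)"
    using that \<chi> by (auto simp: tau_mod_def Let_def characters_iff norm_mult)
  show "\<zero>\<^sub>(tau M) \<in> car (tau M)" by (auto simp: tau_mod_def Let_def characters_iff)
  show "r \<odot>\<^sub>(tau M) \<chi> \<in> car (tau M)" if r: "r \<in> car R"
  proof -
    have \<chi>': "\<chi> \<in> characters (ext1 R M Rm)" using \<chi> by simp
    obtain \<chi>'' where c: "\<chi>'' \<in> characters (ext1 R M Rm)" "!!\<phi>. lin (Om M) Rm \<phi> ==> \<chi>'' (cls M Rm \<phi>) = \<chi> (cls M Rm (\<lambda>x. \<phi> x \<otimes> r))"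
    proof (rule char_exists[OF M fm_reg, of "\<lambda>\<phi>. \<chi> (cls M Rm (\<lambda>x. \<phi> x \<otimes> r))"])
      fix \<phi> assume l: "lin (Om M) Rm \<phi>"
      show "cmod (\<chi> (cls M Rm (\<lambda>x. \<phi> x \<otimes> r))) = 1" using char_norm[OF M fm_reg \<chi>' lin_rmult_comp[OF r l]] .
      show "\<chi> (cls M Rm (\<lambda>x. \<phi> x \<otimes> r)) = 1" if "extendable M Rm \<phi>"
        using char_extendable[OF M fm_reg \<chi>' lin_rmult_comp[OF r l] extendable_comp[OF that lin_rmult[OF r]]] .
      fix \<psi> assume l': "lin (Om M) Rm \<psi>"
      show "\<chi> (cls M Rm (\<lambda>x. \<phi> x \<otimes> r)) = \<chi> (cls M Rm (\<lambda>x. \<psi> x \<otimes> r))" if "!!x. x \<in> car (Om M) ==> \<phi> x = \<psi> x"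
        using cls_closed_iff[OF M fm_reg lin_rmult_comp[OF r l], of "\<lambda>x. \<psi> x \<otimes> r"] that by simp
      have "cls M Rm (\<lambda>x. \<phi> x \<otimes> r \<oplus>\<^sub>Rm \<psi> x \<otimes> r) = cls M Rm (\<lambda>x. (\<phi> x \<oplus>\<^sub>Rm \<psi> x) \<otimes> r)"
        by (rule cls_closed_iff[OF M fm_reg lin_plus[OF fm_reg lin_rmult_comp[OF r l] lin_rmult_comp[OF r l']]])
          (use lin_closed[OF l] lin_closed[OF l'] r in \<open>simp add: l_distr\<close>)
      thus "\<chi> (cls M Rm (\<lambda>x. (\<phi> x \<oplus>\<^sub>Rm \<psi> x) \<otimes> r)) = \<chi> (cls M Rm (\<lambda>x. \<phi> x \<otimes> r)) * \<chi> (cls M Rm (\<lambda>x. \<psi> x \<otimes> r))"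
        using char_mult[OF M fm_reg \<chi>' lin_rmult_comp[OF r l] lin_rmult_comp[OF r l']] by simp
    qed (rule that)
    have "r \<odot>\<^sub>(tau M) \<chi> = \<chi>''"
    proof (rule extensionalityI)
      show "r \<odot>\<^sub>(tau M) \<chi> \<in> extensional (car (ext1 R M Rm))" by (simp add: tau_mod_def Let_def)
      show "\<chi>'' \<in> extensional (car (ext1 R M Rm))" using c(1) unfolding characters_iff by blast
      fix X assume "X \<in> car (ext1 R M Rm)"
      then obtain \<phi> where "lin (Om M) Rm \<phi>" "X = cls M Rm \<phi>" by (rule cls_ex[OF M fm_reg])
      thus "(r \<odot>\<^sub>(tau M) \<chi>) X = \<chi>'' X" using tau_smult[OF r] c(2) by simp
    qed
    thus ?thesis using c(1) by simp
  qed
qed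

lemma tau_eqI:
  assumes "\<chi> \<in> car (tau M)" "\<chi>' \<in> car (tau M)"
    "!!\<phi>. lin (Om M) Rm \<phi> ==> \<chi> (cls M Rm \<phi>) = \<chi>' (cls M Rm \<phi>)"
  shows "\<chi> = \<chi>'" using char_eqI[OF M fm_reg] assms by simp

lemma fm_tau: "fm (tau M)"
proof -
  interpret E: finite_comm_group "ext1 R M Rm" by (rule ext1_comm_group[OF M fm_reg])
  have z: "\<zero>\<^sub>(tau M) \<in> car (tau M)" by (auto simp: tau_mod_def Let_def characters_iff)
  have "abelian_group (tau M)"
  proof (rule abelian_groupI)
    show "\<exists>\<psi>\<in>car (tau M). \<psi> \<oplus>\<^sub>(tau M) \<chi> = \<zero>\<^sub>(tau M)" if \<chi>: "\<chi> \<in> car (tau M)" for \<chi>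
    proof (rule bexI)
      let ?i = "\<lambda>X\<in>car (ext1 R M Rm). inverse (\<chi> X)"
      show "?i \<in> car (tau M)" using \<chi> by (auto simp: characters_iff norm_inverse)
      have nz: "\<chi> X \<noteq> 0" if "X \<in> car (ext1 R M Rm)" for X using \<chi> that by (force simp: characters_iff)
      show "?i \<oplus>\<^sub>(tau M) \<chi> = \<zero>\<^sub>(tau M)" by (auto simp: tau_mod_def Let_def nz intro!: restrict_ext)
    qed
    show "\<chi> \<oplus>\<^sub>(tau M) \<psi> = \<psi> \<oplus>\<^sub>(tau M) \<chi>" for \<chi> \<psi>
      by (auto simp: tau_mod_def Let_def intro!: restrict_ext)
    show "\<chi> \<oplus>\<^sub>(tau M) \<psi> \<oplus>\<^sub>(tau M) \<xi> = \<chi> \<oplus>\<^sub>(tau M) (\<psi> \<oplus>\<^sub>(tau M) \<xi>)" for \<chi> \<psi> \<xi>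
      by (auto simp: tau_mod_def Let_def intro!: restrict_ext)
    show "\<zero>\<^sub>(tau M) \<oplus>\<^sub>(tau M) \<chi> = \<chi>" if "\<chi> \<in> car (tau M)" for \<chi>
      by (rule tau_eqI) (use that z tau_ops_closed(1)[OF z that] in \<open>auto simp: tau_add tau_zero simp del: tau_carrier\<close>)
  qed (use z tau_ops_closed in auto)
  hence "left_module R (tau M)"
  proof (intro left_module.intro left_module_axioms.intro)
    note cl = tau_ops_closed
    fix a b \<chi> \<psi> assume a: "a \<in> car R" and \<chi>: "\<chi> \<in> car (tau M)"
    have \<chi>': "\<chi> \<in> characters (ext1 R M Rm)" using \<chi> by simp
    show "a \<odot>\<^sub>(tau M) \<chi> \<in> car (tau M)" using cl(3) a \<chi> by blast
    show "a \<odot>\<^sub>(tau M) (\<chi> \<oplus>\<^sub>(tau M) \<psi>) = a \<odot>\<^sub>(tau M) \<chi> \<oplus>\<^sub>(tau M) a \<odot>\<^sub>(tau M) \<psi>" if \<psi>: "\<psi> \<in> car (tau M)"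
      by (rule tau_eqI[OF cl(3)[OF cl(1)[OF \<chi> \<psi>] a] cl(1)[OF cl(3)[OF \<chi> a] cl(3)[OF \<psi> a]]])
        (simp add: tau_add tau_smult a lin_rmult_comp)
    assume b: "b \<in> car R"
    show "(a \<oplus> b) \<odot>\<^sub>(tau M) \<chi> = a \<odot>\<^sub>(tau M) \<chi> \<oplus>\<^sub>(tau M) b \<odot>\<^sub>(tau M) \<chi>"
    proof (rule tau_eqI[OF cl(3)[OF \<chi>] cl(1)[OF cl(3)[OF \<chi> a] cl(3)[OF \<chi> b]]])
      fix \<phi> assume l: "lin (Om M) Rm \<phi>"
      have "cls M Rm (\<lambda>x. \<phi> x \<otimes> a \<oplus>\<^sub>Rm \<phi> x \<otimes> b) = cls M Rm (\<lambda>x. \<phi> x \<otimes> (a \<oplus> b))"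
        by (rule cls_closed_iff[OF M fm_reg lin_plus[OF fm_reg lin_rmult_comp[OF a l] lin_rmult_comp[OF b l]]])
          (use lin_closed[OF l] a b in \<open>simp add: r_distr\<close>)
      thus "((a \<oplus> b) \<odot>\<^sub>(tau M) \<chi>) (cls M Rm \<phi>) = (a \<odot>\<^sub>(tau M) \<chi> \<oplus>\<^sub>(tau M) b \<odot>\<^sub>(tau M) \<chi>) (cls M Rm \<phi>)"
        using char_mult[OF M fm_reg \<chi>' lin_rmult_comp[OF a l] lin_rmult_comp[OF b l]] a b l by (simp add: tau_add tau_smult)
    qed (use a b in simp)
    show "(a \<otimes> b) \<odot>\<^sub>(tau M) \<chi> = a \<odot>\<^sub>(tau M) (b \<odot>\<^sub>(tau M) \<chi>)"
    proof (rule tau_eqI[OF cl(3)[OF \<chi>] cl(3)[OF cl(3)[OF \<chi> b] a]])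
      fix \<phi> assume l: "lin (Om M) Rm \<phi>"
      have "cls M Rm (\<lambda>x. \<phi> x \<otimes> a \<otimes> b) = cls M Rm (\<lambda>x. \<phi> x \<otimes> (a \<otimes> b))"
        by (rule cls_closed_iff[OF M fm_reg lin_rmult_comp[OF b lin_rmult_comp[OF a l]]])
          (use lin_closed[OF l] a b in \<open>simp add: m_assoc\<close>)
      thus "((a \<otimes> b) \<odot>\<^sub>(tau M) \<chi>) (cls M Rm \<phi>) = (a \<odot>\<^sub>(tau M) (b \<odot>\<^sub>(tau M) \<chi>)) (cls M Rm \<phi>)"
        using a b l by (simp add: tau_smult lin_rmult_comp)
    qed (use a b in simp)
  next
    fix \<chi> assume \<chi>: "\<chi> \<in> car (tau M)"
    show "\<one> \<odot>\<^sub>(tau M) \<chi> = \<chi>"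
    proof (rule tau_eqI[OF tau_ops_closed(3)[OF \<chi> one_closed] \<chi>])
      fix \<phi> assume l: "lin (Om M) Rm \<phi>"
      have "cls M Rm (\<lambda>x. \<phi> x \<otimes> \<one>) = cls M Rm \<phi>" by (rule cls_closed_iff[OF M fm_reg lin_rmult_comp[OF one_closed l]])
          (use lin_closed[OF l] in simp)
      thus "(\<one> \<odot>\<^sub>(tau M) \<chi>) (cls M Rm \<phi>) = \<chi> (cls M Rm \<phi>)" using l by (simp add: tau_smult)
    qed
  qed (use ring_axioms in auto)
  moreover have "finite (car (tau M))" using E.finite_characters by simp
  ultimately show ?thesis by (simp add: fm_def)
qed

end

lemma tau_map_cls:
  assumes M: "fm M" and M': "fm M'" and g: "lin M M' g" and \<chi>: "\<chi> \<in> car (tau M)" and \<psi>: "lin (Om M') Rm \<psi>"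
  shows "tmap M M' g \<chi> (cls M' Rm \<psi>) = \<chi> (cls M Rm (\<lambda>x. \<psi> (fmap M M' g x)))"
  using cls_in[OF M' fm_reg \<psi>] ext1_pre_cls[OF M M' fm_reg g \<psi>] \<chi> by (simp add: tau_map_def)

lemma tau_map_closed:
  assumes M: "fm M" and M': "fm M'" and g: "lin M M' g" and \<chi>: "\<chi> \<in> car (tau M)"
  shows "tmap M M' g \<chi> \<in> car (tau M')"
proof -
  note gO = lin_free_map_Om[OF M M' g]
  have \<chi>': "\<chi> \<in> characters (ext1 R M Rm)" using \<chi> by simp
  obtain \<xi> where c: "\<xi> \<in> characters (ext1 R M' Rm)"
    "!!\<phi>. lin (Om M') Rm \<phi> ==> \<xi> (cls M' Rm \<phi>) = \<chi> (cls M Rm (\<lambda>x. \<phi> (fmap M M' g x)))"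
  proof (rule char_exists[OF M' fm_reg, of "\<lambda>\<phi>. \<chi> (cls M Rm (\<lambda>x. \<phi> (fmap M M' g x)))"])
    fix \<phi> assume l: "lin (Om M') Rm \<phi>"
    show "cmod (\<chi> (cls M Rm (\<lambda>x. \<phi> (fmap M M' g x)))) = 1" using char_norm[OF M fm_reg \<chi>' lin_comp[OF gO l]] .
    show "\<chi> (cls M Rm (\<lambda>x. \<phi> (fmap M M' g x))) = 1" if "extendable M' Rm \<phi>"
      using char_extendable[OF M fm_reg \<chi>' lin_comp[OF gO l] extendable_pre[OF M M' g that]] .
    fix \<psi> assume l': "lin (Om M') Rm \<psi>"
    show "\<chi> (cls M Rm (\<lambda>x. \<phi> (fmap M M' g x))) = \<chi> (cls M Rm (\<lambda>x. \<psi> (fmap M M' g x)))" if "!!x. x \<in> car (Om M') ==> \<phi> x = \<psi> x"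
      using cls_closed_iff[OF M fm_reg lin_comp[OF gO l], of "\<lambda>x. \<psi> (fmap M M' g x)"] that lin_closed[OF gO] by metis
    show "\<chi> (cls M Rm (\<lambda>x. \<phi> (fmap M M' g x) \<oplus>\<^sub>Rm \<psi> (fmap M M' g x))) =
        \<chi> (cls M Rm (\<lambda>x. \<phi> (fmap M M' g x))) * \<chi> (cls M Rm (\<lambda>x. \<psi> (fmap M M' g x)))"
      using char_mult[OF M fm_reg \<chi>' lin_comp[OF gO l] lin_comp[OF gO l']] .
  qed (rule that)
  have "tmap M M' g \<chi> = \<xi>"
  proof (rule extensionalityI)
    show "tmap M M' g \<chi> \<in> extensional (car (ext1 R M' Rm))" using \<chi> by (simp add: tau_map_def)
    show "\<xi> \<in> extensional (car (ext1 R M' Rm))" using c(1) unfolding characters_iff by blast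
    fix X assume "X \<in> car (ext1 R M' Rm)"
    then obtain \<phi> where "lin (Om M') Rm \<phi>" "X = cls M' Rm \<phi>" by (rule cls_ex[OF M' fm_reg])
    thus "tmap M M' g \<chi> X = \<xi> X" using tau_map_cls[OF M M' g \<chi>] c(2) by simp
  qed
  thus ?thesis using c(1) by simp
qed

lemma lin_tau_map:
  assumes M: "fm M" and M': "fm M'" and g: "lin M M' g"
  shows "lin (tau M) (tau M') (tmap M M' g)" unfolding lin_def
proof (intro conjI ballI funcsetI)
  note gO = lin_free_map_Om[OF M M' g] and T = fm_tau[OF M] and T' = fm_tau[OF M'] and cl = tau_map_closed[OF M M' g]
  show "tmap M M' g \<chi> \<in> car (tau M')" if "\<chi> \<in> car (tau M)" for \<chi> using cl that .
  show "tmap M M' g (\<chi> \<oplus>\<^sub>(tau M) \<psi>) = tmap M M' g \<chi> \<oplus>\<^sub>(tau M') tmap M M' g \<psi>"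
    if "\<chi> \<in> car (tau M)" "\<psi> \<in> car (tau M)" for \<chi> \<psi>
    by (rule tau_eqI[OF M' cl[OF fm_add[OF T that]] fm_add[OF T' cl[OF that(1)] cl[OF that(2)]]])
      (simp add: tau_map_cls[OF M M' g] fm_add[OF T that] that tau_add[OF M'] tau_add[OF M] lin_comp[OF gO] del: tau_carrier)
  show "tmap M M' g (r \<odot>\<^sub>(tau M) \<chi>) = r \<odot>\<^sub>(tau M') tmap M M' g \<chi>"
    if "r \<in> car R" "\<chi> \<in> car (tau M)" for r \<chi>
    by (rule tau_eqI[OF M' cl[OF fm_smult[OF T that]] fm_smult[OF T' that(1) cl[OF that(2)]]])
      (simp add: tau_map_cls[OF M M' g] fm_smult[OF T that] that tau_smult[OF M'] tau_smult[OF M] lin_comp[OF gO] lin_rmult_comp del: tau_carrier)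
qed

lemma tau_map_hom:
  assumes M: "fm M" and M': "fm M'" and g: "lin M M' g"
  shows "tmap M M' g \<in> Hom (tau M) (tau M')" using lin_tau_map[OF assms] by (simp add: mod_hom_iff tau_map_def)

lemma tau_map_comp:
  assumes M: "fm M" and M': "fm M'" and M'': "fm M''" and f: "lin M M' f" and g: "lin M' M'' g" and \<chi>: "\<chi> \<in> car (tau M)"
  shows "tmap M' M'' g (tmap M M' f \<chi>) = tmap M M'' (\<lambda>x. g (f x)) \<chi>"
proof (rule tau_eqI[OF M''])
  note cl = tau_map_closed[OF M M' f \<chi>]
  show "tmap M' M'' g (tmap M M' f \<chi>) \<in> car (tau M'')" using tau_map_closed[OF M' M'' g cl] .
  show "tmap M M'' (\<lambda>x. g (f x)) \<chi> \<in> car (tau M'')" using tau_map_closed[OF M M'' lin_comp[OF f g] \<chi>] .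
  fix \<phi> assume l: "lin (Om M'') Rm \<phi>"
  have "cls M Rm (\<lambda>x. \<phi> (fmap M' M'' g (fmap M M' f x))) = cls M Rm (\<lambda>x. \<phi> (fmap M M'' (\<lambda>x. g (f x)) x))"
    by (rule cls_closed_iff[OF M fm_reg lin_comp[OF lin_free_map_Om[OF M M' f] lin_comp[OF lin_free_map_Om[OF M' M'' g] l]]])
      (simp add: free_map_comp[OF M M' M'' lin_closed[OF f] Om_in_F] del: Om_simps F_simps)
  thus "tmap M' M'' g (tmap M M' f \<chi>) (cls M'' Rm \<phi>) = tmap M M'' (\<lambda>x. g (f x)) \<chi> (cls M'' Rm \<phi>)"
    using tau_map_cls[OF M' M'' g cl l] tau_map_cls[OF M M' f \<chi> lin_comp[OF lin_free_map_Om[OF M' M'' g] l]]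
      tau_map_cls[OF M M'' lin_comp[OF f g] \<chi> l] by simp
qed

lemma tau_map_id:
  assumes M: "fm M" and \<chi>: "\<chi> \<in> car (tau M)"
  shows "tmap M M (\<lambda>x. x) \<chi> = \<chi>"
proof (rule tau_eqI[OF M tau_map_closed[OF M M lin_id \<chi>] \<chi>])
  fix \<phi> assume l: "lin (Om M) Rm \<phi>"
  have "cls M Rm (\<lambda>x. \<phi> (fmap M M (\<lambda>x. x) x)) = cls M Rm \<phi>"
    by (rule cls_closed_iff[OF M fm_reg lin_comp[OF lin_free_map_Om[OF M M lin_id] l]]) (use free_map_id[OF M Om_in_F] in metis)
  thus "tmap M M (\<lambda>x. x) \<chi> (cls M Rm \<phi>) = \<chi> (cls M Rm \<phi>)" using tau_map_cls[OF M M lin_id \<chi> l] by simp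
qed

lemma tau_map_cong:
  assumes M: "fm M" and M': "fm M'" and f: "lin M M' f" and fg: "!!x. x \<in> car M ==> f x = g x" and \<chi>: "\<chi> \<in> car (tau M)"
  shows "tmap M M' f \<chi> = tmap M M' g \<chi>"
proof (rule tau_eqI[OF M'])
  have g: "lin M M' g" using lin_cong[OF f fg M] .
  show "tmap M M' f \<chi> \<in> car (tau M')" "tmap M M' g \<chi> \<in> car (tau M')"
    using tau_map_closed[OF M M' f \<chi>] tau_map_closed[OF M M' g \<chi>] .
  fix \<phi> assume l: "lin (Om M') Rm \<phi>"
  have "cls M Rm (\<lambda>x. \<phi> (fmap M M' f x)) = cls M Rm (\<lambda>x. \<phi> (fmap M M' g x))"
    by (rule cls_closed_iff[OF M fm_reg lin_comp[OF lin_free_map_Om[OF M M' f] l]])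
      (simp add: free_map_cong[OF M M' fg Om_in_F] del: Om_simps F_simps)
  thus "tmap M M' f \<chi> (cls M' Rm \<phi>) = tmap M M' g \<chi> (cls M' Rm \<phi>)"
    using tau_map_cls[OF M M' f \<chi> l] tau_map_cls[OF M M' g \<chi> l] by simp
qed

end

section \<open>Auslander--Reiten duality\<close>

context hereditary_ring
begin

definition sec :: "('r, 'a) module => ('a => 'r) => ('a => 'r) => 'r" where
  "sec M = (SOME s. lin (Om M) (F (Om M)) s \<and> (\<forall>y\<in>car (Om M). pi (Om M) (s y) = y))"

text \<open>The syzygy is projective; \<open>db M\<close> is a dual basis of it, indexed by all its elements.\<close>

definition db :: "('r, 'a) module => ('a => 'r) => ('a => 'r) => 'r" where
  "db M x y = sec M y x"

lemma sec:
  assumes M: "fm M"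
  shows "lin (Om M) (F (Om M)) (sec M)" "!!y. y \<in> car (Om M) ==> pi (Om M) (sec M y) = y"
proof -
  note O = fm_Om[OF M]
  obtain s where s: "lin (Om M) (F (Om M)) s" "!!y. y \<in> car (Om M) ==> pi (Om M) (s y) = y"
    using proj_lift[OF projective_Om[OF M] O fm_F[OF O] O lin_pi[OF O] pi_onto[OF O] lin_id] by metis
  hence "\<exists>s. lin (Om M) (F (Om M)) s \<and> (\<forall>y\<in>car (Om M). pi (Om M) (s y) = y)" by blast
  from someI_ex[OF this] show "lin (Om M) (F (Om M)) (sec M)" "!!y. y \<in> car (Om M) ==> pi (Om M) (sec M y) = y" unfolding sec_def by blast+
qed

lemma lin_db:
  assumes M: "fm M" and x: "x \<in> car (Om M)" shows "lin (Om M) Rm (db M x)"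
  using lin_comp[OF sec(1)[OF M] lin_coord[OF fm_Om[OF M] x]] by (simp add: db_def[abs_def])

text \<open>The dual basis property: a map on the syzygy is the sum of its values at the elements
  \<open>x\<close>, each weighted by the coordinate functional \<open>db M x\<close>.\<close>

lemma db_expand:
  assumes M: "fm M" and N: "fm N" and \<psi>: "lin (Om M) N \<psi>" and y: "y \<in> car (Om M)"
  shows "(\<Oplus>\<^bsub>N\<^esub>x\<in>car (Om M). db M x y \<odot>\<^sub>N \<psi> x) = \<psi> y"
proof -
  note O = fm_Om[OF M]
  have "\<psi> (pi (Om M) (sec M y)) = aug (Om M) N \<psi> (sec M y)"
  proof (rule lin_F_ext[OF O N lin_comp[OF lin_pi[OF O] \<psi>] lin_aug[OF O N lin_closed[OF \<psi>]] _ lin_closed[OF sec(1)[OF M] y]])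
    fix x assume x: "x \<in> car (Om M)"
    show "\<psi> (pi (Om M) (unit_vec (Om M) x)) = aug (Om M) N \<psi> (unit_vec (Om M) x)"
      using pi_unit[OF O x] aug_unit[OF O N lin_closed[OF \<psi>] x] by simp
  qed
  thus ?thesis using sec(2)[OF M y] unfolding aug_def db_def by simp
qed

lemma tau_finsum:
  assumes M: "fm M" and A: "finite A" and f: "!!a. a \<in> A ==> f a \<in> car (tau M)" and \<phi>: "lin (Om M) Rm \<phi>"
  shows "(\<Oplus>\<^bsub>tau M\<^esub>a\<in>A. f a) (cls M Rm \<phi>) = (\<Prod>a\<in>A. f a (cls M Rm \<phi>))"
proof -
  interpret T: abelian_group "tau M" using fm_tau[OF M] fm_ag by auto
  show ?thesis using A f
  proof (induction A rule: finite_induct)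
    case empty
    thus ?case using tau_zero[OF M \<phi>] by simp
  next
    case (insert a A)
    have "(\<Oplus>\<^bsub>tau M\<^esub>a\<in>insert a A. f a) = f a \<oplus>\<^sub>(tau M) (\<Oplus>\<^bsub>tau M\<^esub>a\<in>A. f a)"
      by (rule T.finsum_insert) (use insert in auto)
    thus ?case using insert tau_add[OF M \<phi>] by simp
  qed
qed

text \<open>Through the expansion a character of Ext(M, N) is known from its values on cocycles that
  are a functional followed by a map from \<open>R\<close> to \<open>N\<close>.\<close>

lemma char_db:
  assumes M: "fm M" and N: "fm N" and \<chi>: "\<chi> \<in> characters (ext1 R M N)" and \<psi>: "lin (Om M) N \<psi>"
  shows "\<chi> (cls M N \<psi>) = (\<Prod>x\<in>car (Om M). \<chi> (cls M N (\<lambda>y. db M x y \<odot>\<^sub>N \<psi> x)))"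
proof -
  have l: "lin (Om M) N (\<lambda>y. db M x y \<odot>\<^sub>N \<psi> x)" if "x \<in> car (Om M)" for x
    using lin_comp[OF lin_db[OF M that] lin_from_reg[OF N lin_closed[OF \<psi> that]]] .
  note s = char_sum[OF M N \<chi> fm_finite[OF fm_Om[OF M]], of "\<lambda>x y. db M x y \<odot>\<^sub>N \<psi> x", OF l]
  have "cls M N (\<lambda>y. \<Oplus>\<^bsub>N\<^esub>x\<in>car (Om M). db M x y \<odot>\<^sub>N \<psi> x) = cls M N \<psi>"
    by (rule cls_closed_iff[OF M N s(2) db_expand[OF M N \<psi>]])
  thus ?thesis using s(1) by simp
qed

lemma tau_db:
  assumes M: "fm M" and \<chi>: "\<chi> \<in> car (tau M)" and \<psi>: "lin (Om M) Rm \<psi>"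
  shows "\<chi> (cls M Rm \<psi>) = (\<Prod>x\<in>car (Om M). \<chi> (cls M Rm (\<lambda>y. db M x y \<otimes> \<psi> x)))"
  using char_db[OF M fm_reg _ \<psi>] \<chi> by simp

text \<open>The duality map from the dual of Ext(M, N) to Hom(N, \<tau> M): an element
  \<open>n\<close> gives the map from \<open>R\<close> to \<open>N\<close> sending 1 to
  \<open>n\<close>, along which characters are pulled back to Ext(M, R).\<close>

definition AR :: "('r, 'a) module => ('r, 'b) module => ((('a => 'r) => 'b) set => complex) => 'b => ('r, 'a) tau_elem" where
  "AR M N \<chi> = (\<lambda>n\<in>car N. \<lambda>X\<in>car (ext1 R M Rm). \<chi> (ext1_post R M N (\<lambda>r. r \<odot>\<^sub>N n) X))"

lemma AR_cls:
  assumes M: "fm M" and N: "fm N" and n: "n \<in> car N" and \<phi>: "lin (Om M) Rm \<phi>"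
  shows "AR M N \<chi> n (cls M Rm \<phi>) = \<chi> (cls M N (\<lambda>x. \<phi> x \<odot>\<^sub>N n))"
  using n cls_in[OF M fm_reg \<phi>] ext1_post_cls[OF M fm_reg N lin_from_reg[OF N n] \<phi>] by (simp add: AR_def)

lemma AR_hom:
  assumes M: "fm M" and N: "fm N" and \<chi>: "\<chi> \<in> characters (ext1 R M N)"
  shows "AR M N \<chi> \<in> Hom N (tau M)"
proof -
  note l = lin_comp[OF _ lin_from_reg[OF N]]
  have cl: "AR M N \<chi> n \<in> car (tau M)" if n: "n \<in> car N" for n unfolding tau_carrier characters_iff
  proof (intro conjI ballI)
    show "AR M N \<chi> n \<in> extensional (car (ext1 R M Rm))" using n by (simp add: AR_def)
    fix X assume X: "X \<in> car (ext1 R M Rm)"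
    obtain \<phi> where \<phi>: "lin (Om M) Rm \<phi>" "X = cls M Rm \<phi>" by (rule cls_ex[OF M fm_reg X])
    show "cmod (AR M N \<chi> n X) = 1" using char_norm[OF M N \<chi> l[OF \<phi>(1) n]] AR_cls[OF M N n \<phi>(1)] \<phi>(2) by simp
    fix Y assume Y: "Y \<in> car (ext1 R M Rm)"
    obtain \<psi> where \<psi>: "lin (Om M) Rm \<psi>" "Y = cls M Rm \<psi>" by (rule cls_ex[OF M fm_reg Y])
    have "cls M N (\<lambda>x. (\<phi> x \<oplus>\<^sub>Rm \<psi> x) \<odot>\<^sub>N n) = cls M N (\<lambda>x. \<phi> x \<odot>\<^sub>N n \<oplus>\<^sub>N \<psi> x \<odot>\<^sub>N n)"
      by (rule cls_closed_iff[OF M N l[OF lin_plus[OF fm_reg \<phi>(1) \<psi>(1)] n]])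
        (use lin_closed[OF \<phi>(1)] lin_closed[OF \<psi>(1)] n in \<open>simp add: fm_smult_simps[OF N]\<close>)
    thus "AR M N \<chi> n (X \<otimes>\<^bsub>ext1 R M Rm\<^esub> Y) = AR M N \<chi> n X * AR M N \<chi> n Y"
      using cls_mult[OF M fm_reg \<phi>(1) \<psi>(1)] \<phi>(2) \<psi>(2) AR_cls[OF M N n] \<phi>(1) \<psi>(1) lin_plus[OF fm_reg \<phi>(1) \<psi>(1)]
        char_mult[OF M N \<chi> l[OF \<phi>(1) n] l[OF \<psi>(1) n]] by simp
  qed
  have "lin N (tau M) (AR M N \<chi>)" unfolding lin_def
  proof (intro conjI ballI funcsetI)
    note T = fm_tau[OF M]
    show "AR M N \<chi> n \<in> car (tau M)" if "n \<in> car N" for n using cl that .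
    show "AR M N \<chi> (m \<oplus>\<^sub>N n) = AR M N \<chi> m \<oplus>\<^sub>(tau M) AR M N \<chi> n" if m: "m \<in> car N" and n: "n \<in> car N" for m n
    proof (rule tau_eqI[OF M cl[OF fm_add[OF N m n]] fm_add[OF T cl[OF m] cl[OF n]]])
      fix \<phi> assume \<phi>: "lin (Om M) Rm \<phi>"
      have "cls M N (\<lambda>x. \<phi> x \<odot>\<^sub>N (m \<oplus>\<^sub>N n)) = cls M N (\<lambda>x. \<phi> x \<odot>\<^sub>N m \<oplus>\<^sub>N \<phi> x \<odot>\<^sub>N n)"
        by (rule cls_closed_iff[OF M N l[OF \<phi> fm_add[OF N m n]]])
          (use lin_closed[OF \<phi>] m n in \<open>simp add: fm_smult_simps[OF N]\<close>)
      thus "AR M N \<chi> (m \<oplus>\<^sub>N n) (cls M Rm \<phi>) = (AR M N \<chi> m \<oplus>\<^sub>(tau M) AR M N \<chi> n) (cls M Rm \<phi>)"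
        using tau_add[OF M \<phi>] AR_cls[OF M N _ \<phi>] m n N char_mult[OF M N \<chi> l[OF \<phi> m] l[OF \<phi> n]] by simp
    qed
    show "AR M N \<chi> (r \<odot>\<^sub>N n) = r \<odot>\<^sub>(tau M) AR M N \<chi> n" if r: "r \<in> car R" and n: "n \<in> car N" for r n
    proof (rule tau_eqI[OF M cl[OF fm_smult[OF N r n]] fm_smult[OF T r cl[OF n]]])
      fix \<phi> assume \<phi>: "lin (Om M) Rm \<phi>"
      have "cls M N (\<lambda>x. \<phi> x \<odot>\<^sub>N (r \<odot>\<^sub>N n)) = cls M N (\<lambda>x. (\<phi> x \<otimes> r) \<odot>\<^sub>N n)"
        by (rule cls_closed_iff[OF M N l[OF \<phi> fm_smult[OF N r n]]])
          (use lin_closed[OF \<phi>] r n in \<open>simp add: fm_smult_simps[OF N]\<close>)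
      thus "AR M N \<chi> (r \<odot>\<^sub>N n) (cls M Rm \<phi>) = (r \<odot>\<^sub>(tau M) AR M N \<chi> n) (cls M Rm \<phi>)"
        using tau_smult[OF M r \<phi>] AR_cls[OF M N _ \<phi>] AR_cls[OF M N n lin_rmult_comp[OF r \<phi>]] r n N by simp
    qed
  qed
  thus ?thesis by (simp add: mod_hom_iff AR_def)
qed

lemma AR_db:
  assumes M: "fm M" and N: "fm N" and \<chi>: "\<chi> \<in> characters (ext1 R M N)" and \<psi>: "lin (Om M) N \<psi>"
  shows "\<chi> (cls M N \<psi>) = (\<Prod>x\<in>car (Om M). AR M N \<chi> (\<psi> x) (cls M Rm (db M x)))" unfolding char_db[OF M N \<chi> \<psi>]
  by (rule prod.cong[OF refl]) (simp only: AR_cls[OF M N lin_closed[OF \<psi>] lin_db[OF M]])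

text \<open>A preimage is forced by \<open>AR_db\<close>: its value on \<open>\<psi>\<close> must be
  the stated product. The point to check is that the product is 1 on extendable cocycles.\<close>

lemma AR_surj:
  assumes M: "fm M" and N: "fm N" and \<theta>: "lin N (tau M) \<theta>"
  obtains \<chi> where "\<chi> \<in> characters (ext1 R M N)"
    "!!\<psi>. lin (Om M) N \<psi> ==> \<chi> (cls M N \<psi>) = (\<Prod>x\<in>car (Om M). \<theta> (\<psi> x) (cls M Rm (db M x)))"
    "!!n. n \<in> car N ==> AR M N \<chi> n = \<theta> n"
proof -
  let ?c = "\<lambda>\<psi>. \<Prod>x\<in>car (Om M). \<theta> (\<psi> x) (cls M Rm (db M x))"
  note T = fm_tau[OF M] and \<theta>c = lin_closed[OF \<theta>]
  have \<theta>ch: "\<theta> n \<in> characters (ext1 R M Rm)" if "n \<in> car N" for n using \<theta>c[OF that] by simp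
  obtain \<chi> where \<chi>: "\<chi> \<in> characters (ext1 R M N)" "!!\<psi>. lin (Om M) N \<psi> ==> \<chi> (cls M N \<psi>) = ?c \<psi>"
  proof (rule char_exists[OF M N, of ?c])
    fix \<phi> assume l: "lin (Om M) N \<phi>"
    have "cmod (\<theta> (\<phi> x) (cls M Rm (db M x))) = 1" if "x \<in> car (Om M)" for x
      using char_norm[OF M fm_reg \<theta>ch[OF lin_closed[OF l that]] lin_db[OF M that]] .
    thus "cmod (?c \<phi>) = 1" by (simp add: prod_norm[symmetric] del: Om_simps)
    show "?c \<phi> = ?c \<psi>" if "!!x. x \<in> car (Om M) ==> \<phi> x = \<psi> x" for \<psi> by (rule prod.cong[OF refl]) (simp only: that)
    show "?c (\<lambda>x. \<phi> x \<oplus>\<^sub>N \<psi> x) = ?c \<phi> * ?c \<psi>" if l': "lin (Om M) N \<psi>" for \<psi>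
      unfolding prod.distrib[symmetric]
      by (rule prod.cong[OF refl]) (simp only: lin_add[OF \<theta> lin_closed[OF l] lin_closed[OF l']] tau_add[OF M lin_db[OF M]])
    assume "extendable M N \<phi>"
    then obtain \<Psi> where \<Psi>: "lin (F M) N \<Psi>" "!!x. x \<in> car (Om M) ==> \<Psi> x = \<phi> x" unfolding extendable_def by blast
    let ?n = "\<lambda>m. \<Psi> (unit_vec M m)"
    have n: "?n m \<in> car N" for m using lin_closed[OF \<Psi>(1) unit_vec_closed] .
    have xm: "x m \<in> car R" if "x \<in> car (Om M)" "m \<in> car M" for x m using Om_in_F[OF that(1)] that(2) by auto
    \<comment> \<open>Write \<open>\<phi> x\<close> through the values \<open>?n m\<close> of the
      extension at basis vectors; the scalars \<open>x m\<close> then move into the cocycle.\<close>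
    have 1: "\<theta> (\<phi> x) (cls M Rm (db M x)) = (\<Prod>m\<in>car M. \<theta> (?n m) (cls M Rm (\<lambda>y. db M x y \<otimes> x m)))"
      if x: "x \<in> car (Om M)" for x
    proof -
      have \<theta>\<phi>: "\<theta> (\<phi> x) = (\<Oplus>\<^bsub>tau M\<^esub>m\<in>car M. x m \<odot>\<^sub>(tau M) \<theta> (?n m))"
        using lin_F_eq[OF M T lin_comp[OF \<Psi>(1) \<theta>] Om_in_F[OF x]] \<Psi>(2)[OF x] by (simp add: aug_def)
      have "\<theta> (\<phi> x) (cls M Rm (db M x)) = (\<Prod>m\<in>car M. (x m \<odot>\<^sub>(tau M) \<theta> (?n m)) (cls M Rm (db M x)))"
        unfolding \<theta>\<phi> by (rule tau_finsum[OF M fm_finite[OF M] fm_smult[OF T xm[OF x] \<theta>c[OF n]] lin_db[OF M x]])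
      also have "\<dots> = (\<Prod>m\<in>car M. \<theta> (?n m) (cls M Rm (\<lambda>y. db M x y \<otimes> x m)))"
        by (rule prod.cong[OF refl]) (simp only: tau_smult[OF M xm[OF x] lin_db[OF M x]])
      finally show ?thesis .
    qed
    have "?c \<phi> = (\<Prod>x\<in>car (Om M). \<Prod>m\<in>car M. \<theta> (?n m) (cls M Rm (\<lambda>y. db M x y \<otimes> x m)))"
      by (rule prod.cong[OF refl 1])
    \<comment> \<open>After the swap the inner product, for fixed \<open>m\<close>, is by the dual
      basis expansion the value on the coordinate functional \<open>\<lambda>y. y m\<close>. This
      functional is defined on all of \<open>F M\<close>, hence its class is trivial.\<close>
    also have "\<dots> = (\<Prod>m\<in>car M. \<Prod>x\<in>car (Om M). \<theta> (?n m) (cls M Rm (\<lambda>y. db M x y \<otimes> x m)))"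
      by (rule prod.swap)
    also have "\<dots> = (\<Prod>m\<in>car M. 1)"
    proof (rule prod.cong[OF refl])
      fix m assume m: "m \<in> car M"
      note lc = lin_comp[OF lin_Om_F[OF M] lin_coord[OF M m]]
      have "extendable M Rm (\<lambda>y. y m)" unfolding extendable_def using lin_coord[OF M m] by blast
      hence "\<theta> (?n m) (cls M Rm (\<lambda>y. y m)) = 1" using char_extendable[OF M fm_reg \<theta>ch[OF n] lc] by blast
      thus "(\<Prod>x\<in>car (Om M). \<theta> (?n m) (cls M Rm (\<lambda>y. db M x y \<otimes> x m))) = 1"
        using tau_db[OF M \<theta>c[OF n] lc] by simp
    qed
    finally show "?c \<phi> = 1" by simp
  qed (rule that)
  moreover have "AR M N \<chi> n = \<theta> n" if n: "n \<in> car N" for n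
  proof (rule tau_eqI[OF M _ \<theta>c[OF n]])
    show "AR M N \<chi> n \<in> car (tau M)" using AR_hom[OF M N \<chi>(1)] n lin_closed[of N "tau M"] by (simp only: mod_hom_iff)
    fix \<phi> assume \<phi>: "lin (Om M) Rm \<phi>"
    have "AR M N \<chi> n (cls M Rm \<phi>) = (\<Prod>x\<in>car (Om M). \<theta> (\<phi> x \<odot>\<^sub>N n) (cls M Rm (db M x)))"
      using AR_cls[OF M N n \<phi>] \<chi>(2)[OF lin_comp[OF \<phi> lin_from_reg[OF N n]]] by simp
    also have "\<dots> = (\<Prod>x\<in>car (Om M). \<theta> n (cls M Rm (\<lambda>y. db M x y \<otimes> \<phi> x)))"
    proof (rule prod.cong[OF refl])
      fix x assume x: "x \<in> car (Om M)"
      have "\<phi> x \<in> car R" using lin_closed[OF \<phi> x] by simp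
      thus "\<theta> (\<phi> x \<odot>\<^sub>N n) (cls M Rm (db M x)) = \<theta> n (cls M Rm (\<lambda>y. db M x y \<otimes> \<phi> x))"
        using lin_smult[OF \<theta> _ n] tau_smult[OF M _ lin_db[OF M x]] by simp
    qed
    also have "\<dots> = \<theta> n (cls M Rm \<phi>)" using tau_db[OF M \<theta>c[OF n] \<phi>] by simp
    finally show "AR M N \<chi> n (cls M Rm \<phi>) = \<theta> n (cls M Rm \<phi>)" .
  qed
  ultimately show thesis using that by blast
qed

text \<open>The Auslander-Reiten formula, counted: a finite abelian group and its dual have equal
  size.\<close>

lemma e_eq_h_tau:
  assumes M: "fm M" and N: "fm N" shows "e M N = h N (tau M)"
proof -
  interpret E: finite_comm_group "ext1 R M N" by (rule ext1_comm_group[OF M N])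
  have "bij_betw (AR M N) (characters (ext1 R M N)) (Hom N (tau M))"
  proof (rule bij_betwI')
    show "AR M N \<chi> = AR M N \<chi>' \<longleftrightarrow> \<chi> = \<chi>'"
      if "\<chi> \<in> characters (ext1 R M N)" "\<chi>' \<in> characters (ext1 R M N)" for \<chi> \<chi>'
      using char_eqI[OF M N that] AR_db[OF M N that(1)] AR_db[OF M N that(2)] by auto
    show "AR M N \<chi> \<in> Hom N (tau M)" if "\<chi> \<in> characters (ext1 R M N)" for \<chi> using AR_hom[OF M N that] .
    show "\<exists>\<chi>\<in>characters (ext1 R M N). \<theta> = AR M N \<chi>" if \<theta>: "\<theta> \<in> Hom N (tau M)" for \<theta>
    proof -
      have "lin N (tau M) \<theta>" using \<theta> by (simp add: mod_hom_iff)
      then obtain \<chi> where \<chi>: "\<chi> \<in> characters (ext1 R M N)" "!!n. n \<in> car N ==> AR M N \<chi> n = \<theta> n" by (rule AR_surj[OF M N]) (rule that; assumption)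
      hence "AR M N \<chi> = \<theta>" using mod_hom_eqI[OF AR_hom[OF M N \<chi>(1)] \<theta>] by blast
      thus ?thesis using \<chi>(1) by blast
    qed
  qed
  thus ?thesis using bij_betw_same_card E.card_characters by metis
qed

subsection \<open>The translate is fully faithful on modules without projective summands\<close>

text \<open>Over a hereditary ring this says that \<open>M\<close> has no nonzero projective summand.\<close>

definition stemless :: "('r, 'a) module => bool" where
  "stemless M \<longleftrightarrow> (\<forall>\<phi>. lin M Rm \<phi> --> (\<forall>x\<in>car M. \<phi> x = \<zero>))"

lemma stemless_torsionless:
  assumes M: "fm M" and S: "stemless M" and P: "torsionless P" and f: "lin M P f" and x: "x \<in> car M"
  shows "f x = \<zero>\<^sub>P"
proof (rule ccontr)
  assume "f x \<noteq> \<zero>\<^sub>P"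
  then obtain \<phi> where "lin P Rm \<phi>" "\<phi> (f x) \<noteq> \<zero>" using P lin_closed[OF f x] unfolding torsionless_def by blast
  thus False using S lin_comp[OF f] x unfolding stemless_def by blast
qed

lemma extendable_sum:
  assumes M: "fm M" and N: "fm N" and A: "finite A" and f: "!!a. a \<in> A ==> lin (Om M) N (f a) \<and> extendable M N (f a)"
  shows "extendable M N (\<lambda>x. \<Oplus>\<^bsub>N\<^esub>a\<in>A. f a x)" using A f
proof (induction A rule: finite_induct)
  case empty
  interpret N: abelian_group N using N fm_ag by auto
  show ?case using extendable_zero[OF N] by simp
next
  case (insert b A)
  interpret N: abelian_group N using N fm_ag by auto
  have eq: "f b x \<oplus>\<^sub>N (\<Oplus>\<^bsub>N\<^esub>a\<in>A. f a x) = (\<Oplus>\<^bsub>N\<^esub>a\<in>insert b A. f a x)" if x: "x \<in> car (Om M)" for x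
    by (rule N.finsum_insert[symmetric]) (use insert.hyps lin_closed[OF conjunct1[OF insert.prems] x] in auto)
  show ?case by (rule extendable_cong[OF extendable_plus[OF N, of M "f b"] eq]) (use insert in auto)
qed

text \<open>If \<tau> does not distinguish \<open>g\<close> from \<open>g'\<close>, then the
  difference they induce on syzygies becomes extendable after every functional, because characters
  separate classes. The dual basis makes the difference itself extendable; correcting by the
  extension gives a map from \<open>X\<close> to the free module \<open>F V\<close>, and that is
  zero.\<close>

lemma tau_faithful:
  assumes X: "fm X" and V: "fm V" and S: "stemless X" and g: "lin X V g" "lin X V g'"
    and eq: "!!\<chi>. \<chi> \<in> car (tau X) ==> tmap X V g \<chi> = tmap X V g' \<chi>" and x: "x \<in> car X"
  shows "g x = g' x"
proof -
  let ?g = "fmap X V g" and ?g' = "fmap X V g'"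
  note O = fm_Om[OF V] and gO = lin_free_map_Om[OF X V g(1)] and gO' = lin_free_map_Om[OF X V g(2)]
  let ?\<psi> = "\<lambda>y. ?g y \<ominus>\<^sub>(Om V) ?g' y"
  have \<psi>: "lin (Om X) (Om V) ?\<psi>" using lin_diff[OF O gO gO'] .
  have ext: "extendable X Rm (\<lambda>y. \<phi> (?\<psi> y))" if \<phi>: "lin (Om V) Rm \<phi>" for \<phi>
  proof (rule char_separate[OF X fm_reg lin_comp[OF \<psi> \<phi>]])
    fix \<chi> assume \<chi>: "\<chi> \<in> characters (ext1 R X Rm)"
    have "\<chi> (cls X Rm (\<lambda>y. \<phi> (?g y))) = \<chi> (cls X Rm (\<lambda>y. \<phi> (?g' y)))"
      using tau_map_cls[OF X V g(1) _ \<phi>, of \<chi>] tau_map_cls[OF X V g(2) _ \<phi>, of \<chi>] eq[of \<chi>] \<chi> by simp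
    moreover have "cls X Rm (\<lambda>y. \<phi> (?\<psi> y) \<oplus>\<^sub>Rm \<phi> (?g' y)) = cls X Rm (\<lambda>y. \<phi> (?g y))"
    proof (rule cls_closed_iff[OF X fm_reg lin_plus[OF fm_reg lin_comp[OF \<psi> \<phi>] lin_comp[OF gO' \<phi>]]])
      fix y assume y: "y \<in> car (Om X)"
      show "\<phi> (?\<psi> y) \<oplus>\<^sub>Rm \<phi> (?g' y) = \<phi> (?g y)"
        using lin_add[OF \<phi> lin_closed[OF \<psi> y] lin_closed[OF gO' y]] fm_minus_add(1)[OF O lin_closed[OF gO y] lin_closed[OF gO' y]] by metis
    qed
    ultimately have "\<chi> (cls X Rm (\<lambda>y. \<phi> (?\<psi> y))) * \<chi> (cls X Rm (\<lambda>y. \<phi> (?g' y))) = \<chi> (cls X Rm (\<lambda>y. \<phi> (?g' y)))"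
      using char_mult[OF X fm_reg \<chi> lin_comp[OF \<psi> \<phi>] lin_comp[OF gO' \<phi>]] by simp
    moreover have "\<chi> (cls X Rm (\<lambda>y. \<phi> (?g' y))) \<noteq> 0" using char_norm[OF X fm_reg \<chi> lin_comp[OF gO' \<phi>]] by force
    ultimately show "\<chi> (cls X Rm (\<lambda>y. \<phi> (?\<psi> y))) = 1" by simp
  qed
  \<comment> \<open>Functionals of \<open>?\<psi>\<close> are extendable; reassembling them with the
    dual basis of \<open>Om V\<close> makes \<open>?\<psi>\<close> extendable with values in
    \<open>Om V\<close>, where \<open>pi V\<close> vanishes.\<close>
  have "extendable X (Om V) (\<lambda>y. \<Oplus>\<^bsub>Om V\<^esub>x\<in>car (Om V). db V x (?\<psi> y) \<odot>\<^sub>(Om V) x)"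
  proof (rule extendable_sum[OF X O fm_finite[OF O]])
    fix v assume v: "v \<in> car (Om V)"
    show "lin (Om X) (Om V) (\<lambda>y. db V v (?\<psi> y) \<odot>\<^sub>(Om V) v) \<and> extendable X (Om V) (\<lambda>y. db V v (?\<psi> y) \<odot>\<^sub>(Om V) v)"
      using lin_comp[OF lin_comp[OF \<psi> lin_db[OF V v]] lin_from_reg[OF O v]]
        extendable_comp[OF ext[OF lin_db[OF V v]] lin_from_reg[OF O v]] by blast
  qed
  hence "extendable X (Om V) ?\<psi>" by (rule extendable_cong) (rule db_expand[OF V O lin_id lin_closed[OF \<psi>]])
  then obtain s where s: "lin (F X) (Om V) s" "!!y. y \<in> car (Om X) ==> s y = ?\<psi> y" unfolding extendable_def by blast
  note FV = fm_F[OF V] and FX = fm_F[OF X] and gF = lin_free_map[OF X V, of g] and gF' = lin_free_map[OF X V, of g']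
  have s': "lin (F X) (F V) s" using lin_comp[OF s(1) lin_Om_F[OF V]] .
  \<comment> \<open>Subtracting \<open>s\<close> makes the map vanish on the syzygy of
    \<open>X\<close>, so it descends to \<open>X\<close>.\<close>
  let ?t = "\<lambda>u. (?g u \<ominus>\<^sub>(F V) ?g' u) \<ominus>\<^sub>(F V) s u"
  have t: "lin (F X) (F V) ?t" using lin_diff[OF FV lin_diff[OF FV gF gF'] s'] .
  have t0: "?t u = \<zero>\<^sub>(F V)" if u: "u \<in> car (F X)" "pi X u = \<zero>\<^sub>X" for u
  proof -
    have uO: "u \<in> car (Om X)" using u by (simp add: ker_def)
    have "s u = ?g u \<ominus>\<^sub>(F V) ?g' u"
      using s(2)[OF uO] sub_mod_minus[OF sub_Om[OF V] FV] lin_closed[OF gO uO] lin_closed[OF gO' uO] unfolding Om_eq[of V] by simp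
    thus ?thesis using lin_closed[OF gF u(1)] lin_closed[OF gF' u(1)] FV by (simp del: F_simps)
  qed
  obtain k where k: "lin X (F V) k" "!!u. u \<in> car (F X) ==> k (pi X u) = ?t u" using factor[OF FX X FV lin_pi[OF X] pi_onto[OF X] t t0] by metis
  let ?u = "unit_vec X x"
  have u: "?u \<in> car (F X)" by (rule unit_vec_closed)
  have "?t ?u = \<zero>\<^sub>(F V)" using k(2)[OF u] pi_unit[OF X x] stemless_torsionless[OF X S torsionless_F[OF V] k(1) x] by simp
  hence "?g ?u \<ominus>\<^sub>(F V) ?g' ?u = s ?u"
    using fm_minus_eq_zero[OF FV fm_minus[OF FV lin_closed[OF gF u] lin_closed[OF gF' u]] lin_closed[OF s' u]] by simp
  hence "pi V (?g ?u) \<ominus>\<^sub>V pi V (?g' ?u) = pi V (s ?u)"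
    using lin_minus[OF FV V lin_pi[OF V] lin_closed[OF gF u] lin_closed[OF gF' u]] by metis
  also have "pi V (s ?u) = \<zero>\<^sub>V" using lin_closed[OF s(1) u] by (simp add: ker_def)
  finally show ?thesis
    using pi_free_map[OF X V g(1) u] pi_free_map[OF X V g(2) u] pi_unit[OF X x] fm_minus_eq_zero[OF V lin_closed[OF g(1) x] lin_closed[OF g(2) x]] by simp
qed

text \<open>Exactness of Hom(P, -) for projective \<open>P\<close>, counted.\<close>

lemma h_projective:
  assumes P: "fm P" "projective R P" and B: "fm B" and C: "fm C" and g: "lin B C g" "g ` car B = car C"
  shows "h P B = h P (sub_mod B (ker B C g)) * h P C"
proof -
  let ?K = "Hom P (sub_mod B (ker B C g))" and ?T = "\<lambda>f. \<lambda>x\<in>car P. g (f x)"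
  note K = sub_ker[OF B C g(1)]
  have KI: "k \<in> ?K \<longleftrightarrow> k \<in> Hom P B \<and> (\<forall>x\<in>car P. g (k x) = \<zero>\<^sub>C)" for k
    unfolding mod_hom_def ker_def by (auto simp: PiE_iff)
  have "h P B = card ?K * card (?T ` Hom P B)"
  proof (rule card_hom_fibres[OF P(1) B])
    show "?K \<subseteq> Hom P B" using KI by blast
    fix f f' assume f: "f \<in> Hom P B" "f' \<in> Hom P B"
    hence l: "lin P B f" "lin P B f'" by (auto simp: mod_hom_iff)
    note d = lin_diff[OF B l]
    have "?T f = ?T f' \<longleftrightarrow> (\<forall>x\<in>car P. g (f x) = g (f' x))" unfolding restrict_def fun_eq_iff by auto
    also have "\<dots> \<longleftrightarrow> (\<forall>x\<in>car P. g (f x \<ominus>\<^sub>B f' x) = \<zero>\<^sub>C)"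
      using lin_minus[OF B C g(1) lin_closed[OF l(1)] lin_closed[OF l(2)]]
        fm_minus_eq_zero[OF C lin_closed[OF lin_comp[OF l(1) g(1)]] lin_closed[OF lin_comp[OF l(2) g(1)]]] by simp
    also have "\<dots> \<longleftrightarrow> (\<lambda>x\<in>car P. f x \<ominus>\<^sub>B f' x) \<in> ?K"
      unfolding KI using restrict_mod_hom[OF d P(1)] by simp
    finally show "?T f = ?T f' \<longleftrightarrow> (\<lambda>x\<in>car P. f x \<ominus>\<^sub>B f' x) \<in> ?K" .
  qed
  moreover have "?T ` Hom P B = Hom P C"
  proof (intro equalityI subsetI)
    fix f assume "f \<in> ?T ` Hom P B"
    thus "f \<in> Hom P C" using restrict_mod_hom[OF lin_comp[OF _ g(1)] P(1)] by (auto simp: mod_hom_iff)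
  next
    fix f assume f: "f \<in> Hom P C"
    then obtain k where k: "lin P B k" "!!x. x \<in> car P ==> g (k x) = f x" using proj_lift[OF P(2,1) B C g, of f] by (metis mod_hom_iff)
    have "?T (restrict k (car P)) = f" by (rule extensionalityI[of _ "car P"]) (use k f in \<open>auto simp: mod_hom_iff\<close>)
    thus "f \<in> ?T ` Hom P B" using restrict_mod_hom[OF k(1) P(1)] by (rule image_eqI[OF sym])
  qed
  ultimately show ?thesis by simp
qed

text \<open>By the Auslander-Reiten formula the left side is \<open>e N (tau M)\<close>. The count
  \<open>e_formula\<close> for the pair \<open>N\<close>, \<open>tau M\<close> expresses it by Ext
  groups out of \<open>M\<close>, which are counted by \<open>e_formula\<close> again. As
  \<open>M\<close> has no nonzero maps to projective modules and Hom is exact on projectives,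
  everything cancels but \<open>h M N\<close>.\<close>

lemma h_tau:
  assumes M: "fm M" and S: "stemless M" and N: "fm N" shows "h (tau M) (tau N) = h M N"
proof -
  note T = fm_tau[OF M] and FN = fm_F[OF N] and ON = fm_Om[OF N] and FM = fm_F[OF M] and OM = fm_Om[OF M]
  have z: "h M (F N) = 1" "h M (Om N) = 1" using h_eq_1[OF M FN] h_eq_1[OF M ON] stemless_torsionless[OF M S] torsionless_F[OF N]
      torsionless_projective[OF ON projective_Om[OF N]] by blast+
  have e1: "e N (tau M) * e M (F N) = e M (Om N) * e M N" using e_formula[OF N T] e_eq_h_tau[OF M FN] e_eq_h_tau[OF M ON] e_eq_h_tau[OF M N] by simp
  have e2: "e M (F N) * h (F M) (F N) = h (Om M) (F N)" "e M (Om N) * h (F M) (Om N) = h (Om M) (Om N)"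
    "e M N * h (F M) N = h (Om M) N * h M N" using e_formula[OF M FN] e_formula[OF M ON] e_formula[OF M N] z by simp_all
  have e3: "h (Om M) (F N) = h (Om M) (Om N) * h (Om M) N" "h (F M) (F N) = h (F M) (Om N) * h (F M) N"
    using h_projective[OF OM projective_Om[OF M] FN N lin_pi[OF N] pi_onto[OF N]]
      h_projective[OF FM projective_F[OF M] FN N lin_pi[OF N] pi_onto[OF N]] by (simp_all add: Om_eq)
  let ?b = "h (Om M) (Om N)" and ?c = "h (Om M) N" and ?d = "h (F M) (Om N)" and ?f = "h (F M) N"
  have pos: "?b > 0" "?c > 0" "?d > 0" "?f > 0" using h_pos FM OM ON N by blast+
  have "e N (tau M) * (e M (F N) * (?d * ?f)) = (e M (Om N) * ?d) * (e M N * ?f)" using e1 by (simp add: algebra_simps)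
  hence "e N (tau M) * (?b * ?c) = ?b * (?c * h M N)" using e2 e3 by simp
  hence "e N (tau M) = h M N" using pos by (simp add: algebra_simps)
  thus ?thesis using e_eq_h_tau[OF N T] by simp
qed

text \<open>\<tau> embeds Hom(X, V) into Hom(\<tau> X, \<tau> V), and both sets are finite of the
  same size.\<close>

lemma tau_full:
  assumes X: "fm X" and V: "fm V" and S: "stemless X" and f: "lin (tau X) (tau V) f"
  obtains g where "lin X V g" "!!\<chi>. \<chi> \<in> car (tau X) ==> tmap X V g \<chi> = f \<chi>"
proof -
  let ?H = "Hom X V" and ?H' = "Hom (tau X) (tau V)"
  have "inj_on (tmap X V) ?H"
  proof (rule inj_onI)
    fix g g' assume g: "g \<in> ?H" "g' \<in> ?H" "tmap X V g = tmap X V g'"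
    show "g = g'" by (rule mod_hom_eqI[OF g(1,2)]) (rule tau_faithful[OF X V S], use g in \<open>auto simp: mod_hom_iff\<close>)
  qed
  moreover have "tmap X V ` ?H \<subseteq> ?H'" using tau_map_hom[OF X V] by (auto simp: mod_hom_iff)
  moreover have "finite ?H'" using fm_tau[OF X] fm_tau[OF V] by simp
  ultimately have "tmap X V ` ?H = ?H'" using h_tau[OF X S V] by (simp add: card_image card_subset_eq)
  moreover have "restrict f (car (tau X)) \<in> ?H'" using restrict_mod_hom[OF f fm_tau[OF X]] .
  ultimately have "restrict f (car (tau X)) \<in> tmap X V ` ?H" by simp
  then obtain g where g: "g \<in> ?H" "restrict f (car (tau X)) = tmap X V g" by (rule imageE)
  show thesis
  proof (rule that)
    show "lin X V g" using g(1) by (simp add: mod_hom_iff)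
    show "tmap X V g \<chi> = f \<chi>" if "\<chi> \<in> car (tau X)" for \<chi> using fun_cong[OF g(2), of \<chi>] that by simp
  qed
qed

end

subsection \<open>The left adjoint of the translate\<close>

context hereditary_ring
begin

text \<open>The image of \<open>f\<close> in the torsionless module \<open>L\<close> is projective,
  so the kernel of \<open>f\<close> is a direct summand and maps extend from it by projecting. This
  is the vanishing of Ext in degree two in usable form.\<close>

lemma split_extend:
  assumes D: "fm D" and L: "fm L" and f: "lin D L f" and T: "torsionless L" and N: "fm N"
    and \<phi>: "lin (sub_mod D (ker D L f)) N \<phi>"
  obtains \<Phi> where "lin D N \<Phi>" "!!x. x \<in> ker D L f ==> \<Phi> x = \<phi> x"
proof -
  note K = sub_ker[OF D L f]
  have I: "submodule (f ` car D) R L" using sub_image[OF D L f sub_all[OF D]] .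
  let ?J = "sub_mod L (f ` car D)"
  have J: "fm ?J" "projective R ?J" using fm_sub[OF L I] projective_torsionless[OF fm_sub[OF L I] torsionless_sub[OF L I T]] .
  have fJ: "lin D ?J f" using f by (rule lin_sub_cod) auto
  obtain t where t: "lin ?J D t" "!!y. y \<in> car ?J ==> f (t y) = y" using proj_lift[OF J(2,1) D J(1) fJ _ lin_id] by auto
  let ?r = "\<lambda>x. x \<ominus>\<^sub>D t (f x)"
  have r: "lin D D ?r" using lin_diff[OF D lin_id lin_comp[OF fJ t(1)]] .
  have rK: "?r x \<in> ker D L f" if x: "x \<in> car D" for x
    using lin_closed[OF r x] lin_minus[OF D L f x lin_closed[OF lin_comp[OF fJ t(1)] x]] t(2)[of "f x"] x lin_closed[OF f x] L by (simp add: ker_def)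
  have "lin D N (\<lambda>x. \<phi> (?r x))" using lin_comp[OF lin_sub_cod[OF r rK] \<phi>] .
  moreover have "\<phi> (?r x) = \<phi> x" if "x \<in> ker D L f" for x using that lin_zero[OF J(1) D t(1)] D by (simp add: ker_def)
  ultimately show thesis using that by blast
qed

lemma F_incl:
  assumes M: "fm M" and K: "submodule K R M"
  defines "i \<equiv> fmap (sub_mod M K) M (\<lambda>x. x)"
  shows "lin (F (sub_mod M K)) (F M) i" "lin (Om (sub_mod M K)) (Om M) i"
    "!!c. c \<in> car (F (sub_mod M K)) ==> pi M (i c) = pi (sub_mod M K) c"
    "!!c. [|c \<in> car (F (sub_mod M K)); i c \<in> car (Om M)|] ==> c \<in> car (Om (sub_mod M K))"
proof -
  note S = fm_sub[OF M K]
  show "lin (F (sub_mod M K)) (F M) i" "lin (Om (sub_mod M K)) (Om M) i"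
    unfolding i_def using lin_free_map[OF S M] lin_free_map_Om[OF S M lin_incl[OF M K]] .
  show *: "!!c. c \<in> car (F (sub_mod M K)) ==> pi M (i c) = pi (sub_mod M K) c" unfolding i_def using pi_free_map[OF S M lin_incl[OF M K]] .
  show "c \<in> car (Om (sub_mod M K))" if "c \<in> car (F (sub_mod M K))" "i c \<in> car (Om M)" for c
    using that *[OF that(1)] by (simp add: ker_def)
qed

text \<open>Ext(M, R) maps onto Ext(K, R) for a submodule \<open>K\<close>. In the sum of
  \<open>F K\<close> and \<open>Om M\<close> the pairs with equal image in \<open>F M\<close> form a
  copy of \<open>Om K\<close>; extending \<open>\<phi>\<close> from there and reading off the two
  components gives a coboundary and \<open>\<psi>\<close>.\<close>

lemma cocycle_extend:
  assumes M: "fm M" and K: "submodule K R M" and \<phi>: "lin (Om (sub_mod M K)) Rm \<phi>"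
  obtains \<psi> where "lin (Om M) Rm \<psi>"
    "extendable (sub_mod M K) Rm (\<lambda>c. \<phi> c \<ominus>\<^sub>Rm \<psi> (fmap (sub_mod M K) M (\<lambda>x. x) c))"
proof -
  let ?K = "sub_mod M K" and ?i = "fmap (sub_mod M K) M (\<lambda>x. x)"
  note S = fm_sub[OF M K] and i = F_incl[OF M K]
  note FS = fm_F[OF S] and OM = fm_Om[OF M] and FM = fm_F[OF M]
  let ?D = "dsum (F ?K) (Om M)"
  note D = fm_dsum[OF FS OM] and dl = dsum_lin[OF FS OM]
  let ?f = "\<lambda>d. ?i (fst d) \<ominus>\<^sub>(F M) snd d"
  have f: "lin ?D (F M) ?f" using lin_diff[OF FM lin_comp[OF dl(3) i(1)] lin_comp[OF dl(4) lin_Om_F[OF M]]] .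
  have kerf: "d \<in> ker ?D (F M) ?f \<longleftrightarrow> fst d \<in> car (F ?K) \<and> snd d \<in> car (Om M) \<and> ?i (fst d) = snd d" for d
    unfolding ker_def using fm_minus_eq_zero[OF FM lin_closed[OF i(1)] Om_in_F[of "snd d" M]] by (cases d) (auto simp del: F_simps Om_simps)
  have "lin (sub_mod ?D (ker ?D (F M) ?f)) (F ?K) fst" using lin_sub_dom[OF dl(3) sub_ker[OF D FM f] D] .
  moreover have "fst d \<in> ker (F ?K) ?K (pi ?K)" if "d \<in> ker ?D (F M) ?f" for d using i(4)[of "fst d"] kerf[of d] that by (simp del: F_simps)
  ultimately have fO: "lin (sub_mod ?D (ker ?D (F M) ?f)) (Om ?K) fst"
    unfolding Om_eq[of ?K] sub_mod_simps(1)[of ?D, symmetric] by (rule lin_sub_cod) (simp only: sub_mod_simps)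
  obtain \<Phi> where \<Phi>: "lin ?D Rm \<Phi>" "!!d. d \<in> ker ?D (F M) ?f ==> \<Phi> d = \<phi> (fst d)"
    by (rule split_extend[OF D FM f torsionless_F[OF M] fm_reg lin_comp[OF fO \<phi>]]) (rule that; (assumption | simp only:))
  let ?\<psi> = "\<lambda>b. \<Phi> (\<zero>\<^sub>(F ?K), b)" and ?\<alpha> = "\<lambda>a. \<Phi> (a, \<zero>\<^sub>(Om M))"
  have \<psi>: "lin (Om M) Rm ?\<psi>" using lin_comp[OF dl(2) \<Phi>(1)] .
  have \<alpha>: "lin (F ?K) Rm ?\<alpha>" using lin_comp[OF dl(1) \<Phi>(1)] .
  have "?\<alpha> c = \<phi> c \<ominus>\<^sub>Rm ?\<psi> (?i c)" if c: "c \<in> car (Om ?K)" for c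
  proof -
    have ic: "?i c \<in> car (Om M)" using lin_closed[OF i(2) c] .
    note cF = Om_in_F[OF c]
    have "\<phi> c = \<Phi> (c, ?i c)" using \<Phi>(2)[of "(c, ?i c)"] kerf[of "(c, ?i c)"] ic cF by simp
    also have "(c, ?i c) = (c, \<zero>\<^sub>(Om M)) \<oplus>\<^sub>(?D) (\<zero>\<^sub>(F ?K), ?i c)"
      using fm_zeros(1)[OF OM ic] fm_zeros(2)[OF FS cF] by (simp del: F_simps Om_simps)
    also have "\<Phi> \<dots> = ?\<alpha> c \<oplus>\<^sub>Rm ?\<psi> (?i c)"
      by (rule lin_add[OF \<Phi>(1)]) (use ic cF fm_zero[OF OM] fm_zero[OF FS] in \<open>simp_all del: F_simps Om_simps\<close>)
    finally show ?thesis using fm_minus_add(3)[OF fm_reg lin_closed[OF \<alpha> cF] lin_closed[OF \<psi> ic]] by simp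
  qed
  hence "extendable ?K Rm (\<lambda>c. \<phi> c \<ominus>\<^sub>Rm ?\<psi> (?i c))" unfolding extendable_def using \<alpha> by blast
  thus thesis using \<psi> that[of ?\<psi>] by blast
qed

lemma cls_split:
  assumes M: "fm M" and \<chi>: "\<chi> \<in> characters (ext1 R M Rm)" and l: "lin (Om M) Rm \<phi>" "lin (Om M) Rm \<psi>"
    and x: "extendable M Rm (\<lambda>x. \<phi> x \<ominus>\<^sub>Rm \<psi> x)"
  shows "\<chi> (cls M Rm \<phi>) = \<chi> (cls M Rm \<psi>)" using cls_eq[OF M fm_reg l] x by simp

text \<open>\<tau> of an inclusion is dual to a surjection of Ext groups.\<close>

lemma tau_incl_inj:
  assumes M: "fm M" and K: "submodule K R M"
    and \<chi>: "\<chi> \<in> car (tau (sub_mod M K))" "\<chi>' \<in> car (tau (sub_mod M K))"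
    and eq: "tmap (sub_mod M K) M (\<lambda>x. x) \<chi> = tmap (sub_mod M K) M (\<lambda>x. x) \<chi>'"
  shows "\<chi> = \<chi>'"
proof (rule tau_eqI[OF fm_sub[OF M K] \<chi>])
  note S = fm_sub[OF M K] and i = F_incl[OF M K]
  fix \<phi> assume \<phi>: "lin (Om (sub_mod M K)) Rm \<phi>"
  obtain \<psi> where \<psi>: "lin (Om M) Rm \<psi>"
    "extendable (sub_mod M K) Rm (\<lambda>c. \<phi> c \<ominus>\<^sub>Rm \<psi> (fmap (sub_mod M K) M (\<lambda>x. x) c))"
    using cocycle_extend[OF M K \<phi>] .
  have *: "\<xi> (cls (sub_mod M K) Rm \<phi>) = tmap (sub_mod M K) M (\<lambda>x. x) \<xi> (cls M Rm \<psi>)"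
    if "\<xi> \<in> car (tau (sub_mod M K))" for \<xi>
    using cls_split[OF S _ \<phi> lin_comp[OF i(2) \<psi>(1)] \<psi>(2), of \<xi>] that tau_map_cls[OF S M lin_incl[OF M K] that \<psi>(1)] by simp
  show "\<chi> (cls (sub_mod M K) Rm \<phi>) = \<chi>' (cls (sub_mod M K) Rm \<phi>)" using *[OF \<chi>(1)] *[OF \<chi>(2)] eq by simp
qed

lemma sub_equalizer:
  assumes M: "fm M" and N: "fm N" and g: "lin M N g" "lin M N g'"
  shows "submodule {x \<in> car M. g x = g' x} R M"
  unfolding sub_iff[OF M] using lin_zero[OF M N g(1)] lin_zero[OF M N g(2)] lin_add[OF g(1)] lin_add[OF g(2)] lin_smult[OF g(1)] lin_smult[OF g(2)] g M by auto

text \<open>Exactness of Ext(N, R) -> Ext(M, R) -> Ext(K, R) for the equalizer \<open>K\<close> of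
  \<open>g\<close> and \<open>g'\<close>: a class dying on \<open>K\<close> comes, up to the
  coboundary \<open>\<Theta>\<close>, from the difference of the two pullbacks of a class on
  \<open>N\<close>.\<close>

lemma cocycle_equalizer:
  assumes M: "fm M" and N: "fm N" and g: "lin M N g" "lin M N g'"
  defines "K \<equiv> {x \<in> car M. g x = g' x}"
  assumes \<phi>: "lin (Om M) Rm \<phi>" and ext: "extendable (sub_mod M K) Rm (\<lambda>c. \<phi> (fmap (sub_mod M K) M (\<lambda>x. x) c))"
  obtains \<Theta> \<psi> where "lin (F M) Rm \<Theta>" "lin (Om N) Rm \<psi>"
    "!!x. x \<in> car (Om M) ==> \<phi> x = \<Theta> x \<oplus>\<^sub>Rm (\<psi> (fmap M N g x) \<ominus>\<^sub>Rm \<psi> (fmap M N g' x))"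
proof -
  have K: "submodule K R M" unfolding K_def by (rule sub_equalizer[OF M N g])
  let ?K = "sub_mod M K" and ?i = "fmap (sub_mod M K) M (\<lambda>x. x)"
  let ?d = "\<lambda>x. fmap M N g x \<ominus>\<^sub>(F N) fmap M N g' x"
  note S = fm_sub[OF M K] and i = F_incl[OF M K]
  note FS = fm_F[OF S] and OM = fm_Om[OF M] and FM = fm_F[OF M] and FN = fm_F[OF N] and ON = fm_Om[OF N]
  note gF = lin_free_map[OF M N, of g] and gF' = lin_free_map[OF M N, of g']
  note gO = lin_free_map_Om[OF M N g(1)] and gO' = lin_free_map_Om[OF M N g(2)]
  have d: "lin (F M) (F N) ?d" using lin_diff[OF FN gF gF'] .
  have pid: "pi N (?d x) = g (pi M x) \<ominus>\<^sub>N g' (pi M x)" if "x \<in> car (F M)" for x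
    using lin_minus[OF FN N lin_pi[OF N] lin_closed[OF gF that] lin_closed[OF gF' that]]
      pi_free_map[OF M N g(1) that] pi_free_map[OF M N g(2) that] by simp
  obtain a where a: "lin (F ?K) Rm a" "!!c. c \<in> car (Om ?K) ==> a c = \<phi> (?i c)" using ext unfolding extendable_def by blast
  \<comment> \<open>\<open>?W\<close> is the sum of \<open>Om M\<close> and the image of
    \<open>F K\<close>. On the former \<open>\<phi>\<close> is given, on the latter the extension
    \<open>a\<close>; they agree on the overlap and glue to \<open>\<phi>'\<close>.\<close>
  let ?W = "{x \<in> car (F M). pi M x \<in> K}"
  have W: "submodule ?W R (F M)" by (rule sub_vimage[OF FM M lin_pi[OF M] K])
  note FW = fm_sub[OF FM W]
  let ?B = "dsum (Om M) (F ?K)"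
  note B = fm_dsum[OF OM FS] and Bl = dsum_lin[OF OM FS]
  let ?q = "\<lambda>b. fst b \<oplus>\<^sub>(F M) ?i (snd b)"
  have q: "lin ?B (F M) ?q" using lin_plus[OF FM lin_comp[OF Bl(3) lin_Om_F[OF M]] lin_comp[OF Bl(4) i(1)]] .
  have piq: "pi M (?q b) = pi ?K (snd b)" if b: "b \<in> car ?B" for b
  proof -
    have b': "fst b \<in> car (Om M)" "snd b \<in> car (F ?K)" using b by (auto simp del: F_simps Om_simps)
    have "pi M (?q b) = pi M (fst b) \<oplus>\<^sub>M pi M (?i (snd b))" using lin_add[OF lin_pi[OF M] Om_in_F[OF b'(1)] lin_closed[OF i(1) b'(2)]] .
    also have "\<dots> = pi ?K (snd b)" using b'(1) i(3)[OF b'(2)] lin_closed[OF lin_comp[OF i(1) lin_pi[OF M]] b'(2)] M by (simp add: ker_def)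
    finally show ?thesis .
  qed
  have piK: "pi ?K c \<in> K" if "c \<in> car (F ?K)" for c using lin_closed[OF lin_pi[OF S] that] by simp
  have qW: "lin ?B (sub_mod (F M) ?W) ?q" by (rule lin_sub_cod[OF q]) (use piq lin_closed[OF q] piK in \<open>auto simp del: F_simps Om_simps\<close>)
  have onto: "?q ` car ?B = car (sub_mod (F M) ?W)"
  proof (intro equalityI subsetI)
    show "x \<in> car (sub_mod (F M) ?W)" if "x \<in> ?q ` car ?B" for x using that lin_closed[OF qW] by blast
    fix x assume "x \<in> car (sub_mod (F M) ?W)"
    hence x: "x \<in> car (F M)" "pi M x \<in> K" by simp_all
    let ?c = "unit_vec ?K (pi M x)"
    have c: "?c \<in> car (F ?K)" by (rule unit_vec_closed)
    have pc: "pi ?K ?c = pi M x" using pi_unit[OF S, of "pi M x"] x(2) by simp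
    have ic: "?i ?c \<in> car (F M)" using lin_closed[OF i(1) c] .
    have "pi M (x \<ominus>\<^sub>(F M) ?i ?c) = \<zero>\<^sub>M"
      using lin_minus[OF FM M lin_pi[OF M] x(1) ic] i(3)[OF c] pc lin_closed[OF lin_pi[OF M] x(1)] M by simp
    hence "x \<ominus>\<^sub>(F M) ?i ?c \<in> car (Om M)" using fm_minus[OF FM x(1) ic] by (simp add: ker_def)
    hence "(x \<ominus>\<^sub>(F M) ?i ?c, ?c) \<in> car ?B" using c by (simp del: F_simps Om_simps)
    moreover have "?q (x \<ominus>\<^sub>(F M) ?i ?c, ?c) = x" using fm_minus_add(1)[OF FM x(1) ic] by (simp del: F_simps Om_simps)
    ultimately show "x \<in> ?q ` car ?B" by (rule image_eqI[OF sym, rotated])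
  qed
  let ?p = "\<lambda>b. \<phi> (fst b) \<oplus>\<^sub>Rm a (snd b)"
  have p: "lin ?B Rm ?p" using lin_copair[OF OM FS fm_reg \<phi> a(1)] .
  have pk: "?p b = \<zero>\<^sub>Rm" if b: "b \<in> car ?B" "?q b = \<zero>\<^sub>(sub_mod (F M) ?W)" for b
  proof -
    have b': "fst b \<in> car (Om M)" "snd b \<in> car (F ?K)" using b by (auto simp del: F_simps Om_simps)
    have q0: "?q b = \<zero>\<^sub>(F M)" using b(2) by (simp del: F_simps)
    have "pi ?K (snd b) = \<zero>\<^sub>(?K)" using piq[OF b(1)] q0 lin_zero[OF FM M lin_pi[OF M]] by (simp del: F_simps)
    hence sO: "snd b \<in> car (Om ?K)" using b'(2) by (simp add: ker_def)
    have "?p b = \<phi> (fst b \<oplus>\<^sub>(Om M) ?i (snd b))" using a(2)[OF sO] lin_add[OF \<phi> b'(1) lin_closed[OF i(2) sO]] by simp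
    also have "\<dots> = \<phi> \<zero>\<^sub>(Om M)" using q0 by (simp only: Om_simps)
    finally show ?thesis using lin_zero[OF OM fm_reg \<phi>] by simp
  qed
  obtain \<phi>' where \<phi>': "lin (sub_mod (F M) ?W) Rm \<phi>'" "!!b. b \<in> car ?B ==> \<phi>' (?q b) = ?p b"
    using factor'[OF B FW fm_reg qW onto p pk] by blast
  have \<phi>'O: "\<phi>' x = \<phi> x" if x: "x \<in> car (Om M)" for x
  proof -
    have b: "(x, \<zero>\<^sub>(F ?K)) \<in> car ?B" using x fm_zero[OF FS] by (simp del: F_simps Om_simps)
    have "?i \<zero>\<^sub>(F ?K) = \<zero>\<^sub>(F M)" "a \<zero>\<^sub>(F ?K) = \<zero>\<^sub>Rm" using lin_zero[OF FS FM i(1)] lin_zero[OF FS fm_reg a(1)] .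
    thus ?thesis using \<phi>'(2)[OF b] fm_zeros(2)[OF FM Om_in_F[OF x]] fm_zeros(2)[OF fm_reg lin_closed[OF \<phi> x]] by (simp del: F_simps)
  qed
  \<comment> \<open>\<open>?W\<close> is also the set of \<open>x\<close> whose \<open>?d x\<close>
    is a syzygy of \<open>N\<close>, so the pairs \<open>(x, ?d x)\<close> form a kernel from which
    \<open>\<phi>'\<close> extends; the two components of the extension are \<open>\<Theta>\<close>
    and \<open>\<psi>\<close>.\<close>
  let ?D = "dsum (F M) (Om N)"
  note D = fm_dsum[OF FM ON] and dl = dsum_lin[OF FM ON]
  let ?f = "\<lambda>z. ?d (fst z) \<ominus>\<^sub>(F N) snd z"
  have f: "lin ?D (F N) ?f" using lin_diff[OF FN lin_comp[OF dl(3) d] lin_comp[OF dl(4) lin_Om_F[OF N]]] .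
  have kerf: "z \<in> ker ?D (F N) ?f \<longleftrightarrow> fst z \<in> car (F M) \<and> snd z \<in> car (Om N) \<and> ?d (fst z) = snd z" for z
    unfolding ker_def using fm_minus_eq_zero[OF FN lin_closed[OF d] Om_in_F[of "snd z" N]] by (cases z) (auto simp del: F_simps Om_simps)
  have kW: "fst z \<in> ?W" if "z \<in> ker ?D (F N) ?f" for z
  proof -
    have z: "fst z \<in> car (F M)" "?d (fst z) \<in> car (Om N)" using that kerf by auto
    have "g (pi M (fst z)) \<ominus>\<^sub>N g' (pi M (fst z)) = \<zero>\<^sub>N" using pid[OF z(1)] z(2) by (simp add: ker_def)
    hence "pi M (fst z) \<in> K"
      unfolding K_def using fm_minus_eq_zero[OF N lin_closed[OF lin_comp[OF lin_pi[OF M] g(1)] z(1)] lin_closed[OF lin_comp[OF lin_pi[OF M] g(2)] z(1)]]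
        lin_closed[OF lin_pi[OF M] z(1)] by simp
    thus ?thesis using z(1) by simp
  qed
  have fW: "lin (sub_mod ?D (ker ?D (F N) ?f)) (sub_mod (F M) ?W) fst"
    by (rule lin_sub_cod[OF lin_sub_dom[OF dl(3) sub_ker[OF D FN f] D]]) (use kW in simp)
  obtain \<Phi> where \<Phi>: "lin ?D Rm \<Phi>" "!!z. z \<in> ker ?D (F N) ?f ==> \<Phi> z = \<phi>' (fst z)"
    by (rule split_extend[OF D FN f torsionless_F[OF N] fm_reg lin_comp[OF fW \<phi>'(1)]]) (rule that; (assumption | simp only:))
  let ?\<psi> = "\<lambda>b. \<Phi> (\<zero>\<^sub>(F M), b)" and ?\<Theta> = "\<lambda>a. \<Phi> (a, \<zero>\<^sub>(Om N))"
  have \<psi>: "lin (Om N) Rm ?\<psi>" using lin_comp[OF dl(2) \<Phi>(1)] .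
  have \<Theta>: "lin (F M) Rm ?\<Theta>" using lin_comp[OF dl(1) \<Phi>(1)] .
  have "\<phi> x = ?\<Theta> x \<oplus>\<^sub>Rm (?\<psi> (fmap M N g x) \<ominus>\<^sub>Rm ?\<psi> (fmap M N g' x))" if x: "x \<in> car (Om M)" for x
  proof -
    note xF = Om_in_F[OF x]
    have dd: "?d x = fmap M N g x \<ominus>\<^sub>(Om N) fmap M N g' x"
      using sub_mod_minus[OF sub_Om[OF N] FN] lin_closed[OF gO x] lin_closed[OF gO' x] unfolding Om_eq[of N] by simp
    have dx: "?d x \<in> car (Om N)" unfolding dd using fm_minus[OF ON lin_closed[OF gO x] lin_closed[OF gO' x]] .
    have "\<phi> x = \<Phi> (x, ?d x)" using \<Phi>(2)[of "(x, ?d x)"] kerf[of "(x, ?d x)"] dx xF \<phi>'O[OF x] by simp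
    also have "(x, ?d x) = (x, \<zero>\<^sub>(Om N)) \<oplus>\<^sub>(?D) (\<zero>\<^sub>(F M), ?d x)"
      using fm_zeros(1)[OF ON dx] fm_zeros(2)[OF FM xF] by (simp del: F_simps Om_simps)
    also have "\<Phi> \<dots> = ?\<Theta> x \<oplus>\<^sub>Rm ?\<psi> (?d x)"
      by (rule lin_add[OF \<Phi>(1)]) (use dx xF fm_zero[OF ON] fm_zero[OF FM] in \<open>simp_all del: F_simps Om_simps\<close>)
    finally show ?thesis using lin_minus[OF ON fm_reg \<psi> lin_closed[OF gO x] lin_closed[OF gO' x]] dd by simp
  qed
  thus thesis using that[OF \<Theta> \<psi>] by blast
qed

text \<open>\<tau> preserves equalizers, as befits the right adjoint it is to become. A preimage of
  \<open>\<chi>\<close> evaluates \<open>\<phi>\<close> by extending it to a cocycle on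
  \<open>M\<close> with \<open>cocycle_extend\<close> and applying \<open>\<chi>\<close>;
  \<open>triv\<close> makes the choice of extension harmless.\<close>

lemma tau_equalizer:
  assumes M: "fm M" and N: "fm N" and g: "lin M N g" "lin M N g'"
    and \<chi>: "\<chi> \<in> car (tau M)" "tmap M N g \<chi> = tmap M N g' \<chi>"
  defines "K \<equiv> {x \<in> car M. g x = g' x}"
  shows "\<exists>\<xi>\<in>car (tau (sub_mod M K)). tmap (sub_mod M K) M (\<lambda>x. x) \<xi> = \<chi>"
proof -
  have K: "submodule K R M" unfolding K_def by (rule sub_equalizer[OF M N g])
  let ?K = "sub_mod M K" and ?i = "fmap (sub_mod M K) M (\<lambda>x. x)"
  note S = fm_sub[OF M K] and i = F_incl[OF M K]
  note gO = lin_free_map_Om[OF M N g(1)] and gO' = lin_free_map_Om[OF M N g(2)]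
  have \<chi>': "\<chi> \<in> characters (ext1 R M Rm)" using \<chi>(1) by simp
  \<comment> \<open>By \<open>cocycle_equalizer\<close> the class of \<open>\<phi>\<close> is a
    difference of two pullbacks, on which \<open>\<chi>\<close> takes equal values.\<close>
  have triv: "\<chi> (cls M Rm \<phi>) = 1" if \<phi>: "lin (Om M) Rm \<phi>" and x: "extendable ?K Rm (\<lambda>c. \<phi> (?i c))" for \<phi>
  proof -
    obtain \<Theta> \<psi> where \<Theta>: "lin (F M) Rm \<Theta>" and \<psi>: "lin (Om N) Rm \<psi>"
      and eq: "!!x. x \<in> car (Om M) ==> \<phi> x = \<Theta> x \<oplus>\<^sub>Rm (\<psi> (fmap M N g x) \<ominus>\<^sub>Rm \<psi> (fmap M N g' x))"
      by (rule cocycle_equalizer[OF M N g \<phi> x[unfolded K_def]]) (rule that; (assumption | simp only:))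
    note l1 = lin_comp[OF gO \<psi>] and l2 = lin_comp[OF gO' \<psi>]
    note ld = lin_diff[OF fm_reg l1 l2]
    have "extendable M Rm (\<lambda>x. \<phi> x \<ominus>\<^sub>Rm (\<psi> (fmap M N g x) \<ominus>\<^sub>Rm \<psi> (fmap M N g' x)))"
      unfolding extendable_def by (intro exI[of _ \<Theta>] conjI \<Theta> ballI)
        (simp only: eq fm_minus_add(3)[OF fm_reg lin_closed[OF \<Theta> Om_in_F] lin_closed[OF ld]])
    hence 1: "\<chi> (cls M Rm \<phi>) = \<chi> (cls M Rm (\<lambda>x. \<psi> (fmap M N g x) \<ominus>\<^sub>Rm \<psi> (fmap M N g' x)))"
      by (rule cls_split[OF M \<chi>' \<phi> ld])
    have "cls M Rm (\<lambda>x. (\<psi> (fmap M N g x) \<ominus>\<^sub>Rm \<psi> (fmap M N g' x)) \<oplus>\<^sub>Rm \<psi> (fmap M N g' x)) = cls M Rm (\<lambda>x. \<psi> (fmap M N g x))"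
      by (rule cls_closed_iff[OF M fm_reg lin_plus[OF fm_reg ld l2]])
        (rule fm_minus_add(1)[OF fm_reg lin_closed[OF l1] lin_closed[OF l2]])
    hence 2: "\<chi> (cls M Rm \<phi>) * \<chi> (cls M Rm (\<lambda>x. \<psi> (fmap M N g' x))) = \<chi> (cls M Rm (\<lambda>x. \<psi> (fmap M N g x)))"
      using char_mult[OF M fm_reg \<chi>' ld l2] 1 by simp
    have "\<chi> (cls M Rm (\<lambda>x. \<psi> (fmap M N g x))) = \<chi> (cls M Rm (\<lambda>x. \<psi> (fmap M N g' x)))"
      using tau_map_cls[OF M N g(1) \<chi>(1) \<psi>] tau_map_cls[OF M N g(2) \<chi>(1) \<psi>] \<chi>(2) by simp
    moreover have "\<chi> (cls M Rm (\<lambda>x. \<psi> (fmap M N g' x))) \<noteq> 0" using char_norm[OF M fm_reg \<chi>' l2] by force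
    ultimately show ?thesis using 2 by simp
  qed
  let ?P = "\<lambda>\<phi> \<psi>. lin (Om M) Rm \<psi> \<and> extendable ?K Rm (\<lambda>c. \<phi> c \<ominus>\<^sub>Rm \<psi> (?i c))"
  have wd: "\<chi> (cls M Rm \<psi>) = \<chi> (cls M Rm \<psi>')" if \<phi>: "lin (Om ?K) Rm \<phi>" and p: "?P \<phi> \<psi>" "?P \<phi> \<psi>'" for \<phi> \<psi> \<psi>'
  proof -
    have l: "lin (Om M) Rm \<psi>" "lin (Om M) Rm \<psi>'" using p by auto
    note li = lin_comp[OF i(2) l(1)] lin_comp[OF i(2) l(2)]
    note ld = lin_diff[OF fm_reg l]
    have "cls ?K Rm (\<lambda>c. \<psi> (?i c)) = cls ?K Rm (\<lambda>c. \<psi>' (?i c))"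
      using cls_eq[OF S fm_reg \<phi> li(1)] cls_eq[OF S fm_reg \<phi> li(2)] p by simp
    hence "extendable ?K Rm (\<lambda>c. \<psi> (?i c) \<ominus>\<^sub>Rm \<psi>' (?i c))" using cls_eq[OF S fm_reg li] by simp
    hence "\<chi> (cls M Rm (\<lambda>x. \<psi> x \<ominus>\<^sub>Rm \<psi>' x)) = 1" using triv[OF ld] by simp
    moreover have "cls M Rm (\<lambda>x. (\<psi> x \<ominus>\<^sub>Rm \<psi>' x) \<oplus>\<^sub>Rm \<psi>' x) = cls M Rm \<psi>"
      by (rule cls_closed_iff[OF M fm_reg lin_plus[OF fm_reg ld l(2)]])
        (rule fm_minus_add(1)[OF fm_reg lin_closed[OF l(1)] lin_closed[OF l(2)]])
    ultimately show ?thesis using char_mult[OF M fm_reg \<chi>' ld l(2)] by simp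
  qed
  define w where "w \<phi> = (SOME \<psi>. ?P \<phi> \<psi>)" for \<phi>
  have w: "?P \<phi> (w \<phi>)" if l\<phi>: "lin (Om ?K) Rm \<phi>" for \<phi>
  proof -
    obtain \<psi> where "lin (Om M) Rm \<psi>" "extendable ?K Rm (\<lambda>c. \<phi> c \<ominus>\<^sub>Rm \<psi> (?i c))"
      using cocycle_extend[OF M K l\<phi>] .
    hence "\<exists>\<psi>. ?P \<phi> \<psi>" by blast
    thus ?thesis unfolding w_def by (rule someI_ex)
  qed
  have pe: "extendable ?K Rm (\<lambda>c. (\<phi> c \<oplus>\<^sub>Rm \<phi>' c) \<ominus>\<^sub>Rm (\<psi> (?i c) \<oplus>\<^sub>Rm \<psi>' (?i c)))"
    if "?P \<phi> \<psi>" "?P \<phi>' \<psi>'" "lin (Om ?K) Rm \<phi>" "lin (Om ?K) Rm \<phi>'" for \<phi> \<phi>' \<psi> \<psi>'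
  proof -
    have l: "lin (Om M) Rm \<psi>" "lin (Om M) Rm \<psi>'" using that by auto
    have "extendable ?K Rm (\<lambda>c. (\<phi> c \<ominus>\<^sub>Rm \<psi> (?i c)) \<oplus>\<^sub>Rm (\<phi>' c \<ominus>\<^sub>Rm \<psi>' (?i c)))"
      using that by (intro extendable_plus[OF fm_reg]) auto
    thus ?thesis by (rule extendable_cong)
        (rule fm_add4(2)[OF fm_reg lin_closed[OF that(3)] lin_closed[OF that(4)] lin_closed[OF lin_comp[OF i(2) l(1)]] lin_closed[OF lin_comp[OF i(2) l(2)]], symmetric])
  qed
  obtain \<xi> where \<xi>: "\<xi> \<in> characters (ext1 R ?K Rm)" "!!\<phi>. lin (Om ?K) Rm \<phi> ==> \<xi> (cls ?K Rm \<phi>) = \<chi> (cls M Rm (w \<phi>))"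
  proof (rule char_exists[OF S fm_reg, of "\<lambda>\<phi>. \<chi> (cls M Rm (w \<phi>))"])
    fix \<phi> assume l: "lin (Om ?K) Rm \<phi>"
    note w\<phi> = w[OF l]
    show "cmod (\<chi> (cls M Rm (w \<phi>))) = 1" using char_norm[OF M fm_reg \<chi>'] w\<phi> by blast
    show "\<chi> (cls M Rm (w \<phi>)) = 1" if "extendable ?K Rm \<phi>"
    proof (rule triv)
      have l': "lin (Om M) Rm (w \<phi>)" using w\<phi> by blast
      have "extendable ?K Rm (\<lambda>c. \<phi> c \<ominus>\<^sub>Rm (\<phi> c \<ominus>\<^sub>Rm w \<phi> (?i c)))" using extendable_diff[OF fm_reg that] w\<phi> by blast
      moreover have "\<phi> c \<ominus>\<^sub>Rm (\<phi> c \<ominus>\<^sub>Rm w \<phi> (?i c)) = w \<phi> (?i c)" if c: "c \<in> car (Om ?K)" for c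
      proof -
        note a = lin_closed[OF l c] and b = lin_closed[OF lin_comp[OF i(2) l'] c]
        have "\<phi> c = (\<phi> c \<ominus>\<^sub>Rm w \<phi> (?i c)) \<oplus>\<^sub>Rm w \<phi> (?i c)" using fm_minus_add(1)[OF fm_reg a b] by simp
        thus ?thesis using fm_minus_add(4)[OF fm_reg fm_minus[OF fm_reg a b] b] by metis
      qed
      ultimately show "extendable ?K Rm (\<lambda>c. w \<phi> (?i c))" by (rule extendable_cong)
    qed (use w\<phi> in blast)
    fix \<phi>' assume l': "lin (Om ?K) Rm \<phi>'"
    note w\<phi>' = w[OF l']
    show "\<chi> (cls M Rm (w \<phi>)) = \<chi> (cls M Rm (w \<phi>'))" if eq: "!!x. x \<in> car (Om ?K) ==> \<phi> x = \<phi>' x"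
    proof (rule wd[OF l])
      have "extendable ?K Rm (\<lambda>c. \<phi> c \<ominus>\<^sub>Rm w \<phi>' (?i c))"
        by (rule extendable_cong[OF conjunct2[OF w\<phi>']]) (simp only: eq)
      thus "?P \<phi> (w \<phi>')" using w\<phi>' by blast
    qed (rule w\<phi>)
    have lw: "lin (Om M) Rm (w \<phi>)" "lin (Om M) Rm (w \<phi>')" using w\<phi> w\<phi>' by auto
    note lp = lin_plus[OF fm_reg l l']
    have "\<chi> (cls M Rm (w (\<lambda>x. \<phi> x \<oplus>\<^sub>Rm \<phi>' x))) = \<chi> (cls M Rm (\<lambda>x. w \<phi> x \<oplus>\<^sub>Rm w \<phi>' x))"
      by (rule wd[OF lp w[OF lp]]) (use lin_plus[OF fm_reg lw] pe[OF w\<phi> w\<phi>' l l'] in blast)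
    thus "\<chi> (cls M Rm (w (\<lambda>x. \<phi> x \<oplus>\<^sub>Rm \<phi>' x))) = \<chi> (cls M Rm (w \<phi>)) * \<chi> (cls M Rm (w \<phi>'))"
      using char_mult[OF M fm_reg \<chi>' lw] by simp
  qed (rule that)
  have \<xi>T: "\<xi> \<in> car (tau ?K)" using \<xi>(1) by simp
  have "tmap ?K M (\<lambda>x. x) \<xi> = \<chi>"
  proof (rule tau_eqI[OF M tau_map_closed[OF S M lin_incl[OF M K] \<xi>T] \<chi>(1)])
    fix \<psi> assume \<psi>: "lin (Om M) Rm \<psi>"
    note li = lin_comp[OF i(2) \<psi>]
    have "extendable ?K Rm (\<lambda>c. \<psi> (?i c) \<ominus>\<^sub>Rm \<psi> (?i c))" using cls_eq[OF S fm_reg li li] by simp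
    hence "\<chi> (cls M Rm (w (\<lambda>c. \<psi> (?i c)))) = \<chi> (cls M Rm \<psi>)" by (intro wd[OF li w[OF li]]) (use \<psi> in blast)
    thus "tmap ?K M (\<lambda>x. x) \<xi> (cls M Rm \<psi>) = \<chi> (cls M Rm \<psi>)"
      using tau_map_cls[OF S M lin_incl[OF M K] \<xi>T \<psi>] \<xi>(2)[OF li] by simp
  qed
  thus ?thesis using \<xi>T by blast
qed

section \<open>A cogenerator bounding the size of a module\<close>

definition addg :: "('r, 'a) module => 'a monoid" where
  "addg M = \<lparr>carrier = car M, mult = ring.add M, one = ring.zero M\<rparr>"

lemma addg_simps [simp]: "car (addg M) = car M" "x \<otimes>\<^bsub>addg M\<^esub> y = x \<oplus>\<^sub>M y" "\<one>\<^bsub>addg M\<^esub> = \<zero>\<^sub>M"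
  by (simp_all add: addg_def)

text \<open>The dual of the regular right module, with \<open>R\<close> acting on characters through
  right multiplication of the argument.\<close>

definition cog :: "('r, 'r => complex) module" where
  "cog = \<lparr>carrier = characters (addg Rm), mult = undefined, one = undefined,
      ring.zero = (\<lambda>x\<in>car R. 1), ring.add = (\<lambda>\<chi> \<psi>. \<lambda>x\<in>car R. \<chi> x * \<psi> x),
      smult = (\<lambda>r \<chi>. \<lambda>x\<in>car R. \<chi> (x \<otimes> r))\<rparr>"

lemma add_finite_comm_group: "fm M ==> finite_comm_group (addg M)"
proof (intro finite_comm_group.intro finite_comm_group_axioms.intro comm_groupI)
  assume M: "fm M"
  interpret M: abelian_group M using fm_ag[OF M] .
  fix x y z assume x: "x \<in> car (addg M)" and y: "y \<in> car (addg M)" and z: "z \<in> car (addg M)"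
  show "x \<otimes>\<^bsub>addg M\<^esub> y \<otimes>\<^bsub>addg M\<^esub> z = x \<otimes>\<^bsub>addg M\<^esub> (y \<otimes>\<^bsub>addg M\<^esub> z)" using x y z by (simp add: M.a_assoc)
next
  assume M: "fm M"
  fix x assume x: "x \<in> car (addg M)"
  show "\<exists>y\<in>car (addg M). y \<otimes>\<^bsub>addg M\<^esub> x = \<one>\<^bsub>addg M\<^esub>"
    using x M by (intro bexI[of _ "\<ominus>\<^bsub>M\<^esub> x"]) simp_all
qed (simp_all add: fm_comm)

lemma cog_simps:
  "\<chi> \<in> car cog \<longleftrightarrow> \<chi> \<in> extensional (car R) \<and> (\<forall>x\<in>car R. cmod (\<chi> x) = 1) \<and>
    (\<forall>x\<in>car R. \<forall>y\<in>car R. \<chi> (x \<oplus> y) = \<chi> x * \<chi> y)"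
  "\<zero>\<^sub>cog = (\<lambda>x\<in>car R. 1)" "\<chi> \<oplus>\<^sub>cog \<psi> = (\<lambda>x\<in>car R. \<chi> x * \<psi> x)"
  "r \<odot>\<^sub>cog \<chi> = (\<lambda>x\<in>car R. \<chi> (x \<otimes> r))" by (auto simp: cog_def characters_iff)

lemma fm_cog: "fm cog"
proof -
  interpret A: finite_comm_group "addg Rm" using add_finite_comm_group[OF fm_reg] .
  have "abelian_group cog"
  proof (rule abelian_groupI)
    show "\<exists>\<psi>\<in>car cog. \<psi> \<oplus>\<^sub>cog \<chi> = \<zero>\<^sub>cog" if \<chi>: "\<chi> \<in> car cog" for \<chi>
    proof (rule bexI)
      have nz: "\<chi> x \<noteq> 0" if "x \<in> car R" for x using \<chi> that by (force simp: cog_simps)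
      show "(\<lambda>x\<in>car R. inverse (\<chi> x)) \<in> car cog" using \<chi> by (auto simp: cog_simps norm_inverse)
      show "(\<lambda>x\<in>car R. inverse (\<chi> x)) \<oplus>\<^sub>cog \<chi> = \<zero>\<^sub>cog" by (auto simp: cog_simps nz intro!: restrict_ext)
    qed
    show "\<zero>\<^sub>cog \<oplus>\<^sub>cog \<chi> = \<chi>" if "\<chi> \<in> car cog" for \<chi>
      by (rule extensionalityI[of _ "car R"]) (use that in \<open>auto simp: cog_simps\<close>)
  qed (auto simp: cog_simps norm_mult intro!: restrict_ext)
  hence "left_module R cog"
  proof (intro left_module.intro left_module_axioms.intro)
    show "\<one> \<odot>\<^sub>cog \<chi> = \<chi>" if "\<chi> \<in> car cog" for \<chi>
      by (rule extensionalityI[of _ "car R"]) (use that in \<open>auto simp: cog_simps\<close>)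
  qed (use ring_axioms in \<open>auto simp: cog_simps l_distr r_distr m_assoc intro!: restrict_ext\<close>)
  moreover have "finite (car cog)" using A.finite_characters by (simp add: cog_def addg_def)
  ultimately show ?thesis by (simp add: fm_def)
qed

text \<open>An additive character \<open>\<chi>\<close> of \<open>M\<close> yields the homomorphism
  that sends \<open>m\<close> to \<open>\<lambda>r. \<chi> (r m)\<close>, from which
  \<open>\<chi>\<close> is recovered at \<open>\<one>\<close>; and there are as many characters as
  elements.\<close>

lemma card_le_h_cog:
  assumes M: "fm M" shows "card (car M) \<le> h M cog"
proof -
  interpret A: finite_comm_group "addg M" using add_finite_comm_group[OF M] .
  let ?g = "\<lambda>\<chi>. \<lambda>m\<in>car M. \<lambda>r\<in>car R. \<chi> (r \<odot>\<^sub>M m)"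
  have "card (characters (addg M)) \<le> h M cog"
  proof (rule card_inj_on_le)
    show "inj_on ?g (characters (addg M))"
    proof (rule inj_onI, rule extensionalityI[of _ "car M"])
      fix \<chi> \<chi>' m assume \<chi>: "\<chi> \<in> characters (addg M)" "\<chi>' \<in> characters (addg M)" "?g \<chi> = ?g \<chi>'" and m: "m \<in> car M"
      hence "?g \<chi> m \<one> = ?g \<chi>' m \<one>" by simp
      thus "\<chi> m = \<chi>' m" using m fm_smult_simps(4)[OF M m] by simp
    qed (auto simp: characters_iff)
    show "?g ` characters (addg M) \<subseteq> Hom M cog"
    proof
      fix f assume "f \<in> ?g ` characters (addg M)"
      then obtain \<chi> where \<chi>: "\<chi> \<in> characters (addg M)" "f = ?g \<chi>" by blast
      have "lin M cog (\<lambda>m. \<lambda>r\<in>car R. \<chi> (r \<odot>\<^sub>M m))" unfolding lin_def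
        using \<chi>(1) M by (auto simp: characters_iff cog_simps fm_smult_simps intro!: restrict_ext)
      thus "f \<in> Hom M cog" using restrict_mod_hom[OF _ M] \<chi>(2) by blast
    qed
  qed (use M fm_cog in simp)
  thus ?thesis using A.card_characters by simp
qed

lemma lift_injective:
  assumes U: "fm U" and A: "fm A" and B: "fm B" and j: "lin A B j" and inj_j: "inj_on j (car A)"
    and f: "lin U B f" and im: "\<forall>u\<in>car U. \<exists>x\<in>car A. j x = f u"
  shows "\<exists>k. lin U A k \<and> (\<forall>u\<in>car U. j (k u) = f u)"
proof -
  note inj = inj_onD[OF inj_j]
  define k where "k u = (SOME x. x \<in> car A \<and> j x = f u)" for u
  have k: "k u \<in> car A \<and> j (k u) = f u" if "u \<in> car U" for u unfolding k_def using someI_ex[OF bspec[OF im that, unfolded Bex_def]] .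
  have "lin U A k" unfolding lin_def
  proof (intro conjI ballI funcsetI)
    show "k u \<in> car A" if "u \<in> car U" for u using k[OF that] by blast
    show "k (u \<oplus>\<^sub>U v) = k u \<oplus>\<^sub>A k v" if uv: "u \<in> car U" "v \<in> car U" for u v
      by (rule inj) (use k[OF uv(1)] k[OF uv(2)] k[OF fm_add[OF U uv]] A lin_add[OF j, of "k u" "k v"] lin_add[OF f uv] in auto)
    show "k (r \<odot>\<^sub>U v) = r \<odot>\<^sub>A k v" if uv: "r \<in> car R" "v \<in> car U" for r v
      by (rule inj) (use uv k[OF uv(2)] k[OF fm_smult[OF U uv]] A lin_smult[OF j uv(1), of "k v"] lin_smult[OF f uv] in auto)
  qed
  thus ?thesis using k by blast
qed

text \<open>Not automatic, because \<open>free_map\<close> of the zero map sends every basis vector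
  to the basis vector at zero. That vector is a syzygy, so pulled back cocycles extend to
  \<open>F X\<close> and are trivial.\<close>

lemma tau_zero_map:
  assumes X: "fm X" and V: "fm V" and \<chi>: "\<chi> \<in> car (tau X)"
  shows "tmap X V (\<lambda>x. \<zero>\<^sub>V) \<chi> = \<zero>\<^sub>(tau V)"
proof (rule tau_eqI[OF V tau_map_closed[OF X V lin_zero_map[OF V] \<chi>] fm_zero[OF fm_tau[OF V]]])
  fix \<phi> assume \<phi>: "lin (Om V) Rm \<phi>"
  note z = lin_zero_map[OF V, of X]
  let ?g = "fmap X V (\<lambda>x. \<zero>\<^sub>V)" and ?u = "unit_vec V \<zero>\<^sub>V"
  have uO: "?u \<in> car (Om V)" using pi_unit[OF V fm_zero[OF V]] by (simp add: ker_def)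
  have lu: "lin (F X) (Om V) (aug X (Om V) (\<lambda>m. ?u))" by (rule lin_aug[OF X fm_Om[OF V] uO])
  have "aug X (Om V) (\<lambda>m. ?u) c = ?g c" if "c \<in> car (F X)" for c
  proof (rule lin_F_ext[OF X fm_F[OF V] lin_comp[OF lu lin_Om_F[OF V]] lin_free_map[OF X V] _ that])
    show "aug X (Om V) (\<lambda>m. ?u) (unit_vec X m) = ?g (unit_vec X m)" if "m \<in> car X" for m
      using aug_unit[OF X fm_Om[OF V], of "\<lambda>m. ?u", OF uO that] free_map_unit[OF X V that] by simp
  qed
  hence "extendable X Rm (\<lambda>x. \<phi> (?g x))" unfolding extendable_def using lin_comp[OF lu \<phi>] Om_in_F by (metis (no_types, lifting))
  hence "\<chi> (cls X Rm (\<lambda>x. \<phi> (?g x))) = 1"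
    using char_extendable[OF X fm_reg _ lin_comp[OF lin_free_map_Om[OF X V z] \<phi>]] \<chi> by simp
  thus "tmap X V (\<lambda>x. \<zero>\<^sub>V) \<chi> (cls V Rm \<phi>) = \<zero>\<^sub>(tau V) (cls V Rm \<phi>)"
    using tau_map_cls[OF X V z \<chi> \<phi>] tau_zero[OF V \<phi>] by simp
qed

context
  fixes U :: "'r nmod"
  assumes U: "fm U"
begin

text \<open>The left adjoint is found among the pairs \<open>(M, f : U \<rightarrow> \<tau>M)\<close> for which \<open>f\<close> does not factor through
  \<open>\<tau>K\<close> for a proper submodule \<open>K\<close>: their size is bounded, and one of maximal size is universal.\<close>

definition through :: "'r nmod => (nat => ('r, nat) tau_elem) => nat set => bool" where
  "through M f K \<longleftrightarrow> submodule K R M \<and>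
    (\<exists>k. lin U (tau (sub_mod M K)) k \<and> (\<forall>u\<in>car U. tmap (sub_mod M K) M (\<lambda>x. x) (k u) = f u))"

definition min_pair :: "'r nmod => (nat => ('r, nat) tau_elem) => bool" where
  "min_pair M f \<longleftrightarrow> fm M \<and> lin U (tau M) f \<and> (\<forall>K. through M f K --> K = car M)"

text \<open>Two maps that agree after \<tau> along \<open>f\<close> have an equalizer through whose
  translate \<open>f\<close> factors; minimality makes it all of \<open>M\<close>.\<close>

lemma min_pair_cancel:
  assumes mp: "min_pair M f" and N: "fm N" and g: "lin M N g" "lin M N g'"
    and eq: "!!u. u \<in> car U ==> tmap M N g (f u) = tmap M N g' (f u)" and x: "x \<in> car M"
  shows "g x = g' x"
proof -
  have M: "fm M" and f: "lin U (tau M) f" using mp by (auto simp: min_pair_def)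
  let ?K = "{x \<in> car M. g x = g' x}"
  note K = sub_equalizer[OF M N g]
  have im: "\<forall>u\<in>car U. \<exists>\<xi>\<in>car (tau (sub_mod M ?K)). tmap (sub_mod M ?K) M (\<lambda>x. x) \<xi> = f u"
    using tau_equalizer[OF M N g lin_closed[OF f] eq] by blast
  have "\<exists>k. lin U (tau (sub_mod M ?K)) k \<and> (\<forall>u\<in>car U. tmap (sub_mod M ?K) M (\<lambda>x. x) (k u) = f u)"
    by (rule lift_injective[OF U fm_tau[OF fm_sub[OF M K]] fm_tau[OF M] lin_tau_map[OF fm_sub[OF M K] M lin_incl[OF M K]] inj_onI[OF tau_incl_inj[OF M K]] f im])
  hence "through M f ?K" unfolding through_def using K by blast
  hence "?K = car M" using mp unfolding min_pair_def by blast
  thus ?thesis using x by blast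
qed

text \<open>By cancellation Hom(M, cog) embeds in Hom(U, \<tau> cog), a set independent of
  \<open>M\<close>.\<close>

lemma min_pair_bound:
  assumes mp: "min_pair M f" shows "card (car M) \<le> h U (tau cog)"
proof -
  have M: "fm M" and f: "lin U (tau M) f" using mp by (auto simp: min_pair_def)
  have "h M cog \<le> h U (tau cog)"
  proof (rule card_inj_on_le)
    let ?t = "\<lambda>g. \<lambda>u\<in>car U. tmap M cog g (f u)"
    show "inj_on ?t (Hom M cog)"
    proof (rule inj_onI)
      fix g g' assume g: "g \<in> Hom M cog" "g' \<in> Hom M cog" "?t g = ?t g'"
      have "tmap M cog g (f u) = tmap M cog g' (f u)" if "u \<in> car U" for u using fun_cong[OF g(3), of u] that by simp
      thus "g = g'" using min_pair_cancel[OF mp fm_cog, of g g'] g by (intro mod_hom_eqI[OF g(1,2)]) (auto simp: mod_hom_iff)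
    qed
    show "?t ` Hom M cog \<subseteq> Hom U (tau cog)" using restrict_mod_hom[OF lin_comp[OF f lin_tau_map[OF M fm_cog]] U] by (auto simp: mod_hom_iff)
  qed (use U fm_tau[OF fm_cog] in simp)
  thus ?thesis using card_le_h_cog[OF M] by simp
qed

lemma through_self:
  assumes M: "fm M" and f: "lin U (tau M) f" shows "through M f (car M)" unfolding through_def sub_mod_self
  using sub_all[OF M] f tau_map_id[OF M lin_closed[OF f]] by blast

text \<open>Take a smallest submodule through whose translate \<open>f\<close> factors.\<close>

lemma min_pair_exists:
  assumes M: "fm M" and f: "lin U (tau M) f"
  obtains K k where "submodule K R M" "min_pair (sub_mod M K) k"
    "!!u. u \<in> car U ==> tmap (sub_mod M K) M (\<lambda>x. x) (k u) = f u"
proof -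
  define K where "K = arg_min (card :: nat set => nat) (through M f)"
  have K: "through M f K" unfolding K_def using arg_min_natI[of "through M f"] through_self[OF M f] by blast
  have min: "card K \<le> card K'" if "through M f K'" for K' unfolding K_def using arg_min_nat_le[of "through M f"] that by blast
  obtain k where sK: "submodule K R M" and k: "lin U (tau (sub_mod M K)) k"
    "!!u. u \<in> car U ==> tmap (sub_mod M K) M (\<lambda>x. x) (k u) = f u" using K unfolding through_def by blast
  note S = fm_sub[OF M sK]
  have "K' = K" if t: "through (sub_mod M K) k K'" for K'
  proof -
    obtain k' where sK': "submodule K' R (sub_mod M K)" and k': "lin U (tau (sub_mod M K')) k'"
      "!!u. u \<in> car U ==> tmap (sub_mod M K') (sub_mod M K) (\<lambda>x. x) (k' u) = k u" using t unfolding through_def sub_mod_sub_mod by blast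
    have KK: "submodule K' R M" "K' \<subseteq> K" using sK' sub_sub[OF M sK] by auto
    have l: "lin (sub_mod M K') (sub_mod M K) (\<lambda>x. x)" using lin_incl[OF S sK'] by (simp add: sub_mod_sub_mod)
    have "tmap (sub_mod M K') M (\<lambda>x. x) (k' u) = f u" if u: "u \<in> car U" for u
      using tau_map_comp[OF fm_sub[OF M KK(1)] S M l lin_incl[OF M sK] lin_closed[OF k'(1) u]] k'(2)[OF u] k(2)[OF u] by simp
    hence "through M f K'" unfolding through_def using KK k'(1) by blast
    hence "card K \<le> card K'" by (rule min)
    moreover have "finite K" using S fm_finite by fastforce
    ultimately show ?thesis using KK(2) card_seteq by blast
  qed
  hence "min_pair (sub_mod M K) k" unfolding min_pair_def using S k(1) by simp
  thus thesis using that[OF sK] k(2) by blast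
qed

text \<open>Combine \<open>f\<close> and \<open>f'\<close> into a map to the translate of the direct
  sum and shrink it to a minimal pair on a submodule \<open>K\<close>. The projection of
  \<open>K\<close> to \<open>M\<close> is onto since \<open>f\<close> factors through the translate
  of its image, and bijective since \<open>M\<close> has the largest size; the other projection
  after its inverse is \<open>g\<close>.\<close>

lemma min_pair_universal:
  assumes mp: "min_pair M f" and max: "!!M' f'. min_pair M' f' ==> card (car M') \<le> card (car M)"
    and L: "fm L" and f': "lin U (tau L) f'"
  shows "\<exists>g. lin M L g \<and> (\<forall>u\<in>car U. tmap M L g (f u) = f' u)"
proof -
  have M: "fm M" and f: "lin U (tau M) f" using mp by (auto simp: min_pair_def)
  note DM = fm_dsum[OF M L] and Dl = dsum_lin[OF M L]
  obtain D :: "'r nmod" where D: "fm D" "mod_iso R (dsum M L) D" using exists_nat_copy[OF DM] .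
  obtain a where a: "lin (dsum M L) D a" "bij_betw a (car (dsum M L)) (car D)" using mod_isoE[OF D(2)] .
  note b = lin_bij_inv[OF DM a]
  let ?b = "inv_into (car (dsum M L)) a"
  have ba: "?b (a x) = x" if "x \<in> car (dsum M L)" for x using bij_betw_inv_into_left[OF a(2) that] .
  let ?i = "\<lambda>x. a (x, \<zero>\<^sub>L)" and ?j = "\<lambda>y. a (\<zero>\<^sub>M, y)" and ?p = "\<lambda>d. fst (?b d)" and ?q = "\<lambda>d. snd (?b d)"
  have i: "lin M D ?i" and j: "lin L D ?j" and p: "lin D M ?p" and q: "lin D L ?q"
    using lin_comp[OF Dl(1) a(1)] lin_comp[OF Dl(2) a(1)] lin_comp[OF b(1) Dl(3)] lin_comp[OF b(1) Dl(4)] .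
  let ?f = "\<lambda>u. tmap M D ?i (f u) \<oplus>\<^sub>(tau D) tmap L D ?j (f' u)"
  note TD = fm_tau[OF D(1)] and TM = fm_tau[OF M] and TL = fm_tau[OF L]
  have fi: "lin U (tau D) (\<lambda>u. tmap M D ?i (f u))" using lin_comp[OF f lin_tau_map[OF M D(1) i]] .
  have fj: "lin U (tau D) (\<lambda>u. tmap L D ?j (f' u))" using lin_comp[OF f' lin_tau_map[OF L D(1) j]] .
  have ff: "lin U (tau D) ?f" using lin_plus[OF TD fi fj] .
  have pf: "tmap D M ?p (?f u) = f u" if u: "u \<in> car U" for u
  proof -
    have "tmap D M ?p (?f u) = tmap D M ?p (tmap M D ?i (f u)) \<oplus>\<^sub>(tau M) tmap D M ?p (tmap L D ?j (f' u))"
      using lin_add[OF lin_tau_map[OF D(1) M p] lin_closed[OF fi u] lin_closed[OF fj u]] .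
    also have "tmap D M ?p (tmap M D ?i (f u)) = tmap M M (\<lambda>x. x) (f u)" unfolding tau_map_comp[OF M D(1) M i p lin_closed[OF f u]]
      by (rule tau_map_cong[OF M M lin_comp[OF i p] _ lin_closed[OF f u]]) (use ba L in simp)
    also have "tmap D M ?p (tmap L D ?j (f' u)) = tmap L M (\<lambda>x. \<zero>\<^sub>M) (f' u)"
      unfolding tau_map_comp[OF L D(1) M j p lin_closed[OF f' u]]
      by (rule tau_map_cong[OF L M lin_comp[OF j p] _ lin_closed[OF f' u]]) (use ba M in simp)
    finally show ?thesis
      using tau_map_id[OF M lin_closed[OF f u]] tau_zero_map[OF L M lin_closed[OF f' u]] fm_zeros(2)[OF TM lin_closed[OF f u]] by simp
  qed
  have qf: "tmap D L ?q (?f u) = f' u" if u: "u \<in> car U" for u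
  proof -
    have "tmap D L ?q (?f u) = tmap D L ?q (tmap M D ?i (f u)) \<oplus>\<^sub>(tau L) tmap D L ?q (tmap L D ?j (f' u))"
      using lin_add[OF lin_tau_map[OF D(1) L q] lin_closed[OF fi u] lin_closed[OF fj u]] .
    also have "tmap D L ?q (tmap L D ?j (f' u)) = tmap L L (\<lambda>x. x) (f' u)" unfolding tau_map_comp[OF L D(1) L j q lin_closed[OF f' u]]
      by (rule tau_map_cong[OF L L lin_comp[OF j q] _ lin_closed[OF f' u]]) (use ba M in simp)
    also have "tmap D L ?q (tmap M D ?i (f u)) = tmap M L (\<lambda>x. \<zero>\<^sub>L) (f u)"
      unfolding tau_map_comp[OF M D(1) L i q lin_closed[OF f u]]
      by (rule tau_map_cong[OF M L lin_comp[OF i q] _ lin_closed[OF f u]]) (use ba L in simp)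
    finally show ?thesis
      using tau_map_id[OF L lin_closed[OF f' u]] tau_zero_map[OF M L lin_closed[OF f u]] fm_zeros(1)[OF TL lin_closed[OF f' u]] by simp
  qed
  obtain K k where K: "submodule K R D" and mk: "min_pair (sub_mod D K) k"
    and kf: "!!u. u \<in> car U ==> tmap (sub_mod D K) D (\<lambda>x. x) (k u) = ?f u"
    by (rule min_pair_exists[OF D(1) ff]) (rule that; (assumption | simp only:))
  note S = fm_sub[OF D(1) K] and inc = lin_incl[OF D(1) K]
  have k: "lin U (tau (sub_mod D K)) k" using mk by (simp add: min_pair_def)
  have pK: "lin (sub_mod D K) M ?p" using lin_comp[OF inc p] .
  have pkf: "tmap (sub_mod D K) M ?p (k u) = f u" if u: "u \<in> car U" for u
    using tau_map_comp[OF S D(1) M inc p lin_closed[OF k u]] kf[OF u] pf[OF u] by simp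
  let ?I = "?p ` car (sub_mod D K)"
  have I: "submodule ?I R M" using sub_image[OF S M pK sub_all[OF S]] .
  have pI: "lin (sub_mod D K) (sub_mod M ?I) ?p" using pK by (rule lin_sub_cod) auto
  have "through M f ?I" unfolding through_def
  proof (intro conjI I exI ballI)
    show "lin U (tau (sub_mod M ?I)) (\<lambda>u. tmap (sub_mod D K) (sub_mod M ?I) ?p (k u))"
      using lin_comp[OF k lin_tau_map[OF S fm_sub[OF M I] pI]] .
    show "tmap (sub_mod M ?I) M (\<lambda>x. x) (tmap (sub_mod D K) (sub_mod M ?I) ?p (k u)) = f u" if u: "u \<in> car U" for u
      using tau_map_comp[OF S fm_sub[OF M I] M pI lin_incl[OF M I] lin_closed[OF k u]] pkf[OF u] by simp
  qed
  hence onto: "?I = car M" using mp unfolding min_pair_def by blast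
  have "card (car (sub_mod D K)) \<le> card (car M)" using max[OF mk] .
  hence "inj_on ?p (car (sub_mod D K))" using onto card_image_le[of "car (sub_mod D K)" ?p] fm_finite[OF S] by (intro eq_card_imp_inj_on) auto
  hence bij: "bij_betw ?p (car (sub_mod D K)) (car M)" using onto by (auto simp: bij_betw_def)
  let ?r = "inv_into (car (sub_mod D K)) ?p"
  note r = lin_bij_inv[OF S pK bij]
  let ?g = "\<lambda>x. ?q (?r x)"
  have qK: "lin (sub_mod D K) L ?q" using lin_comp[OF inc q] .
  have "tmap M L ?g (f u) = f' u" if u: "u \<in> car U" for u
  proof -
    note ku = lin_closed[OF k u]
    have "tmap M L ?g (f u) = tmap M L ?g (tmap (sub_mod D K) M ?p (k u))" using pkf[OF u] by simp
    also have "\<dots> = tmap (sub_mod D K) L (\<lambda>x. ?g (?p x)) (k u)" using tau_map_comp[OF S M L pK lin_comp[OF r(1) qK] ku] .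
    also have "\<dots> = tmap (sub_mod D K) L ?q (k u)" by (rule tau_map_cong[OF S L lin_comp[OF pK lin_comp[OF r(1) qK]] _ ku])
        (simp only: bij_betw_inv_into_left[OF bij])
    also have "\<dots> = f' u" using tau_map_comp[OF S D(1) L inc q ku] kf[OF u] qf[OF u] by simp
    finally show ?thesis .
  qed
  thus ?thesis using lin_comp[OF r(1) qK] by blast
qed

lemma tau_minus_exists: "\<exists>X. tau_minus R U X"
proof -
  obtain Z :: "'r nmod" where Z: "fm Z" "mod_iso R Rm Z" using exists_nat_copy[OF fm_reg] .
  \<comment> \<open>The zero map provides one minimal pair; together with
    \<open>min_pair_bound\<close> this makes the maximum exist.\<close>
  obtain K k where mk: "min_pair (sub_mod Z K) k" by (rule min_pair_exists[OF Z(1) lin_zero_map[OF fm_tau[OF Z(1)]]])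
  let ?P = "\<lambda>(M, f). min_pair M f" and ?c = "\<lambda>(M :: 'r nmod, f :: nat => ('r, nat) tau_elem). card (car M)"
  have "\<exists>x. ?P x \<and> (\<forall>y. ?P y --> ?c y \<le> ?c x)"
    by (rule ex_has_greatest_nat[of ?P "(sub_mod Z K, k)" ?c "Suc (h U (tau cog))"])
      (use mk min_pair_bound in \<open>auto simp: less_Suc_eq_le\<close>)
  then obtain X f where mp: "min_pair X f" and max: "!!M' f'. min_pair M' f' ==> card (car M') \<le> card (car X)" by auto
  have X: "fm X" and f: "lin U (tau X) f" using mp by (auto simp: min_pair_def)
  have "tau_minus R U X" unfolding tau_minus_def
  proof (intro conjI bexI[of _ "restrict f (car U)"] ballI)
    show "X \<in> fl_mods R" using X by simp
    show "restrict f (car U) \<in> Hom U (tau X)" using restrict_mod_hom[OF f U] .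
    fix M :: "'r nmod" and f' assume "M \<in> fl_mods R" and f': "f' \<in> Hom U (tau M)"
    hence M: "fm M" by simp
    have f'l: "lin U (tau M) f'" using f' by (simp add: mod_hom_iff)
    have comp: "compose (car U) (tmap X M g) (restrict f (car U)) = f' \<longleftrightarrow> (\<forall>u\<in>car U. tmap X M g (f u) = f' u)" for g
    proof
      assume eq: "compose (car U) (tmap X M g) (restrict f (car U)) = f'"
      show "\<forall>u\<in>car U. tmap X M g (f u) = f' u" unfolding eq[symmetric] by (simp add: compose_def)
    next
      assume *: "\<forall>u\<in>car U. tmap X M g (f u) = f' u"
      show "compose (car U) (tmap X M g) (restrict f (car U)) = f'"
        by (rule extensionalityI[of _ "car U"]) (use f' * in \<open>auto simp: compose_def mod_hom_iff\<close>)
    qed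
    obtain g where g: "lin X M g" "\<forall>u\<in>car U. tmap X M g (f u) = f' u" using min_pair_universal[OF mp _ M f'l] max by blast
    have rg: "tmap X M (restrict g (car X)) (f u) = f' u" if u: "u \<in> car U" for u
      using tau_map_cong[OF X M g(1) _ lin_closed[OF f u], of "restrict g (car X)"] g(2) u by simp
    show "\<exists>!g. g \<in> Hom X M \<and> compose (car U) (tmap X M g) (restrict f (car U)) = f'"
    proof (rule ex1I)
      show "restrict g (car X) \<in> Hom X M \<and> compose (car U) (tmap X M (restrict g (car X))) (restrict f (car U)) = f'"
        unfolding comp using restrict_mod_hom[OF g(1) X] rg by blast
      fix k assume k: "k \<in> Hom X M \<and> compose (car U) (tmap X M k) (restrict f (car U)) = f'"
      show "k = restrict g (car X)"
      proof (rule mod_hom_eqI[OF conjunct1[OF k] restrict_mod_hom[OF g(1) X]])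
        fix x assume x: "x \<in> car X"
        have "k x = g x" by (rule min_pair_cancel[OF mp M _ g(1) _ x]) (use k g(2) in \<open>auto simp: mod_hom_iff comp\<close>)
        thus "k x = restrict g (car X) x" using x by simp
      qed
    qed
  qed
  thus ?thesis by blast
qed

end

end

section \<open>Indecomposable modules and the translate\<close>

context hereditary_ring
begin

lemma is_zeroI: "[|fm M; !!x. x \<in> car M ==> x = \<zero>\<^sub>M|] ==> is_zero M"
  unfolding is_zero_def using fm_zero[of M] by (intro equalityI subsetI) simp_all

lemma quot_nat:
  fixes B :: "('r, 'a) module"
  assumes B: "fm B" and K: "submodule K R B"
  obtains N :: "'r nmod" and q where "fm N" "lin B N q" "q ` car B = car N" "ker B N q = K"
proof -
  note Q = quot_mod[OF B K]
  obtain N :: "'r nmod" where N: "fm N" "mod_iso R (quot_mod B K) N" using exists_nat_copy[OF Q(1)] .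
  obtain a where a: "lin (quot_mod B K) N a" "bij_betw a (car (quot_mod B K)) (car N)" using mod_isoE[OF N(2)] .
  have inj: "\<forall>y\<in>car (quot_mod B K). a y = \<zero>\<^sub>N --> y = \<zero>\<^sub>(quot_mod B K)"
    using a(2) inj_on_iff_ker[OF Q(1) N(1) a(1)] by (simp add: bij_betw_def)
  show thesis
  proof (rule that[OF N(1) lin_comp[OF Q(2) a(1)]])
    have "(\<lambda>x. a (K +>\<^bsub>B\<^esub> x)) ` car B = a ` (a_r_coset B K ` car B)" by (simp add: image_image)
    thus "(\<lambda>x. a (K +>\<^bsub>B\<^esub> x)) ` car B = car N" using Q(3) a(2) by (simp add: bij_betw_def)
    have "a (K +>\<^bsub>B\<^esub> x) = \<zero>\<^sub>N \<longleftrightarrow> x \<in> K" if x: "x \<in> car B" for x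
      using inj lin_closed[OF Q(2) x] Q(4)[OF x] lin_zero[OF Q(1) N(1) a(1)] by metis
    thus "ker B N (\<lambda>x. a (K +>\<^bsub>B\<^esub> x)) = K" using subD(3)[OF K B] by (auto simp: ker_def)
  qed
qed

text \<open>If \<open>\<eta>\<close> is injective on Ext(N, -), a map \<open>f\<close> on the kernel
  of \<open>q\<close> extends to \<open>B\<close> as soon as \<open>\<eta>\<close> after
  \<open>f\<close> does: the obstruction to extending \<open>f\<close> is a class in Ext(N, U), and
  \<open>\<eta>\<close> kills it.\<close>

lemma ext_extend:
  assumes B: "fm B" and N: "fm N" and U: "fm U" and V: "fm V" and q: "lin B N q" "q ` car B = car N"
    and \<eta>: "lin U V \<eta>"
    and star: "!!\<psi>. [|lin (Om N) U \<psi>; extendable N V (\<lambda>x. \<eta> (\<psi> x))|] ==> extendable N U \<psi>"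
    and f: "lin (sub_mod B (ker B N q)) U f" and k: "lin B V k" "!!x. x \<in> ker B N q ==> k x = \<eta> (f x)"
  shows "\<exists>\<Phi>. lin B U \<Phi> \<and> (\<forall>x\<in>ker B N q. \<Phi> x = f x)"
proof -
  let ?A = "sub_mod B (ker B N q)"
  note K = sub_ker[OF B N q(1)]
  note A = fm_sub[OF B K] and FN = fm_F[OF N] and ON = fm_Om[OF N]
  \<comment> \<open>The lift \<open>l\<close> of the free presentation of \<open>N\<close>
    represents the extension \<open>B\<close> by a cocycle on \<open>Om N\<close> with values in the
    kernel of \<open>q\<close>.\<close>
  obtain l where l: "lin (F N) B l" "!!c. c \<in> car (F N) ==> q (l c) = pi N c"
    using proj_lift[OF projective_F[OF N] FN B N q lin_pi[OF N]] by metis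
  have lker: "l c \<in> ker B N q \<longleftrightarrow> c \<in> car (Om N)" if "c \<in> car (F N)" for c
    using that l(2)[OF that] lin_closed[OF l(1) that] by (simp add: ker_def)
  have lO: "lin (Om N) ?A l" by (rule lin_sub_cod[OF lin_comp[OF lin_Om_F[OF N] l(1)]]) (use lker Om_in_F in blast)
  have "extendable N V (\<lambda>x. \<eta> (f (l x)))" unfolding extendable_def
    by (intro exI[of _ "\<lambda>x. k (l x)"] conjI ballI lin_comp[OF l(1) k(1)]) (use k(2) lker Om_in_F in blast)
  from star[OF lin_comp[OF lO f] this] obtain s where s: "lin (F N) U s" "!!c. c \<in> car (Om N) ==> s c = f (l c)" unfolding extendable_def by blast
  \<comment> \<open>\<open>B\<close> is the sum of the kernel and \<open>F N\<close> with the two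
    images of \<open>Om N\<close> identified, so \<open>f\<close> and \<open>s\<close> define a map
    on it.\<close>
  let ?D = "dsum ?A (F N)"
  note D = fm_dsum[OF A FN] and dl = dsum_lin[OF A FN]
  have g: "lin ?D B (\<lambda>d. fst d \<oplus>\<^sub>B l (snd d))" using lin_copair[OF A FN B lin_incl[OF B K] l(1)] .
  have h: "lin ?D U (\<lambda>d. f (fst d) \<oplus>\<^sub>U s (snd d))" using lin_copair[OF A FN U f s(1)] .
  have onto: "(\<lambda>d. fst d \<oplus>\<^sub>B l (snd d)) ` car ?D = car B"
  proof (intro equalityI subsetI)
    fix b assume b: "b \<in> car B"
    let ?c = "unit_vec N (q b)"
    have qb: "q b \<in> car N" using lin_closed[OF q(1) b] .
    note lc = lin_closed[OF l(1) unit_vec_closed[of N "q b"]]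
    have "q (b \<ominus>\<^sub>B l ?c) = \<zero>\<^sub>N"
      using lin_minus[OF B N q(1) b lc] l(2)[OF unit_vec_closed[of N "q b"]] pi_unit[OF N qb] qb N by simp
    hence "(b \<ominus>\<^sub>B l ?c, ?c) \<in> car ?D" using fm_minus[OF B b lc] by (simp add: ker_def)
    moreover have "b = fst (b \<ominus>\<^sub>B l ?c, ?c) \<oplus>\<^sub>B l (snd (b \<ominus>\<^sub>B l ?c, ?c))" using fm_minus_add(1)[OF B b lc] by simp
    ultimately show "b \<in> (\<lambda>d. fst d \<oplus>\<^sub>B l (snd d)) ` car ?D" by (rule image_eqI[rotated])
  qed (use lin_closed[OF g] in blast)
  have kill: "f (fst d) \<oplus>\<^sub>U s (snd d) = \<zero>\<^sub>U" if d: "d \<in> car ?D" "fst d \<oplus>\<^sub>B l (snd d) = \<zero>\<^sub>B" for d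
  proof -
    have d': "fst d \<in> car ?A" "snd d \<in> car (F N)" using d(1) by (auto simp del: F_simps)
    have fB: "fst d \<in> car B" "q (fst d) = \<zero>\<^sub>N" using d'(1) by (auto simp: ker_def)
    have "q (fst d) \<oplus>\<^sub>N q (l (snd d)) = \<zero>\<^sub>N"
      using lin_add[OF q(1) fB(1) lin_closed[OF l(1) d'(2)]] d(2) lin_zero[OF B N q(1)] by simp
    hence "q (l (snd d)) = \<zero>\<^sub>N" using fB(2) N lin_closed[OF q(1) lin_closed[OF l(1) d'(2)]] by simp
    hence c: "snd d \<in> car (Om N)" using l(2)[OF d'(2)] d'(2) by (simp add: ker_def)
    have "f (fst d) \<oplus>\<^sub>U s (snd d) = f (fst d \<oplus>\<^sub>(?A) l (snd d))"
      using lin_add[OF f d'(1) lin_closed[OF lO c]] s(2)[OF c] by simp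
    also have "\<dots> = f \<zero>\<^sub>(?A)" using d(2) by simp
    finally show ?thesis using lin_zero[OF A U f] by simp
  qed
  obtain \<Phi> where \<Phi>: "lin B U \<Phi>" "\<forall>d\<in>car ?D. \<Phi> (fst d \<oplus>\<^sub>B l (snd d)) = f (fst d) \<oplus>\<^sub>U s (snd d)"
    using factor'[OF D B U g onto h kill] by blast
  have "\<Phi> x = f x" if x: "x \<in> ker B N q" for x
  proof -
    have xA: "x \<in> car ?A" "x \<in> car B" using x by (auto simp: ker_def)
    have "(x, \<zero>\<^sub>(F N)) \<in> car ?D" using xA(1) fm_zero[OF FN] by (simp del: F_simps)
    hence "\<Phi> (x \<oplus>\<^sub>B l \<zero>\<^sub>(F N)) = f x \<oplus>\<^sub>U s \<zero>\<^sub>(F N)" using \<Phi>(2) by fastforce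
    thus ?thesis using lin_zero[OF FN B l(1)] lin_zero[OF FN U s(1)] fm_zeros(2)[OF B xA(2)] fm_zeros(2)[OF U lin_closed[OF f xA(1)]] by simp
  qed
  thus ?thesis using \<Phi>(1) by blast
qed

text \<open>The case \<open>\<eta> = 0\<close>, where injectivity on Ext means that Ext(N, U)
  vanishes.\<close>

lemma ext1_split:
  assumes B: "fm B" and N: "fm N" and U: "fm U" and q: "lin B N q" "q ` car B = car N"
    and v: "ext1_vanishes R N U" and f: "lin (sub_mod B (ker B N q)) U f"
  shows "\<exists>\<Phi>. lin B U \<Phi> \<and> (\<forall>x\<in>ker B N q. \<Phi> x = f x)"
  by (rule ext_extend[OF B N U U q lin_zero_map[OF U] _ f lin_zero_map[OF U] refl]) (use v ext1_vanishes_iff[OF N U] in blast)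

lemma ext1_vanishes_projective:
  assumes P: "fm P" "projective R P" and N: "fm N" shows "ext1_vanishes R P N" unfolding ext1_vanishes_iff[OF P(1) N]
proof (intro allI impI)
  fix \<psi> assume \<psi>: "lin (Om P) N \<psi>"
  note FP = fm_F[OF P(1)]
  obtain s where s: "lin P (F P) s" "!!x. x \<in> car P ==> pi P (s x) = x"
    using proj_lift[OF P(2,1) FP P(1) lin_pi[OF P(1)] pi_onto[OF P(1)] lin_id] by metis
  let ?r = "\<lambda>c. c \<ominus>\<^sub>(F P) s (pi P c)"
  have r: "lin (F P) (F P) ?r" using lin_diff[OF FP lin_id lin_comp[OF lin_pi[OF P(1)] s(1)]] .
  have "?r c \<in> ker (F P) P (pi P)" if c: "c \<in> car (F P)" for c
    using lin_closed[OF r c] lin_minus[OF FP P(1) lin_pi[OF P(1)] c lin_closed[OF lin_comp[OF lin_pi[OF P(1)] s(1)] c]]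
      s(2)[OF lin_closed[OF lin_pi[OF P(1)] c]] lin_closed[OF lin_pi[OF P(1)] c] P(1) by (simp add: ker_def del: F_simps)
  hence rO: "lin (F P) (Om P) ?r" unfolding Om_eq by (rule lin_sub_cod[OF r])
  have "\<psi> (?r x) = \<psi> x" if x: "x \<in> car (Om P)" for x
  proof -
    have "pi P x = \<zero>\<^sub>P" using x by (simp add: ker_def)
    thus ?thesis using lin_zero[OF P(1) FP s(1)] fm_zeros(4)[OF FP Om_in_F[OF x]] by simp
  qed
  thus "extendable P N \<psi>" unfolding extendable_def using lin_comp[OF rO \<psi>] by blast
qed

text \<open>Ext(P, R) has one element, and \<open>h_reg\<close> turns this into the size of
  \<open>tau P\<close>.\<close>

lemma tau_projective:
  assumes P: "fm P" "projective R P" shows "is_zero (tau P)"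
proof -
  have "e P Rm = 1" using ext1_vanishes_projective[OF P fm_reg] ext1_vanishes_card[OF P(1) fm_reg] by simp
  hence "h Rm (tau P) = 1" using e_eq_h_tau[OF P(1) fm_reg] by simp
  thus ?thesis using h_reg[OF fm_tau[OF P(1)]] is_zero_iff_card[OF fm_tau[OF P(1)]] by simp
qed

lemma torsionless_Rm: "torsionless Rm" unfolding torsionless_def using lin_id[of Rm] by (metis reg_simps(2))

text \<open>The image of a functional is a left ideal, hence projective, so the functional splits.
  For an indecomposable \<open>U\<close> either its kernel is zero, which makes \<open>U\<close>
  torsionless and projective, or its image is.\<close>

lemma indec_stemless:
  assumes U: "fm U" "indec U" "\<not> projective R U" shows "stemless U" unfolding stemless_def
proof (intro allI impI ballI)
  fix \<phi> x assume \<phi>: "lin U Rm \<phi>" and x: "x \<in> car U"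
  have I: "submodule (\<phi> ` car U) R Rm" using sub_image[OF U(1) fm_reg \<phi> sub_all[OF U(1)]] .
  let ?J = "sub_mod Rm (\<phi> ` car U)"
  note J = fm_sub[OF fm_reg I]
  have \<phi>J: "lin U ?J \<phi>" using \<phi> by (rule lin_sub_cod) auto
  obtain s where s: "lin ?J U s" "!!y. y \<in> car ?J ==> \<phi> (s y) = y"
    using proj_lift[OF projective_left_ideal[OF I] J U(1) J \<phi>J _ lin_id] by auto
  have "int_direct_sum R U (ker U ?J \<phi>) (s ` car ?J)" by (rule retract_direct_sum[OF U(1) J \<phi>J s(1,2)])
  then consider "ker U ?J \<phi> = {\<zero>\<^sub>U}" | "s ` car ?J = {\<zero>\<^sub>U}" using U(2) unfolding indecomposable_def by blast
  thus "\<phi> x = \<zero>"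
  proof cases
    case 1
    have "torsionless U" by (rule torsionless_embed[OF U(1) fm_reg \<phi> _ torsionless_Rm]) (use 1 in \<open>auto simp: ker_def\<close>)
    thus ?thesis using U projective_torsionless by blast
  next
    case 2
    have y: "\<phi> x \<in> car ?J" using x by simp
    hence "s (\<phi> x) = \<zero>\<^sub>U" using 2 by blast
    thus ?thesis using s(2)[OF y] lin_zero[OF U(1) fm_reg \<phi>] by simp
  qed
qed

lemma stemless_projective_zero:
  assumes "fm U" "stemless U" "projective R U" shows "is_zero U"
proof -
  have "x = \<zero>\<^sub>U" if "x \<in> car U" for x using stemless_torsionless[OF assms(1,2) torsionless_projective[OF assms(1,3)] lin_id that] .
  thus ?thesis using is_zeroI[OF assms(1)] by simp
qed

lemma tau_iso:
  assumes MN: "mod_iso R M N" and M: "fm M" and N: "fm N" shows "mod_iso R (tau M) (tau N)"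
proof -
  obtain f where f: "lin M N f" "bij_betw f (car M) (car N)" using mod_isoE[OF MN] .
  let ?g = "inv_into (car M) f"
  note g = lin_bij_inv[OF M f]
  have gf: "tmap N M ?g (tmap M N f \<chi>) = \<chi>" if \<chi>: "\<chi> \<in> car (tau M)" for \<chi>
    using tau_map_comp[OF M N M f(1) g(1) \<chi>] tau_map_cong[OF M M lin_comp[OF f(1) g(1)] _ \<chi>, of "\<lambda>x. x"]
      bij_betw_inv_into_left[OF f(2)] tau_map_id[OF M \<chi>] by simp
  have fg: "tmap M N f (tmap N M ?g \<chi>) = \<chi>" if \<chi>: "\<chi> \<in> car (tau N)" for \<chi>
    using tau_map_comp[OF N M N g(1) f(1) \<chi>] tau_map_cong[OF N N lin_comp[OF g(1) f(1)] _ \<chi>, of "\<lambda>x. x"]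
      bij_betw_inv_into_right[OF f(2)] tau_map_id[OF N \<chi>] by simp
  have "bij_betw (tmap M N f) (car (tau M)) (car (tau N))" by (rule bij_betwI[where g="tmap N M ?g"])
      (use gf fg tau_map_closed[OF M N f(1)] tau_map_closed[OF N M g(1)] in blast)+
  thus ?thesis using mod_isoI[OF fm_tau[OF M] lin_tau_map[OF M N f(1)]] by blast
qed

lemma e_iso:
  assumes "mod_iso R M M'" "mod_iso R N N'" "fm M" "fm M'" "fm N" "fm N'" shows "e M N = e M' N'"
  using h_iso[OF assms(2) tau_iso[OF assms(1,3,4)] assms(5,6) fm_tau[OF assms(3)] fm_tau[OF assms(4)]]
    e_eq_h_tau assms by metis

lemma ext1_vanishes_iso:
  assumes "mod_iso R M M'" "mod_iso R N N'" "fm M" "fm M'" "fm N" "fm N'"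
  shows "ext1_vanishes R M N \<longleftrightarrow> ext1_vanishes R M' N'" using e_iso[OF assms] ext1_vanishes_card assms by metis

subsection \<open>Injective modules\<close>

lemma inj_lift:
  assumes I: "fm I" "injective R I" and A: "fm A" and B: "fm B" and i: "lin A B i" "inj_on i (car A)" and f: "lin A I f"
  shows "\<exists>k. lin B I k \<and> (\<forall>x\<in>car A. k (i x) = f x)"
proof -
  obtain A' :: "'r nmod" where A': "fm A'" "mod_iso R A A'" using exists_nat_copy[OF A] .
  obtain B' :: "'r nmod" where B': "fm B'" "mod_iso R B B'" using exists_nat_copy[OF B] .
  obtain a where a: "lin A A' a" "bij_betw a (car A) (car A')" using mod_isoE[OF A'(2)] .
  obtain b where b: "lin B B' b" "bij_betw b (car B) (car B')" using mod_isoE[OF B'(2)] .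
  note a' = lin_bij_inv[OF A a]
  let ?a = "inv_into (car A) a"
  let ?i = "\<lambda>x\<in>car A'. b (i (?a x))" and ?f = "\<lambda>x\<in>car A'. f (?a x)"
  have "?i \<in> Hom A' B'" using restrict_mod_hom[OF lin_comp[OF a'(1) lin_comp[OF i(1) b(1)]] A'(1)] .
  moreover have "?f \<in> Hom A' I" using restrict_mod_hom[OF lin_comp[OF a'(1) f] A'(1)] .
  moreover have "inj_on ?i (car A')"
  proof (rule inj_onI)
    fix x y assume xy: "x \<in> car A'" "y \<in> car A'" "?i x = ?i y"
    have "?a x \<in> car A" "?a y \<in> car A" using xy lin_closed[OF a'(1)] by blast+
    hence "?a x = ?a y" using xy i(2) b(2) lin_closed[OF i(1)] by (simp add: bij_betw_def inj_on_def)
    thus "x = y" using xy a'(2) by (meson bij_betw_imp_inj_on inj_onD)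
  qed
  ultimately obtain k where k: "k \<in> Hom B' I" "compose (car A') k ?i = ?f"
    using I(2) A'(1) B'(1) unfolding injective_def fl_mods_iff[symmetric] by blast
  have kl: "lin B' I k" using k(1) by (simp add: mod_hom_iff)
  have "k (b (i x)) = f x" if x: "x \<in> car A" for x
    using fun_cong[OF k(2), of "a x"] lin_closed[OF a(1) x] bij_betw_inv_into_left[OF a(2) x] by (simp add: compose_def)
  thus ?thesis using lin_comp[OF b(1) kl] by blast
qed

lemma injectiveI:
  assumes I: "fm I"
    and lift: "!!(A :: 'r nmod) (B :: 'r nmod) i f. [|fm A; fm B; lin A B i; inj_on i (car A); lin A I f|] ==>
      \<exists>k. lin B I k \<and> (\<forall>x\<in>car A. k (i x) = f x)"
  shows "injective R I" unfolding injective_def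
proof (intro conjI ballI impI)
  show "left_module R I" using I fm_mod by auto
  fix A :: "'r nmod" and B :: "'r nmod" and i f
  assume *: "A \<in> fl_mods R" "B \<in> fl_mods R" "i \<in> Hom A B" "f \<in> Hom A I" "inj_on i (car A)"
  hence B: "fm B" by simp
  obtain k where k: "lin B I k" "\<forall>x\<in>car A. k (i x) = f x" using lift[of A B i f] * by (auto simp: mod_hom_iff)
  have ic: "i x \<in> car B" if "x \<in> car A" for x using *(3) that by (auto simp: mod_hom_def)
  have "compose (car A) (restrict k (car B)) i = f"
    by (rule extensionalityI[of _ "car A"]) (use k * ic in \<open>auto simp: compose_def mod_hom_iff\<close>)
  thus "\<exists>h\<in>Hom B I. compose (car A) h i = f" using restrict_mod_hom[OF k(1) B] by blast
qed

text \<open>An embedding of \<open>A\<close> in \<open>B\<close> has a cokernel \<open>N\<close>,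
  and extension along it is governed by Ext(N, I). The vanishing condition is what the Hom counts
  can handle.\<close>

lemma injective_iff:
  fixes I :: "('r, 'a) module"
  assumes I: "fm I"
  shows "injective R I \<longleftrightarrow> (\<forall>N :: 'r nmod. fm N --> ext1_vanishes R N I)"
proof
  assume inj: "injective R I"
  have "ext1_vanishes R N I" if N: "fm N" for N :: "'r nmod" unfolding ext1_vanishes_iff[OF N I] extendable_def
    using inj_lift[OF I inj fm_Om[OF N] fm_F[OF N] lin_Om_F[OF N]] by (simp add: inj_on_def)
  thus "\<forall>N :: 'r nmod. fm N --> ext1_vanishes R N I" by blast
next
  assume v: "\<forall>N :: 'r nmod. fm N --> ext1_vanishes R N I"
  show "injective R I"
  proof (rule injectiveI[OF I])
    fix A :: "'r nmod" and B :: "'r nmod" and i f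
    assume A: "fm A" and B: "fm B" and i: "lin A B i" "inj_on i (car A)" and f: "lin A I f"
    let ?K = "i ` car A"
    have K: "submodule ?K R B" using sub_image[OF A B i(1) sub_all[OF A]] .
    have iK: "lin A (sub_mod B ?K) i" using i(1) by (rule lin_sub_cod) auto
    have bij: "bij_betw i (car A) (car (sub_mod B ?K))" using i(2) by (simp add: bij_betw_def)
    note r = lin_bij_inv[OF A iK bij]
    obtain N :: "'r nmod" and q where N: "fm N" "lin B N q" "q ` car B = car N" "ker B N q = ?K" using quot_nat[OF B K] .
    obtain \<Phi> where \<Phi>: "lin B I \<Phi>" "\<forall>x\<in>?K. \<Phi> x = f (inv_into (car A) i x)"
      using ext1_split[OF B N(1) I N(2,3) v[rule_format, OF N(1)], unfolded N(4), OF lin_comp[OF r(1) f]] by blast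
    hence "\<forall>x\<in>car A. \<Phi> (i x) = f x" using i(2) by simp
    thus "\<exists>k. lin B I k \<and> (\<forall>x\<in>car A. k (i x) = f x)" using \<Phi>(1) by blast
  qed
qed

lemma injective_iso:
  assumes "mod_iso R I J" "fm I" "fm J" "injective R I" shows "injective R J" unfolding injective_iff[OF assms(3)]
proof (intro allI impI)
  fix N :: "'r nmod" assume N: "fm N"
  have "ext1_vanishes R N I" using assms(4) N unfolding injective_iff[OF assms(2)] by simp
  thus "ext1_vanishes R N J" using ext1_vanishes_iso[OF iso_refl[OF N] assms(1) N N assms(2,3)] by simp
qed

text \<open>Heredity on the injective side: a cocycle into \<open>U\<close> lifts to
  \<open>J\<close> because syzygies are projective, and there it extends.\<close>

lemma injective_image:
  assumes J: "fm J" "injective R J" and U: "fm U" and f: "lin J U f" "f ` car J = car U"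
  shows "injective R U" unfolding injective_iff[OF U]
proof (intro allI impI)
  fix N :: "'r nmod" assume N: "fm N"
  show "ext1_vanishes R N U" unfolding ext1_vanishes_iff[OF N U]
  proof (intro allI impI)
    fix \<psi> assume \<psi>: "lin (Om N) U \<psi>"
    obtain k where k: "lin (Om N) J k" "!!x. x \<in> car (Om N) ==> f (k x) = \<psi> x"
      using proj_lift[OF projective_Om[OF N] fm_Om[OF N] J(1) U f \<psi>] by metis
    have "extendable N J k" using J(2) injective_iff[OF J(1)] N ext1_vanishes_iff[OF N J(1)] k(1) by blast
    from extendable_cong[OF extendable_comp[OF this f(1)] k(2)] show "extendable N U \<psi>" .
  qed
qed

text \<open>The image is injective by \<open>injective_image\<close>, so it is a nonzero summand of
  \<open>U\<close>, that is, all of it.\<close>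

lemma injective_to_indec:
  assumes J: "fm J" "injective R J" and U: "fm U" "indec U" and f: "lin J U f"
    and x: "x \<in> car J" "f x \<noteq> \<zero>\<^sub>U"
  shows "injective R U"
proof -
  let ?I = "f ` car J"
  have I: "submodule ?I R U" using sub_image[OF J(1) U(1) f sub_all[OF J(1)]] .
  note S = fm_sub[OF U(1) I]
  have fI: "lin J (sub_mod U ?I) f" using f by (rule lin_sub_cod) auto
  have inj: "injective R (sub_mod U ?I)" by (rule injective_image[OF J S fI]) simp
  obtain r where r: "lin U (sub_mod U ?I) r" "\<forall>y\<in>car (sub_mod U ?I). r y = y"
    using inj_lift[OF S inj S U(1) lin_incl[OF U(1) I] _ lin_id] by auto
  have rU: "lin U U r" using lin_comp[OF r(1) lin_incl[OF U(1) I]] .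
  have "\<forall>y\<in>car U. r (r y) = r y" using r lin_closed[OF r(1)] by blast
  hence "(\<forall>y\<in>car U. r y = \<zero>\<^sub>U) \<or> (\<forall>y\<in>car U. r y = y)" using U rU indecomposable_iff[OF U(1)] by blast
  moreover have "r (f x) = f x" "f x \<in> car U" using r(2) x(1) lin_closed[OF f x(1)] by auto
  ultimately have "\<forall>y\<in>car U. r y = y" using x(2) by metis
  hence "?I = car U" using lin_closed[OF r(1)] subD(1)[OF I U(1)] by (auto; metis sub_mod_simps(1))
  thus ?thesis using inj sub_mod_self by metis
qed

subsection \<open>The inverse translate\<close>

lemma tau_minusD:
  assumes U: "fm U" and tm: "tau_minus R U X"
  obtains \<eta> where "fm X" "lin U (tau X) \<eta>"
    "\<forall>(M :: 'r nmod) f. fm M --> lin U (tau M) f --> (\<exists>g. lin X M g \<and> (\<forall>u\<in>car U. tmap X M g (\<eta> u) = f u))"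
    "\<forall>(M :: 'r nmod) g g'. fm M --> lin X M g --> lin X M g' -->
      (\<forall>u\<in>car U. tmap X M g (\<eta> u) = tmap X M g' (\<eta> u)) --> (\<forall>x\<in>car X. g x = g' x)"
proof -
  obtain \<eta> where X: "fm X" and \<eta>: "\<eta> \<in> Hom U (tau X)"
    and univ': "\<forall>M\<in>fl_mods R. \<forall>f\<in>Hom U (tau M).
      \<exists>!g. g \<in> Hom X M \<and> compose (car U) (tmap X M g) \<eta> = f"
    using tm unfolding tau_minus_def by (elim conjE bexE) (rule that, simp, assumption, assumption)
  note univ = univ'[rule_format]
  have \<eta>l: "lin U (tau X) \<eta>" using \<eta> by (simp add: mod_hom_iff)
  show thesis
  proof (rule that[OF X \<eta>l]; intro allI impI)
    fix M :: "'r nmod" and f assume M: "fm M" and f: "lin U (tau M) f"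
    obtain g where g: "g \<in> Hom X M" "compose (car U) (tmap X M g) \<eta> = restrict f (car U)"
      using univ[of M "restrict f (car U)"] restrict_mod_hom[OF f U] M unfolding fl_mods_iff by blast
    have "tmap X M g (\<eta> u) = f u" if "u \<in> car U" for u using fun_cong[OF g(2), of u] that by (simp add: compose_def)
    thus "\<exists>g. lin X M g \<and> (\<forall>u\<in>car U. tmap X M g (\<eta> u) = f u)" using g(1) by (auto simp: mod_hom_iff)
  next
    fix M :: "'r nmod" and g g' assume M: "fm M" and g: "lin X M g" "lin X M g'"
      and eq: "\<forall>u\<in>car U. tmap X M g (\<eta> u) = tmap X M g' (\<eta> u)"
    let ?f = "compose (car U) (tmap X M (restrict g (car X))) \<eta>"
    let ?f' = "compose (car U) (tmap X M (restrict g' (car X))) \<eta>"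
    have rc: "tmap X M (restrict k (car X)) (\<eta> u) = tmap X M k (\<eta> u)" if "lin X M k" "u \<in> car U" for k u
      using tau_map_cong[OF X M that(1) _ lin_closed[OF \<eta>l that(2)], of "restrict k (car X)"] by simp
    have ff: "?f = ?f'" unfolding compose_def using eq rc[OF g(1)] rc[OF g(2)] by (auto intro!: restrict_ext)
    have rl: "lin X M (restrict g (car X))" using restrict_mod_hom[OF g(1) X] by (simp add: mod_hom_iff)
    have "?f \<in> Hom U (tau M)" using restrict_mod_hom[OF lin_comp[OF \<eta>l lin_tau_map[OF X M rl]] U] by (simp add: compose_def)
    hence "restrict g (car X) = restrict g' (car X)"
      using univ[of M ?f] ff restrict_mod_hom[OF g(1) X] restrict_mod_hom[OF g(2) X] M unfolding fl_mods_iff by metis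
    thus "\<forall>x\<in>car X. g x = g' x" by (metis restrict_apply')
  qed
qed

text \<open>The adjunction composed with the Auslander-Reiten formula.\<close>

lemma tau_minus_h:
  assumes U: "fm U" and tm: "tau_minus R U X" and M: "fm (M :: 'r nmod)"
  shows "fm X" "h X M = e M U"
proof -
  obtain \<eta> where X: "fm X" and \<eta>: "lin U (tau X) \<eta>"
    and ex: "\<forall>(M :: 'r nmod) f. fm M --> lin U (tau M) f --> (\<exists>g. lin X M g \<and> (\<forall>u\<in>car U. tmap X M g (\<eta> u) = f u))"
    and uni: "\<forall>(M :: 'r nmod) g g'. fm M --> lin X M g --> lin X M g' -->
      (\<forall>u\<in>car U. tmap X M g (\<eta> u) = tmap X M g' (\<eta> u)) --> (\<forall>x\<in>car X. g x = g' x)" using tau_minusD[OF U tm] .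
  show "fm X" by fact
  have "bij_betw (\<lambda>g. \<lambda>u\<in>car U. tmap X M g (\<eta> u)) (Hom X M) (Hom U (tau M))"
  proof (rule bij_betwI')
    fix g g' assume g: "g \<in> Hom X M" "g' \<in> Hom X M"
    show "(\<lambda>u\<in>car U. tmap X M g (\<eta> u)) = (\<lambda>u\<in>car U. tmap X M g' (\<eta> u)) \<longleftrightarrow> g = g'"
    proof
      assume eq: "(\<lambda>u\<in>car U. tmap X M g (\<eta> u)) = (\<lambda>u\<in>car U. tmap X M g' (\<eta> u))"
      have "\<forall>u\<in>car U. tmap X M g (\<eta> u) = tmap X M g' (\<eta> u)"
      proof
        show "tmap X M g (\<eta> u) = tmap X M g' (\<eta> u)" if "u \<in> car U" for u using fun_cong[OF eq, of u] that by simp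
      qed
      thus "g = g'" using uni M g by (intro mod_hom_eqI[OF g]) (auto simp: mod_hom_iff)
    qed simp
  next
    show "(\<lambda>u\<in>car U. tmap X M g (\<eta> u)) \<in> Hom U (tau M)" if "g \<in> Hom X M" for g
      using restrict_mod_hom[OF lin_comp[OF \<eta> lin_tau_map[OF X M]] U, of g] that by (simp add: mod_hom_iff)
  next
    fix f assume f: "f \<in> Hom U (tau M)"
    hence "lin U (tau M) f" by (simp add: mod_hom_iff)
    then obtain g where g: "lin X M g" "\<forall>u\<in>car U. tmap X M g (\<eta> u) = f u" using ex M by blast
    have rg: "tmap X M (restrict g (car X)) (\<eta> u) = f u" if "u \<in> car U" for u
      using tau_map_cong[OF X M g(1) _ lin_closed[OF \<eta> that], of "restrict g (car X)"] g(2) that by simp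
    have "f = (\<lambda>u\<in>car U. tmap X M (restrict g (car X)) (\<eta> u))"
      by (rule extensionalityI[of _ "car U"]) (use f rg in \<open>auto simp: mod_hom_iff\<close>)
    thus "\<exists>g\<in>Hom X M. f = (\<lambda>u\<in>car U. tmap X M g (\<eta> u))" using restrict_mod_hom[OF g(1) X] by blast
  qed
  thus "h X M = e M U" using bij_betw_same_card e_eq_h_tau[OF M U] by metis
qed

text \<open>Hom(X, R) has the size of Ext(R, U), which vanishes. A copy of \<open>R\<close> on
  \<open>nat\<close> stands in for it, since \<open>tau_minus_h\<close> speaks of such
  modules.\<close>

lemma tau_minus_stemless:
  assumes U: "fm U" and tm: "tau_minus R U X" shows "stemless X"
proof -
  obtain Z :: "'r nmod" where Z: "fm Z" "mod_iso R Rm Z" using exists_nat_copy[OF fm_reg] .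
  note X = tau_minus_h(1)[OF U tm Z(1)]
  have "h X Rm = h X Z" using h_iso[OF iso_refl[OF X] Z(2) X X fm_reg Z(1)] .
  also have "\<dots> = e Z U" using tau_minus_h(2)[OF U tm Z(1)] .
  also have "\<dots> = e Rm U" using e_iso[OF Z(2) iso_refl[OF U] fm_reg Z(1) U U] by simp
  also have "\<dots> = 1" using ext1_vanishes_projective[OF fm_reg projective_reg U] ext1_vanishes_card[OF fm_reg U] by simp
  finally show ?thesis unfolding stemless_def using h_eq_1[OF X fm_reg] by simp
qed

lemma h_self_1: "fm X ==> h X X = 1 \<longleftrightarrow> is_zero X"
proof
  assume X: "fm X" and "h X X = 1"
  hence "\<forall>x\<in>car X. x = \<zero>\<^sub>X" using h_eq_1[OF X X] lin_id[of X] by blast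
  thus "is_zero X" using is_zeroI[OF X] by simp
next
  assume X: "fm X" and "is_zero X"
  hence "\<forall>x\<in>car X. f x = \<zero>\<^sub>X" if "lin X X f" for f using lin_zero[OF X X that] by (simp add: is_zero_def)
  thus "h X X = 1" using h_eq_1[OF X X] by blast
qed

lemma tau_minus_injective:
  assumes U: "fm U" "injective R U" and tm: "tau_minus R U X" shows "is_zero X"
proof -
  obtain Z :: "'r nmod" where Z: "fm Z" using exists_nat_copy[OF fm_reg] by metis
  note X = tau_minus_h(1)[OF U(1) tm Z]
  have "h X X = e X U" using tau_minus_h(2)[OF U(1) tm X] .
  also have "\<dots> = 1" using U(2) injective_iff[OF U(1)] X ext1_vanishes_card[OF X U(1)] by blast
  finally show ?thesis using h_self_1[OF X] by simp
qed

text \<open>The powers of an endomorphism of a finite module repeat from some exponent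
  \<open>i\<close> on with a period \<open>p\<close>.\<close>

lemma idempotent_power:
  assumes U: "fm U" and g: "lin U U g"
  obtains n where "n > 0" "\<forall>x\<in>car U. (g ^^ n) ((g ^^ n) x) = (g ^^ n) x"
proof -
  have cl: "(g ^^ n) x \<in> car U" if "x \<in> car U" for n x by (induction n) (use that lin_closed[OF g] in auto)
  let ?r = "\<lambda>n. \<lambda>x\<in>car U. (g ^^ n) x"
  have "range ?r \<subseteq> car U \<rightarrow>\<^sub>E car U" using cl by auto
  moreover have "finite (car U \<rightarrow>\<^sub>E car U)" using U by (intro finite_PiE) auto
  ultimately have "finite (range ?r)" by (rule finite_subset)
  hence "\<not> inj ?r" using finite_imageD by auto
  then obtain i j where "i \<noteq> j" "?r i = ?r j" unfolding inj_def by blast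
  then obtain i j where ij: "i < j" "?r i = ?r j" by (metis linorder_neqE_nat)
  define p where "p = j - i"
  have p: "p > 0" using ij by (simp add: p_def)
  have step: "(g ^^ (m + p)) x = (g ^^ m) x" if "m \<ge> i" "x \<in> car U" for m x
  proof -
    have "(g ^^ j) x = (g ^^ i) x" using fun_cong[OF ij(2), of x] that(2) by simp
    hence "(g ^^ (m - i)) ((g ^^ j) x) = (g ^^ (m - i)) ((g ^^ i) x)" by simp
    moreover have "m - i + j = m + p" "m - i + i = m" using that(1) ij(1) by (auto simp: p_def)
    ultimately show ?thesis by (metis comp_apply funpow_add)
  qed
  have steps: "(g ^^ (m + k * p)) x = (g ^^ m) x" if "m \<ge> i" "x \<in> car U" for m k x
    by (induction k) (use step[of "m + _ * p" x] that in \<open>auto simp: add.assoc[symmetric] add.commute[of p]\<close>)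
  \<comment> \<open>A positive multiple of the period that is at least \<open>i\<close>, so doubling
    the exponent changes nothing.\<close>
  let ?n = "Suc i * p"
  have "?n \<ge> i" using p by (metis Suc_le_mono le_SucI mult.commute mult_le_mono1 nat_mult_1 Suc_leI less_eq_Suc_le order_trans One_nat_def le_add2 mult_Suc_right)
  hence "(g ^^ ?n) ((g ^^ ?n) x) = (g ^^ ?n) x" if "x \<in> car U" for x using steps[of ?n x "Suc i"] that by (simp only: funpow_add comp_apply)
  moreover have "?n > 0" using p by simp
  ultimately show thesis using that by blast
qed

text \<open>Take a map \<open>f\<close> from \<open>A\<close> to \<open>U\<close> that does not
  extend along an embedding \<open>i\<close> of \<open>A\<close> in \<open>B\<close>, and form the
  pushout \<open>P\<close>. A retraction of \<open>P\<close> onto \<open>U\<close> would, after the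
  map from \<open>B\<close> to \<open>P\<close>, extend \<open>f\<close>.\<close>

lemma nonsplit_extension:
  assumes U: "fm U" "\<not> injective R U"
  obtains P :: "'r nmod" and j where "fm P" "lin U P j" "inj_on j (car U)"
    "\<not> (\<exists>r. lin P U r \<and> (\<forall>u\<in>car U. r (j u) = u))"
proof -
  have "\<exists>(A :: 'r nmod) (B :: 'r nmod) i f. fm A \<and> fm B \<and> lin A B i \<and> inj_on i (car A) \<and> lin A U f \<and>
      \<not> (\<exists>k. lin B U k \<and> (\<forall>x\<in>car A. k (i x) = f x))" using injectiveI[OF U(1)] U(2) by blast
  then obtain A :: "'r nmod" and B :: "'r nmod" and i f where A: "fm A" and B: "fm B" and i: "lin A B i" "inj_on i (car A)" and f: "lin A U f"
    and no: "\<not> (\<exists>k. lin B U k \<and> (\<forall>x\<in>car A. k (i x) = f x))" by blast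
  let ?D = "dsum U B"
  note D = fm_dsum[OF U(1) B] and dl = dsum_lin[OF U(1) B]
  have m: "lin A ?D (\<lambda>a. (f a, \<zero>\<^sub>B \<ominus>\<^sub>B i a))" using lin_pair[OF f lin_diff[OF B lin_zero_map[OF B] i(1)]] .
  let ?S = "(\<lambda>a. (f a, \<zero>\<^sub>B \<ominus>\<^sub>B i a)) ` car A"
  have S: "submodule ?S R ?D" using sub_image[OF A D m sub_all[OF A]] .
  obtain P :: "'r nmod" and q where P: "fm P" "lin ?D P q" "q ` car ?D = car P" "ker ?D P q = ?S" using quot_nat[OF D S] .
  let ?j = "\<lambda>u. q (u, \<zero>\<^sub>B)" and ?b = "\<lambda>b. q (\<zero>\<^sub>U, b)"
  have j: "lin U P ?j" and b: "lin B P ?b" using lin_comp[OF dl(1) P(2)] lin_comp[OF dl(2) P(2)] .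
  have jb: "?j (f a) = ?b (i a)" if a: "a \<in> car A" for a
  proof -
    have fa: "f a \<in> car U" and ia: "i a \<in> car B" using lin_closed[OF f a] lin_closed[OF i(1) a] .
    have x: "(f a, \<zero>\<^sub>B \<ominus>\<^sub>B i a) \<in> car ?D" using lin_closed[OF m a] .
    have y: "(\<zero>\<^sub>U, i a) \<in> car ?D" using ia U(1) by simp
    have "(f a, \<zero>\<^sub>B \<ominus>\<^sub>B i a) \<in> ker ?D P q" using P(4) a by blast
    hence "q (f a, \<zero>\<^sub>B \<ominus>\<^sub>B i a) = \<zero>\<^sub>P" by (simp add: ker_def)
    moreover have "(f a, \<zero>\<^sub>B) = (f a, \<zero>\<^sub>B \<ominus>\<^sub>B i a) \<oplus>\<^sub>(?D) (\<zero>\<^sub>U, i a)"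
      using fm_minus_add(1)[OF B fm_zero[OF B] ia] fm_zeros(2)[OF U(1) fa] by simp
    ultimately show ?thesis using lin_add[OF P(2) x y] fm_zeros(1)[OF P(1) lin_closed[OF P(2) y]] by simp
  qed
  have "inj_on ?j (car U)" unfolding inj_on_iff_ker[OF U(1) P(1) j]
  proof (intro ballI impI)
    fix u assume u: "u \<in> car U" "?j u = \<zero>\<^sub>P"
    hence "(u, \<zero>\<^sub>B) \<in> ker ?D P q" using B by (simp add: ker_def)
    then obtain a where a: "a \<in> car A" "u = f a" "\<zero>\<^sub>B = \<zero>\<^sub>B \<ominus>\<^sub>B i a" unfolding P(4) by auto
    have ia: "i a \<in> car B" using lin_closed[OF i(1) a(1)] .
    have "i a = (\<zero>\<^sub>B \<ominus>\<^sub>B i a) \<oplus>\<^sub>B i a" using a(3) ia B fm_zeros(1)[OF B ia] by simp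
    hence "i a = \<zero>\<^sub>B" using fm_minus_add(1)[OF B fm_zero[OF B] ia] by simp
    hence "a = \<zero>\<^sub>A" using i(2) inj_on_iff_ker[OF A B i(1)] a(1) by blast
    thus "u = \<zero>\<^sub>U" using a(2) lin_zero[OF A U(1) f] by simp
  qed
  moreover have "\<not> (\<exists>r. lin P U r \<and> (\<forall>u\<in>car U. r (?j u) = u))"
  proof
    assume "\<exists>r. lin P U r \<and> (\<forall>u\<in>car U. r (?j u) = u)"
    then obtain r where r: "lin P U r" "\<forall>u\<in>car U. r (?j u) = u" by blast
    have "\<forall>a\<in>car A. r (?b (i a)) = f a" using r(2) jb lin_closed[OF f] by metis
    thus False using no lin_comp[OF b r(1)] by blast
  qed
  ultimately show thesis using that[OF P(1) j] by blast
qed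

lemma injective_inverse:
  assumes A: "fm A" and B: "fm B" and i: "lin A B i" "inj_on i (car A)"
  obtains k where "lin (sub_mod B (i ` car A)) A k" "!!x. x \<in> car A ==> k (i x) = x"
proof -
  have iK: "lin A (sub_mod B (i ` car A)) i" using i(1) by (rule lin_sub_cod) auto
  have bij: "bij_betw i (car A) (car (sub_mod B (i ` car A)))" using i(2) by (simp add: bij_betw_def)
  show thesis using that[OF lin_bij_inv(1)[OF A iK bij]] i(2) by simp
qed

text \<open>The unit \<open>\<eta>\<close> of the adjunction is an isomorphism at \<open>U\<close>.
  The key is that it is injective on every Ext(N, -), which allows maps to be extended along
  extensions; this gives injectivity of \<open>\<eta>\<close>, then a retraction, which fullness of
  \<tau> turns into an inverse.\<close>

lemma tau_minus_indec:
  assumes U: "fm U" "indec U" "\<not> injective R U" and tm: "tau_minus R U X"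
  shows "mod_iso R U (tau X)" "fm X"
proof -
  obtain \<eta> where X: "fm X" and \<eta>: "lin U (tau X) \<eta>"
    and ex: "\<forall>(M :: 'r nmod) f. fm M --> lin U (tau M) f --> (\<exists>g. lin X M g \<and> (\<forall>u\<in>car U. tmap X M g (\<eta> u) = f u))"
    and uni: "\<forall>(M :: 'r nmod) g g'. fm M --> lin X M g --> lin X M g' -->
      (\<forall>u\<in>car U. tmap X M g (\<eta> u) = tmap X M g' (\<eta> u)) --> (\<forall>x\<in>car X. g x = g' x)" using tau_minusD[OF U(1) tm] .
  show "fm X" by fact
  note T = fm_tau[OF X]
  \<comment> \<open>A character of Ext(N, U) corresponds to a map from \<open>U\<close> to
    \<open>tau N\<close>. This factors through \<open>\<eta>\<close>, so the character comes from
    one of Ext(N, tau X) and is trivial on \<open>\<psi>\<close>.\<close>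
  have star: "extendable N U \<psi>" if N: "fm N" and \<psi>: "lin (Om N) U \<psi>" and x: "extendable N (tau X) (\<lambda>x. \<eta> (\<psi> x))"
    for N :: "'r nmod" and \<psi>
  proof (rule char_separate[OF N U(1) \<psi>])
    fix \<chi> assume \<chi>: "\<chi> \<in> characters (ext1 R N U)"
    have "lin U (tau N) (AR N U \<chi>)" using AR_hom[OF N U(1) \<chi>] by (simp add: mod_hom_iff)
    then obtain g where g: "lin X N g" "\<forall>u\<in>car U. tmap X N g (\<eta> u) = AR N U \<chi> u" using ex N by blast
    obtain \<chi>' where \<chi>': "\<chi>' \<in> characters (ext1 R N (tau X))"
      "!!\<psi>. lin (Om N) (tau X) \<psi> ==> \<chi>' (cls N (tau X) \<psi>) = (\<Prod>x\<in>car (Om N). tmap X N g (\<psi> x) (cls N Rm (db N x)))"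
      by (rule AR_surj[OF N T lin_tau_map[OF X N g(1)]]) (rule that; (assumption | simp only:))
    have "\<chi> (cls N U \<psi>) = (\<Prod>x\<in>car (Om N). AR N U \<chi> (\<psi> x) (cls N Rm (db N x)))" using AR_db[OF N U(1) \<chi> \<psi>] .
    also have "\<dots> = (\<Prod>x\<in>car (Om N). tmap X N g (\<eta> (\<psi> x)) (cls N Rm (db N x)))"
      by (rule prod.cong[OF refl]) (simp only: bspec[OF g(2) lin_closed[OF \<psi>]])
    also have "\<dots> = \<chi>' (cls N (tau X) (\<lambda>x. \<eta> (\<psi> x)))" using \<chi>'(2)[OF lin_comp[OF \<psi> \<eta>]] by simp
    also have "\<dots> = 1" using char_extendable[OF N T \<chi>'(1) lin_comp[OF \<psi> \<eta>] x] .
    finally show "\<chi> (cls N U \<psi>) = 1" .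
  qed
  have inj: "inj_on \<eta> (car U)" unfolding inj_on_iff_ker[OF U(1) T \<eta>]
  proof (intro ballI impI, rule ccontr)
    fix x assume x: "x \<in> car U" "\<eta> x = \<zero>\<^sub>(tau X)" "x \<noteq> \<zero>\<^sub>U"
    obtain P :: "'r nmod" and j where P: "fm P" and j: "lin U P j" "inj_on j (car U)"
      and no: "\<not> (\<exists>r. lin P U r \<and> (\<forall>u\<in>car U. r (j u) = u))" using nonsplit_extension[OF U(1,3)] .
    let ?K = "ker U (tau X) \<eta>"
    have K: "submodule ?K R U" using sub_ker[OF U(1) T \<eta>] .
    note S = fm_sub[OF U(1) K]
    have jK: "lin (sub_mod U ?K) P j" using lin_sub_dom[OF j(1) K U(1)] .
    have "inj_on j (car (sub_mod U ?K))" using j(2) subD(1)[OF K U(1)] by (auto intro: inj_on_subset)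
    then obtain k where k: "lin (sub_mod P (j ` car (sub_mod U ?K))) (sub_mod U ?K) k" "!!x. x \<in> car (sub_mod U ?K) ==> k (j x) = x"
      using injective_inverse[OF S P jK] by metis
    have jK': "submodule (j ` ?K) R P" using sub_image[OF U(1) P j(1) K] .
    obtain N :: "'r nmod" and q where N: "fm N" "lin P N q" "q ` car P = car N" "ker P N q = j ` ?K" using quot_nat[OF P jK'] .
    have k': "lin (sub_mod P (ker P N q)) U k" using lin_comp[OF k(1) lin_incl[OF U(1) K]] N(4) by simp
    have \<eta>k: "\<zero>\<^sub>(tau X) = \<eta> (k y)" if "y \<in> ker P N q" for y
    proof -
      obtain z where "z \<in> ?K" "y = j z" using \<open>y \<in> ker P N q\<close> N(4) by blast
      thus ?thesis using k(2)[of z] by (simp add: ker_def)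
    qed
    \<comment> \<open>The inclusion of the kernel of \<open>\<eta>\<close> into \<open>U\<close>,
      seen on its copy in \<open>P\<close>, becomes zero under \<open>\<eta>\<close>. The zero map
      extends this composite, so \<open>ext_extend\<close> extends the inclusion to all of
      \<open>P\<close>.\<close>
    obtain \<Phi> where \<Phi>: "lin P U \<Phi>" "\<forall>y\<in>ker P N q. \<Phi> y = k y"
      using ext_extend[OF P N(1) U(1) T N(2,3) \<eta> star[OF N(1)] k' lin_zero_map[OF T] \<eta>k] by blast
    let ?g = "\<lambda>u. \<Phi> (j u)"
    have g: "lin U U ?g" using lin_comp[OF j(1) \<Phi>(1)] .
    have xK: "x \<in> ?K" using x by (simp add: ker_def)
    have gx: "?g x = x" using \<Phi>(2) N(4) k(2)[of x] xK by simp
    \<comment> \<open>\<open>?g\<close> fixes the nonzero element \<open>x\<close>, so its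
      idempotent power is not zero and must be the identity. Then a power of \<open>?g\<close> after
      \<open>\<Phi>\<close> is a retraction of \<open>j\<close>, against the choice of
      \<open>P\<close>.\<close>
    obtain n where n: "n > 0" "\<forall>u\<in>car U. (?g ^^ n) ((?g ^^ n) u) = (?g ^^ n) u" using idempotent_power[OF U(1) g] .
    have gl: "lin U U (?g ^^ m)" for m
    proof (induction m)
      case 0 thus ?case using lin_id by (simp add: id_def)
    next
      case (Suc m) thus ?case using lin_comp[OF Suc g] by (simp add: comp_def)
    qed
    have gnx: "(?g ^^ m) x = x" for m by (induction m) (simp_all add: gx)
    have "(\<forall>u\<in>car U. (?g ^^ n) u = \<zero>\<^sub>U) \<or> (\<forall>u\<in>car U. (?g ^^ n) u = u)"
      using U(2) indecomposable_iff[OF U(1)] gl[of n] n(2) by blast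
    hence id: "\<forall>u\<in>car U. (?g ^^ n) u = u" using gnx[of n] x by metis
    obtain m where m: "n = Suc m" using n(1) by (cases n) auto
    have "(?g ^^ m) (\<Phi> (j u)) = u" if "u \<in> car U" for u using bspec[OF id that] unfolding m funpow_Suc_right by simp
    thus False using no lin_comp[OF \<Phi>(1) gl[of m]] by blast
  qed
  obtain k where k: "lin (sub_mod (tau X) (\<eta> ` car U)) U k" "!!x. x \<in> car U ==> k (\<eta> x) = x"
    using injective_inverse[OF U(1) T \<eta> inj] by metis
  have I: "submodule (\<eta> ` car U) R (tau X)" using sub_image[OF U(1) T \<eta> sub_all[OF U(1)]] .
  obtain N :: "'r nmod" and q where N: "fm N" "lin (tau X) N q" "q ` car (tau X) = car N" "ker (tau X) N q = \<eta> ` car U" using quot_nat[OF T I] .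
  have k': "lin (sub_mod (tau X) (ker (tau X) N q)) U k" using k(1) N(4) by simp
  have \<eta>k: "y = \<eta> (k y)" if "y \<in> ker (tau X) N q" for y using that N(4) k(2) by auto
  obtain \<Phi> where \<Phi>: "lin (tau X) U \<Phi>" "\<forall>y\<in>ker (tau X) N q. \<Phi> y = k y"
    using ext_extend[OF T N(1) U(1) T N(2,3) \<eta> star[OF N(1)] k' lin_id \<eta>k] by blast
  have \<Phi>\<eta>: "\<Phi> (\<eta> u) = u" if "u \<in> car U" for u using \<Phi>(2) N(4) k(2)[OF that] that by simp
  \<comment> \<open>The idempotent \<open>\<eta>\<close> after \<open>\<Phi>\<close> is \<tau> of
    some \<open>g\<close> by fullness. Since it fixes the image of \<open>\<eta>\<close>, uniqueness
    in the universal property makes \<open>g\<close> the identity, hence \<open>\<eta>\<close> is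
    onto.\<close>
  obtain g where g: "lin X X g" "!!\<chi>. \<chi> \<in> car (tau X) ==> tmap X X g \<chi> = \<eta> (\<Phi> \<chi>)"
    using tau_full[OF X X tau_minus_stemless[OF U(1) tm] lin_comp[OF \<Phi>(1) \<eta>]] by metis
  have "\<forall>u\<in>car U. tmap X X g (\<eta> u) = tmap X X (\<lambda>x. x) (\<eta> u)"
    using g(2)[OF lin_closed[OF \<eta>]] \<Phi>\<eta> tau_map_id[OF X lin_closed[OF \<eta>]] by simp
  hence "\<forall>x\<in>car X. g x = x" using uni X g(1) lin_id by blast
  hence "tmap X X g \<chi> = \<chi>" if "\<chi> \<in> car (tau X)" for \<chi>
    using tau_map_cong[OF X X g(1) _ that, of "\<lambda>x. x"] tau_map_id[OF X that] by simp
  hence "\<chi> = \<eta> (\<Phi> \<chi>)" if "\<chi> \<in> car (tau X)" for \<chi> using g(2)[OF that] that by simp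
  hence "\<eta> ` car U = car (tau X)" using lin_closed[OF \<eta>] lin_closed[OF \<Phi>(1)] by (blast intro: sym)
  thus "mod_iso R U (tau X)" using mod_isoI[OF U(1) \<eta>] inj by (simp add: bij_betw_def)
qed

text \<open>Idempotent, zero and identity endomorphisms correspond under \<tau>, which is fully
  faithful at \<open>X\<close>.\<close>

lemma tau_indecomposable:
  assumes X: "fm X" and S: "stemless X"
  shows "indec (tau X) \<longleftrightarrow> indec X"
proof -
  note T = fm_tau[OF X]
  have z: "is_zero (tau X) \<longleftrightarrow> is_zero X" using h_tau[OF X S X] h_self_1[OF X] h_self_1[OF T] by simp
  have idem: "(\<forall>x\<in>car X. g (g x) = g x) \<longleftrightarrow> (\<forall>\<chi>\<in>car (tau X). tmap X X g (tmap X X g \<chi>) = tmap X X g \<chi>)" (is "?L \<longleftrightarrow> ?R")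
    if g: "lin X X g" for g
  proof
    assume ?L
    thus ?R using tau_map_comp[OF X X X g g] tau_map_cong[OF X X lin_comp[OF g g], of g] by simp
  next
    assume ?R
    hence "tmap X X (\<lambda>x. g (g x)) \<chi> = tmap X X g \<chi>" if "\<chi> \<in> car (tau X)" for \<chi>
      using tau_map_comp[OF X X X g g that] that by simp
    thus ?L using tau_faithful[OF X X S lin_comp[OF g g] g] by blast
  qed
  have zer: "(\<forall>x\<in>car X. g x = \<zero>\<^sub>X) \<longleftrightarrow> (\<forall>\<chi>\<in>car (tau X). tmap X X g \<chi> = \<zero>\<^sub>(tau X))" (is "?L \<longleftrightarrow> ?R")
    if g: "lin X X g" for g
  proof
    assume ?L
    thus ?R using tau_zero_map[OF X X] tau_map_cong[OF X X g, of "\<lambda>x. \<zero>\<^sub>X"] by simp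
  next
    assume ?R
    thus ?L using tau_faithful[OF X X S g lin_zero_map[OF X]] tau_zero_map[OF X X] by simp
  qed
  have idn: "(\<forall>x\<in>car X. g x = x) \<longleftrightarrow> (\<forall>\<chi>\<in>car (tau X). tmap X X g \<chi> = \<chi>)" (is "?L \<longleftrightarrow> ?R")
    if g: "lin X X g" for g
  proof
    assume ?L
    thus ?R using tau_map_id[OF X] tau_map_cong[OF X X g, of "\<lambda>x. x"] by simp
  next
    assume ?R
    thus ?L using tau_faithful[OF X X S g lin_id] tau_map_id[OF X] by simp
  qed
  show ?thesis
  proof
    assume I: "indec (tau X)"
    show "indec X" unfolding indecomposable_iff[OF X]
    proof (intro conjI allI impI)
      show "\<not> is_zero X" using I z by (simp add: indecomposable_def)
      fix g assume g: "lin X X g" "\<forall>x\<in>car X. g (g x) = g x"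
      thus "(\<forall>x\<in>car X. g x = \<zero>\<^sub>X) \<or> (\<forall>x\<in>car X. g x = x)"
        using I lin_tau_map[OF X X g(1)] unfolding indecomposable_iff[OF T] idem[OF g(1)] zer[OF g(1)] idn[OF g(1)] by blast
    qed
  next
    assume I: "indec X"
    show "indec (tau X)" unfolding indecomposable_iff[OF T]
    proof (intro conjI allI impI)
      show "\<not> is_zero (tau X)" using I z by (simp add: indecomposable_def)
      fix \<epsilon> assume \<epsilon>: "lin (tau X) (tau X) \<epsilon>" "\<forall>\<chi>\<in>car (tau X). \<epsilon> (\<epsilon> \<chi>) = \<epsilon> \<chi>"
      obtain g where g: "lin X X g" "!!\<chi>. \<chi> \<in> car (tau X) ==> tmap X X g \<chi> = \<epsilon> \<chi>" using tau_full[OF X X S \<epsilon>(1)] by metis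
      have "\<forall>\<chi>\<in>car (tau X). tmap X X g (tmap X X g \<chi>) = tmap X X g \<chi>"
        using g(2) \<epsilon>(2) lin_closed[OF \<epsilon>(1)] by simp
      hence "(\<forall>x\<in>car X. g x = \<zero>\<^sub>X) \<or> (\<forall>x\<in>car X. g x = x)"
        using I g(1) unfolding indecomposable_iff[OF X] idem[OF g(1), symmetric] by blast
      thus "(\<forall>\<chi>\<in>car (tau X). \<epsilon> \<chi> = \<zero>\<^sub>(tau X)) \<or> (\<forall>\<chi>\<in>car (tau X). \<epsilon> \<chi> = \<chi>)"
        unfolding zer[OF g(1)] idn[OF g(1)] using g(2) by simp
    qed
  qed
qed

text \<open>Fullness gives existence and faithfulness uniqueness in the universal property of an
  isomorphism from \<open>U\<close> to \<open>tau X\<close>.\<close>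

lemma tau_minus_of_tau:
  assumes X: "fm (X :: 'r nmod)" and S: "stemless X" and U: "fm (U :: 'r nmod)" and iso: "mod_iso R (tau X) U"
  shows "tau_minus R U X"
proof -
  note T = fm_tau[OF X]
  obtain \<eta> where \<eta>: "lin U (tau X) \<eta>" "bij_betw \<eta> (car U) (car (tau X))" using mod_isoE[OF iso_sym[OF iso T U]] .
  note r = lin_bij_inv[OF U \<eta>]
  show ?thesis unfolding tau_minus_def
  proof (intro conjI bexI[of _ "restrict \<eta> (car U)"] ballI)
    show "X \<in> fl_mods R" using X by simp
    show "restrict \<eta> (car U) \<in> Hom U (tau X)" using restrict_mod_hom[OF \<eta>(1) U] .
    fix M :: "'r nmod" and f assume "M \<in> fl_mods R" and f: "f \<in> Hom U (tau M)"
    hence M: "fm M" by simp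
    have fl: "lin U (tau M) f" using f by (simp add: mod_hom_iff)
    have comp: "compose (car U) (tmap X M g) (restrict \<eta> (car U)) = f \<longleftrightarrow> (\<forall>u\<in>car U. tmap X M g (\<eta> u) = f u)" for g
    proof
      assume eq: "compose (car U) (tmap X M g) (restrict \<eta> (car U)) = f"
      show "\<forall>u\<in>car U. tmap X M g (\<eta> u) = f u" unfolding eq[symmetric] by (simp add: compose_def)
    next
      assume *: "\<forall>u\<in>car U. tmap X M g (\<eta> u) = f u"
      show "compose (car U) (tmap X M g) (restrict \<eta> (car U)) = f"
        by (rule extensionalityI[of _ "car U"]) (use f * in \<open>auto simp: compose_def mod_hom_iff\<close>)
    qed
    obtain g where g: "lin X M g" "!!\<chi>. \<chi> \<in> car (tau X) ==> tmap X M g \<chi> = f (inv_into (car U) \<eta> \<chi>)"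
      using tau_full[OF X M S lin_comp[OF r(1) fl]] by metis
    have rg: "tmap X M (restrict g (car X)) (\<eta> u) = f u" if u: "u \<in> car U" for u
      using tau_map_cong[OF X M g(1) _ lin_closed[OF \<eta>(1) u], of "restrict g (car X)"] g(2)[OF lin_closed[OF \<eta>(1) u]]
        bij_betw_inv_into_left[OF \<eta>(2) u] by simp
    show "\<exists>!g. g \<in> Hom X M \<and> compose (car U) (tmap X M g) (restrict \<eta> (car U)) = f"
    proof (rule ex1I)
      show "restrict g (car X) \<in> Hom X M \<and> compose (car U) (tmap X M (restrict g (car X))) (restrict \<eta> (car U)) = f"
        unfolding comp using restrict_mod_hom[OF g(1) X] rg by blast
      fix k assume k: "k \<in> Hom X M \<and> compose (car U) (tmap X M k) (restrict \<eta> (car U)) = f"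
      have kl: "lin X M k" using k by (simp add: mod_hom_iff)
      have "tmap X M k \<chi> = tmap X M g \<chi>" if "\<chi> \<in> car (tau X)" for \<chi>
      proof -
        obtain u where u: "u \<in> car U" "\<chi> = \<eta> u"
          using \<open>\<chi> \<in> car (tau X)\<close> unfolding bij_betw_imp_surj_on[OF \<eta>(2), symmetric] by blast
        thus ?thesis using k g(2)[OF that] bij_betw_inv_into_left[OF \<eta>(2) u(1)] unfolding comp by simp
      qed
      hence "k x = g x" if "x \<in> car X" for x using tau_faithful[OF X M S kl g(1) _ that] by blast
      thus "k = restrict g (car X)" by (intro mod_hom_eqI[OF conjunct1[OF k] restrict_mod_hom[OF g(1) X]]) simp
    qed
  qed
qed

end

section \<open>Translation orbits\<close>

context hereditary_ring
begin

text \<open>\<open>tt X U\<close>: \<open>X\<close> is indecomposable, not projective, and \<open>U\<close> is a copy of \<open>\<tau>X\<close>.  By the translation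
  chains that start or end in them, \<open>pp\<close> singles out the preprojective and \<open>qi\<close> the preinjective
  indecomposable modules.\<close>

definition tt :: "'r nmod => 'r nmod => bool" where
  "tt X U \<longleftrightarrow> fm X \<and> indec X \<and> \<not> projective R X \<and> fm U \<and> mod_iso R (tau X) U"

definition pp :: "'r nmod => bool" where
  "pp U \<longleftrightarrow> (\<exists>n P. (tt ^^ n) U P \<and> projective R P)"

definition qi :: "'r nmod => bool" where
  "qi U \<longleftrightarrow> (\<exists>n I. (tt ^^ n) I U \<and> injective R I)"

lemma tt_stemless: "tt X U ==> stemless X" using indec_stemless by (auto simp: tt_def)

lemma tt_fm: "tt X U ==> fm X \<and> fm U \<and> indec X \<and> mod_iso R (tau X) U" by (auto simp: tt_def)

lemma tt_exists: "[|fm X; indec X; \<not> projective R X|] ==> \<exists>U. tt X U" using exists_nat_copy[OF fm_tau] unfolding tt_def by metis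

lemma indec_nonzero: "[|fm X; indec X|] ==> h X X \<noteq> 1" using h_self_1 by (auto simp: indecomposable_def)

text \<open>Both Auslander-Reiten formulas for one step of an orbit. The second rewrites Ext(N, U)
  as Hom between translates and then removes \<tau> by \<open>h_tau\<close>.\<close>

lemma tt_e:
  assumes t: "tt X U" and N: "fm N" shows "e X N = h N U" "h X N = e N U"
proof -
  have X: "fm X" and U: "fm U" and iso: "mod_iso R (tau X) U" using tt_fm[OF t] by auto
  note T = fm_tau[OF X]
  show "e X N = h N U" using e_eq_h_tau[OF X N] h_iso[OF iso_refl[OF N] iso N N T U] by simp
  have "e N U = e N (tau X)" using e_iso[OF iso_refl[OF N] iso N N T U] by simp
  also have "\<dots> = h (tau X) (tau N)" using e_eq_h_tau[OF N T] .
  also have "\<dots> = h X N" using h_tau[OF X tt_stemless[OF t] N] .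
  finally show "h X N = e N U" by simp
qed

lemma tt_h:
  assumes t: "tt X U" and t': "tt Y V" shows "h X Y = h U V"
proof -
  have X: "fm X" and U: "fm U" and iso: "mod_iso R (tau X) U" using tt_fm[OF t] by auto
  have Y: "fm Y" and V: "fm V" and iso': "mod_iso R (tau Y) V" using tt_fm[OF t'] by auto
  show ?thesis using h_tau[OF X tt_stemless[OF t] Y] h_iso[OF iso iso' fm_tau[OF X] U fm_tau[OF Y] V] by simp
qed

text \<open>Ext(X, U) has the size of End(U), which is not 1, so \<open>U\<close> cannot be
  injective.\<close>

lemma tt_target:
  assumes t: "tt X U" shows "indec U" "\<not> injective R U"
proof -
  have X: "fm X" "indec X" and U: "fm U" and iso: "mod_iso R (tau X) U" using tt_fm[OF t] by auto
  show I: "indec U" using indecomposable_iso[OF iso fm_tau[OF X(1)] U] tau_indecomposable[OF X(1) tt_stemless[OF t]] X by simp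
  have "e X U \<noteq> 1" using tt_e(1)[OF t U] indec_nonzero[OF U I] by simp
  thus "\<not> injective R U" using injective_iff[OF U] ext1_vanishes_card[OF X(1) U] X(1) by blast
qed

lemma tt_source:
  assumes U: "fm U" "indec U" "\<not> injective R U" and tm: "tau_minus R U X" shows "tt X U"
proof -
  note iso = tau_minus_indec[OF U tm] and S = tau_minus_stemless[OF U(1) tm]
  note X = iso(2) and T = fm_tau[OF iso(2)]
  have iso': "mod_iso R (tau X) U" using iso_sym[OF iso(1) U(1) T] .
  have I: "indec X" using indecomposable_iso[OF iso(1) U(1) T U(2)] tau_indecomposable[OF X S] by simp
  moreover have "\<not> projective R X" using stemless_projective_zero[OF X S] I by (auto simp: indecomposable_def)
  ultimately show ?thesis using X U(1) iso' by (simp add: tt_def)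
qed

lemma tt_exists_source: "[|fm U; indec U; \<not> injective R U|] ==> \<exists>X. tt X U" using tau_minus_exists tt_source by blast

lemma tt_tau_minus: "tt X U ==> tau_minus R U X" using tau_minus_of_tau tt_stemless tt_fm by blast

lemma tt_iso:
  assumes t: "tt X U" and X': "fm X'" "mod_iso R X X'" and U': "fm U'" "mod_iso R U U'" shows "tt X' U'"
proof -
  have X: "fm X" "indec X" "\<not> projective R X" and U: "fm U" and iso: "mod_iso R (tau X) U" using t by (auto simp: tt_def)
  note T = fm_tau[OF X(1)] and T' = fm_tau[OF X'(1)]
  have "mod_iso R (tau X') U'" using iso_trans[OF iso_sym[OF tau_iso[OF X'(2) X(1) X'(1)] T T'] iso_trans[OF iso U'(2) T] T'] .
  moreover have "\<not> projective R X'" using projective_iso[OF iso_sym[OF X'(2) X(1) X'(1)] X'(1) X(1)] X(3) by blast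
  ultimately show ?thesis using indecomposable_iso[OF X'(2) X(1) X'(1) X(2)] X'(1) U'(1) by (simp add: tt_def)
qed

lemma tt_unique_target:
  assumes t: "tt X U" and t': "tt X' U'" and iso: "mod_iso R X X'" shows "mod_iso R U U'"
proof -
  have X: "fm X" and U: "fm U" and i: "mod_iso R (tau X) U" using tt_fm[OF t] by auto
  have X': "fm X'" and U': "fm U'" and i': "mod_iso R (tau X') U'" using tt_fm[OF t'] by auto
  note T = fm_tau[OF X] and T' = fm_tau[OF X']
  show ?thesis using iso_trans[OF iso_sym[OF i T U] iso_trans[OF tau_iso[OF iso X X'] i' T] U] .
qed

text \<open>Fullness lifts an isomorphism of the translates and its inverse, and faithfulness shows
  that the lifts are mutually inverse.\<close>

lemma tt_unique_source:
  assumes t: "tt X U" and t': "tt X' U'" and iso: "mod_iso R U U'" shows "mod_iso R X X'"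
proof -
  have X: "fm X" and U: "fm U" and i: "mod_iso R (tau X) U" using tt_fm[OF t] by auto
  have X': "fm X'" and U': "fm U'" and i': "mod_iso R (tau X') U'" using tt_fm[OF t'] by auto
  note T = fm_tau[OF X] and T' = fm_tau[OF X'] and S = tt_stemless[OF t] and S' = tt_stemless[OF t']
  have "mod_iso R (tau X) (tau X')" using iso_trans[OF i iso_trans[OF iso iso_sym[OF i' T' U'] U] T] .
  then obtain f where f: "lin (tau X) (tau X') f" "bij_betw f (car (tau X)) (car (tau X'))" using mod_isoE by metis
  note r = lin_bij_inv[OF T f]
  let ?f' = "inv_into (car (tau X)) f"
  obtain g where g: "lin X X' g" "!!\<chi>. \<chi> \<in> car (tau X) ==> tmap X X' g \<chi> = f \<chi>" using tau_full[OF X X' S f(1)] by metis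
  obtain g' where g': "lin X' X g'" "!!\<chi>. \<chi> \<in> car (tau X') ==> tmap X' X g' \<chi> = ?f' \<chi>" using tau_full[OF X' X S' r(1)] by metis
  have "tmap X X (\<lambda>x. g' (g x)) \<chi> = tmap X X (\<lambda>x. x) \<chi>" if \<chi>: "\<chi> \<in> car (tau X)" for \<chi>
    using tau_map_comp[OF X X' X g(1) g'(1) \<chi>] g(2)[OF \<chi>] g'(2)[OF lin_closed[OF f(1) \<chi>]] bij_betw_inv_into_left[OF f(2) \<chi>] tau_map_id[OF X \<chi>] by simp
  hence 1: "g' (g x) = x" if "x \<in> car X" for x using tau_faithful[OF X X S lin_comp[OF g(1) g'(1)] lin_id _ that] by blast
  have "tmap X' X' (\<lambda>x. g (g' x)) \<chi> = tmap X' X' (\<lambda>x. x) \<chi>" if \<chi>: "\<chi> \<in> car (tau X')" for \<chi>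
    using tau_map_comp[OF X' X X' g'(1) g(1) \<chi>] g'(2)[OF \<chi>] g(2)[OF lin_closed[OF r(1) \<chi>]] bij_betw_inv_into_right[OF f(2) \<chi>] tau_map_id[OF X' \<chi>] by simp
  hence 2: "g (g' x) = x" if "x \<in> car X'" for x using tau_faithful[OF X' X' S' lin_comp[OF g'(1) g(1)] lin_id _ that] by blast
  have "bij_betw g (car X) (car X')" by (rule bij_betwI[where g=g']) (use 1 2 lin_closed[OF g(1)] lin_closed[OF g'(1)] in blast)+
  thus ?thesis using mod_isoI[OF X g(1)] by blast
qed

lemma pp_iso:
  assumes "pp U" and U: "fm U" and U': "fm U'" and iso: "mod_iso R U U'" shows "pp U'"
proof -
  obtain n P where n: "(tt ^^ n) U P" "projective R P" using assms(1) by (auto simp: pp_def)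
  show ?thesis
  proof (cases n)
    case 0
    hence "(tt ^^ 0) U' U'" "projective R U'" using n projective_iso[OF iso U U'] by auto
    thus ?thesis unfolding pp_def by blast
  next
    case (Suc m)
    then obtain Y where "tt U Y" "(tt ^^ m) Y P" using n(1) relpowp_Suc_D2 by metis
    hence "tt U' Y" "(tt ^^ m) Y P" using tt_iso[OF _ U' iso] iso_refl tt_fm by blast+
    thus ?thesis using n(2) unfolding pp_def by (meson relpowp_Suc_I2)
  qed
qed

lemma qi_chain_iso:
  assumes "(tt ^^ n) I U" "injective R I" and U: "fm U" and U': "fm U'" and iso: "mod_iso R U U'"
  shows "\<exists>I'. (tt ^^ n) I' U' \<and> injective R I'"
proof (cases n)
  case 0
  hence "(tt ^^ n) U' U'" "injective R U'" using assms(1,2) injective_iso[OF iso U U'] by auto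
  thus ?thesis by blast
next
  case (Suc m)
  then obtain Y where "(tt ^^ m) I Y" "tt Y U" using assms(1) by auto
  hence "(tt ^^ m) I Y" "tt Y U'" using tt_iso[OF _ _ _ U' iso] iso_refl tt_fm by blast+
  thus ?thesis using assms(2) Suc by auto
qed

lemma qi_iso: "[|qi U; fm U; fm U'; mod_iso R U U'|] ==> qi U'" unfolding qi_def using qi_chain_iso by blast

text \<open>\<open>tt\<close> determines its partner only up to isomorphism, so a chain from
  \<open>X\<close> passes through a copy of \<open>U\<close>, and \<open>pp_iso\<close> compares the
  two.\<close>

lemma pp_tt: assumes t: "tt X U" shows "pp X \<longleftrightarrow> pp U"
proof
  assume "pp U"
  thus "pp X" using t unfolding pp_def by (meson relpowp_Suc_I2)
next
  assume "pp X"
  then obtain n P where n: "(tt ^^ n) X P" "projective R P" by (auto simp: pp_def)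
  have "n \<noteq> 0"
  proof
    assume "n = 0"
    hence "X = P" using n(1) by simp
    thus False using n(2) t unfolding tt_def by blast
  qed
  then obtain m where "n = Suc m" using not0_implies_Suc by blast
  then obtain Y where Y: "tt X Y" "(tt ^^ m) Y P" using n(1) relpowp_Suc_D2 by metis
  have "pp Y" using Y(2) n(2) unfolding pp_def by blast
  moreover have "mod_iso R Y U" using tt_unique_target[OF Y(1) t] iso_refl tt_fm[OF t] by blast
  ultimately show "pp U" using pp_iso tt_fm[OF Y(1)] tt_fm[OF t] by blast
qed

lemma qi_tt: assumes t: "tt X U" shows "qi X \<longleftrightarrow> qi U"
proof
  assume "qi X"
  thus "qi U" using t unfolding qi_def by (meson relpowp_Suc_I)
next
  assume "qi U"
  then obtain n I where n: "(tt ^^ n) I U" "injective R I" by (auto simp: qi_def)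
  have "n \<noteq> 0"
  proof
    assume "n = 0"
    hence "I = U" using n(1) by simp
    thus False using n(2) tt_target(2)[OF t] by blast
  qed
  then obtain m where "n = Suc m" using not0_implies_Suc by blast
  then obtain Y where Y: "tt Y U" "(tt ^^ m) I Y" using n(1) by auto
  have "qi Y" using Y(2) n(2) unfolding qi_def by blast
  moreover have "mod_iso R Y X" using tt_unique_source[OF Y(1) t] iso_refl tt_fm[OF t] by blast
  ultimately show "qi X" using qi_iso tt_fm[OF Y(1)] tt_fm[OF t] by blast
qed

text \<open>Translate both modules until \<open>Q\<close> is projective; the number of homomorphisms
  is unchanged by \<open>tt_h\<close>. At that stage the translate of \<open>U\<close> is not
  projective, hence has no nonzero map to a projective.\<close>

lemma hom_to_pp:
  assumes "fm U" "indec U" "\<not> pp U" "fm Q" "(tt ^^ n) Q P" "projective R P"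
  shows "h U Q = 1" using assms
proof (induction n arbitrary: U Q)
  case 0
  hence "Q = P" by simp
  have "\<not> projective R U" using 0(3) unfolding pp_def by (metis relpowp_0_I)
  hence "stemless U" using 0 indec_stemless by blast
  thus ?case using h_eq_1[OF 0(1,4)] stemless_torsionless[OF 0(1)] torsionless_projective[OF 0(4)] 0(6) \<open>Q = P\<close> by blast
next
  case (Suc n)
  obtain Q' where Q': "tt Q Q'" "(tt ^^ n) Q' P" using Suc.prems(5) relpowp_Suc_D2 by metis
  have "\<not> projective R U" using Suc.prems(3) unfolding pp_def by (metis relpowp_0_I)
  then obtain U' where U': "tt U U'" using tt_exists Suc.prems by blast
  have "h U' Q' = 1" by (rule Suc.IH) (use U' Q' Suc.prems tt_fm tt_target pp_tt in blast)+
  thus ?case using tt_h[OF U' Q'(1)] by simp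
qed

text \<open>Dually, move backwards along the orbits until \<open>J\<close> is injective, and use
  that an indecomposable receiving a nonzero map from an injective is injective.\<close>

lemma hom_from_qi:
  assumes "fm U" "indec U" "\<not> qi U" "fm J" "(tt ^^ n) I J" "injective R I"
  shows "h J U = 1" using assms
proof (induction n arbitrary: U J)
  case 0
  hence "J = I" by simp
  have "\<not> injective R U" using 0(3) unfolding qi_def by (metis relpowp_0_I)
  thus ?case using h_eq_1[OF 0(4,1)] injective_to_indec[OF 0(4) _ 0(1,2)] 0(6) \<open>J = I\<close> by blast
next
  case (Suc n)
  obtain J' where J': "tt J' J" "(tt ^^ n) I J'" using Suc.prems(5) by auto
  have "\<not> injective R U" using Suc.prems(3) unfolding qi_def by (metis relpowp_0_I)
  then obtain U' where U': "tt U' U" using tt_exists_source Suc.prems by blast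
  have "h J' U' = 1" by (rule Suc.IH) (use U' J' Suc.prems tt_fm tt_target qi_tt in blast)+
  thus ?case using tt_h[OF J'(1) U'] by simp
qed

lemma hom_pp: "[|fm U; indec U; \<not> pp U; fm Q; pp Q|] ==> h U Q = 1" using hom_to_pp unfolding pp_def[of Q] by blast

lemma hom_qi: "[|fm U; indec U; \<not> qi U; fm J; qi J|] ==> h J U = 1" using hom_from_qi unfolding qi_def[of J] by blast

subsection \<open>Indecomposable summands\<close>

lemma proper_summand:
  assumes M: "fm M" and U: "\<not> indec M" "\<not> is_zero M"
  obtains A B where "int_direct_sum R M A B" "card A < card (car M)" "card B < card (car M)"
proof -
  obtain A B where AB: "int_direct_sum R M A B" "A \<noteq> {\<zero>\<^sub>M}" "B \<noteq> {\<zero>\<^sub>M}"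
    using U unfolding indecomposable_def by blast
  have A: "submodule A R M" and B: "submodule B R M" and I: "A \<inter> B = {\<zero>\<^sub>M}" using AB(1) by (auto simp: int_direct_sum_iff)
  have "A \<subset> car M" "B \<subset> car M" using AB(2,3) I subD(1,2)[OF A M] subD(1,2)[OF B M] by blast+
  thus thesis using that[OF AB(1)] psubset_card_mono fm_finite[OF M] by blast
qed

text \<open>In a proper decomposition \<open>w\<close> has a nonzero component in one of the smaller
  summands, and induction finds an indecomposable summand there that detects it.\<close>

lemma indec_retract:
  fixes M :: "('r, 'a) module"
  assumes M: "fm M" and "w \<in> car M" "w \<noteq> \<zero>\<^sub>M"
  shows "\<exists>U p. submodule U R M \<and> indec (sub_mod M U) \<and> lin M (sub_mod M U) p \<and> (\<forall>u\<in>U. p u = u) \<and> p w \<noteq> \<zero>\<^sub>M"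
  using assms
proof (induction "card (car M)" arbitrary: M w rule: less_induct)
  case less
  note M = less.prems(1)
  show ?case
  proof (cases "indec M")
    case True
    thus ?thesis using less.prems sub_all[OF M] lin_id[of M] sub_mod_self[of M] by (intro exI[of _ "car M"] exI[of _ "\<lambda>x. x"]) simp
  next
    case False
    have nz: "\<not> is_zero M" using less.prems by (auto simp: is_zero_def)
    obtain A B where AB: "int_direct_sum R M A B" "card A < card (car M)" "card B < card (car M)" using proper_summand[OF M False nz] .
    have step: ?thesis if ids: "int_direct_sum R M A B" and c: "card A < card (car M)" and p: "lin M (sub_mod M A) p" "\<forall>u\<in>A. p u = u" and pw: "p w \<noteq> \<zero>\<^sub>M" for A B p
    proof -
      have A: "submodule A R M" using ids by (simp add: int_direct_sum_iff)
      note S = fm_sub[OF M A]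
      have pA: "p w \<in> A" using lin_closed[OF p(1) less.prems(2)] by simp
      obtain U q where U: "submodule U R (sub_mod M A)" "indec (sub_mod (sub_mod M A) U)"
        "lin (sub_mod M A) (sub_mod (sub_mod M A) U) q" "\<forall>u\<in>U. q u = u" "q (p w) \<noteq> \<zero>\<^sub>(sub_mod M A)"
        using less.hyps[of "sub_mod M A" "p w"] c S pA pw by auto
      have "lin M (sub_mod M U) (\<lambda>x. q (p x))" using lin_comp[OF p(1) U(3)] by (simp add: sub_mod_sub_mod)
      moreover have "submodule U R M" "U \<subseteq> A" using U(1) sub_sub[OF M A] by auto
      moreover have "\<forall>u\<in>U. q (p u) = u" using U(4) p(2) \<open>U \<subseteq> A\<close> by auto
      ultimately show ?thesis using U(2,5) unfolding sub_mod_sub_mod by (intro exI[of _ U] exI[of _ "\<lambda>x. q (p x)"]) simp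
    qed
    obtain p where p: "lin M (sub_mod M A) p" "\<forall>u\<in>A. p u = u" "\<forall>v\<in>B. p v = \<zero>\<^sub>M" "\<forall>x\<in>car M. x \<ominus>\<^sub>M p x \<in> B"
      using projection[OF M AB(1)] by metis
    show ?thesis
    proof (cases "p w = \<zero>\<^sub>M")
      case False
      thus ?thesis using step[OF AB(1,2) p(1,2)] by blast
    next
      case True
      note BA = int_direct_sum_sym[OF M AB(1)]
      obtain q where q: "lin M (sub_mod M B) q" "\<forall>u\<in>B. q u = u" using projection[OF M BA] by metis
      have "w \<in> B" using bspec[OF p(4) less.prems(2)] True less.prems M by simp
      hence "q w \<noteq> \<zero>\<^sub>M" using q(2) less.prems(3) by simp
      thus ?thesis using step[OF BA AB(3) q] by blast
    qed
  qed
qed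

text \<open>As in \<open>indec_retract\<close>, with \<open>f w\<close> nonzero forcing
  \<open>f\<close> to be nonzero on one of the two components of \<open>w\<close>.\<close>

lemma indec_retract_source:
  fixes M :: "('r, 'a) module" and N :: "('r, 'b) module"
  assumes M: "fm M" and N: "fm N" and f: "lin M N f" and "w \<in> car M" "f w \<noteq> \<zero>\<^sub>N"
  shows "\<exists>U p. submodule U R M \<and> indec (sub_mod M U) \<and> lin M (sub_mod M U) p \<and> (\<forall>u\<in>U. p u = u) \<and> (\<exists>u\<in>U. f u \<noteq> \<zero>\<^sub>N)"
  using assms
proof (induction "card (car M)" arbitrary: M w rule: less_induct)
  case less
  note M = less.prems(1) and f = less.prems(3)
  show ?case
  proof (cases "indec M")
    case True
    thus ?thesis using less.prems sub_all[OF M] lin_id[of M] sub_mod_self[of M] by (intro exI[of _ "car M"] exI[of _ "\<lambda>x. x"]) auto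
  next
    case False
    have nz: "\<not> is_zero M" using less.prems lin_zero[OF M N f] by (auto simp: is_zero_def)
    obtain A B where AB: "int_direct_sum R M A B" "card A < card (car M)" "card B < card (car M)" using proper_summand[OF M False nz] .
    have step: ?thesis if ids: "int_direct_sum R M A B" and c: "card A < card (car M)" and a: "a \<in> A" "f a \<noteq> \<zero>\<^sub>N" for A B a
    proof -
      have A: "submodule A R M" using ids by (simp add: int_direct_sum_iff)
      note S = fm_sub[OF M A]
      obtain p where p: "lin M (sub_mod M A) p" "\<forall>u\<in>A. p u = u" using projection[OF M ids] by metis
      obtain U q where U: "submodule U R (sub_mod M A)" "indec (sub_mod (sub_mod M A) U)"
        "lin (sub_mod M A) (sub_mod (sub_mod M A) U) q" "\<forall>u\<in>U. q u = u" "\<exists>u\<in>U. f u \<noteq> \<zero>\<^sub>N"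
        using less.hyps[of "sub_mod M A" a] c S N lin_sub_dom[OF f A M] a by auto
      have "lin M (sub_mod M U) (\<lambda>x. q (p x))" using lin_comp[OF p(1) U(3)] by (simp add: sub_mod_sub_mod)
      moreover have "submodule U R M" "U \<subseteq> A" using U(1) sub_sub[OF M A] by auto
      moreover have "\<forall>u\<in>U. q (p u) = u" using U(4) p(2) \<open>U \<subseteq> A\<close> by auto
      ultimately show ?thesis using U(2,5) unfolding sub_mod_sub_mod by (intro exI[of _ U] exI[of _ "\<lambda>x. q (p x)"]) simp
    qed
    have "w \<in> plus_set M A B" using AB(1) less.prems(4) by (simp add: int_direct_sum_iff)
    then obtain a b where ab: "a \<in> A" "b \<in> B" "w = a \<oplus>\<^sub>M b" unfolding plus_set_def by blast
    have "a \<in> car M" "b \<in> car M" using ab AB(1) subD(3)[OF _ M] unfolding int_direct_sum_iff by blast+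
    hence "f w = f a \<oplus>\<^sub>N f b" using lin_add[OF f] ab(3) by simp
    hence "f a \<noteq> \<zero>\<^sub>N \<or> f b \<noteq> \<zero>\<^sub>N" using less.prems(5) fm_zeros(1)[OF N fm_zero[OF N]] by auto
    thus ?thesis using step[OF AB(1,2) ab(1)] step[OF int_direct_sum_sym[OF M AB(1)] AB(3) ab(2)] by blast
  qed
qed

lemma retract_summand:
  assumes M: "fm M" and U: "submodule U R M" and p: "lin M (sub_mod M U) p" "\<forall>u\<in>U. p u = u"
  shows "int_direct_sum R M U (ker M (sub_mod M U) p)"
proof -
  have "int_direct_sum R M (ker M (sub_mod M U) p) ((\<lambda>x. x) ` car (sub_mod M U))"
    by (rule retract_direct_sum[OF M fm_sub[OF M U] p(1) lin_incl[OF M U]]) (use p(2) in simp)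
  thus ?thesis using int_direct_sum_sym[OF M] by simp
qed

text \<open>The image is projective, so \<open>f\<close> splits onto its image and its kernel is a
  summand.\<close>

lemma indec_hom_split:
  assumes M: "fm M" "indec M" and P: "fm P" "projective R P" and f: "lin M P f"
    and x: "x \<in> car M" "f x \<noteq> \<zero>\<^sub>P"
  shows "inj_on f (car M)"
proof -
  have "\<not> stemless M" using stemless_torsionless[OF M(1) _ torsionless_projective[OF P] f x(1)] x(2) by blast
  hence proj: "projective R M" using indec_stemless M by blast
  have I: "submodule (f ` car M) R P" using sub_image[OF M(1) P(1) f sub_all[OF M(1)]] .
  note J = fm_sub[OF P(1) I] and JP = projective_sub[OF P I]
  have fJ: "lin M (sub_mod P (f ` car M)) f" using f by (rule lin_sub_cod) auto
  obtain s where s: "lin (sub_mod P (f ` car M)) M s" "!!y. y \<in> car (sub_mod P (f ` car M)) ==> f (s y) = y"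
    using proj_lift[OF JP J M(1) J fJ _ lin_id] by auto
  have "int_direct_sum R M (ker M (sub_mod P (f ` car M)) f) (s ` car (sub_mod P (f ` car M)))" by (rule retract_direct_sum[OF M(1) J fJ s(1,2)])
  then consider "ker M (sub_mod P (f ` car M)) f = {\<zero>\<^sub>M}" | "s ` car (sub_mod P (f ` car M)) = {\<zero>\<^sub>M}"
    using M(2) unfolding indecomposable_def by blast
  thus ?thesis
  proof cases
    case 1
    thus ?thesis unfolding inj_on_iff_ker[OF M(1) P(1) f] by (auto simp: ker_def)
  next
    case 2
    have y: "f x \<in> car (sub_mod P (f ` car M))" using x by simp
    hence "s (f x) = \<zero>\<^sub>M" using 2 by blast
    thus ?thesis using s(2)[OF y] lin_zero[OF M(1) P(1) f] x(2) by simp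
  qed
qed

text \<open>Multiplication of ring elements with \<open>m\<close> is nonzero on some indecomposable
  summand of \<open>R\<close>. Indecomposable projectives thus test whether a module is
  zero.\<close>

lemma projective_source:
  assumes M: "fm M" and m: "m \<in> car M" "m \<noteq> \<zero>\<^sub>M"
  shows "\<exists>(P :: 'r nmod) f x. fm P \<and> projective R P \<and> indec P \<and> lin P M f \<and> x \<in> car P \<and> f x \<noteq> \<zero>\<^sub>M"
proof -
  have "\<one> \<odot>\<^sub>M m \<noteq> \<zero>\<^sub>M" using m fm_smult_simps(4)[OF M m(1)] by simp
  then obtain U where U: "submodule U R Rm" "indec (sub_mod Rm U)" "\<exists>u\<in>U. u \<odot>\<^sub>M m \<noteq> \<zero>\<^sub>M"
    using indec_retract_source[OF fm_reg M lin_from_reg[OF M m(1)], of \<one>] by auto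
  note S = fm_sub[OF fm_reg U(1)]
  obtain P :: "'r nmod" where P: "fm P" "mod_iso R (sub_mod Rm U) P" using exists_nat_copy[OF S] .
  obtain a where a: "lin P (sub_mod Rm U) a" "bij_betw a (car P) (car (sub_mod Rm U))" using mod_isoE[OF iso_sym[OF P(2) S P(1)]] .
  have l: "lin P M (\<lambda>x. a x \<odot>\<^sub>M m)" using lin_comp[OF a(1) lin_sub_dom[OF lin_from_reg[OF M m(1)] U(1) fm_reg]] .
  obtain u where u: "u \<in> U" "u \<odot>\<^sub>M m \<noteq> \<zero>\<^sub>M" using U(3) by blast
  obtain x where x: "x \<in> car P" "a x = u" using u(1) a(2) unfolding bij_betw_def by (metis imageE sub_mod_simps(1))
  show ?thesis using P(1) projective_iso[OF P(2) S P(1) projective_left_ideal[OF U(1)]] indecomposable_iso[OF P(2) S P(1) U(2)] l x u(2) by blast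
qed

text \<open>The quotient by \<open>V\<close> is tested by \<open>projective_source\<close>, and the
  map found lifts along the projection.\<close>

lemma projective_source_quot:
  fixes M :: "('r, 'a) module"
  assumes M: "fm M" and V: "submodule V R M" and m: "m \<in> car M" "m \<notin> V"
  shows "\<exists>(P :: 'r nmod) f x. fm P \<and> projective R P \<and> indec P \<and> lin P M f \<and> x \<in> car P \<and> f x \<notin> V"
proof -
  obtain N :: "'r nmod" and q where N: "fm N" "lin M N q" "q ` car M = car N" "ker M N q = V" using quot_nat[OF M V] .
  have "q m \<in> car N" "q m \<noteq> \<zero>\<^sub>N" using m N(4) lin_closed[OF N(2) m(1)] by (auto simp: ker_def)
  then obtain P :: "'r nmod" and f x where P: "fm P" "projective R P" "indec P" "lin P N f" "x \<in> car P" "f x \<noteq> \<zero>\<^sub>N"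
    using projective_source[OF N(1)] by blast
  obtain k where k: "lin P M k" "!!x. x \<in> car P ==> q (k x) = f x" using proj_lift[OF P(2,1) M N(1-3) P(4)] by metis
  have "k x \<notin> V" using k(2)[OF P(5)] P(6) N(4) by (auto simp: ker_def)
  thus ?thesis using P k(1) by blast
qed

subsection \<open>Finiteness of isomorphism classes\<close>

lemma iso_class_eq:
  assumes "fm M" "fm N" shows "iso_class R M = iso_class R N \<longleftrightarrow> mod_iso R M N"
proof
  assume eq: "iso_class R M = iso_class R N"
  obtain L :: "'r nmod" where L: "fm L" "mod_iso R M L" using exists_nat_copy[OF assms(1)] .
  hence "L \<in> iso_class R N" using eq by (auto simp: iso_class_def)
  hence "mod_iso R N L" by (simp add: iso_class_def)
  thus "mod_iso R M N" using iso_trans[OF L(2) iso_sym[OF _ assms(2) L(1)] assms(1)] by blast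
next
  assume iso: "mod_iso R M N"
  have "mod_iso R M L \<longleftrightarrow> mod_iso R N L" if "fm L" for L :: "'r nmod"
    using iso_trans[OF iso_sym[OF iso assms] _ assms(2)] iso_trans[OF iso _ assms(1)] by blast
  thus "iso_class R M = iso_class R N" unfolding iso_class_def fl_mods_iff by auto
qed

lemma iso_class_self: "fm M ==> M \<in> iso_class R M" by (simp add: iso_class_def iso_refl)

lemma finite_image_factor:
  assumes "finite (g ` A)" and "!!x y. [|x \<in> A; y \<in> A; g x = g y|] ==> f x = f y"
  shows "finite (f ` A)"
proof -
  have "f ` A = (\<lambda>c. f (SOME x. x \<in> A \<and> g x = c)) ` (g ` A)"
  proof -
    have "f (SOME y. y \<in> A \<and> g y = g x) = f x" if "x \<in> A" for x
      using someI[of "\<lambda>y. y \<in> A \<and> g y = g x" x] that assms(2) by blast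
    thus ?thesis by (simp add: image_image)
  qed
  thus ?thesis using assms(1) by simp
qed

text \<open>A module of at most \<open>n\<close> elements can be moved to an initial segment of the
  naturals, where it is given by finite tables of its operations.\<close>

lemma finite_classes:
  "finite (iso_class R ` {M :: 'r nmod. fm M \<and> card (car M) \<le> n})"
proof -
  define mk :: "nat \<times> nat \<times> (nat \<times> nat => nat) \<times> ('r \<times> nat => nat) => 'r nmod" where
    "mk = (\<lambda>(k, z, a, s). \<lparr>carrier = {..<k}, mult = undefined, one = undefined, ring.zero = z,
      ring.add = (\<lambda>x y. a (x, y)), smult = (\<lambda>r x. s (r, x))\<rparr>)"
  let ?T = "{..n} \<times> {..<n} \<times> (({..<n} \<times> {..<n}) \<rightarrow>\<^sub>E {..<n}) \<times> ((car R \<times> {..<n}) \<rightarrow>\<^sub>E {..<n})"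
  have "finite ?T" using finite_R by (intro finite_cartesian_product finite_PiE) auto
  moreover have "iso_class R M \<in> iso_class R ` (mk ` ?T)" if M: "fm M" "card (car M) \<le> n" for M :: "'r nmod"
  proof -
    let ?k = "card (car M)"
    obtain b where b: "bij_betw b (car M) {..<?k}" using ex_bij_betw_finite_nat[of "car M"] M(1) atLeast0LessThan by auto
    let ?i = "inv_into (car M) b"
    have bk: "b x < ?k" if "x \<in> car M" for x using b that by (auto simp: bij_betw_def)
    have ib: "?i (b x) = x" if "x \<in> car M" for x using bij_betw_inv_into_left[OF b that] .
    have ik: "?i y \<in> car M" if "y < ?k" for y using b that by (metis bij_betw_def inv_into_into lessThan_iff)
    \<comment> \<open>Outside the initial segment of length \<open>?k\<close> the tables are filled
      with 0, which keeps all entries below \<open>n\<close>.\<close>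
    let ?a = "\<lambda>(x, y)\<in>{..<n} \<times> {..<n}. if x < ?k \<and> y < ?k then b (?i x \<oplus>\<^sub>M ?i y) else 0"
    let ?s = "\<lambda>(r, x)\<in>car R \<times> {..<n}. if x < ?k then b (r \<odot>\<^sub>M ?i x) else 0"
    define N where "N = mk (?k, b \<zero>\<^sub>M, ?a, ?s)"
    have "?k > 0" using fm_zero[OF M(1)] fm_finite[OF M(1)] by (metis card_gt_0_iff empty_iff)
    hence t: "(?k, b \<zero>\<^sub>M, ?a, ?s) \<in> ?T" using M(2) bk M(1) ik by (auto intro!: less_le_trans[OF bk])
    have img: "b ` car M = car N" using b by (simp add: N_def mk_def bij_betw_def)
    have bn: "b x < n" if "x \<in> car M" for x using bk[OF that] M(2) by simp
    have 1: "b x \<oplus>\<^sub>N b y = b (x \<oplus>\<^sub>M y)" if "x \<in> car M" "y \<in> car M" for x y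
      using that bk bn ib by (simp add: N_def mk_def)
    have 2: "r \<odot>\<^sub>N b x = b (r \<odot>\<^sub>M x)" if "r \<in> car R" "x \<in> car M" for r x
      using that bk bn ib by (simp add: N_def mk_def)
    have 3: "\<zero>\<^sub>N = b \<zero>\<^sub>M" by (simp add: N_def mk_def)
    note N = fm_surj[OF M(1) img 1 3 2]
    have "mod_iso R M N" using mod_isoI[OF M(1) N(2)] b img by (simp add: bij_betw_def)
    hence "iso_class R M = iso_class R N" using iso_class_eq[OF M(1) N(1)] by simp
    hence "iso_class R M = iso_class R (mk (?k, b \<zero>\<^sub>M, ?a, ?s))" unfolding N_def .
    thus ?thesis using t by blast
  qed
  ultimately have "finite (iso_class R ` (mk ` ?T))" and
    "iso_class R ` {M :: 'r nmod. fm M \<and> card (car M) \<le> n} \<subseteq> iso_class R ` (mk ` ?T)" by blast+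
  thus ?thesis by (rule rev_finite_subset)
qed

lemma tt_pow_fm: "(tt ^^ n) X U ==> fm X \<and> indec X ==> fm U \<and> indec U"
proof (induction n arbitrary: U)
  case (Suc n)
  then obtain Y where "tt Y U" by auto
  thus ?case using tt_fm tt_target by blast
qed simp

lemma tt_pow_h: "[|(tt ^^ n) X U; (tt ^^ n) Y V|] ==> h X Y = h U V"
proof (induction n arbitrary: U V)
  case (Suc n)
  obtain U' V' where *: "(tt ^^ n) X U'" "tt U' U" "(tt ^^ n) Y V'" "tt V' V" using Suc.prems by auto
  show ?case using Suc.IH[OF *(1,3)] tt_h[OF *(2,4)] by simp
qed simp

lemma tt_pow_source: "[|(tt ^^ n) X U; (tt ^^ n) X' U'; mod_iso R U U'|] ==> mod_iso R X X'"
proof (induction n arbitrary: U U')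
  case (Suc n)
  obtain V V' where *: "(tt ^^ n) X V" "tt V U" "(tt ^^ n) X' V'" "tt V' U'" using Suc.prems by auto
  show ?case using Suc.IH[OF *(1,3) tt_unique_source[OF *(2,4) Suc.prems(3)]] .
qed simp

lemma tau_plus_projective:
  assumes "(tau_plus R ^^ n) U P" "fm U" "projective R U" "is_zero U" shows "is_zero P" using assms
proof (induction n arbitrary: U)
  case (Suc n)
  obtain Y where Y: "tau_plus R U Y" "(tau_plus R ^^ n) Y P" using Suc.prems(1) relpowp_Suc_D2 by metis
  have fY: "fm Y" and iso: "mod_iso R (tau U) Y" using Y(1) by (auto simp: tau_plus_def)
  have "is_zero Y" using iso_is_zero[OF iso fm_tau[OF Suc.prems(2)] fY] tau_projective[OF Suc.prems(2,3)] by blast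
  thus ?case using Suc.IH[OF Y(2) fY projective_zero[OF fY]] by blast
qed simp

text \<open>\<open>tau_plus\<close> also continues past projective modules, but from there on only
  with zero modules. The requirement that the end be nonzero therefore turns the chain into one of
  \<open>tt\<close>.\<close>

lemma pp_tau_plus:
  assumes "fm U" "indec U"
  shows "(\<exists>n P. (tau_plus R ^^ n) U P \<and> projective R P \<and> \<not> is_zero P) \<longleftrightarrow> pp U"
proof
  assume "\<exists>n P. (tau_plus R ^^ n) U P \<and> projective R P \<and> \<not> is_zero P"
  then obtain n P where "(tau_plus R ^^ n) U P" "projective R P" "\<not> is_zero P" by blast
  thus "pp U" using assms
  proof (induction n arbitrary: U)
    case 0
    hence "(tt ^^ 0) U P" by simp
    thus ?case using 0 unfolding pp_def by blast
  next
    case (Suc n)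
    obtain Y where Y: "tau_plus R U Y" "(tau_plus R ^^ n) Y P" using Suc.prems(1) relpowp_Suc_D2 by metis
    have fY: "fm Y" and iso: "mod_iso R (tau U) Y" using Y(1) by (auto simp: tau_plus_def)
    have "\<not> projective R U"
    proof
      assume p: "projective R U"
      have "is_zero Y" using iso_is_zero[OF iso fm_tau[OF Suc.prems(4)] fY] tau_projective[OF Suc.prems(4) p] by blast
      thus False using tau_plus_projective[OF Y(2) fY projective_zero[OF fY]] Suc.prems(3) by blast
    qed
    hence t: "tt U Y" using Suc.prems fY iso by (simp add: tt_def)
    show ?case using Suc.IH[OF Y(2) Suc.prems(2,3) fY tt_target(1)[OF t]] pp_tt[OF t] by blast
  qed
next
  assume "pp U"
  then obtain n P where n: "(tt ^^ n) U P" "projective R P" unfolding pp_def by blast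
  have "tau_plus R X Y" if "tt X Y" for X Y using that by (simp add: tt_def tau_plus_def)
  hence "(tau_plus R ^^ n) U P" using relpowp_mono[of tt "tau_plus R"] n(1) by simp
  moreover have "\<not> is_zero P" using tt_pow_fm[OF n(1)] assms by (auto simp: indecomposable_def)
  ultimately show "\<exists>n P. (tau_plus R ^^ n) U P \<and> projective R P \<and> \<not> is_zero P" using n(2) by blast
qed

lemma injective_zero: assumes "fm I" "is_zero I" shows "injective R I"
proof (rule injectiveI[OF assms(1)])
  fix A B :: "'r nmod" and i f
  assume "lin A I f"
  thus "\<exists>k. lin B I k \<and> (\<forall>x\<in>car A. k (i x) = f x)"
    using lin_zero_map[OF assms(1), of B] lin_closed[of A I f] assms(2) unfolding is_zero_def by (intro exI[of _ "\<lambda>x. \<zero>\<^sub>I"]) auto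
qed

lemma tau_minus_zero:
  assumes "(tau_minus R ^^ n) U I" "fm U" "is_zero U" shows "is_zero I" using assms
proof (induction n arbitrary: U)
  case (Suc n)
  obtain Y where Y: "tau_minus R U Y" "(tau_minus R ^^ n) Y I" using Suc.prems(1) relpowp_Suc_D2 by metis
  show ?case using Suc.IH[OF Y(2)] tau_minus_injective[OF Suc.prems(2) injective_zero Y(1)] Suc.prems(2,3)
      tau_minus_h(1)[OF Suc.prems(2) Y(1) Suc.prems(2)] by blast
qed simp

text \<open>The same for the inverse translate, which sends injective modules to zero. The end of a
  \<open>tau_minus\<close> chain is the beginning of a \<open>tt\<close> chain.\<close>

lemma qi_tau_minus:
  assumes "fm U" "indec U"
  shows "(\<exists>n I. (tau_minus R ^^ n) U I \<and> injective R I \<and> \<not> is_zero I) \<longleftrightarrow> qi U"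
proof
  assume "\<exists>n I. (tau_minus R ^^ n) U I \<and> injective R I \<and> \<not> is_zero I"
  then obtain n I where "(tau_minus R ^^ n) U I" "injective R I" "\<not> is_zero I" by blast
  thus "qi U" using assms
  proof (induction n arbitrary: U)
    case 0
    hence "(tt ^^ 0) I U" by simp
    thus ?case using 0 unfolding qi_def by blast
  next
    case (Suc n)
    obtain Y where Y: "tau_minus R U Y" "(tau_minus R ^^ n) Y I" using Suc.prems(1) relpowp_Suc_D2 by metis
    have fY: "fm Y" using tau_minus_h(1)[OF Suc.prems(4) Y(1) Suc.prems(4)] .
    have "\<not> injective R U" using tau_minus_injective[OF Suc.prems(4) _ Y(1)] tau_minus_zero[OF Y(2) fY] Suc.prems(3) by blast
    hence t: "tt Y U" using tt_source Suc.prems Y(1) by blast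
    show ?case using Suc.IH[OF Y(2) Suc.prems(2,3) fY] qi_tt[OF t] tt_fm[OF t] by blast
  qed
next
  assume "qi U"
  then obtain n I where n: "(tt ^^ n) I U" "injective R I" unfolding qi_def by blast
  have "fm I \<and> indec I \<and> (tau_minus R ^^ n) U I" using n(1) assms
  proof (induction n arbitrary: U)
    case (Suc n)
    obtain Y where Y: "(tt ^^ n) I Y" "tt Y U" using Suc.prems by auto
    thus ?case using Suc.IH[OF Y(1)] tt_fm[OF Y(2)] tt_tau_minus[OF Y(2)] by (meson relpowp_Suc_I2)
  qed simp
  thus "\<exists>n I. (tau_minus R ^^ n) U I \<and> injective R I \<and> \<not> is_zero I" using n(2) by (auto simp: indecomposable_def)
qed

subsection \<open>No indecomposable module is both preprojective and preinjective\<close>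

lemma maximal_sub:
  assumes P: "fm P" and V: "submodule V R P" "V \<noteq> car P"
  shows "\<exists>W. submodule W R P \<and> V \<subseteq> W \<and> W \<noteq> car P \<and> (\<forall>X. submodule X R P --> W \<subset> X --> X = car P)"
  using V
proof (induction "card (car P) - card V" arbitrary: V rule: less_induct)
  case less
  show ?case
  proof (cases "\<forall>X. submodule X R P --> V \<subset> X --> X = car P")
    case False
    then obtain X where X: "submodule X R P" "V \<subset> X" "X \<noteq> car P" by blast
    have "X \<subset> car P" using subD(1)[OF X(1) P] X(3) by blast
    hence "card X < card (car P)" "card V < card X" using X(2) fm_finite[OF P] psubset_card_mono finite_subset by (metis psubset_imp_subset)+
    thus ?thesis using less.hyps[OF _ X(1,3)] X(2) by (meson diff_less_mono2 less_trans order_trans psubset_imp_subset)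
  qed (use less.prems in blast)
qed

text \<open>If the image of a nonzero \<open>f : Q \<rightarrow> P\<close> lies in a maximal submodule \<open>W\<close> of \<open>P\<close>, it is detected
  on an indecomposable summand \<open>E0\<close> of \<open>W\<close>.  With \<open>E0 = \<tau>X\<close> one has Ext\<open>(X, P) = 0 \<noteq>\<close> Ext\<open>(X, E0)\<close>, and an
  extension class killed in \<open>P\<close> yields an epimorphism \<open>X \<rightarrow> P/W\<close>, hence a nonzero map \<open>P \<rightarrow> X\<close>.\<close>

lemma qi_projective_source:
  assumes "fm P" "indec P" "projective R P" "qi P"
    and Q: "fm Q" "indec Q" and "h Q P \<noteq> 1"
  shows "qi Q" using assms(1-4) assms(7)
proof (induction "card (car P)" arbitrary: P rule: less_induct)
  case less
  note P = less.prems(1) and Pi = less.prems(2) and Pp = less.prems(3)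
  obtain f x where f: "lin Q P f" and x: "x \<in> car Q" "f x \<noteq> \<zero>\<^sub>P" using less.prems(5) h_eq_1[OF Q(1) P] by blast
  note inj = indec_hom_split[OF Q P Pp f x]
  show ?case
  proof (cases "f ` car Q = car P")
    case True
    hence "mod_iso R Q P" using mod_isoI[OF Q(1) f] inj by (simp add: bij_betw_def)
    thus ?thesis using qi_iso[OF less.prems(4) P Q(1)] iso_sym[OF _ Q(1) P] by blast
  next
    case False
    obtain W where W: "submodule W R P" "f ` car Q \<subseteq> W" "W \<noteq> car P" "\<forall>X. submodule X R P --> W \<subset> X --> X = car P"
      using maximal_sub[OF P sub_image[OF Q(1) P f sub_all[OF Q(1)]] False] by blast
    note fW = fm_sub[OF P W(1)]
    have fx: "f x \<in> car (sub_mod P W)" "f x \<noteq> \<zero>\<^sub>(sub_mod P W)" using W(2) x by auto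
    obtain G p where G: "submodule G R (sub_mod P W)" "indec (sub_mod (sub_mod P W) G)"
      "lin (sub_mod P W) (sub_mod (sub_mod P W) G) p" "\<forall>u\<in>G. p u = u" "p (f x) \<noteq> \<zero>\<^sub>(sub_mod P W)"
      using indec_retract[OF fW fx] by blast
    define E0 where "E0 = sub_mod P G"
    have GP: "submodule G R P" and GW: "G \<subseteq> W" using G(1) sub_sub[OF P W(1)] by auto
    have E0: "fm E0" "indec E0" "projective R E0" and p: "lin (sub_mod P W) E0 p"
      using fm_sub[OF P GP] G(2,3) projective_sub[OF P Pp GP] by (simp_all add: E0_def sub_mod_sub_mod)
    have cE0: "car E0 = G" "\<zero>\<^sub>E0 = \<zero>\<^sub>P" by (simp_all add: E0_def)
    have "lin Q E0 (\<lambda>y. p (f y))" by (rule lin_comp[OF lin_sub_cod[OF f] p]) (use W(2) in blast)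
    hence hQ: "h Q E0 \<noteq> 1" using h_eq_1[OF Q(1) E0(1)] x(1) G(5) cE0 by auto
    have "W \<subset> car P" using subD(1)[OF W(1) P] W(3) by blast
    hence cl: "card (car E0) < card (car P)" using GW fm_finite[OF P] cE0 by (metis order_le_less_trans psubset_card_mono)
    have "qi E0"
    proof (cases "injective R E0")
      case True
      thus ?thesis unfolding qi_def by (metis relpowp_0_I)
    next
      case False
      obtain X where X: "tt X E0" using tt_exists_source[OF E0(1,2) False] by blast
      have fX: "fm X" using tt_fm[OF X] by blast
      \<comment> \<open>A nonzero map would embed \<open>P\<close> into \<open>E0\<close>, which is
        smaller.\<close>
      have "h P E0 = 1"
      proof (rule ccontr)
        assume "h P E0 \<noteq> 1"
        then obtain g y where "lin P E0 g" "y \<in> car P" "g y \<noteq> \<zero>\<^sub>E0" using h_eq_1[OF P E0(1)] by blast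
        note gi = indec_hom_split[OF P Pi E0(1,3) this] and g = this(1)
        have "g ` car P \<subseteq> car E0" using lin_closed[OF g] by blast
        thus False using card_inj_on_le[OF gi _ fm_finite[OF E0(1)]] cl by simp
      qed
      hence "ext1_vanishes R X P" using tt_e(1)[OF X P] ext1_vanishes_card[OF fX P] by simp
      moreover have "\<not> ext1_vanishes R X E0" using tt_e(1)[OF X E0(1)] ext1_vanishes_card[OF fX E0(1)] indec_nonzero[OF E0(1,2)] by simp
      ultimately obtain \<psi> where \<psi>: "lin (Om X) E0 \<psi>" "\<not> extendable X E0 \<psi>" and v: "!!\<phi>. lin (Om X) P \<phi> ==> extendable X P \<phi>"
        using ext1_vanishes_iff[OF fX P] ext1_vanishes_iff[OF fX E0(1)] by blast
      have iE: "lin E0 P (\<lambda>x. x)" unfolding E0_def by (rule lin_incl[OF P GP])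
      obtain \<Psi> where \<Psi>: "lin (F X) P \<Psi>" "\<forall>c\<in>car (Om X). \<Psi> c = \<psi> c"
        using v[OF lin_comp[OF \<psi>(1) iE]] unfolding extendable_def by blast
      have \<psi>G: "\<psi> c \<in> G" if "c \<in> car (Om X)" for c using lin_closed[OF \<psi>(1) that] cE0 by simp
      \<comment> \<open>Otherwise the retraction \<open>p\<close> of \<open>W\<close> onto
        \<open>E0\<close> would turn \<open>\<Psi>\<close> into an extension of
        \<open>\<psi>\<close>.\<close>
      have "\<exists>c\<in>car (F X). \<Psi> c \<notin> W"
      proof (rule ccontr)
        assume "\<not> ?thesis"
        hence "lin (F X) E0 (\<lambda>c. p (\<Psi> c))" by (intro lin_comp[OF lin_sub_cod[OF \<Psi>(1)] p]) blast
        moreover have "\<forall>c\<in>car (Om X). p (\<Psi> c) = \<psi> c" using \<Psi>(2) \<psi>G G(4) by (simp del: Om_simps)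
        ultimately show False using \<psi>(2) unfolding extendable_def by blast
      qed
      then obtain c where c: "c \<in> car (F X)" "\<Psi> c \<notin> W" by blast
      obtain N :: "'r nmod" and q where N: "fm N" "lin P N q" "q ` car P = car N" "ker P N q = W" using quot_nat[OF P W(1)] .
      have qW: "q w = \<zero>\<^sub>N" if "w \<in> W" for w using that N(4) by (auto simp: ker_def)
      have qW': "w \<in> W" if "q w = \<zero>\<^sub>N" "w \<in> car P" for w using that N(4) by (auto simp: ker_def)
      have "q (\<Psi> c) = \<zero>\<^sub>N" if "c \<in> car (F X)" "pi X c = \<zero>\<^sub>X" for c
      proof -
        have "c \<in> car (Om X)" using that by (simp add: ker_def)
        thus ?thesis using \<Psi>(2) qW \<psi>G GW by (simp del: Om_simps add: subset_iff)
      qed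
      then obtain g where g: "lin X N g" "\<forall>c\<in>car (F X). g (pi X c) = q (\<Psi> c)"
        using factor'[OF fm_F[OF fX] fX N(1) lin_pi[OF fX] pi_onto[OF fX] lin_comp[OF \<Psi>(1) N(2)]] by blast
      \<comment> \<open>\<open>Y\<close> is a submodule of \<open>P\<close> containing
        \<open>W\<close> and a point outside it, so by maximality it is \<open>P\<close>; this is
        the surjectivity of \<open>g\<close>.\<close>
      define Y where "Y = {y \<in> car P. q y \<in> g ` car X}"
      have gX: "submodule (g ` car X) R N" by (rule sub_image[OF fX N(1) g(1) sub_all[OF fX]])
      have Y: "submodule Y R P" unfolding Y_def by (rule sub_vimage[OF P N(1,2) gX])
      have "W \<subseteq> Y" using qW subD(1)[OF W(1) P] subD(2)[OF gX N(1)] by (auto simp: Y_def)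
      moreover have "\<Psi> c \<in> Y"
      proof -
        have "q (\<Psi> c) = g (pi X c)" using bspec[OF g(2) c(1)] by (rule sym)
        thus ?thesis using lin_closed[OF \<Psi>(1) c(1)] lin_closed[OF lin_pi[OF fX] c(1)] by (auto simp: Y_def)
      qed
      ultimately have YP: "Y = car P" using W(4) Y c(2) by blast
      have onto: "g ` car X = car N"
      proof
        show "g ` car X \<subseteq> car N" using subD(1)[OF gX N(1)] .
        show "car N \<subseteq> g ` car X"
        proof
          fix n assume "n \<in> car N"
          then obtain y where y: "y \<in> car P" "n = q y" using N(3) by (metis imageE)
          hence "y \<in> Y" using YP by simp
          thus "n \<in> g ` car X" using y(2) by (simp add: Y_def)
        qed
      qed
      obtain k where k: "lin P X k" "!!x. x \<in> car P ==> g (k x) = q x" using proj_lift[OF Pp P fX N(1) g(1) onto N(2)] by metis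
      have "k (\<Psi> c) \<noteq> \<zero>\<^sub>X"
      proof
        assume "k (\<Psi> c) = \<zero>\<^sub>X"
        hence "q (\<Psi> c) = \<zero>\<^sub>N" using k(2)[OF lin_closed[OF \<Psi>(1) c(1)]] lin_zero[OF fX N(1) g(1)] by simp
        thus False using qW' c(2) lin_closed[OF \<Psi>(1) c(1)] by blast
      qed
      hence "h P X \<noteq> 1" using h_eq_1[OF P fX] k(1) lin_closed[OF \<Psi>(1) c(1)] by blast
      hence "qi X" using hom_qi[OF fX _ _ P less.prems(4)] tt_fm[OF X] by blast
      thus ?thesis using qi_tt[OF X] by blast
    qed
    \<comment> \<open>Induction: \<open>E0\<close> is a smaller indecomposable projective in the
      orbit of an injective, and it still receives a nonzero map from \<open>Q\<close>.\<close>
    thus ?thesis using less.hyps[OF cl E0 _ hQ] by blast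
  qed
qed

section \<open>Splitting the category along its projectives\<close>

definition orth :: "'r nmod set => 'r nmod set" where
  "orth S = {M. fm M \<and> (\<forall>P\<in>S. h P M = 1)}"

lemma orthI:
  assumes "fm M" and S: "!!P. P \<in> S ==> fm P"
    and "!!P f x. [|P \<in> S; lin P M f; x \<in> car P|] ==> f x = \<zero>\<^sub>M"
  shows "M \<in> orth S" using assms h_eq_1[OF S assms(1)] by (auto simp: orth_def)

lemma orthD:
  assumes "M \<in> orth S" "P \<in> S" "fm P" "lin P M f" "x \<in> car P" shows "f x = \<zero>\<^sub>M"
  using assms h_eq_1[OF assms(3), of M] by (auto simp: orth_def)

context
  fixes S :: "'r nmod set" assumes S: "!!P. P \<in> S ==> fm P \<and> projective R P"
begin

lemma orth_embed:
  assumes M: "M \<in> orth S" and N: "fm N" and f: "lin N M f" and k: "!!x. [|x \<in> car N; f x = \<zero>\<^sub>M|] ==> x = \<zero>\<^sub>N"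
  shows "N \<in> orth S"
proof (rule orthI[OF N])
  fix P g x assume *: "P \<in> S" "lin P N g" "x \<in> car P"
  have "fm P" using S[OF *(1)] by simp
  from orthD[OF M *(1) this lin_comp[OF *(2) f] *(3)] show "g x = \<zero>\<^sub>N" using k[OF lin_closed[OF *(2,3)]] by simp
qed (use S in blast)

lemma orth_sub: "[|fm M; M \<in> orth S; submodule U R M|] ==> sub_mod M U \<in> orth S" by (rule orth_embed[OF _ fm_sub lin_incl]) auto

text \<open>Maps out of the projective members of \<open>S\<close> lift along \<open>q\<close>, so
  orthogonality passes to quotients. \<open>M\<close> may have any carrier type, as the external sum
  in \<open>orth_plus\<close> requires.\<close>

lemma orth_image:
  assumes M: "fm (M :: ('r, 'a) module)" "!!P f x. [|P \<in> S; lin P M f; x \<in> car P|] ==> f x = \<zero>\<^sub>M"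
    and N: "fm N" and q: "lin M N q" "q ` car M = car N"
  shows "N \<in> orth S"
proof (rule orthI[OF N])
  fix P g x assume *: "P \<in> S" "lin P N g" "x \<in> car P"
  obtain k where k: "lin P M k" "!!x. x \<in> car P ==> q (k x) = g x" using proj_lift[OF _ _ M(1) N q *(2)] S *(1) by metis
  thus "g x = \<zero>\<^sub>N" using k(2)[OF *(3)] M(2)[OF *(1) k(1) *(3)] lin_zero[OF M(1) N q(1)] by simp
qed (use S in blast)

lemma orth_image_nat:
  assumes "M \<in> orth S" "fm N" "lin M N q" "q ` car M = car N" shows "N \<in> orth S"
proof -
  have "fm M" using assms(1) by (simp add: orth_def)
  from orth_image[OF this _ assms(2-4)] show ?thesis using orthD[OF assms(1)] S by blast
qed

lemma orth_plus:
  assumes M: "fm M" and A: "submodule A R M" "sub_mod M A \<in> orth S" and B: "submodule B R M" "sub_mod M B \<in> orth S"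
  shows "sub_mod M (plus_set M A B) \<in> orth S"
proof -
  let ?D = "dsum (sub_mod M A) (sub_mod M B)" and ?N = "sub_mod M (plus_set M A B)"
  let ?q = "\<lambda>x. fst x \<oplus>\<^sub>M snd x"
  note fA = fm_sub[OF M A(1)] and fB = fm_sub[OF M B(1)] and N = fm_sub[OF M sub_plus[OF M A(1) B(1)]]
  have l: "lin ?D ?N ?q"
    by (rule lin_sub_cod[OF lin_copair[OF fA fB M lin_incl[OF M A(1)] lin_incl[OF M B(1)]]]) (simp add: plus_set_def mem_Times_iff, blast)
  have "?q ` car ?D = car ?N" by (force simp: plus_set_def)
  moreover have "f x = \<zero>\<^sub>(?D)" if P: "P \<in> S" and f: "lin P ?D f" and x: "x \<in> car P" for P f x
    using orthD[OF A(2) P _ lin_comp[OF f dsum_lin(3)[OF fA fB]] x] orthD[OF B(2) P _ lin_comp[OF f dsum_lin(4)[OF fA fB]] x] S[OF P]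
    by (simp add: prod_eq_iff)
  ultimately show ?thesis using orth_image[OF fm_dsum[OF fA fB] _ N l] by blast
qed

lemma orth_abelian: "abelian_subcat R (orth S)" unfolding abelian_subcat_def
proof (intro conjI ballI allI impI)
  show "orth S \<subseteq> fl_mods R" by (auto simp: orth_def)
  fix M assume M: "M \<in> orth S"
  hence fM: "fm M" by (simp add: orth_def)
  show "iso_class R M \<subseteq> orth S"
  proof
    fix N assume "N \<in> iso_class R M"
    hence N: "fm N" "mod_iso R M N" by (auto simp: iso_class_def)
    obtain f where f: "lin M N f" "bij_betw f (car M) (car N)" using mod_isoE[OF N(2)] .
    show "N \<in> orth S" by (rule orth_image[OF fM _ N(1) f(1)]) (use f(2) orthD[OF M] S in \<open>auto simp: bij_betw_def\<close>)
  qed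
  fix N f assume N: "N \<in> orth S" and "f \<in> Hom M N"
  hence f: "lin M N f" and fN: "fm N" by (auto simp: mod_hom_iff orth_def)
  show "sub_mod M {x \<in> car M. f x = \<zero>\<^sub>N} \<in> orth S" using orth_sub[OF fM M sub_ker[OF fM fN f]] by (simp add: ker_def)
  have I: "submodule (f ` car M) R N" by (rule sub_image[OF fM fN f sub_all[OF fM]])
  note Q = quot_mod[OF fN I]
  show "iso_class R (quot_mod N (f ` car M)) \<subseteq> orth S"
  proof
    fix L assume "L \<in> iso_class R (quot_mod N (f ` car M))"
    hence L: "fm L" "mod_iso R (quot_mod N (f ` car M)) L" by (auto simp: iso_class_def)
    obtain g where g: "lin (quot_mod N (f ` car M)) L g" "bij_betw g (car (quot_mod N (f ` car M))) (car L)" using mod_isoE[OF L(2)] .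
    have "(\<lambda>x. g (a_r_coset N (f ` car M) x)) ` car N = car L" using g(2) Q(3) by (metis bij_betw_imp_surj_on image_image)
    thus "L \<in> orth S" using orth_image[OF fN _ L(1) lin_comp[OF Q(2) g(1)]] orthD[OF N] S by blast
  qed
next
  obtain N :: "'r nmod" where N: "fm N" using exists_nat_copy[OF fm_reg] .
  have "sub_mod N {\<zero>\<^sub>N} \<in> orth S" by (rule orthI[OF fm_sub[OF N sub_zero[OF N]]]) (use S lin_closed in force)+
  thus "\<exists>Z\<in>orth S. is_zero Z" by (rule bexI[rotated]) (simp add: is_zero_def)
next
  fix M U V assume "M \<in> fl_mods R" and *: "int_direct_sum R M U V \<and> sub_mod M U \<in> orth S \<and> sub_mod M V \<in> orth S"
  hence M: "fm M" and U: "submodule U R M" and V: "submodule V R M" and P: "plus_set M U V = car M" by (auto simp: int_direct_sum_iff)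
  show "M \<in> orth S" using orth_plus[OF M U _ V] * P sub_mod_self[of M] by simp
qed

text \<open>The class is closed under sums of submodules by \<open>orth_plus\<close>, so a member of
  largest size contains all others.\<close>

lemma orth_max:
  assumes M: "fm M"
  shows "\<exists>U. submodule U R M \<and> sub_mod M U \<in> orth S \<and> (\<forall>V. submodule V R M --> sub_mod M V \<in> orth S --> V \<subseteq> U)"
proof -
  let ?T = "{U. submodule U R M \<and> sub_mod M U \<in> orth S}"
  have "?T \<subseteq> Pow (car M)" using subD(1)[OF _ M] by blast
  hence fin: "finite ?T" using fm_finite[OF M] by (meson finite_Pow_iff finite_subset)
  have "sub_mod M {\<zero>\<^sub>M} \<in> orth S" by (rule orthI[OF fm_sub[OF M sub_zero[OF M]]]) (use S lin_closed in force)+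
  hence ne: "?T \<noteq> {}" using sub_zero[OF M] by blast
  obtain U where U: "U \<in> ?T" "\<forall>V\<in>?T. card V \<le> card U" using Max_in[of "card ` ?T"] Max_ge[of "card ` ?T"] fin ne by fastforce
  have "V \<subseteq> U" if V: "submodule V R M" "sub_mod M V \<in> orth S" for V
  proof -
    have UR: "submodule U R M" using U(1) by blast
    have "plus_set M U V \<in> ?T" using sub_plus[OF M UR V(1)] orth_plus[OF M UR _ V] U(1) by blast
    hence le: "card (plus_set M U V) \<le> card U" using U(2) by blast
    have fi: "finite (plus_set M U V)" using subD(1)[OF sub_plus[OF M UR V(1)] M] fm_finite[OF M] finite_subset by blast
    show ?thesis using card_seteq[OF fi plus_set_upper(1)[OF M UR V(1)] le] plus_set_upper(2)[OF M UR V(1)] by simp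
  qed
  thus ?thesis using U(1) by blast
qed

end

text \<open>A nonzero image receives a nonzero map from an indecomposable projective
  \<open>P\<close>. If \<open>P \<in> S\<close> it lifts to \<open>M\<close>, if
  \<open>P \<in> T\<close> it composes to \<open>N\<close>; both are excluded.\<close>

lemma orth_hom_zero:
  assumes cover: "!!P :: 'r nmod. [|fm P; indec P; projective R P|] ==> P \<in> S \<or> P \<in> T"
    and M: "M \<in> orth S" and N: "N \<in> orth T" and f: "lin M N f" and m: "m \<in> car M"
  shows "f m = \<zero>\<^sub>N"
proof (rule ccontr)
  assume nz: "f m \<noteq> \<zero>\<^sub>N"
  have fM: "fm M" and fN: "fm N" using M N by (auto simp: orth_def)
  have I: "submodule (f ` car M) R N" by (rule sub_image[OF fM fN f sub_all[OF fM]])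
  let ?I = "sub_mod N (f ` car M)"
  note fI = fm_sub[OF fN I]
  have fm': "f m \<in> car ?I" "f m \<noteq> \<zero>\<^sub>(?I)" using nz m by auto
  obtain P :: "'r nmod" and g x where P: "fm P" "projective R P" "indec P" "lin P ?I g" "x \<in> car P" "g x \<noteq> \<zero>\<^sub>(?I)"
    using projective_source[OF fI fm'] by blast
  have fI': "lin M ?I f" using f by (rule lin_sub_cod) auto
  have ontoI: "f ` car M = car ?I" by simp
  obtain k where k: "lin P M k" "!!x. x \<in> car P ==> f (k x) = g x" using proj_lift[OF P(2,1) fM fI fI' ontoI P(4)] by metis
  from cover[OF P(1,3,2)] show False
  proof
    assume "P \<in> S"
    hence "k x = \<zero>\<^sub>M" using orthD[OF M _ P(1) k(1) P(5)] by blast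
    thus False using k(2)[OF P(5)] P(6) lin_zero[OF fM fN f] by simp
  next
    assume "P \<in> T"
    thus False using orthD[OF N _ P(1) lin_comp[OF P(4) lin_incl[OF fN I]] P(5)] P(6) by simp
  qed
qed

text \<open>The two summands of \<open>M\<close> are its largest submodules orthogonal to
  \<open>S\<close> and to \<open>T\<close>. They exhaust \<open>M\<close>, since an indecomposable
  projective in \<open>T\<close> is itself orthogonal to \<open>S\<close>, so its images lie in the
  first summand, and conversely.\<close>

lemma orth_direct_sum:
  assumes S: "!!P. P \<in> S ==> fm P \<and> projective R P" and T: "!!P. P \<in> T ==> fm P \<and> projective R P"
    and cover: "!!P :: 'r nmod. [|fm P; indec P; projective R P|] ==> P \<in> S \<or> P \<in> T"
    and ST: "!!P Q. [|P \<in> S; Q \<in> T|] ==> h P Q = 1" and TS: "!!P Q. [|P \<in> T; Q \<in> S|] ==> h P Q = 1"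
  shows "cat_direct_sum R (orth S) (orth T)" unfolding cat_direct_sum_def
proof (intro conjI ballI)
  fix M N f m assume "M \<in> orth S" "N \<in> orth T" "f \<in> Hom M N" "m \<in> car M"
  thus "f m = \<zero>\<^sub>N" using orth_hom_zero[of S T M N f m] cover by (auto simp: mod_hom_iff)
next
  fix M N f m assume "M \<in> orth S" "N \<in> orth T" "f \<in> Hom N M" "m \<in> car N"
  thus "f m = \<zero>\<^sub>M" using orth_hom_zero[of T S N M f m] cover by (auto simp: mod_hom_iff)
next
  fix M assume "M \<in> fl_mods R"
  hence M: "fm M" by simp
  obtain U where U: "submodule U R M" "sub_mod M U \<in> orth S" "!!V. [|submodule V R M; sub_mod M V \<in> orth S|] ==> V \<subseteq> U"
    using orth_max[OF S M] by blast
  obtain V where V: "submodule V R M" "sub_mod M V \<in> orth T" "!!W. [|submodule W R M; sub_mod M W \<in> orth T|] ==> W \<subseteq> V"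
    using orth_max[OF T M] by blast
  have UV: "submodule (U \<inter> V) R M" by (rule sub_Int[OF M U(1) V(1)])
  have "U \<inter> V = {\<zero>\<^sub>M}"
  proof (rule ccontr)
    assume "\<not> ?thesis"
    then obtain w where w: "w \<in> U \<inter> V" "w \<noteq> \<zero>\<^sub>M" using subD(2)[OF UV M] by blast
    have S': "sub_mod M (U \<inter> V) \<in> orth S"
      using orth_sub[OF S fm_sub[OF M U(1)] U(2), of "U \<inter> V"] sub_sub[OF M U(1)] UV by (simp add: sub_mod_sub_mod)
    have T': "sub_mod M (U \<inter> V) \<in> orth T"
      using orth_sub[OF T fm_sub[OF M V(1)] V(2), of "U \<inter> V"] sub_sub[OF M V(1)] UV by (simp add: sub_mod_sub_mod)
    have "w \<in> car (sub_mod M (U \<inter> V))" using w(1) by simp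
    from orth_hom_zero[OF cover S' T' lin_id this] show False using w(2) by simp
  qed
  moreover have "plus_set M U V = car M"
  proof (rule ccontr)
    note P = sub_plus[OF M U(1) V(1)] and up = plus_set_upper[OF M U(1) V(1)]
    assume "\<not> ?thesis"
    then obtain m where m: "m \<in> car M" "m \<notin> plus_set M U V" using subD(1)[OF P M] by blast
    obtain Q :: "'r nmod" and f x where Q: "fm Q" "projective R Q" "indec Q" "lin Q M f" "x \<in> car Q" "f x \<notin> plus_set M U V"
      using projective_source_quot[OF M P m] by blast
    have I: "submodule (f ` car Q) R M" by (rule sub_image[OF Q(1) M Q(4) sub_all[OF Q(1)]])
    have l: "lin Q (sub_mod M (f ` car Q)) f" using Q(4) by (rule lin_sub_cod) auto
    have onto: "f ` car Q = car (sub_mod M (f ` car Q))" by simp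
    from cover[OF Q(1,3,2)] show False
    proof
      assume "Q \<in> T"
      hence "Q \<in> orth S" using Q(1) ST by (simp add: orth_def)
      from orth_image_nat[OF S this fm_sub[OF M I] l onto] show False using U(3)[OF I] up(1) Q(5,6) by blast
    next
      assume "Q \<in> S"
      hence "Q \<in> orth T" using Q(1) TS by (simp add: orth_def)
      from orth_image_nat[OF T this fm_sub[OF M I] l onto] show False using V(3)[OF I] up(2) Q(5,6) by blast
    qed
  qed
  ultimately have "int_direct_sum R M U V" using U(1) V(1) by (simp add: int_direct_sum_iff)
  thus "\<exists>U V. int_direct_sum R M U V \<and> sub_mod M U \<in> orth S \<and> sub_mod M V \<in> orth T" using U(2) V(2) by blast
qed

text \<open>A nonzero functional on \<open>P\<close> is injective, so \<open>P\<close> embeds in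
  \<open>R\<close>.\<close>

lemma card_indec_projective:
  assumes P: "fm P" "indec P" "projective R P" shows "card (car P) \<le> card (car R)"
proof -
  obtain x where x: "x \<in> car P" "x \<noteq> \<zero>\<^sub>P" using P(2) is_zeroI[OF P(1)] unfolding indecomposable_def by blast
  then obtain \<phi> where \<phi>: "lin P Rm \<phi>" "\<phi> x \<noteq> \<zero>\<^sub>Rm" using torsionless_projective[OF P(1,3)] by (auto simp: torsionless_def)
  have "inj_on \<phi> (car P)" by (rule indec_hom_split[OF P(1,2) fm_reg projective_reg \<phi>(1) x(1) \<phi>(2)])
  moreover have "\<phi> ` car P \<subseteq> car R" using lin_closed[OF \<phi>(1)] by auto
  ultimately show ?thesis using card_inj_on_le finite_R by blast
qed

abbreviation IP :: "'r nmod set" where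
  "IP \<equiv> {P. fm P \<and> indec P \<and> projective R P}"

lemma finite_IP: "finite (iso_class R ` IP)"
  by (rule finite_subset[OF image_mono finite_classes[of "card (car R)"]]) (use card_indec_projective in blast)

text \<open>The chains from injectives to the finitely many indecomposable projectives have bounded length
  \<open>N\<close>; \<open>\<tau>\<^sup>n M\<close> with \<open>n > N\<close> would receive no map from a projective module.\<close>

lemma qi_projectives_finite_type:
  assumes all: "!!P. P \<in> IP ==> qi P"
  shows "\<not> infinite_type R"
proof -
  \<comment> \<open>The least length of a chain from an injective to \<open>P\<close>. It depends
    only on the isomorphism class, so it takes finitely many values.\<close>
  define nn where "nn P = (LEAST n. \<exists>I. (tt ^^ n) I P \<and> injective R I)" for P
  have nn: "\<exists>I. (tt ^^ nn P) I P \<and> injective R I" if "P \<in> IP" for P using all[OF that] unfolding nn_def qi_def by (rule LeastI_ex)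
  have chain: "(\<exists>I. (tt ^^ n) I P \<and> injective R I) \<longleftrightarrow> (\<exists>I. (tt ^^ n) I P' \<and> injective R I)"
    if "P \<in> IP" "P' \<in> IP" "iso_class R P = iso_class R P'" for n P P'
    using qi_chain_iso[of n _ P P'] qi_chain_iso[of n _ P' P] iso_class_eq[of P P'] iso_class_eq[of P' P] that by auto
  have "nn P = nn P'" if "P \<in> IP" "P' \<in> IP" "iso_class R P = iso_class R P'" for P P' unfolding nn_def chain[OF that] ..
  hence "finite (nn ` IP)" using finite_image_factor[OF finite_IP, of nn] by blast
  hence "\<forall>P\<in>IP. nn P \<le> Max (nn ` IP)" by (meson Max_ge imageI)
  then obtain N where N: "!!P. P \<in> IP ==> nn P \<le> N" by blast
  define T where "T n = {M. fm M \<and> indec M \<and> (\<exists>P. (tt ^^ n) M P \<and> projective R P)}" for n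
  have "M \<in> (\<Union>n\<le>N. T n)" if M: "fm M" "indec M" for M
  proof (rule ccontr)
    assume "\<not> ?thesis"
    hence np: "\<not> projective R P" if "n \<le> N" "(tt ^^ n) M P" for n P using M that by (auto simp: T_def)
    have "\<exists>V. (tt ^^ n) M V" if "n \<le> Suc N" for n using that
    proof (induction n)
      case (Suc n)
      then obtain V where V: "(tt ^^ n) M V" by auto
      then obtain V' where "tt V V'" using tt_exists[of V] np[OF _ V] tt_pow_fm[OF V] M Suc.prems by auto
      thus ?case using V by auto
    qed auto
    then obtain V where V: "(tt ^^ Suc N) M V" by blast
    note fV = tt_pow_fm[OF V]
    have "h P V = 1" if P: "P \<in> IP" for P
    proof -
      obtain I where I: "(tt ^^ nn P) I P" "injective R I" using nn[OF P] by blast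
      \<comment> \<open>Split the chain from \<open>M\<close> to \<open>V\<close> so that its last
        \<open>nn P\<close> steps run parallel to the chain from \<open>I\<close> to
        \<open>P\<close>; then \<open>h P V = h I Y\<close>. At least one step remains in front, so
        \<open>Y\<close> is a translate and not injective, and \<open>I\<close> has no nonzero map
        to it.\<close>
      have "Suc N = Suc (N - nn P) + nn P" using N[OF P] by simp
      hence "(tt ^^ Suc (N - nn P) OO tt ^^ nn P) M V" using V relpowp_add[of "Suc (N - nn P)" "nn P" tt] by simp
      then obtain Y where Y: "(tt ^^ Suc (N - nn P)) M Y" "(tt ^^ nn P) Y V" by (auto simp del: relpowp.simps)
      obtain X where X: "tt X Y" using Y(1) by auto
      have fI: "fm I"
      proof (cases "nn P")
        case 0
        hence "I = P" using I(1) by simp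
        thus ?thesis using P by blast
      next
        case (Suc k)
        hence "(tt ^^ Suc k) I P" using I(1) by simp
        from relpowp_Suc_D2[OF this] show ?thesis using tt_fm by blast
      qed
      have "h I Y = 1" using h_eq_1[OF fI, of Y] injective_to_indec[OF fI I(2), of Y] tt_target[OF X] tt_fm[OF X] by blast
      thus ?thesis using tt_pow_h[OF I(1) Y(2)] by simp
    qed
    hence "V \<in> orth IP" using fV M by (simp add: orth_def)
    moreover obtain v where "v \<in> car V" "v \<noteq> \<zero>\<^sub>V" using fV M is_zeroI[of V] unfolding indecomposable_def by blast
    ultimately show False using projective_source[of V v] fV M orthD[of V IP] by blast
  qed
  hence sub: "iso_class R ` {M \<in> fl_mods R. indec M} \<subseteq> (\<Union>n\<le>N. iso_class R ` T n)" unfolding fl_mods_iff by blast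
  have "finite (iso_class R ` T n)" for n
  proof -
    \<comment> \<open>A module in \<open>T n\<close> is determined up to isomorphism by the
      projective at the end of its chain, and up to isomorphism there are finitely many of
      those.\<close>
    define g where "g M = (SOME P. (tt ^^ n) M P \<and> projective R P)" for M
    have g: "(tt ^^ n) M (g M)" "projective R (g M)" if "M \<in> T n" for M
      using someI_ex[of "\<lambda>P. (tt ^^ n) M P \<and> projective R P"] that by (auto simp: T_def g_def)
    have gI: "g M \<in> IP" if "M \<in> T n" for M using g[OF that] tt_pow_fm[OF g(1)[OF that]] that by (auto simp: T_def)
    have "finite ((\<lambda>M. iso_class R (g M)) ` T n)" by (rule finite_subset[OF _ finite_IP]) (use gI in blast)
    moreover have "iso_class R M = iso_class R M'" if "M \<in> T n" "M' \<in> T n" "iso_class R (g M) = iso_class R (g M')" for M M'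
      using tt_pow_source[OF g(1)[OF that(1)] g(1)[OF that(2)]] iso_class_eq[of "g M" "g M'"] gI[OF that(1)] gI[OF that(2)]
        iso_class_eq[of M M'] that by (auto simp: T_def)
    ultimately show ?thesis by (rule finite_image_factor)
  qed
  hence "finite (iso_classes R {M \<in> fl_mods R. indec M})"
    unfolding iso_classes_def using finite_subset[OF sub finite_UN_I[OF finite_atMost]] by blast
  thus ?thesis by (simp add: infinite_type_def)
qed

end

locale connected_hereditary_ring = hereditary_ring R for R :: "('r, 's) ring_scheme" (structure) +
  assumes connected: "connected_cat R" and infinite_type: "infinite_type R"
begin

text \<open>Following the orbit, some indecomposable projective is \<open>qi\<close>. The
  projectives that are \<open>qi\<close> and those that are not have no nonzero maps between them,
  in one direction by \<open>hom_qi\<close> and in the other by \<open>qi_projective_source\<close>.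
  Infinite type provides one of the second kind, so the category would decompose.\<close>

lemma not_pp_qi:
  assumes U: "fm U" "indec U" and "pp U" "qi U" shows False
proof -
  obtain n P where n: "(tt ^^ n) U P" "projective R P" using assms by (auto simp: pp_def)
  have "qi P" using n(1) assms(4)
  proof (induction n arbitrary: P)
    case (Suc n)
    thus ?case using qi_tt by auto
  qed simp
  hence P: "P \<in> IP" "qi P" using tt_pow_fm[OF n(1)] U n(2) by auto
  let ?D = "{P \<in> IP. qi P}" and ?E = "{P \<in> IP. \<not> qi P}"
  have DE: "h P Q = 1" if "P \<in> ?D" "Q \<in> ?E" for P Q using hom_qi that by blast
  have ED: "h Q P = 1" if "Q \<in> ?E" "P \<in> ?D" for P Q using qi_projective_source that by blast
  have "?E \<noteq> {}" using qi_projectives_finite_type infinite_type by blast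
  then obtain Q where Q: "Q \<in> ?E" by blast
  have "cat_direct_sum R (orth ?D) (orth ?E)" by (rule orth_direct_sum) (use DE ED in auto)
  moreover have "Q \<in> orth ?D" "P \<in> orth ?E" using Q P DE ED by (auto simp: orth_def)
  moreover have "\<not> is_zero Q" "\<not> is_zero P" using Q P by (auto simp: indecomposable_def)
  moreover have "abelian_subcat R (orth ?D)" "abelian_subcat R (orth ?E)" by (rule orth_abelian; blast)+
  ultimately show False using connected unfolding connected_cat_def by blast
qed

end

section \<open>The torsion pairs and the canonical filtration\<close>

context finite_ring
begin

definition lorth :: "('r nmod => bool) => ('r, 'a) module => bool" where
  "lorth Y M \<longleftrightarrow> fm M \<and> (\<forall>U f x. fm U --> Y U --> lin M U f --> x \<in> car M --> f x = \<zero>\<^sub>U)"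

definition rorth :: "('r nmod => bool) => ('r, 'a) module => bool" where
  "rorth Y M \<longleftrightarrow> fm M \<and> (\<forall>U f x. fm U --> Y U --> lin U M f --> x \<in> car U --> f x = \<zero>\<^sub>M)"

lemma finite_submodules: "fm M ==> finite {U. submodule U R M}"
  using finite_subset[of "{U. submodule U R M}" "Pow (car M)"] subD(1) fm_finite by blast

lemma lorth_h: "lorth Y M \<longleftrightarrow> fm M \<and> (\<forall>U. fm U --> Y U --> h M U = 1)" unfolding lorth_def using h_eq_1[of M] by blast

lemma rorth_h: "rorth Y M \<longleftrightarrow> fm M \<and> (\<forall>U. fm U --> Y U --> h U M = 1)"
  unfolding rorth_def using h_eq_1[of _ M] by blast

lemma lorthD: "[|lorth Y M; fm U; Y U; lin M U f; x \<in> car M|] ==> f x = \<zero>\<^sub>U" unfolding lorth_def by blast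

lemma rorthD: "[|rorth Y M; fm U; Y U; lin U M f; x \<in> car U|] ==> f x = \<zero>\<^sub>M" unfolding rorth_def by blast

lemma orth_fm: "lorth Y M ==> fm M" "rorth Y M ==> fm M" by (auto simp: lorth_def rorth_def)

lemma lorth_zero: assumes "fm M" "is_zero M" shows "lorth Y M" using assms lin_zero[OF assms(1)] by (auto simp: lorth_def is_zero_def)

lemma rorth_zero: assumes "fm M" "is_zero M" shows "rorth Y M" using assms lin_closed[of _ M] by (fastforce simp: rorth_def is_zero_def)

lemma lorth_image:
  assumes M: "lorth Y M" and N: "fm N" and q: "lin M N q" "q ` car M = car N" shows "lorth Y N" unfolding lorth_def
proof (intro conjI allI impI)
  fix U f x assume *: "fm U" "Y U" "lin N U f" "x \<in> car N"
  obtain m where "m \<in> car M" "x = q m" using q(2) *(4) by blast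
  thus "f x = \<zero>\<^sub>U" using lorthD[OF M *(1,2) lin_comp[OF q(1) *(3)]] by simp
qed (rule N)

lemma rorth_embed:
  assumes M: "rorth Y M" and N: "fm N" and i: "lin N M i" "!!x. [|x \<in> car N; i x = \<zero>\<^sub>M|] ==> x = \<zero>\<^sub>N"
  shows "rorth Y N" unfolding rorth_def
proof (intro conjI allI impI)
  fix U f x assume *: "fm U" "Y U" "lin U N f" "x \<in> car U"
  show "f x = \<zero>\<^sub>N" using rorthD[OF M *(1,2) lin_comp[OF *(3) i(1)] *(4)] i(2) lin_closed[OF *(3,4)] by blast
qed (rule N)

lemma rorth_sub: "[|rorth Y M; submodule U R M|] ==> rorth Y (sub_mod M U)" by (rule rorth_embed[OF _ fm_sub lin_incl]) (auto simp: rorth_def)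

lemma lorth_iso: assumes "mod_iso R M N" "lorth Y M" "fm N" shows "lorth Y N"
proof -
  obtain f where "lin M N f" "bij_betw f (car M) (car N)" using mod_isoE[OF assms(1)] .
  thus ?thesis using lorth_image[OF assms(2,3)] by (simp add: bij_betw_def)
qed

lemma rorth_iso: assumes "mod_iso R M N" "rorth Y M" "fm N" shows "rorth Y N"
proof -
  have M: "fm M" using assms(2) by (rule orth_fm)
  obtain f where f: "lin N M f" "bij_betw f (car N) (car M)" using mod_isoE[OF iso_sym[OF assms(1) M assms(3)]] .
  hence "inj_on f (car N)" by (simp add: bij_betw_def)
  thus ?thesis using rorth_embed[OF assms(2,3) f(1)] inj_on_iff_ker[OF assms(3) M f(1)] by blast
qed

lemma lorth_extension:
  assumes M: "fm M" and q: "lin M N q" "q ` car M = car N" and N: "lorth Y N" and K: "lorth Y (sub_mod M (ker M N q))"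
  shows "lorth Y M" unfolding lorth_def
proof (intro conjI allI impI)
  fix U f x assume *: "fm U" "Y U" "lin M U f" "x \<in> car M"
  have fN: "fm N" using N by (rule orth_fm)
  have "f y = \<zero>\<^sub>U" if "y \<in> car M" "q y = \<zero>\<^sub>N" for y
    using lorthD[OF K *(1,2) lin_sub_dom[OF *(3) sub_ker[OF M fN q(1)] M]] that by (simp add: ker_def)
  then obtain g where g: "lin N U g" "\<forall>x\<in>car M. g (q x) = f x" using factor'[OF M fN *(1) q *(3)] by blast
  show "f x = \<zero>\<^sub>U" using lorthD[OF N *(1,2) g(1) lin_closed[OF q(1) *(4)]] g(2) *(4) by simp
qed (rule M)

lemma rorth_extension:
  assumes M: "fm M" and q: "lin M N q" and N: "rorth Y N" and K: "rorth Y (sub_mod M (ker M N q))"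
  shows "rorth Y M" unfolding rorth_def
proof (intro conjI allI impI)
  fix U f x assume *: "fm U" "Y U" "lin U M f" "x \<in> car U"
  have "f x \<in> ker M N q" if "x \<in> car U" for x
    using rorthD[OF N *(1,2) lin_comp[OF *(3) q] that] lin_closed[OF *(3) that] by (simp add: ker_def)
  hence "lin U (sub_mod M (ker M N q)) f" by (rule lin_sub_cod[OF *(3)])
  thus "f x = \<zero>\<^sub>M" using rorthD[OF K *(1,2) _ *(4)] by simp
qed (rule M)

lemma summand_projection:
  assumes M: "fm M" and S: "int_direct_sum R M U V"
  shows "\<exists>p. lin M (sub_mod M U) p \<and> p ` car M = car (sub_mod M U) \<and> ker M (sub_mod M U) p = V"
proof -
  obtain p where p: "lin M (sub_mod M U) p" "!!u. u \<in> U ==> p u = u"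
    "!!v. v \<in> V ==> p v = \<zero>\<^sub>M" "!!x. x \<in> car M ==> x \<ominus>\<^sub>M p x \<in> V" using projection[OF M S] by blast
  have U: "U \<subseteq> car M" and V: "V \<subseteq> car M" using S subD(1)[OF _ M] by (auto simp: int_direct_sum_iff)
  have "x \<in> V" if "x \<in> car M" "p x = \<zero>\<^sub>M" for x using p(4)[OF that(1)] that M by simp
  hence "ker M (sub_mod M U) p = V" using p(3) V by (auto simp: ker_def)
  moreover have "p ` car M = car (sub_mod M U)"
  proof
    show "p ` car M \<subseteq> car (sub_mod M U)" using lin_closed[OF p(1)] by blast
    show "car (sub_mod M U) \<subseteq> p ` car M"
    proof
      fix u assume "u \<in> car (sub_mod M U)"
      hence "u \<in> U" by simp
      thus "u \<in> p ` car M" using p(2) U by (metis image_eqI subsetD)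
    qed
  qed
  ultimately show ?thesis using p(1) by blast
qed

lemma dsum_iso:
  assumes M: "fm M" "mod_iso R M M'" and N: "fm N" "mod_iso R N N'" shows "mod_iso R (dsum M N) (dsum M' N')"
proof -
  obtain f where f: "lin M M' f" "bij_betw f (car M) (car M')" using mod_isoE[OF M(2)] .
  obtain g where g: "lin N N' g" "bij_betw g (car N) (car N')" using mod_isoE[OF N(2)] .
  note l = lin_pair[OF lin_comp[OF dsum_lin(3)[OF M(1) N(1)] f(1)] lin_comp[OF dsum_lin(4)[OF M(1) N(1)] g(1)]]
  have "bij_betw (\<lambda>x. (f (fst x), g (snd x))) (car (dsum M N)) (car (dsum M' N'))"
    using bij_betw_map_prod[OF f(2) g(2)] by (simp add: map_prod_def case_prod_beta')
  thus ?thesis using mod_isoI[OF fm_dsum[OF M(1) N(1)] l] by blast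
qed

lemma dsum_sub_quot:
  assumes N: "fm N" and I: "fm I" and K: "fm K" and iso: "mod_iso R (dsum N I) K"
  shows "\<exists>U. submodule U R K \<and> mod_iso R I (sub_mod K U) \<and> mod_iso R N (quot_mod K U)"
proof -
  note D = fm_dsum[OF N I] and dl = dsum_lin[OF N I]
  obtain f where f: "lin (dsum N I) K f" "bij_betw f (car (dsum N I)) (car K)" using mod_isoE[OF iso] .
  obtain g where g: "lin K (dsum N I) g" "bij_betw g (car K) (car (dsum N I))" "\<forall>x\<in>car (dsum N I). g (f x) = x" "\<forall>y\<in>car K. f (g y) = y"
    using lin_bij_inv[OF D f] bij_betw_inv_into_left[OF f(2)] bij_betw_inv_into_right[OF f(2)] by blast
  define s where "s = (\<lambda>y. f (\<zero>\<^sub>N, y))"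
  have s: "lin I K s" unfolding s_def by (rule lin_comp[OF dl(2) f(1)])
  have gs: "g (s y) = (\<zero>\<^sub>N, y)" if "y \<in> car I" for y using g(3) that N by (simp add: s_def)
  define U where "U = s ` car I"
  have U: "submodule U R K" unfolding U_def by (rule sub_image[OF I K s sub_all[OF I]])
  have sU: "lin I (sub_mod K U) s" using s by (rule lin_sub_cod) (auto simp: U_def)
  have "inj_on s (car I)" by (rule inj_onI) (metis gs prod.inject)
  hence "mod_iso R I (sub_mod K U)" using mod_isoI[OF I sU] by (simp add: bij_betw_def U_def)
  moreover have "mod_iso R N (quot_mod K U)"
  proof (rule surj_iso[OF K N quot_mod(1)[OF K U] lin_comp[OF g(1) dl(3)] _ quot_mod(2,3)[OF K U]])
    show "(\<lambda>x. fst (g x)) ` car K = car N"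
    proof -
      have "(\<lambda>x. fst (g x)) ` car K = fst ` car (dsum N I)" using g(2) by (metis bij_betw_imp_surj_on image_image)
      also have "\<dots> = car N" using fm_zero[OF I] by force
      finally show ?thesis .
    qed
    fix x assume x: "x \<in> car K"
    have gx: "g x \<in> car (dsum N I)" using lin_closed[OF g(1) x] .
    have "x \<in> U" if "fst (g x) = \<zero>\<^sub>N"
    proof -
      have "x = s (snd (g x))" using g(4) x that unfolding s_def by (metis prod.collapse)
      moreover have "snd (g x) \<in> car I" using gx by auto
      ultimately show ?thesis unfolding U_def by (rule image_eqI)
    qed
    moreover have "fst (g x) = \<zero>\<^sub>N" if "x \<in> U" using that gs by (auto simp: U_def)
    ultimately show "fst (g x) = \<zero>\<^sub>N \<longleftrightarrow> a_r_coset K U x = \<zero>\<^sub>(quot_mod K U)" using quot_mod(4)[OF K U x] by blast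
  qed
  ultimately show ?thesis using U by blast
qed

end

section \<open>Ext along short exact sequences, and splitting\<close>

context hereditary_ring
begin

text \<open>Between the syzygy and \<open>F M\<close> lies the kernel of the map from
  \<open>F M\<close> to \<open>N\<close>. The cocycle is extended first to it, with obstruction in
  Ext of the kernel of \<open>q\<close>, and then to \<open>F M\<close>, with obstruction in Ext of
  \<open>N\<close>.\<close>

lemma ext1_vanishes_extension:
  assumes M: "fm M" and N: "fm N" and C: "fm C" and q: "lin M N q" "q ` car M = car N"
    and vN: "ext1_vanishes R N C" and vK: "ext1_vanishes R (sub_mod M (ker M N q)) C"
  shows "ext1_vanishes R M C" unfolding ext1_vanishes_iff[OF M C]
proof (intro allI impI)
  fix \<psi> assume \<psi>: "lin (Om M) C \<psi>"
  note FM = fm_F[OF M] and pi = lin_pi[OF M]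
  let ?A = "sub_mod M (ker M N q)" and ?K = "ker (F M) N (\<lambda>c. q (pi M c))"
  note qp = lin_comp[OF pi q(1)]
  note K = sub_ker[OF FM N qp] and A = sub_ker[OF M N q(1)]
  let ?B = "sub_mod (F M) ?K"
  have pB: "lin ?B ?A (pi M)"
    by (rule lin_sub_cod[OF lin_sub_dom[OF pi K FM]]) (use lin_closed[OF pi] in \<open>simp add: ker_def del: F_simps\<close>)
  have onto: "pi M ` car ?B = car ?A"
  proof
    show "pi M ` car ?B \<subseteq> car ?A" using lin_closed[OF pB] by blast
    show "car ?A \<subseteq> pi M ` car ?B"
    proof
      fix a assume "a \<in> car ?A"
      hence a: "a \<in> car M" "q a = \<zero>\<^sub>N" by (auto simp: ker_def)
      then obtain c where c: "c \<in> car (F M)" "a = pi M c" using pi_onto[OF M] by blast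
      hence "c \<in> car ?B" using a(2) by (simp add: ker_def del: F_simps)
      thus "a \<in> pi M ` car ?B" using c(2) by blast
    qed
  qed
  have kB: "ker ?B ?A (pi M) = ker (F M) M (pi M)" using lin_zero[OF M N q(1)] by (auto simp: ker_def simp del: F_simps)
  have "sub_mod ?B (ker ?B ?A (pi M)) = Om M" unfolding kB Om_eq sub_mod_sub_mod ..
  hence "lin (sub_mod ?B (ker ?B ?A (pi M))) C \<psi>" using \<psi> by simp
  from ext1_split[OF fm_sub[OF FM K] fm_sub[OF M A] C pB onto vK this]
  obtain \<Phi> where \<Phi>: "lin ?B C \<Phi>" "\<forall>x\<in>ker (F M) M (pi M). \<Phi> x = \<psi> x" unfolding kB by blast
  have onto': "(\<lambda>c. q (pi M c)) ` car (F M) = car N" using q(2) pi_onto[OF M] by (metis image_image)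
  from ext1_split[OF FM N C qp onto' vN \<Phi>(1)]
  obtain \<Psi> where \<Psi>: "lin (F M) C \<Psi>" "\<forall>x\<in>?K. \<Psi> x = \<Phi> x" by blast
  have "\<Psi> x = \<psi> x" if "x \<in> car (Om M)" for x
  proof -
    have x: "x \<in> ker (F M) M (pi M)" using that by simp
    hence "x \<in> ?K" using lin_zero[OF M N q(1)] by (simp add: ker_def del: F_simps)
    thus ?thesis using \<Psi>(2) \<Phi>(2) x by simp
  qed
  thus "extendable M C \<psi>" unfolding extendable_def using \<Psi>(1) by blast
qed

text \<open>Extend the cocycle after passing to \<open>B\<close>, lift the extension along
  \<open>g\<close> because \<open>F M\<close> is projective, and correct by the difference, which
  takes values in the kernel of \<open>g\<close>.\<close>

lemma ext1_vanishes_extension':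
  assumes M: "fm M" and N: "fm N" and B: "fm B" and g: "lin N B g" "g ` car N = car B"
    and vB: "ext1_vanishes R M B" and vK: "ext1_vanishes R M (sub_mod N (ker N B g))"
  shows "ext1_vanishes R M N" unfolding ext1_vanishes_iff[OF M N]
proof (intro allI impI)
  fix \<psi> assume \<psi>: "lin (Om M) N \<psi>"
  note K = sub_ker[OF N B g(1)] and OF = lin_Om_F[OF M]
  obtain \<Phi> where \<Phi>: "lin (F M) B \<Phi>" "\<forall>x\<in>car (Om M). \<Phi> x = g (\<psi> x)"
    using vB lin_comp[OF \<psi> g(1)] unfolding ext1_vanishes_iff[OF M B] extendable_def by blast
  obtain k where k: "lin (F M) N k" "!!x. x \<in> car (F M) ==> g (k x) = \<Phi> x"
    using proj_lift[OF projective_F[OF M] fm_F[OF M] N B g \<Phi>(1)] by metis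
  let ?d = "\<lambda>x. \<psi> x \<ominus>\<^sub>N k x"
  have kO: "lin (Om M) N k" using lin_comp[OF OF k(1)] .
  have d: "lin (Om M) (sub_mod N (ker N B g)) ?d"
  proof (rule lin_sub_cod[OF lin_diff[OF N \<psi> kO]])
    fix x assume x: "x \<in> car (Om M)"
    note c = lin_closed[OF \<psi> x] lin_closed[OF kO x]
    have "g (k x) = g (\<psi> x)" using k(2)[OF Om_in_F[OF x]] \<Phi>(2) x by simp
    hence "g (?d x) = \<zero>\<^sub>B" using lin_minus[OF N B g(1) c] fm_zeros(3)[OF B lin_closed[OF g(1) c(1)]] by simp
    thus "?d x \<in> ker N B g" using c N by (simp add: ker_def)
  qed
  have "extendable M (sub_mod N (ker N B g)) ?d" using vK d unfolding ext1_vanishes_iff[OF M fm_sub[OF N K]] by blast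
  from extendable_comp[OF this lin_incl[OF N K]] have 1: "extendable M N ?d" .
  have 2: "extendable M N k" unfolding extendable_def using k(1) by blast
  show "extendable M N \<psi>"
    by (rule extendable_cong[OF extendable_plus[OF N 1 2]]) (use fm_minus_add(1)[OF N lin_closed[OF \<psi>] lin_closed[OF kO]] in blast)
qed

text \<open>The identity of \<open>U\<close> extends to a retraction of \<open>K\<close>, which
  together with the projection gives the isomorphism.\<close>

lemma split_dsum:
  assumes K: "fm K" and U: "submodule U R K" and v: "ext1_vanishes R (quot_mod K U) (sub_mod K U)"
  shows "mod_iso R (dsum (quot_mod K U) (sub_mod K U)) K"
proof -
  note Q = quot_mod[OF K U] and S = fm_sub[OF K U]
  let ?c = "a_r_coset K U"
  have k: "ker K (quot_mod K U) ?c = U" using Q(4) subD(1)[OF U K] by (auto simp: ker_def)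
  obtain r where r: "lin K (sub_mod K U) r" "\<forall>u\<in>U. r u = u"
    using ext1_split[OF K Q(1) S Q(2,3) v, of "\<lambda>x. x"] lin_id unfolding k by blast
  have "mod_iso R K (dsum (quot_mod K U) (sub_mod K U))"
  proof (rule mod_isoI'[OF K fm_dsum[OF Q(1) S] lin_pair[OF Q(2) r(1)]])
    show "(\<lambda>x. (?c x, r x)) ` car K = car (dsum (quot_mod K U) (sub_mod K U))"
    proof
      show "(\<lambda>x. (?c x, r x)) ` car K \<subseteq> car (dsum (quot_mod K U) (sub_mod K U))"
        using lin_closed[OF Q(2)] lin_closed[OF r(1)] by auto
      show "car (dsum (quot_mod K U) (sub_mod K U)) \<subseteq> (\<lambda>x. (?c x, r x)) ` car K"
      proof
        fix z assume "z \<in> car (dsum (quot_mod K U) (sub_mod K U))"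
        then obtain a u where z: "z = (a, u)" "a \<in> car (quot_mod K U)" "u \<in> U" by auto
        then obtain x where x: "x \<in> car K" "a = ?c x" using Q(3) by blast
        have rx: "r x \<in> U" using lin_closed[OF r(1) x(1)] by simp
        define d where "d = u \<ominus>\<^sub>K r x"
        have d: "d \<in> U" "d \<in> car K" using sub_minus[OF U K z(3) rx] subD(3)[OF U K] by (auto simp: d_def)
        have "?c (x \<oplus>\<^sub>K d) = ?c x \<oplus>\<^sub>(quot_mod K U) ?c d" using lin_add[OF Q(2) x(1) d(2)] .
        also have "\<dots> = ?c x" using Q(4)[OF d(2)] d(1) fm_zeros(2)[OF Q(1) lin_closed[OF Q(2) x(1)]] by simp
        finally have 1: "?c (x \<oplus>\<^sub>K d) = a" using x(2) by simp
        have "r (x \<oplus>\<^sub>K d) = r x \<oplus>\<^sub>K d" using lin_add[OF r(1) x(1) d(2)] r(2) d(1) by simp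
        hence "r (x \<oplus>\<^sub>K d) = u" using fm_minus_add(2)[OF K subD(3)[OF U K z(3)] subD(3)[OF U K rx]] by (simp add: d_def)
        thus "z \<in> (\<lambda>x. (?c x, r x)) ` car K" using 1 z(1) fm_add[OF K x(1) d(2)] by force
      qed
    qed
    fix x assume x: "x \<in> car K" "(?c x, r x) = \<zero>\<^sub>(dsum (quot_mod K U) (sub_mod K U))"
    hence "x \<in> U" using Q(4) by simp
    thus "x = \<zero>\<^sub>K" using r(2) x(2) by simp
  qed
  thus ?thesis using iso_sym K fm_dsum[OF Q(1) S] by blast
qed

end

section \<open>The three subcategories as orthogonal classes\<close>

context connected_hereditary_ring
begin

text \<open>\<open>Ap\<close>, \<open>Am\<close> and \<open>A0\<close> turn out to be the
  preinjective, preprojective and regular modules. Orthogonality makes closure of \<open>Ap\<close>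
  under quotients and extensions, and of \<open>Am\<close> under submodules and extensions,
  immediate.\<close>

definition Ap :: "('r, 'a) module => bool" where
  "Ap M \<longleftrightarrow> lorth (\<lambda>U. indec U \<and> \<not> qi U) M"

definition Am :: "('r, 'a) module => bool" where
  "Am M \<longleftrightarrow> rorth (\<lambda>U. indec U \<and> \<not> pp U) M"

definition A0 :: "('r, 'a) module => bool" where
  "A0 M \<longleftrightarrow> rorth Ap M \<and> lorth Am M"

lemma Ap_fm: "Ap M ==> fm M" and Am_fm: "Am M ==> fm M" and A0_fm: "A0 M ==> fm M" by (auto simp: Ap_def Am_def A0_def orth_fm)

lemma Ap_iso: "[|mod_iso R M N; Ap M; fm N|] ==> Ap N" unfolding Ap_def by (rule lorth_iso)

lemma Am_iso: "[|mod_iso R M N; Am M; fm N|] ==> Am N" unfolding Am_def by (rule rorth_iso)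

lemma A0_iso: "[|mod_iso R M N; A0 M; fm N|] ==> A0 N" unfolding A0_def using lorth_iso rorth_iso by blast

lemma qi_Ap: "[|fm J; qi J|] ==> Ap J" unfolding Ap_def lorth_h using hom_qi by blast

lemma pp_Am: "[|fm Q; pp Q|] ==> Am Q" unfolding Am_def rorth_h using hom_pp by blast

lemma Ap_qi: "[|Ap U; indec U|] ==> qi U" unfolding Ap_def lorth_h using indec_nonzero by blast

lemma Am_pp: "[|Am U; indec U|] ==> pp U" unfolding Am_def rorth_h using indec_nonzero by blast

text \<open>A nonzero map to an indecomposable outside the orbits of injectives is nonzero on an
  indecomposable summand, against \<open>hom_qi\<close>. Conversely a summand is a quotient, so it
  stays in \<open>Ap\<close>, and an indecomposable in \<open>Ap\<close> is \<open>qi\<close>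
  because of its identity map.\<close>

lemma preinjective_Ap: "preinjective R = {M. Ap M}"
proof (rule equalityI; rule subsetI)
  fix M assume "M \<in> preinjective R"
  hence M: "fm M" and q: "!!U V. [|int_direct_sum R M U V; indec (sub_mod M U)|] ==> qi (sub_mod M U)"
    using qi_tau_minus fm_sub unfolding preinjective_def int_direct_sum_iff fl_mods_iff by blast+
  have "f x = \<zero>\<^sub>U" if U: "fm U" "indec U \<and> \<not> qi U" and f: "lin M U f" and x: "x \<in> car M" for U f x
  proof (rule ccontr)
    assume "f x \<noteq> \<zero>\<^sub>U"
    then obtain W p where W: "submodule W R M" "indec (sub_mod M W)" "lin M (sub_mod M W) p" "\<forall>u\<in>W. p u = u" "\<exists>u\<in>W. f u \<noteq> \<zero>\<^sub>U"
      using indec_retract_source[OF M U(1) f x] by blast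
    note S = fm_sub[OF M W(1)]
    have "h (sub_mod M W) U = 1" using hom_qi[OF U(1) _ _ S q[OF retract_summand[OF M W(1,3,4)] W(2)]] U(2) by blast
    thus False using h_eq_1[OF S U(1)] lin_sub_dom[OF f W(1) M] W(5) by auto
  qed
  thus "M \<in> {M. Ap M}" using M by (simp add: Ap_def lorth_def)
next
  fix M :: "'r nmod" assume "M \<in> {M. Ap M}"
  hence A: "Ap M" by simp
  note M = Ap_fm[OF A]
  have "qi (sub_mod M U)" if ids: "int_direct_sum R M U V" and I: "indec (sub_mod M U)" for U V
  proof -
    have U: "submodule U R M" using ids by (simp add: int_direct_sum_iff)
    obtain p where p: "lin M (sub_mod M U) p" "p ` car M = car (sub_mod M U)" using summand_projection[OF M ids] by blast
    have "Ap (sub_mod M U)" using lorth_image[OF A[unfolded Ap_def] fm_sub[OF M U] p] by (simp add: Ap_def)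
    thus ?thesis using Ap_qi I by blast
  qed
  thus "M \<in> preinjective R" using M qi_tau_minus fm_sub unfolding preinjective_def int_direct_sum_iff fl_mods_iff mem_Collect_eq by metis
qed

lemma preprojective_Am: "preprojective R = {M. Am M}"
proof (rule equalityI; rule subsetI)
  fix M assume "M \<in> preprojective R"
  hence M: "fm M" and q: "!!U V. [|int_direct_sum R M U V; indec (sub_mod M U)|] ==> pp (sub_mod M U)"
    using pp_tau_plus fm_sub unfolding preprojective_def int_direct_sum_iff fl_mods_iff by blast+
  have "f x = \<zero>\<^sub>M" if U: "fm U" "indec U \<and> \<not> pp U" and f: "lin U M f" and x: "x \<in> car U" for U f x
  proof (rule ccontr)
    assume "f x \<noteq> \<zero>\<^sub>M"
    then obtain W p where W: "submodule W R M" "indec (sub_mod M W)" "lin M (sub_mod M W) p" "\<forall>u\<in>W. p u = u" "p (f x) \<noteq> \<zero>\<^sub>M"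
      using indec_retract[OF M lin_closed[OF f x]] by blast
    note S = fm_sub[OF M W(1)]
    have "h U (sub_mod M W) = 1" using hom_pp[OF U(1) _ _ S q[OF retract_summand[OF M W(1,3,4)] W(2)]] U(2) by blast
    thus False using h_eq_1[OF U(1) S] lin_comp[OF f W(3)] W(5) x by auto
  qed
  thus "M \<in> {M. Am M}" using M by (simp add: Am_def rorth_def)
next
  fix M :: "'r nmod" assume "M \<in> {M. Am M}"
  hence A: "Am M" by simp
  note M = Am_fm[OF A]
  have "pp (sub_mod M U)" if ids: "int_direct_sum R M U V" and I: "indec (sub_mod M U)" for U V
  proof -
    have U: "submodule U R M" using ids by (simp add: int_direct_sum_iff)
    have "Am (sub_mod M U)" using rorth_sub[OF A[unfolded Am_def] U] by (simp add: Am_def)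
    thus ?thesis using Am_pp I by blast
  qed
  thus "M \<in> preprojective R" using M pp_tau_plus fm_sub unfolding preprojective_def int_direct_sum_iff fl_mods_iff mem_Collect_eq by metis
qed

text \<open>A nonzero map is nonzero on an indecomposable summand of its source. This summand is in
  \<open>Ap\<close>, hence \<open>qi\<close>, and by \<open>not_pp_qi\<close> not \<open>pp\<close>,
  so it has no nonzero map to \<open>Am\<close>.\<close>

lemma Am_rorth_Ap: assumes A: "Am N" shows "rorth Ap N"
proof -
  note N = Am_fm[OF A]
  have "f x = \<zero>\<^sub>N" if M: "fm M" "Ap M" and f: "lin M N f" and x: "x \<in> car M" for M :: "'r nmod" and f x
  proof (rule ccontr)
    assume nz: "f x \<noteq> \<zero>\<^sub>N"
    obtain W p where W: "submodule W R M" "indec (sub_mod M W)" "lin M (sub_mod M W) p" "\<forall>u\<in>W. p u = u" "\<exists>u\<in>W. f u \<noteq> \<zero>\<^sub>N"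
      using indec_retract_source[OF M(1) N f x nz] by blast
    note S = fm_sub[OF M(1) W(1)]
    obtain q where q: "lin M (sub_mod M W) q" "q ` car M = car (sub_mod M W)"
      using summand_projection[OF M(1) retract_summand[OF M(1) W(1,3,4)]] by blast
    have "Ap (sub_mod M W)" using lorth_image[OF M(2)[unfolded Ap_def] S q] by (simp add: Ap_def)
    hence "\<not> pp (sub_mod M W)" using Ap_qi W(2) not_pp_qi S by blast
    thus False using rorthD[OF A[unfolded Am_def] S _ lin_sub_dom[OF f W(1) M(1)]] W(2,5) by auto
  qed
  thus ?thesis using N by (simp add: rorth_def)
qed

text \<open>For an indecomposable nonprojective \<open>P\<close> the group has the size of Hom(N,
  \<tau> P), and \<tau> P is again in \<open>Am\<close>. Decomposable \<open>P\<close> are reduced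
  to proper summands.\<close>

lemma ext1_Am:
  assumes N: "fm N" and hom: "!!V :: 'r nmod. [|fm V; Am V|] ==> h N V = 1" and "Am (P :: 'r nmod)"
  shows "ext1_vanishes R P N" using assms(3)
proof (induction "card (car P)" arbitrary: P rule: less_induct)
  case less
  note P = Am_fm[OF less.prems]
  consider "is_zero P" | "indec P" "projective R P" | "indec P" "\<not> projective R P" | "\<not> indec P" "\<not> is_zero P" by blast
  thus ?case
  proof cases
    case 3
    obtain U where U: "tt P U" using tt_exists[OF P 3] by blast
    have "pp U" using pp_tt[OF U] Am_pp[OF less.prems 3(1)] by blast
    hence "h N U = 1" using hom pp_Am tt_fm[OF U] by blast
    thus ?thesis using tt_e(1)[OF U N] ext1_vanishes_card[OF P N] by simp
  next
    case 4
    obtain A B where AB: "int_direct_sum R P A B" "card A < card (car P)" "card B < card (car P)" using proper_summand[OF P 4] .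
    obtain p where p: "lin P (sub_mod P A) p" "p ` car P = car (sub_mod P A)" "ker P (sub_mod P A) p = B" using summand_projection[OF P AB(1)] by blast
    have A: "submodule A R P" and B: "submodule B R P" using AB(1) by (auto simp: int_direct_sum_iff)
    have "Am (sub_mod P A)" "Am (sub_mod P B)" using less.prems rorth_sub A B unfolding Am_def by blast+
    hence "ext1_vanishes R (sub_mod P A) N" "ext1_vanishes R (sub_mod P (ker P (sub_mod P A) p)) N" using less.hyps AB(2,3) p(3) by simp_all
    thus ?thesis using ext1_vanishes_extension[OF P fm_sub[OF P A] N p(1,2)] by blast
  qed (use projective_zero ext1_vanishes_projective P N in blast)+
qed

text \<open>Dually, for an indecomposable noninjective \<open>I\<close>, Ext(N, I) has the size of
  Hom from the inverse translate of \<open>I\<close> to \<open>N\<close>.\<close>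

lemma ext1_Ap:
  assumes N: "fm (N :: 'r nmod)" and hom: "!!V :: 'r nmod. [|fm V; Ap V|] ==> h V N = 1" and "Ap (I :: 'r nmod)"
  shows "ext1_vanishes R N I" using assms(3)
proof (induction "card (car I)" arbitrary: I rule: less_induct)
  case less
  note I = Ap_fm[OF less.prems]
  consider "injective R I" | "indec I" "\<not> injective R I" | "\<not> indec I" "\<not> is_zero I" using injective_zero[OF I] by blast
  thus ?case
  proof cases
    case 1
    thus ?thesis using injective_iff[OF I] N by blast
  next
    case 2
    obtain X where X: "tt X I" using tt_exists_source[OF I 2] by blast
    have "qi X" using qi_tt[OF X] Ap_qi[OF less.prems 2(1)] by blast
    hence "h X N = 1" using hom qi_Ap tt_fm[OF X] by blast
    thus ?thesis using tt_e(2)[OF X N] ext1_vanishes_card[OF N I] by simp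
  next
    case 3
    obtain A B where AB: "int_direct_sum R I A B" "card A < card (car I)" "card B < card (car I)" using proper_summand[OF I 3] .
    have A: "submodule A R I" and B: "submodule B R I" using AB(1) by (auto simp: int_direct_sum_iff)
    note fA = fm_sub[OF I A] and fB = fm_sub[OF I B]
    obtain p where p: "lin I (sub_mod I A) p" "p ` car I = car (sub_mod I A)" "ker I (sub_mod I A) p = B" using summand_projection[OF I AB(1)] by blast
    obtain q where q: "lin I (sub_mod I B) q" "q ` car I = car (sub_mod I B)" using summand_projection[OF I int_direct_sum_sym[OF I AB(1)]] by blast
    have "Ap (sub_mod I A)" "Ap (sub_mod I B)" using lorth_image[OF less.prems[unfolded Ap_def]] fA fB p q unfolding Ap_def by blast+
    hence "ext1_vanishes R N (sub_mod I A)" "ext1_vanishes R N (sub_mod I (ker I (sub_mod I A) p))" using less.hyps AB(2,3) p(3) by simp_all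
    thus ?thesis using ext1_vanishes_extension'[OF N I fA p(1,2)] by blast
  qed
qed

text \<open>The Ext conditions become Hom conditions by translating: an indecomposable
  \<open>W\<close> in \<open>Ap\<close> is not projective by \<open>not_pp_qi\<close>, so Hom(W, C)
  has the size of Ext(C, \<tau> W), with \<tau> W again in \<open>Ap\<close>; dually for
  \<open>Am\<close>.\<close>

lemma regular_A0: "regular R = {C. A0 C}"
proof (rule equalityI; rule subsetI)
  fix C assume "C \<in> regular R"
  hence C: "fm C" and P: "!!P :: 'r nmod. Am P ==> ext1_vanishes R P C" and I: "!!I :: 'r nmod. Ap I ==> ext1_vanishes R C I"
    by (auto simp: regular_def preprojective_Am preinjective_Ap)
  have "f x = \<zero>\<^sub>C" if M: "fm M" "Ap M" and f: "lin M C f" and x: "x \<in> car M" for M :: "'r nmod" and f x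
  proof (rule ccontr)
    assume nz: "f x \<noteq> \<zero>\<^sub>C"
    obtain W p where W: "submodule W R M" "indec (sub_mod M W)" "lin M (sub_mod M W) p" "\<forall>u\<in>W. p u = u" "\<exists>u\<in>W. f u \<noteq> \<zero>\<^sub>C"
      using indec_retract_source[OF M(1) C f x nz] by blast
    note S = fm_sub[OF M(1) W(1)]
    have "M \<in> preinjective R" using M preinjective_Ap by blast
    hence q: "qi (sub_mod M W)" using retract_summand[OF M(1) W(1,3,4)] W(2) qi_tau_minus[OF S W(2)] unfolding preinjective_def by blast
    hence "\<not> projective R (sub_mod M W)" using not_pp_qi[OF S W(2)] unfolding pp_def by (metis relpowp_0_I)
    then obtain U where U: "tt (sub_mod M W) U" using tt_exists[OF S W(2)] by blast
    have fU: "fm U" using tt_fm[OF U] by blast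
    have "Ap U" using qi_tt[OF U] q qi_Ap fU by blast
    hence "h (sub_mod M W) C = 1" using tt_e(2)[OF U C] I ext1_vanishes_card[OF C fU] by simp
    thus False using h_eq_1[OF S C] lin_sub_dom[OF f W(1) M(1)] W(5) by auto
  qed
  moreover have "f x = \<zero>\<^sub>M" if M: "fm M" "Am M" and f: "lin C M f" and x: "x \<in> car C" for M :: "'r nmod" and f x
  proof (rule ccontr)
    assume nz: "f x \<noteq> \<zero>\<^sub>M"
    obtain W p where W: "submodule W R M" "indec (sub_mod M W)" "lin M (sub_mod M W) p" "\<forall>u\<in>W. p u = u" "p (f x) \<noteq> \<zero>\<^sub>M"
      using indec_retract[OF M(1) lin_closed[OF f x] nz] by blast
    note S = fm_sub[OF M(1) W(1)]
    have "Am (sub_mod M W)" using rorth_sub[OF M(2)[unfolded Am_def] W(1)] by (simp add: Am_def)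
    hence p: "pp (sub_mod M W)" using Am_pp W(2) by blast
    hence "\<not> injective R (sub_mod M W)" using not_pp_qi[OF S W(2)] unfolding qi_def by (metis relpowp_0_I)
    then obtain X where X: "tt X (sub_mod M W)" using tt_exists_source[OF S W(2)] by blast
    have fX: "fm X" using tt_fm[OF X] by blast
    have "Am X" using pp_tt[OF X] p pp_Am fX by blast
    hence "h C (sub_mod M W) = 1" using tt_e(1)[OF X C] P ext1_vanishes_card[OF fX C] by simp
    thus False using h_eq_1[OF C S] lin_comp[OF f W(3)] W(5) x by auto
  qed
  ultimately show "C \<in> {C. A0 C}" using C by (simp add: A0_def lorth_def rorth_def)
next
  fix C :: "'r nmod" assume "C \<in> {C. A0 C}"
  hence A: "rorth Ap C" "lorth Am C" and C: "fm C" by (auto simp: A0_def orth_fm)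
  have "ext1_vanishes R P C" if "Am P" for P :: "'r nmod" by (rule ext1_Am[OF C _ that]) (use A(2) lorth_h in blast)
  moreover have "ext1_vanishes R C I" if "Ap I" for I :: "'r nmod" by (rule ext1_Ap[OF C _ that]) (use A(1) rorth_h in blast)
  ultimately show "C \<in> regular R" using C by (simp add: regular_def preprojective_Am preinjective_Ap)
qed

text \<open>The filtration is taken in two steps, and \<open>filt2\<close> concerns a module of its
  own: the iterated Hall product sees the quotient by \<open>U\<close> only through its isomorphism
  class.\<close>

definition filt1 :: "'r nmod => nat set => bool" where
  "filt1 K U \<longleftrightarrow> submodule U R K \<and> Ap (sub_mod K U) \<and> rorth Ap (quot_mod K U)"

definition filt2 :: "'r nmod => nat set => bool" where
  "filt2 N W \<longleftrightarrow> submodule W R N \<and> A0 (sub_mod N W) \<and> Am (quot_mod N W)"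

text \<open>A largest submodule in \<open>Ap\<close> works: the preimage \<open>Y\<close> of the
  image of a map from \<open>Ap\<close> to the quotient is an extension of two members of
  \<open>Ap\<close>, so it is no larger than \<open>U\<close> and the map is zero.\<close>

lemma filt1_exists:
  assumes K: "fm K" shows "\<exists>U. filt1 K U"
proof -
  let ?T = "{U. submodule U R K \<and> Ap (sub_mod K U)}"
  have fin: "finite ?T" by (rule finite_subset[OF _ finite_submodules[OF K]]) blast
  have "is_zero (sub_mod K {\<zero>\<^sub>K})" by (simp add: is_zero_def)
  hence "{\<zero>\<^sub>K} \<in> ?T" using sub_zero[OF K] lorth_zero[OF fm_sub[OF K sub_zero[OF K]]] unfolding Ap_def by blast
  hence ne: "?T \<noteq> {}" by blast
  obtain U where U: "U \<in> ?T" "\<forall>V\<in>?T. card V \<le> card U" using Max_in[of "card ` ?T"] Max_ge[of "card ` ?T"] fin ne by fastforce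
  have UR: "submodule U R K" and UA: "Ap (sub_mod K U)" using U(1) by auto
  let ?Q = "quot_mod K U" and ?c = "a_r_coset K U"
  note Q = quot_mod[OF K UR]
  have "f x = \<zero>\<^sub>(?Q)" if X: "fm X" "Ap X" and f: "lin X ?Q f" and x: "x \<in> car X" for X :: "'r nmod" and f x
  proof -
    let ?I = "sub_mod ?Q (f ` car X)"
    define Y where "Y = {y \<in> car K. ?c y \<in> f ` car X}"
    have I: "submodule (f ` car X) R ?Q" by (rule sub_image[OF X(1) Q(1) f sub_all[OF X(1)]])
    note fI = fm_sub[OF Q(1) I]
    have Y: "submodule Y R K" unfolding Y_def by (rule sub_vimage[OF K Q(1,2) I])
    have fI': "lin X ?I f" using f by (rule lin_sub_cod) auto
    have AI: "Ap ?I" using lorth_image[OF X(2)[unfolded Ap_def] fI fI'] by (simp add: Ap_def)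
    have c: "lin (sub_mod K Y) ?I ?c" by (rule lin_sub_cod[OF lin_sub_dom[OF Q(2) Y K]]) (simp add: Y_def)
    have onto: "?c ` car (sub_mod K Y) = car ?I"
    proof
      show "?c ` car (sub_mod K Y) \<subseteq> car ?I" using lin_closed[OF c] by blast
      show "car ?I \<subseteq> ?c ` car (sub_mod K Y)"
      proof
        fix z assume "z \<in> car ?I"
        hence z: "z \<in> f ` car X" "z \<in> car ?Q" using subD(1)[OF I Q(1)] by auto
        then obtain y where "y \<in> car K" "z = ?c y" using Q(3) by blast
        thus "z \<in> ?c ` car (sub_mod K Y)" using z(1) by (auto simp: Y_def)
      qed
    qed
    have UY: "U \<subseteq> Y"
    proof
      fix u assume "u \<in> U"
      hence u: "u \<in> car K" "?c u = \<zero>\<^sub>(?Q)" using subD(1)[OF UR K] Q(4) by auto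
      thus "u \<in> Y" using subD(2)[OF I Q(1)] by (simp add: Y_def)
    qed
    have "ker (sub_mod K Y) ?I ?c = U" using Q(4) subD(1)[OF Y K] UY by (auto simp: ker_def)
    hence "Ap (sub_mod K Y)" using lorth_extension[OF fm_sub[OF K Y] c onto AI[unfolded Ap_def]] UA by (simp add: Ap_def sub_mod_sub_mod)
    hence "card Y \<le> card U" using U(2) Y by blast
    hence "U = Y" using card_seteq[OF finite_subset[OF subD(1)[OF Y K] fm_finite[OF K]] UY] by blast
    moreover obtain y where y: "y \<in> car K" "f x = ?c y" using lin_closed[OF f x] Q(3) by (metis imageE)
    ultimately have "y \<in> U" using x unfolding Y_def by (metis (mono_tags, lifting) image_eqI mem_Collect_eq)
    thus ?thesis using y Q(4) by simp
  qed
  hence "rorth Ap ?Q" using Q(1) by (simp add: rorth_def)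
  thus ?thesis using UR UA by (auto simp: filt1_def)
qed

text \<open>The map from \<open>U\<close> to the quotient by \<open>V\<close> starts in
  \<open>Ap\<close> and ends in its orthogonal, so it is zero. By symmetry the submodule is
  unique.\<close>

lemma filt1_le:
  assumes K: "fm K" and U: "filt1 K U" and V: "filt1 K V" shows "U \<subseteq> V"
proof
  have U': "submodule U R K" "Ap (sub_mod K U)" and V': "submodule V R K" "rorth Ap (quot_mod K V)" using U V by (auto simp: filt1_def)
  fix u assume u: "u \<in> U"
  have "a_r_coset K V u = \<zero>\<^sub>(quot_mod K V)"
    using rorthD[OF V'(2) fm_sub[OF K U'(1)] U'(2) lin_sub_dom[OF quot_mod(2)[OF K V'(1)] U'(1) K]] u by simp
  thus "u \<in> V" using quot_mod(4)[OF K V'(1)] subD(3)[OF U'(1) K u] by blast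
qed

text \<open>Take a smallest \<open>W\<close> with quotient in \<open>Am\<close>. For a map from
  \<open>W\<close> to \<open>Am\<close> with kernel \<open>L\<close>, the quotient by
  \<open>L\<close> extends the quotient by \<open>W\<close> by a submodule of a member of
  \<open>Am\<close>, so it is in \<open>Am\<close> and \<open>L = W\<close> by minimality.\<close>

lemma filt2_exists:
  assumes A: "rorth Ap (N :: 'r nmod)" shows "\<exists>W. filt2 N W"
proof -
  have N: "fm N" using A by (rule orth_fm)
  let ?T = "{W. submodule W R N \<and> Am (quot_mod N W)}"
  have fin: "finite ?T" by (rule finite_subset[OF _ finite_submodules[OF N]]) blast
  note Q0 = quot_mod[OF N sub_all[OF N]]
  have "is_zero (quot_mod N (car N))" using Q0(3,4) by (intro is_zeroI[OF Q0(1)]) blast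
  hence "car N \<in> ?T" using sub_all[OF N] rorth_zero[OF Q0(1)] unfolding Am_def by blast
  hence ne: "?T \<noteq> {}" by blast
  obtain W where W: "W \<in> ?T" "\<forall>V\<in>?T. card W \<le> card V" using Min_in[of "card ` ?T"] Min_le[of "card ` ?T"] fin ne by fastforce
  have WR: "submodule W R N" and WA: "Am (quot_mod N W)" using W(1) by auto
  note fW = fm_sub[OF N WR] and Q = quot_mod[OF N WR]
  have "g w = \<zero>\<^sub>M" if M: "fm M" "Am M" and g: "lin (sub_mod N W) M g" and w: "w \<in> W" for M :: "'r nmod" and g w
  proof -
    define L where "L = ker (sub_mod N W) M g"
    have LN: "submodule L R N" and LW: "L \<subseteq> W" using sub_ker[OF fW M(1) g] sub_sub[OF N WR] by (auto simp: L_def)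
    note P = quot_mod[OF N LN]
    let ?Q = "quot_mod N W" and ?c = "a_r_coset N W" and ?P = "quot_mod N L" and ?d = "a_r_coset N L"
    have "?c x = \<zero>\<^sub>(?Q)" if "x \<in> car N" "?d x = \<zero>\<^sub>(?P)" for x using that P(4) Q(4) LW by blast
    then obtain r where r: "lin ?P ?Q r" "\<forall>x\<in>car N. r (?d x) = ?c x" using factor'[OF N P(1) Q(1) P(2,3) Q(2)] by blast
    note K = sub_ker[OF P(1) Q(1) r(1)]
    let ?K = "sub_mod ?P (ker ?P ?Q r)"
    have dW: "?d x \<in> car ?K \<longleftrightarrow> x \<in> W" if "x \<in> car N" for x
      using r(2) that lin_closed[OF P(2) that] Q(4)[OF that] by (simp add: ker_def)
    have d: "lin (sub_mod N W) ?K ?d" by (rule lin_sub_cod[OF lin_sub_dom[OF P(2) WR N]]) (use dW subD(3)[OF WR N] in auto)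
    have onto: "?d ` car (sub_mod N W) = car ?K"
    proof
      show "?d ` car (sub_mod N W) \<subseteq> car ?K" using lin_closed[OF d] by blast
      show "car ?K \<subseteq> ?d ` car (sub_mod N W)"
      proof
        fix z assume z: "z \<in> car ?K"
        hence "z \<in> car ?P" by (simp add: ker_def)
        then obtain x where x: "x \<in> car N" "z = ?d x" using P(3) by blast
        thus "z \<in> ?d ` car (sub_mod N W)" using dW[OF x(1)] z by simp
      qed
    qed
    have "g x = \<zero>\<^sub>M" if "x \<in> car (sub_mod N W)" "?d x = \<zero>\<^sub>(?K)" for x
    proof -
      have "x \<in> L" using that P(4) subD(3)[OF WR N] by auto
      thus ?thesis by (simp add: L_def ker_def)
    qed
    then obtain s where s: "lin ?K M s" "\<forall>x\<in>car (sub_mod N W). s (?d x) = g x" using factor'[OF fW fm_sub[OF P(1) K] M(1) d onto g] by blast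
    have "z = \<zero>\<^sub>(?K)" if z: "z \<in> car ?K" "s z = \<zero>\<^sub>M" for z
    proof -
      obtain x where x: "x \<in> car (sub_mod N W)" "z = ?d x" using onto z(1) by blast
      hence "x \<in> L" using s(2) z(2) by (simp add: L_def ker_def)
      thus ?thesis using P(4) subD(3)[OF LN N] x(2) by simp
    qed
    hence "Am ?K" using rorth_embed[OF M(2)[unfolded Am_def] fm_sub[OF P(1) K] s(1)] by (simp add: Am_def)
    hence "Am ?P" using rorth_extension[OF P(1) r(1)] WA unfolding Am_def by blast
    hence "card W \<le> card L" using W(2) LN by blast
    hence "L = W" using card_seteq[OF finite_subset[OF subD(1)[OF WR N] fm_finite[OF N]] LW] by blast
    thus ?thesis using w by (auto simp: L_def ker_def)
  qed
  hence "lorth Am (sub_mod N W)" using fW by (simp add: lorth_def)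
  hence "A0 (sub_mod N W)" using rorth_sub[OF A WR] by (simp add: A0_def)
  thus ?thesis using WR WA by (auto simp: filt2_def)
qed

lemma quot_copy:
  fixes B :: "('r, 'a) module"
  assumes B: "fm B" and K: "submodule K R B"
  shows "\<exists>(N :: 'r nmod) q. fm N \<and> lin B N q \<and> q ` car B = car N \<and> (\<forall>x\<in>car B. q x = \<zero>\<^sub>N \<longleftrightarrow> x \<in> K) \<and> mod_iso R (quot_mod B K) N"
proof -
  obtain N :: "'r nmod" and q where N: "fm N" "lin B N q" "q ` car B = car N" "ker B N q = K" using quot_nat[OF B K] .
  have k: "q x = \<zero>\<^sub>N \<longleftrightarrow> x \<in> K" if "x \<in> car B" for x using N(4) that by (auto simp: ker_def)
  have "mod_iso R (quot_mod B K) N"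
    by (rule surj_iso[OF B quot_mod(1)[OF B K] N(1) quot_mod(2,3)[OF B K] N(2,3)]) (use k quot_mod(4)[OF B K] in blast)
  thus ?thesis using N k by blast
qed

lemma filt2_le:
  assumes N: "fm N" and U: "filt2 N U" and V: "filt2 N V" shows "U \<subseteq> V"
proof
  have U': "submodule U R N" "lorth Am (sub_mod N U)" and V': "submodule V R N" "Am (quot_mod N V)" using U V by (auto simp: filt2_def A0_def)
  obtain L :: "'r nmod" and q where L: "fm L" "lin N L q" "\<forall>x\<in>car N. q x = \<zero>\<^sub>L \<longleftrightarrow> x \<in> V" "mod_iso R (quot_mod N V) L"
    using quot_copy[OF N V'(1)] by blast
  fix u assume u: "u \<in> U"
  have "q u = \<zero>\<^sub>L" using lorthD[OF U'(2) L(1) Am_iso[OF L(4) V'(2) L(1)] lin_sub_dom[OF L(2) U'(1) N]] u by simp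
  thus "u \<in> V" using L(3) subD(3)[OF U'(1) N u] by blast
qed

text \<open>Ext of the torsion-free quotient with the torsion part vanishes by
  \<open>ext1_Ap\<close>; the quotient is first copied to \<open>nat\<close>, where that lemma
  applies.\<close>

lemma filt1_split:
  assumes K: "fm K" and U: "filt1 K U" shows "mod_iso R (dsum (quot_mod K U) (sub_mod K U)) K"
proof -
  have U': "submodule U R K" "Ap (sub_mod K U)" "rorth Ap (quot_mod K U)" using U by (auto simp: filt1_def)
  obtain N :: "'r nmod" and q where N: "fm N" "lin K N q" "mod_iso R (quot_mod K U) N" using quot_copy[OF K U'(1)] by blast
  note S = fm_sub[OF K U'(1)] and Q = quot_mod(1)[OF K U'(1)]
  have "ext1_vanishes R N (sub_mod K U)" by (rule ext1_Ap[OF N(1) _ U'(2)]) (use rorth_iso[OF N(3) U'(3) N(1)] rorth_h in blast)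
  hence "ext1_vanishes R (quot_mod K U) (sub_mod K U)" using ext1_vanishes_iso[OF N(3) iso_refl[OF S] Q N(1) S S] by blast
  thus ?thesis using split_dsum[OF K U'(1)] by blast
qed

lemma filt2_split:
  assumes N: "fm N" and W: "filt2 N W" shows "mod_iso R (dsum (quot_mod N W) (sub_mod N W)) N"
proof -
  have W': "submodule W R N" "lorth Am (sub_mod N W)" "Am (quot_mod N W)" using W by (auto simp: filt2_def A0_def)
  obtain P :: "'r nmod" and q where P: "fm P" "lin N P q" "mod_iso R (quot_mod N W) P" using quot_copy[OF N W'(1)] by blast
  note S = fm_sub[OF N W'(1)] and Q = quot_mod(1)[OF N W'(1)]
  have "ext1_vanishes R P (sub_mod N W)" by (rule ext1_Am[OF S _ Am_iso[OF P(3) W'(3) P(1)]]) (use W'(2) lorth_h in blast)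
  hence "ext1_vanishes R (quot_mod N W) (sub_mod N W)" using ext1_vanishes_iso[OF P(3) iso_refl[OF S] Q P(1) S S] by blast
  thus ?thesis using split_dsum[OF N W'(1)] by blast
qed

lemma filt2_rorth_Ap:
  assumes N: "fm N" and W: "filt2 N W" shows "rorth Ap N"
proof -
  have W': "submodule W R N" "rorth Ap (sub_mod N W)" "Am (quot_mod N W)" using W by (auto simp: filt2_def A0_def)
  note Q = quot_mod[OF N W'(1)]
  have "ker N (quot_mod N W) (a_r_coset N W) = W" using Q(4) subD(1)[OF W'(1) N] by (auto simp: ker_def)
  thus ?thesis using rorth_extension[OF N Q(2) Am_rorth_Ap[OF W'(3)]] W'(2) by simp
qed

end

section \<open>Finitely supported functions\<close>

definition finsupp :: "'x set => ('x => rat) set" where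
  "finsupp A = {f. finite {x. f x \<noteq> 0} \<and> {x. f x \<noteq> 0} \<subseteq> A}"

lemma vector_space_fscale: "vector_space fscale" by unfold_locales (auto simp: fscale_def fun_eq_iff algebra_simps)

interpretation fs: vector_space fscale by (rule vector_space_fscale)

lemma subspace_finsupp: "fs.subspace (finsupp A)"
proof (rule fs.subspaceI)
  fix f g assume "f \<in> finsupp A" "g \<in> finsupp A"
  moreover have "{x. (f + g) x \<noteq> 0} \<subseteq> {x. f x \<noteq> 0} \<union> {x. g x \<noteq> 0}" by auto
  ultimately show "f + g \<in> finsupp A" unfolding finsupp_def by (auto intro: finite_subset)
next
  fix c f assume "f \<in> finsupp A"
  moreover have "{x. fscale c f x \<noteq> 0} \<subseteq> {x. f x \<noteq> 0}" by (auto simp: fscale_def)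
  ultimately show "fscale c f \<in> finsupp A" unfolding finsupp_def by (auto intro: finite_subset)
qed (simp add: finsupp_def)

lemma finsupp_expand:
  assumes "finite {x. f x \<noteq> 0}" shows "f = (\<Sum>x\<in>{x. f x \<noteq> 0}. fscale (f x) (basis_vec x))"
proof
  fix y
  have "(\<Sum>x\<in>S. g x) y = (\<Sum>x\<in>S. g x y)" for S and g :: "'a => 'a => rat" by (induction S rule: infinite_finite_induct) auto
  hence "(\<Sum>x\<in>{x. f x \<noteq> 0}. fscale (f x) (basis_vec x)) y = (\<Sum>x\<in>{x. f x \<noteq> 0}. if y = x then f x else 0)"
    by (auto simp: fscale_def basis_vec_def intro!: sum.cong)
  also have "\<dots> = f y" using assms by (simp add: sum.delta')
  finally show "f y = (\<Sum>x\<in>{x. f x \<noteq> 0}. fscale (f x) (basis_vec x)) y" ..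
qed

lemma basis_vec_finsupp: "x \<in> A ==> basis_vec x \<in> finsupp A" by (auto simp: finsupp_def basis_vec_def split: if_splits)

lemma span_basis_vec: "fs.span (basis_vec ` A) = finsupp A"
proof (rule equalityI)
  show "fs.span (basis_vec ` A) \<subseteq> finsupp A" by (rule fs.span_minimal[OF _ subspace_finsupp]) (auto intro: basis_vec_finsupp)
  show "finsupp A \<subseteq> fs.span (basis_vec ` A)"
  proof
    fix f assume f: "f \<in> finsupp A"
    have "(\<Sum>x\<in>{x. f x \<noteq> 0}. fscale (f x) (basis_vec x)) \<in> fs.span (basis_vec ` A)"
      by (intro fs.span_sum fs.span_scale fs.span_base) (use f in \<open>auto simp: finsupp_def\<close>)
    thus "f \<in> fs.span (basis_vec ` A)" using finsupp_expand[of f] f by (simp add: finsupp_def)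
  qed
qed

text \<open>Basis vectors of the right side are pure tensors, and pure tensors of finitely supported
  functions have finite support.\<close>

lemma tensor3_finsupp: "tensor3 (finsupp A) (finsupp B) (finsupp C) = finsupp (A \<times> B \<times> C)"
proof (rule equalityI)
  let ?T = "{pure_tensor u v w | u v w. u \<in> finsupp A \<and> v \<in> finsupp B \<and> w \<in> finsupp C}"
  have "pure_tensor u v w \<in> finsupp (A \<times> B \<times> C)" if "u \<in> finsupp A" "v \<in> finsupp B" "w \<in> finsupp C" for u v w
  proof -
    have "{t. pure_tensor u v w t \<noteq> 0} = {x. u x \<noteq> 0} \<times> {x. v x \<noteq> 0} \<times> {x. w x \<noteq> 0}"
      by (auto simp: pure_tensor_def)
    thus ?thesis using that unfolding finsupp_def by auto
  qed
  thus "tensor3 (finsupp A) (finsupp B) (finsupp C) \<subseteq> finsupp (A \<times> B \<times> C)"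
    unfolding tensor3_def by (intro fs.span_minimal[OF _ subspace_finsupp]) blast
  have "basis_vec t \<in> ?T" if t: "t \<in> A \<times> B \<times> C" for t
  proof -
    obtain a b c where abc: "t = (a, b, c)" "a \<in> A" "b \<in> B" "c \<in> C" using t by blast
    have "basis_vec t = pure_tensor (basis_vec a) (basis_vec b) (basis_vec c)" by (auto simp: abc(1) pure_tensor_def basis_vec_def fun_eq_iff)
    thus ?thesis using basis_vec_finsupp[OF abc(2)] basis_vec_finsupp[OF abc(3)] basis_vec_finsupp[OF abc(4)] by blast
  qed
  thus "finsupp (A \<times> B \<times> C) \<subseteq> tensor3 (finsupp A) (finsupp B) (finsupp C)"
    unfolding tensor3_def span_basis_vec[symmetric] by (intro fs.span_mono) blast
qed

text \<open>Reindexing along a bijection of the index sets; with \<open>\<Phi> = parts\<close> this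
  is the triple product map.\<close>

lemma bij_betw_finsupp:
  assumes b: "bij_betw \<Phi> I J"
  shows "bij_betw (\<lambda>T Z. if Z \<in> I then T (\<Phi> Z) else 0) (finsupp J) (finsupp I)"
proof (rule bij_betwI[where g = "\<lambda>f t. if t \<in> J then f (inv_into I \<Phi> t) else 0"])
  note l = bij_betw_inv_into_left[OF b] and r = bij_betw_inv_into_right[OF b]
  have \<Phi>J: "\<Phi> Z \<in> J" if "Z \<in> I" for Z using b that by (auto simp: bij_betw_def)
  have iI: "inv_into I \<Phi> t \<in> I" if "t \<in> J" for t using bij_betw_inv_into[OF b] that by (auto simp: bij_betw_def)
  show "(\<lambda>T Z. if Z \<in> I then T (\<Phi> Z) else 0) \<in> finsupp J \<rightarrow> finsupp I"
  proof
    fix T assume T: "T \<in> finsupp J"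
    have "{Z. (if Z \<in> I then T (\<Phi> Z) else 0) \<noteq> 0} \<subseteq> inv_into I \<Phi> ` {t. T t \<noteq> 0}" using l by (force split: if_splits)
    from finite_subset[OF this] show "(\<lambda>Z. if Z \<in> I then T (\<Phi> Z) else 0) \<in> finsupp I" using T by (simp add: finsupp_def) auto
  qed
  show "(\<lambda>f t. if t \<in> J then f (inv_into I \<Phi> t) else 0) \<in> finsupp I \<rightarrow> finsupp J"
  proof
    fix f assume f: "f \<in> finsupp I"
    have "{t. (if t \<in> J then f (inv_into I \<Phi> t) else 0) \<noteq> 0} \<subseteq> \<Phi> ` {Z. f Z \<noteq> 0}" using r by (force split: if_splits)
    from finite_subset[OF this] show "(\<lambda>t. if t \<in> J then f (inv_into I \<Phi> t) else 0) \<in> finsupp J" using f by (simp add: finsupp_def) auto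
  qed
  show "(\<lambda>t. if t \<in> J then if inv_into I \<Phi> t \<in> I then T (\<Phi> (inv_into I \<Phi> t)) else 0 else 0) = T" if "T \<in> finsupp J" for T
    using that r iI by (auto simp: finsupp_def fun_eq_iff)
  show "(\<lambda>Z. if Z \<in> I then if \<Phi> Z \<in> J then f (inv_into I \<Phi> (\<Phi> Z)) else 0 else 0) = f" if "f \<in> finsupp I" for f
    using that l \<Phi>J by (auto simp: finsupp_def fun_eq_iff)
qed

section \<open>The Hall algebra\<close>

context hereditary_ring
begin

abbreviation cl :: "('r, 'a) module => 'r nmod set" where "cl \<equiv> iso_class R"

abbreviation IC :: "'r nmod set set" where "IC \<equiv> iso_classes R (fl_mods R)"

definition rep :: "'r nmod set => 'r nmod" where "rep Z = (SOME K. K \<in> Z)"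

lemma cl_in_IC: assumes "fm M" shows "cl M \<in> IC"
proof -
  obtain N :: "'r nmod" where N: "fm N" "mod_iso R M N" using exists_nat_copy[OF assms] .
  thus ?thesis using iso_class_eq[OF assms N(1)] unfolding iso_classes_def by auto
qed

lemma rep: assumes "Z \<in> IC" shows "fm (rep Z)" "cl (rep Z) = Z"
proof -
  obtain M :: "'r nmod" where M: "fm M" "Z = cl M" using assms unfolding iso_classes_def by auto
  hence "rep Z \<in> cl M" using someI[of "\<lambda>K. K \<in> Z"] iso_class_self[OF M(1)] unfolding rep_def by blast
  hence *: "fm (rep Z)" "mod_iso R M (rep Z)" by (auto simp: iso_class_def)
  thus "fm (rep Z)" "cl (rep Z) = Z" using iso_class_eq[OF M(1) *(1)] M(2) by simp_all
qed

lemma rep_cl: assumes "fm M" shows "fm (rep (cl M))" "mod_iso R M (rep (cl M))"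
  using rep[OF cl_in_IC[OF assms]] iso_class_eq[OF assms, of "rep (cl M)"] by simp_all

text \<open>The Hall number of a pair of classes counts the submodules of the representative with
  that quotient and that submodule, so the weighted sum over pairs regroups into a sum over
  submodules.\<close>

lemma hall_mult_eval:
  assumes Z: "Z \<in> IC"
  shows "hall_mult R f g Z = (\<Sum>U | submodule U R (rep Z). f (cl (quot_mod (rep Z) U)) * g (cl (sub_mod (rep Z) U)))"
proof -
  define K where "K = rep Z"
  have K: "fm K" using rep(1)[OF Z] by (simp add: K_def)
  let ?A = "{U. submodule U R K}" and ?p = "\<lambda>U. (cl (quot_mod K U), cl (sub_mod K U))"
  let ?S = "{(X, Y). X \<in> IC \<and> Y \<in> IC \<and> hall_number R X Y K \<noteq> 0}"
  have A: "finite ?A" by (rule finite_submodules[OF K])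
  have hn: "hall_number R X Y K = card {U \<in> ?A. ?p U = (X, Y)}" for X Y unfolding hall_number_def by (rule arg_cong[of _ _ card]) auto
  have "?S = ?p ` ?A"
  proof (intro equalityI subsetI)
    fix z assume "z \<in> ?S"
    then obtain X Y where z: "z = (X, Y)" "hall_number R X Y K \<noteq> 0" by blast
    hence "{U \<in> ?A. ?p U = (X, Y)} \<noteq> {}" using hn[of X Y] by (metis card.empty)
    thus "z \<in> ?p ` ?A" using z(1) by auto
  next
    fix z assume "z \<in> ?p ` ?A"
    then obtain U where U: "submodule U R K" "z = ?p U" by blast
    hence "{V \<in> ?A. ?p V = ?p U} \<noteq> {}" by blast
    moreover have "finite {V \<in> ?A. ?p V = ?p U}" using A by simp
    ultimately have "hall_number R (cl (quot_mod K U)) (cl (sub_mod K U)) K \<noteq> 0" unfolding hn by (simp only: card_0_eq) simp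
    thus "z \<in> ?S" using cl_in_IC[OF quot_mod(1)[OF K U(1)]] cl_in_IC[OF fm_sub[OF K U(1)]] U(2) by simp
  qed
  hence "(\<Sum>(X, Y)\<in>?S. of_nat (hall_number R X Y K) * f X * g Y) = (\<Sum>(X, Y)\<in>?p ` ?A. of_nat (card {U \<in> ?A. ?p U = (X, Y)}) * f X * g Y)"
    by (simp only: hn)
  also have "\<dots> = (\<Sum>z\<in>?p ` ?A. \<Sum>U\<in>{U \<in> ?A. ?p U = z}. f (cl (quot_mod K U)) * g (cl (sub_mod K U)))"
    by (rule sum.cong[OF refl]) (auto simp: mult.assoc)
  also have "\<dots> = (\<Sum>U\<in>?A. f (cl (quot_mod K U)) * g (cl (sub_mod K U)))" by (rule sum.image_gen[OF A, symmetric])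
  finally show ?thesis using Z unfolding hall_mult_def rep_def[symmetric] K_def Let_def by simp
qed

lemma hall_mult_single:
  assumes Z: "Z \<in> IC" and U: "submodule U R (rep Z)"
    and uniq: "!!V. [|submodule V R (rep Z); f (cl (quot_mod (rep Z) V)) \<noteq> 0; g (cl (sub_mod (rep Z) V)) \<noteq> 0|] ==> V = U"
  shows "hall_mult R f g Z = f (cl (quot_mod (rep Z) U)) * g (cl (sub_mod (rep Z) U))"
proof -
  have "(\<Sum>V | submodule V R (rep Z). f (cl (quot_mod (rep Z) V)) * g (cl (sub_mod (rep Z) V))) =
    (\<Sum>V\<in>{U}. f (cl (quot_mod (rep Z) V)) * g (cl (sub_mod (rep Z) V)))"
    by (rule sum.mono_neutral_right[OF finite_submodules[OF rep(1)[OF Z]]]) (use U uniq in auto)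
  thus ?thesis unfolding hall_mult_eval[OF Z] by simp
qed

lemma hall_mult_nonzero:
  assumes "hall_mult R f g Z \<noteq> 0"
  shows "Z \<in> IC" "\<exists>V. submodule V R (rep Z) \<and> f (cl (quot_mod (rep Z) V)) \<noteq> 0 \<and> g (cl (sub_mod (rep Z) V)) \<noteq> 0"
proof -
  show Z: "Z \<in> IC" using assms by (auto simp: hall_mult_def split: if_splits)
  show "\<exists>V. submodule V R (rep Z) \<and> f (cl (quot_mod (rep Z) V)) \<noteq> 0 \<and> g (cl (sub_mod (rep Z) V)) \<noteq> 0"
  proof (rule ccontr)
    assume "\<not> ?thesis"
    hence "hall_mult R f g Z = 0" unfolding hall_mult_eval[OF Z] by (intro sum.neutral) auto
    thus False using assms by simp
  qed
qed

lemma dsum_cl: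
  assumes "mod_iso R (dsum A B) K" "mod_iso R (dsum A' B') K'" "cl A = cl A'" "cl B = cl B'"
    and fm: "fm A" "fm A'" "fm B" "fm B'" "fm K" "fm K'"
  shows "cl K = cl K'"
proof -
  have iso: "mod_iso R A A'" "mod_iso R B B'" using assms iso_class_eq by blast+
  have D: "fm (dsum A B)" "fm (dsum A' B')" using fm fm_dsum by blast+
  have "mod_iso R K K'"
    using iso_trans[OF iso_trans[OF iso_sym[OF assms(1) D(1) fm(5)] dsum_iso[OF fm(1) iso(1) fm(3) iso(2)] fm(5)] assms(2) fm(5)] .
  thus ?thesis using iso_class_eq fm by blast
qed

subsection \<open>Classes in the Grothendieck group\<close>

text \<open>Exactness of Hom(R, -) read through \<open>h_reg\<close>.\<close>

lemma card_sub_quot: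
  assumes K: "fm K" and U: "submodule U R K"
  shows "card (car K) = card U * card (car (quot_mod K U))"
proof -
  note Q = quot_mod[OF K U]
  have k: "ker K (quot_mod K U) (a_r_coset K U) = U" using Q(4) subD(1)[OF U K] by (auto simp: ker_def)
  show ?thesis using h_projective[OF fm_reg projective_reg K Q(1-3)] h_reg[OF K] h_reg[OF Q(1)] h_reg[OF fm_sub[OF K U]] unfolding k by simp
qed

text \<open>The logarithm of the size, extended additively to formal sums of classes. Sizes multiply
  along short exact sequences, so it vanishes on the relations of \<open>K0\<close>, and a degree
  fixes the size of the modules in it.\<close>

definition lcard :: "('r nmod set \<Rightarrow>\<^sub>0 int) => real" where
  "lcard c = (\<Sum>X\<in>Poly_Mapping.keys c. real_of_int (Poly_Mapping.lookup c X) * ln (card (car (rep X))))"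

lemma lcard_eq:
  assumes "finite S" "Poly_Mapping.keys c \<subseteq> S"
  shows "lcard c = (\<Sum>X\<in>S. real_of_int (Poly_Mapping.lookup c X) * ln (card (car (rep X))))"
  unfolding lcard_def by (rule sum.mono_neutral_left) (use assms in \<open>auto simp: in_keys_iff\<close>)

lemma lcard_diff: "lcard (a - b) = lcard a - lcard b"
proof -
  let ?S = "Poly_Mapping.keys a \<union> Poly_Mapping.keys b"
  have S: "finite ?S" by simp
  show ?thesis using lcard_eq[OF S, of a] lcard_eq[OF S, of b] lcard_eq[OF S Poly_Mapping.keys_diff]
    by (simp add: lookup_minus left_diff_distrib sum_subtractf)
qed

lemma lcard_0: "lcard 0 = 0" by (simp add: lcard_def)

lemma lcard_uminus: "lcard (- a) = - lcard a" using lcard_diff[of 0 a] by (simp add: lcard_0)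

lemma lcard_add: "lcard (a + b) = lcard a + lcard b" using lcard_diff[of a "- b"] by (simp add: lcard_uminus)

lemma lcard_of: "fm M ==> lcard (frag_of (cl M)) = ln (card (car M))" using iso_card[OF rep_cl(2), of M] by (simp add: lcard_def)

lemma lcard_rels: assumes "c \<in> K0_rels R" shows "lcard c = 0"
proof -
  let ?H = "{frag_of (cl K) - frag_of (cl (sub_mod K U)) - frag_of (cl (quot_mod K U)) | K U. K \<in> fl_mods R \<and> submodule U R K}"
  have H: "lcard x = 0 \<and> Poly_Mapping.keys x \<subseteq> IC" if x: "x \<in> ?H" for x
  proof -
    obtain K :: "'r nmod" and U where K: "fm K" and U: "submodule U R K" and x: "x = frag_of (cl K) - frag_of (cl (sub_mod K U)) - frag_of (cl (quot_mod K U))"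
      using x by auto
    note S = fm_sub[OF K U] and Q = quot_mod(1)[OF K U]
    have "card (car K) = card (car (sub_mod K U)) * card (car (quot_mod K U))" using card_sub_quot[OF K U] by simp
    moreover have "card (car (sub_mod K U)) > 0" "card (car (quot_mod K U)) > 0"
      using fm_zero[OF S] fm_finite[OF S] fm_zero[OF Q] fm_finite[OF Q] by (metis card_gt_0_iff empty_iff)+
    ultimately have "lcard x = 0" unfolding x lcard_diff lcard_of[OF K] lcard_of[OF S] lcard_of[OF Q] by (simp add: ln_mult)
    moreover have "Poly_Mapping.keys x \<subseteq> IC"
      unfolding x using keys_diff[of "frag_of (cl K) - frag_of (cl (sub_mod K U))" "frag_of (cl (quot_mod K U))"]
        keys_diff[of "frag_of (cl K)" "frag_of (cl (sub_mod K U))"] cl_in_IC[OF K] cl_in_IC[OF S] cl_in_IC[OF Q] by auto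
    ultimately show ?thesis ..
  qed
  show ?thesis using assms unfolding K0_rels_def
  proof (induction rule: generate.induct)
    case (inv x)
    thus ?case using H[OF inv] inv_free_Abelian_group[of x IC] by (simp add: lcard_uminus)
  qed (use H in \<open>auto simp: lcard_0 lcard_add\<close>)
qed

lemma K0_class_card:
  assumes X: "X \<in> IC" and Y: "Y \<in> IC" and eq: "K0_class R X = K0_class R Y"
  shows "card (car (rep X)) = card (car (rep Y))"
proof -
  let ?G = "free_Abelian_group IC"
  have "0 \<in> K0_rels R" using generate.one[of ?G] unfolding K0_rels_def by simp
  hence "frag_of X \<in> K0_class R X" unfolding K0_class_def r_coset_def by force
  then obtain c where c: "c \<in> K0_rels R" "frag_of X = c + frag_of Y" unfolding eq unfolding K0_class_def r_coset_def by auto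
  hence "lcard (frag_of (cl (rep X))) = lcard (frag_of (cl (rep Y)))" using lcard_rels[OF c(1)] rep(2)[OF X] rep(2)[OF Y] c(2) by (simp add: lcard_add)
  hence eq: "ln (real (card (car (rep X)))) = ln (real (card (car (rep Y))))" unfolding lcard_of[OF rep(1)[OF X]] lcard_of[OF rep(1)[OF Y]] .
  have "card (car M) > 0" if "fm M" for M :: "'r nmod" using fm_zero[OF that] fm_finite[OF that] by (metis card_gt_0_iff empty_iff)
  thus ?thesis using eq rep(1)[OF X] rep(1)[OF Y] by simp
qed

text \<open>By \<open>K0_class_card\<close> the modules of one degree have one size, and there are
  finitely many classes of each size.\<close>

lemma Exp_hall_completion: assumes "\<B> \<subseteq> fl_mods R" shows "Exp_hall R \<B> \<in> hall_completion R"
proof -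
  have sub: "iso_classes R \<B> \<subseteq> IC" using assms by (auto simp: iso_classes_def)
  have fin: "finite {X \<in> IC. K0_class R X = \<gamma>}" for \<gamma>
  proof (cases "{X \<in> IC. K0_class R X = \<gamma>} = {}")
    case False
    then obtain Y where Y: "Y \<in> IC" "K0_class R Y = \<gamma>" by blast
    have "{X \<in> IC. K0_class R X = \<gamma>} \<subseteq> cl ` {M :: 'r nmod. fm M \<and> card (car M) \<le> card (car (rep Y))}"
    proof
      fix X assume X: "X \<in> {X \<in> IC. K0_class R X = \<gamma>}"
      hence "card (car (rep X)) = card (car (rep Y))" using K0_class_card Y by blast
      moreover have "fm (rep X)" "X = cl (rep X)" using rep X by auto
      ultimately show "X \<in> cl ` {M :: 'r nmod. fm M \<and> card (car M) \<le> card (car (rep Y))}" by (metis (mono_tags, lifting) image_eqI mem_Collect_eq order_refl)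
    qed
    thus ?thesis using finite_classes finite_subset by blast
  qed (simp only: finite.emptyI)
  have "finite {X. Exp_hall R \<B> X \<noteq> 0 \<and> K0_class R X = \<gamma>}" for \<gamma>
    by (rule finite_subset[OF _ fin[of \<gamma>]]) (use sub in \<open>auto simp: Exp_hall_def\<close>)
  thus ?thesis using sub by (auto simp: hall_completion_def Exp_hall_def)
qed

end

section \<open>The filtration inside the Hall algebra\<close>

context connected_hereditary_ring
begin

abbreviation ICm where "ICm \<equiv> iso_classes R (preprojective R)"
abbreviation IC0 where "IC0 \<equiv> iso_classes R (regular R)"
abbreviation ICp where "ICp \<equiv> iso_classes R (preinjective R)"

text \<open>All three properties are invariant under isomorphism, so membership of a class is
  decided on any module in it, whatever its carrier type.\<close>

lemma cl_in:
  assumes M: "fm M"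
  shows "cl M \<in> ICm \<longleftrightarrow> Am M" "cl M \<in> IC0 \<longleftrightarrow> A0 M" "cl M \<in> ICp \<longleftrightarrow> Ap M"
proof -
  have *: "cl M \<in> iso_classes R (Collect Q) \<longleftrightarrow> Q' M"
    if "!!N. [|fm N; mod_iso R M N; Q' M|] ==> Q N" "!!N. [|Q N; mod_iso R N M|] ==> Q' M" "!!N. Q N ==> fm N"
    for Q :: "'r nmod => bool" and Q' :: "('r, 'a) module => bool"
  proof
    assume "cl M \<in> iso_classes R (Collect Q)"
    then obtain N where N: "Q N" "cl M = cl N" unfolding iso_classes_def by blast
    hence "mod_iso R N M" using iso_class_eq[OF that(3)[OF N(1)] M] by simp
    thus "Q' M" using that(2) N(1) by blast
  next
    assume "Q' M"
    hence "Q (rep (cl M))" using that(1) rep_cl[OF M] by blast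
    thus "cl M \<in> iso_classes R (Collect Q)" using rep(2)[OF cl_in_IC[OF M]] unfolding iso_classes_def by (metis imageI mem_Collect_eq)
  qed
  show "cl M \<in> ICm \<longleftrightarrow> Am M" unfolding preprojective_Am by (rule *) (use M Am_iso Am_fm in blast)+
  show "cl M \<in> IC0 \<longleftrightarrow> A0 M" unfolding regular_A0 by (rule *) (use M A0_iso A0_fm in blast)+
  show "cl M \<in> ICp \<longleftrightarrow> Ap M" unfolding preinjective_Ap by (rule *) (use M Ap_iso Ap_fm in blast)+
qed

definition torsion :: "'r nmod set => nat set" where
  "torsion Z = (THE U. filt1 (rep Z) U)"

text \<open>The quotient is replaced by the representative of its class before \<open>middle\<close>
  is formed, since that is where the inner Hall product is evaluated.\<close>

definition zN :: "'r nmod set => 'r nmod set" where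
  "zN Z = cl (quot_mod (rep Z) (torsion Z))"

definition middle :: "'r nmod set => nat set" where
  "middle Z = (THE W. filt2 (rep (zN Z)) W)"

definition parts :: "'r nmod set => 'r nmod set \<times> 'r nmod set \<times> 'r nmod set" where
  "parts Z = (cl (quot_mod (rep (zN Z)) (middle Z)), cl (sub_mod (rep (zN Z)) (middle Z)), cl (sub_mod (rep Z) (torsion Z)))"

lemma torsionI: "[|Z \<in> IC; filt1 (rep Z) U|] ==> torsion Z = U" unfolding torsion_def by (rule the_equality) (use filt1_le[OF rep(1)] in blast)+

lemma torsion: assumes Z: "Z \<in> IC" shows "filt1 (rep Z) (torsion Z)" using filt1_exists[OF rep(1)[OF Z]] torsionI[OF Z] by metis

lemma zN: assumes Z: "Z \<in> IC" shows "zN Z \<in> IC" "mod_iso R (quot_mod (rep Z) (torsion Z)) (rep (zN Z))"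
proof -
  have "submodule (torsion Z) R (rep Z)" using torsion[OF Z] by (simp add: filt1_def)
  note Q = quot_mod(1)[OF rep(1)[OF Z] this]
  show "zN Z \<in> IC" "mod_iso R (quot_mod (rep Z) (torsion Z)) (rep (zN Z))" unfolding zN_def using cl_in_IC[OF Q] rep_cl[OF Q] by blast+
qed

lemma middleI: "[|Z \<in> IC; filt2 (rep (zN Z)) W|] ==> middle Z = W"
  unfolding middle_def by (rule the_equality) (use filt2_le[OF rep(1)[OF zN(1)]] in blast)+

lemma middle: assumes Z: "Z \<in> IC" shows "filt2 (rep (zN Z)) (middle Z)"
proof -
  have "rorth Ap (rep (zN Z))" using rorth_iso[OF zN(2)[OF Z] _ rep(1)[OF zN(1)[OF Z]]] torsion[OF Z] unfolding filt1_def by blast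
  thus ?thesis using filt2_exists middleI[OF Z] by metis
qed

text \<open>Both steps of the filtration split, so the three classes determine \<open>zN Z\<close>
  and then \<open>Z\<close> as direct sums.\<close>

lemma parts_inj: assumes Z: "Z \<in> IC" and Z': "Z' \<in> IC" and eq: "parts Z = parts Z'" shows "Z = Z'"
proof -
  note f = torsion[OF Z] torsion[OF Z'] and g = middle[OF Z] middle[OF Z']
  note K = rep(1)[OF Z] rep(1)[OF Z'] and N = rep(1)[OF zN(1)[OF Z]] rep(1)[OF zN(1)[OF Z']]
  have U: "submodule (torsion Z) R (rep Z)" "submodule (torsion Z') R (rep Z')" using f by (auto simp: filt1_def)
  have W: "submodule (middle Z) R (rep (zN Z))" "submodule (middle Z') R (rep (zN Z'))" using g by (auto simp: filt2_def)
  have "cl (rep (zN Z)) = cl (rep (zN Z'))"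
    by (rule dsum_cl[OF filt2_split[OF N(1) g(1)] filt2_split[OF N(2) g(2)]]) (use eq quot_mod(1) fm_sub N W in \<open>auto simp: parts_def\<close>)
  hence "zN Z = zN Z'" using rep(2) zN(1) Z Z' by simp
  hence "cl (rep Z) = cl (rep Z')"
    by (intro dsum_cl[OF filt1_split[OF K(1) f(1)] filt1_split[OF K(2) f(2)]]) (use eq quot_mod(1) fm_sub K U in \<open>auto simp: parts_def zN_def\<close>)
  thus ?thesis using rep(2) Z Z' by simp
qed

lemma parts_bij: "bij_betw parts IC (ICm \<times> IC0 \<times> ICp)"
proof -
  have "parts Z \<in> ICm \<times> IC0 \<times> ICp" if Z: "Z \<in> IC" for Z
  proof -
    note f = torsion[OF Z, unfolded filt1_def] and g = middle[OF Z, unfolded filt2_def]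
    note K = rep(1)[OF Z] and N = rep(1)[OF zN(1)[OF Z]]
    show ?thesis using f g cl_in(1)[OF quot_mod(1)[OF N]] cl_in(2)[OF fm_sub[OF N]] cl_in(3)[OF fm_sub[OF K]] by (simp add: parts_def)
  qed
  moreover have "t \<in> parts ` IC" if t: "t \<in> ICm \<times> IC0 \<times> ICp" for t
  proof -
    obtain P C I :: "'r nmod" where PCI: "t = (cl P, cl C, cl I)" "Am P" "A0 C" "Ap I"
      using t unfolding preprojective_Am regular_A0 preinjective_Ap iso_classes_def by blast
    note fP = Am_fm[OF PCI(2)] and fC = A0_fm[OF PCI(3)] and fI = Ap_fm[OF PCI(4)]
    \<comment> \<open>Direct sums are built in the order of the filtration, \<open>P\<close> with
      \<open>C\<close> and then the result with \<open>I\<close>. The evident submodules satisfy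
      \<open>filt2\<close> and \<open>filt1\<close>, and by uniqueness they are the canonical
      ones.\<close>
    define Y where "Y = cl (dsum P C)"
    define N where "N = rep Y"
    have N: "fm N" "mod_iso R (dsum P C) N" "cl N = Y"
      using rep_cl[OF fm_dsum[OF fP fC]] rep(2)[OF cl_in_IC[OF fm_dsum[OF fP fC]]] by (simp_all add: N_def Y_def)
    obtain W where W: "submodule W R N" "mod_iso R C (sub_mod N W)" "mod_iso R P (quot_mod N W)" using dsum_sub_quot[OF fP fC N(1,2)] by blast
    note SW = fm_sub[OF N(1) W(1)] and QW = quot_mod(1)[OF N(1) W(1)]
    have g: "filt2 N W" using A0_iso[OF W(2) PCI(3) SW] Am_iso[OF W(3) PCI(2) QW] W(1) by (simp add: filt2_def)
    define Z where "Z = cl (dsum N I)"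
    have Z: "Z \<in> IC" unfolding Z_def by (rule cl_in_IC[OF fm_dsum[OF N(1) fI]])
    define K where "K = rep Z"
    have K: "fm K" "mod_iso R (dsum N I) K" using rep_cl[OF fm_dsum[OF N(1) fI]] by (simp_all add: K_def Z_def)
    obtain U where U: "submodule U R K" "mod_iso R I (sub_mod K U)" "mod_iso R N (quot_mod K U)" using dsum_sub_quot[OF N(1) fI K] by blast
    note SU = fm_sub[OF K(1) U(1)] and QU = quot_mod(1)[OF K(1) U(1)]
    have "filt1 K U" using Ap_iso[OF U(2) PCI(4) SU] rorth_iso[OF U(3) filt2_rorth_Ap[OF N(1) g] QU] U(1) by (simp add: filt1_def)
    hence tU: "torsion Z = U" using torsionI[OF Z] by (simp add: K_def)
    have zY: "zN Z = Y" using iso_class_eq[OF N(1) QU] U(3) N(3) by (simp add: zN_def tU K_def)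
    have "middle Z = W" using middleI[OF Z] g by (simp add: zY N_def)
    hence "parts Z = t" using tU zY iso_class_eq[OF fP QW] iso_class_eq[OF fC SW] iso_class_eq[OF fI SU] W(2,3) U(2) PCI(1)
      by (simp add: parts_def N_def K_def)
    thus ?thesis using Z by blast
  qed
  ultimately have "parts ` IC = ICm \<times> IC0 \<times> ICp" by blast
  thus ?thesis using parts_inj by (simp add: bij_betw_def inj_on_def)
qed

text \<open>A submodule contributing to the outer product satisfies \<open>filt1\<close>, because a
  nonzero inner coefficient puts its quotient into the orthogonal of \<open>Ap\<close>; likewise
  inner contributions satisfy \<open>filt2\<close>. Uniqueness of both leaves one term in each sum,
  and \<open>parts\<close> names its three classes.\<close>

lemma hall_triple:
  assumes x: "!!X. x X \<noteq> 0 ==> X \<in> ICm" and y: "!!X. y X \<noteq> 0 ==> X \<in> IC0" and z: "!!X. z X \<noteq> 0 ==> X \<in> ICp"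
  shows "hall_mult R (hall_mult R x y) z = (\<lambda>Z. if Z \<in> IC then pure_tensor x y z (parts Z) else 0)"
proof
  fix Z
  have filt2: "filt2 (rep Y) V" if Y: "Y \<in> IC" and V: "submodule V R (rep Y)" "x (cl (quot_mod (rep Y) V)) \<noteq> 0" "y (cl (sub_mod (rep Y) V)) \<noteq> 0" for Y V
    using cl_in(1)[OF quot_mod(1)[OF rep(1)[OF Y] V(1)]] cl_in(2)[OF fm_sub[OF rep(1)[OF Y] V(1)]] x[OF V(2)] y[OF V(3)] V(1) by (simp add: filt2_def)
  show "hall_mult R (hall_mult R x y) z Z = (if Z \<in> IC then pure_tensor x y z (parts Z) else 0)"
  proof (cases "Z \<in> IC")
    case Z: True
    note K = rep(1)[OF Z] and f = torsion[OF Z] and Y = zN(1)[OF Z]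
    note N = rep(1)[OF Y] and g = middle[OF Z]
    have "hall_mult R (hall_mult R x y) z Z = hall_mult R x y (cl (quot_mod (rep Z) (torsion Z))) * z (cl (sub_mod (rep Z) (torsion Z)))"
    proof (rule hall_mult_single[OF Z])
      show "submodule (torsion Z) R (rep Z)" using f by (simp add: filt1_def)
      fix V assume V: "submodule V R (rep Z)" "hall_mult R x y (cl (quot_mod (rep Z) V)) \<noteq> 0" "z (cl (sub_mod (rep Z) V)) \<noteq> 0"
      note QV = quot_mod(1)[OF K V(1)]
      obtain W where "filt2 (rep (cl (quot_mod (rep Z) V))) W" using hall_mult_nonzero[OF V(2)] filt2 by blast
      hence "rorth Ap (rep (cl (quot_mod (rep Z) V)))" using filt2_rorth_Ap rep_cl(1)[OF QV] by blast
      hence "rorth Ap (quot_mod (rep Z) V)" using rorth_iso[OF iso_sym[OF rep_cl(2)[OF QV] QV rep_cl(1)[OF QV]] _ QV] by blast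
      hence "filt1 (rep Z) V" using V(1) cl_in(3)[OF fm_sub[OF K V(1)]] z[OF V(3)] by (simp add: filt1_def)
      thus "V = torsion Z" using torsionI[OF Z] by blast
    qed
    also have "hall_mult R x y (cl (quot_mod (rep Z) (torsion Z))) = hall_mult R x y (zN Z)" by (simp add: zN_def)
    also have "\<dots> = x (cl (quot_mod (rep (zN Z)) (middle Z))) * y (cl (sub_mod (rep (zN Z)) (middle Z)))"
    proof (rule hall_mult_single[OF Y])
      show "submodule (middle Z) R (rep (zN Z))" using g by (simp add: filt2_def)
      fix V assume "submodule V R (rep (zN Z))" "x (cl (quot_mod (rep (zN Z)) V)) \<noteq> 0" "y (cl (sub_mod (rep (zN Z)) V)) \<noteq> 0"
      from middleI[OF Z filt2[OF Y this]] show "V = middle Z" ..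
    qed
    finally show ?thesis using Z by (simp add: parts_def pure_tensor_def)
  qed (simp add: hall_mult_def)
qed

end

theorem corollary1p13:
  fixes R :: "('r, 's) ring_scheme"
  assumes "ring R" and "finite (carrier R)" and "hereditary R"
    and "connected_cat R" and "infinite_type R"
  shows
    "(\<exists>\<mu>. Vector_Spaces.linear fscale fscale \<mu> \<and>
        (\<forall>x\<in>hall_space R (preprojective R). \<forall>y\<in>hall_space R (regular R).
         \<forall>z\<in>hall_space R (preinjective R).
            \<mu> (pure_tensor x y z) = hall_mult R (hall_mult R x y) z) \<and>
        bij_betw \<mu>
          (tensor3 (hall_space R (preprojective R)) (hall_space R (regular R))
                   (hall_space R (preinjective R)))
          (hall_space R (fl_mods R)))
     \<and>
     (Exp_hall R (fl_mods R) \<in> hall_completion R \<and>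
      Exp_hall R (preprojective R) \<in> hall_completion R \<and>
      Exp_hall R (regular R) \<in> hall_completion R \<and>
      Exp_hall R (preinjective R) \<in> hall_completion R \<and>
      Exp_hall R (fl_mods R) =
        hall_mult R (hall_mult R (Exp_hall R (preprojective R)) (Exp_hall R (regular R)))
                    (Exp_hall R (preinjective R)))"
proof -
  interpret connected_hereditary_ring R
    using assms by (intro connected_hereditary_ring.intro hereditary_ring.intro finite_ring.intro finite_ring_axioms.intro
        hereditary_ring_axioms.intro connected_hereditary_ring_axioms.intro)
  \<comment> \<open>Reindexing along \<open>parts\<close> is linear on all functions of three
    variables and agrees with the triple product on pure tensors by
    \<open>hall_triple\<close>.\<close>
  define \<mu> where "\<mu> T Z = (if Z \<in> IC then T (parts Z) else (0 :: rat))" for T Z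
  have "Vector_Spaces.linear fscale fscale \<mu>"
    by (intro Vector_Spaces.linear.intro vector_space_fscale module_hom.intro module_hom_axioms.intro fs.module_axioms)
      (auto simp: \<mu>_def fscale_def fun_eq_iff)
  moreover have "\<mu> (pure_tensor x y z) = hall_mult R (hall_mult R x y) z"
    if "x \<in> hall_space R (preprojective R)" "y \<in> hall_space R (regular R)" "z \<in> hall_space R (preinjective R)" for x y z
  proof -
    have "x X \<noteq> 0 \<Longrightarrow> X \<in> ICm" "y X \<noteq> 0 \<Longrightarrow> X \<in> IC0" "z X \<noteq> 0 \<Longrightarrow> X \<in> ICp" for X
      using that unfolding hall_space_def span_basis_vec finsupp_def by auto
    thus ?thesis using hall_triple[of x y z] by (simp add: \<mu>_def fun_eq_iff)
  qed
  moreover have "bij_betw \<mu> (tensor3 (hall_space R (preprojective R)) (hall_space R (regular R)) (hall_space R (preinjective R)))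
      (hall_space R (fl_mods R))" unfolding hall_space_def span_basis_vec tensor3_finsupp \<mu>_def by (rule bij_betw_finsupp[OF parts_bij])
  moreover have "Exp_hall R (fl_mods R) = hall_mult R (hall_mult R (Exp_hall R (preprojective R)) (Exp_hall R (regular R))) (Exp_hall R (preinjective R))"
  proof -
    \<comment> \<open>The three exponentials have coefficient 1 on their own classes, so their
      product has coefficient 1 at every \<open>Z\<close>.\<close>
    have "parts Z \<in> ICm \<times> IC0 \<times> ICp" if "Z \<in> IC" for Z using parts_bij that by (auto simp: bij_betw_def)
    thus ?thesis using hall_triple[of "Exp_hall R (preprojective R)" "Exp_hall R (regular R)" "Exp_hall R (preinjective R)"]
      by (fastforce simp: Exp_hall_def pure_tensor_def fun_eq_iff split: if_splits)
  qed
  moreover have "preprojective R \<subseteq> fl_mods R" "regular R \<subseteq> fl_mods R" "preinjective R \<subseteq> fl_mods R"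
    by (auto simp: preprojective_def regular_def preinjective_def)
  ultimately show ?thesis using Exp_hall_completion by blast
qed

end
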